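(* Let $\gamma>0$ and $v\in(0,v_{cr}(\gamma))$, and let $\xi_1,\xi_2>0$, with $\xi_2<\xi_1$, be the two solutions $\xi$ of $$\gamma=\sqrt2\,(1-v^2/2)^{3/2}\,\frac{\tanh\bigl(\sqrt{1/2-v^2/4}\;\xi\bigr)}{v^2/2+\sinh^2\bigl(\sqrt{1/2-v^2/4}\;\xi\bigr)}.$$ Then the stationary solution $u(\cdot;\xi_1)$ is orbitally stable. More precisely, for any $\varepsilon>0$ and $A>0$ there exists $\delta>0$ such that, for any $u_0\in\mathcal{E}$ satisfying $d_A(u_0,u(\cdot;\xi_1))<\delta$, it holds $$\sup_{t\in\mathbf{R}}\ \inf_{\phi\in\mathbf{R}}\ d_A\bigl(\psi(t),e^{i\phi}u(\cdot;\xi_1)\bigr)\le\varepsilon,$$ where $\psi(t)$ is the unique (global) solution of $i\partial_tu+\partial_x^2u-iv\partial_xu-\gamma\delta(x)u+(1-|u|^2)u=0$ with initial datum $u_0$.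
   Context: Functions are complex valued on $\mathbf{R}$. The energy space is $\mathcal{E}=\{u\in H^1_{loc}(\mathbf{R}) : \partial_xu\in L^2(\mathbf{R}),\ 1-|u|^2\in L^2(\mathbf{R})\}$, with distance $d_\infty(u,w)=\|\partial_xu-\partial_xw\|_{L^2(\mathbf{R})}+\|u-w\|_{L^\infty(\mathbf{R})}+\||u|^2-|w|^2\|_{L^2(\mathbf{R})}$ and, for $A>0$, the distance $d_A(u,w)=\|\partial_xu-\partial_xw\|_{L^2(\mathbf{R})}+\|u-w\|_{L^\infty([-A,A])}+\||u|^2-|w|^2\|_{L^2(\mathbf{R})}$. Let $\langle f,g\rangle=\int_{\mathbf{R}}\overline fg\,dx$ and $F(u)=(1-|u|^2)u$. A (global) solution with initial datum $u_0\in\mathcal{E}$ is a map $u:\mathbf{R}\to\mathcal{E}$, continuous for $d_\infty$, with $u(0)=u_0$ and, for every $\phi\in\mathcal{S}(\mathbf{R})$, $\frac{d}{dt}\langle iu(t),\phi\rangle-\langle\partial_xu,\partial_x\phi\rangle-\langle iv\partial_xu,\phi\rangle-\gamma\overline u(t,0)\phi(0)+\langle F(u),\phi\rangle=0$ in the sense of distributions in $t$. For every $u_0\in\mathcal{E}$ there is a unique such solution. Critical velocity: for $\gamma>0$, $v_{cr}(\gamma)\in(0,\sqrt2)$ is the number such that the displayed equation for $\xi>0$ has exactly two solutions if $0<v<v_{cr}(\gamma)$, exactly one if $v=v_{cr}(\gamma)$, and none if $v_{cr}(\gamma)<v<\sqrt2$. Stationary solutions: for a solution $\xi>0$ of the displayed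 equation, $u(x;\xi)=(1+r(x;\xi))e^{i\theta(x;\xi)}$, where $$r(x;\xi)=-1+\sqrt{\tfrac{v^2}{2}+\bigl(1-\tfrac{v^2}{2}\bigr)\tanh^2\Bigl(\sqrt{\tfrac{2-v^2}{4}}\,(x\pm\xi)\Bigr)}\quad\text{for }\pm x\ge0,$$ and $\theta(\cdot;\xi)$ is the solution of $\partial_x\theta(x;\xi)=\frac v2\bigl(1-\frac1{(1+r(x;\xi))^2}\bigr)$ with $\theta(0;\xi)=0$. *)

theory Defs
  imports "HOL-Probability.Essential_Supremum"
begin

section \<open>Function spaces on the real line\<close>

definition vderiv :: "(real \<Rightarrow> complex) \<Rightarrow> real \<Rightarrow> complex" where
  "vderiv f = (\<lambda>x. vector_derivative f (at x))"

definition smooth :: "(real \<Rightarrow> complex) \<Rightarrow> bool" where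
  "smooth f \<longleftrightarrow> (\<forall>n x. (vderiv ^^ n) f differentiable (at x))"

definition test_function :: "(real \<Rightarrow> complex) \<Rightarrow> bool" where
  "test_function f \<longleftrightarrow> smooth f \<and> bounded {x. f x \<noteq> 0}"

definition schwartz :: "(real \<Rightarrow> complex) \<Rightarrow> bool" where
  "schwartz f \<longleftrightarrow> smooth f \<and>
     (\<forall>m n. bounded (range (\<lambda>x. of_real (x ^ m) * (vderiv ^^ n) f x)))"

definition in_L2 :: "(real \<Rightarrow> complex) \<Rightarrow> bool" where
  "in_L2 f \<longleftrightarrow> f \<in> borel_measurable lborel \<and> integrable lborel (\<lambda>x. (cmod (f x))\<^sup>2)"

definition locally_integrable :: "(real \<Rightarrow> complex) \<Rightarrow> bool" where
  "locally_integrable f \<longleftrightarrow> f \<in> borel_measurable lborel \<and>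
     (\<forall>a b. set_integrable lborel {a..b} f)"

definition in_L2_loc :: "(real \<Rightarrow> complex) \<Rightarrow> bool" where
  "in_L2_loc f \<longleftrightarrow> f \<in> borel_measurable lborel \<and>
     (\<forall>a b. set_integrable lborel {a..b} (\<lambda>x. (cmod (f x))\<^sup>2))"

text \<open>\<open>f' = g\<close> in the sense of distributions, both sides being locally integrable functions.\<close>

definition has_weak_deriv :: "(real \<Rightarrow> complex) \<Rightarrow> (real \<Rightarrow> complex) \<Rightarrow> bool" where
  "has_weak_deriv f g \<longleftrightarrow> locally_integrable f \<and> locally_integrable g \<and>
     (\<forall>\<eta>. test_function \<eta> \<longrightarrow>
        (LINT x|lborel. f x * vderiv \<eta> x) = - (LINT x|lborel. g x * \<eta> x))"

text \<open>The weak derivative is determined only almost everywhere; it is used below only in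
  contexts that do not depend on the representative.\<close>

definition weak_deriv :: "(real \<Rightarrow> complex) \<Rightarrow> real \<Rightarrow> complex" where
  "weak_deriv f = (SOME g. has_weak_deriv f g)"

definition in_H1_loc :: "(real \<Rightarrow> complex) \<Rightarrow> bool" where
  "in_H1_loc f \<longleftrightarrow> in_L2_loc f \<and> (\<exists>g. has_weak_deriv f g \<and> in_L2_loc g)"

text \<open>Classes in \<open>H\<^sup>1\<^sub>l\<^sub>o\<^sub>c\<close> of the line are represented by their unique continuous
  representative, so that the point values \<open>u(t,0)\<close> below make sense.\<close>

definition energy_space :: "(real \<Rightarrow> complex) set" where
  "energy_space = {u. continuous_on UNIV u \<and> in_H1_loc u \<and> in_L2 (weak_deriv u) \<and>
     in_L2 (\<lambda>x. of_real (1 - (cmod (u x))\<^sup>2))}"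

text \<open>The two norms are real valued; they have their intended meaning on functions of finite
  norm. For \<open>u\<close> and \<open>w\<close> in the energy space the norms in both distances are finite, since
  functions in the energy space are bounded.\<close>

definition L2_norm :: "(real \<Rightarrow> complex) \<Rightarrow> real" where
  "L2_norm f = sqrt (LINT x|lborel. (cmod (f x))\<^sup>2)"

definition Linf_norm :: "real set \<Rightarrow> (real \<Rightarrow> complex) \<Rightarrow> real" where
  "Linf_norm S f = real_of_ereal (esssup (restrict_space lborel S) (\<lambda>x. ereal (cmod (f x))))"

definition dist_inf :: "(real \<Rightarrow> complex) \<Rightarrow> (real \<Rightarrow> complex) \<Rightarrow> real" where
  "dist_inf u w = L2_norm (\<lambda>x. weak_deriv u x - weak_deriv w x)
     + Linf_norm UNIV (\<lambda>x. u x - w x)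
     + L2_norm (\<lambda>x. of_real ((cmod (u x))\<^sup>2 - (cmod (w x))\<^sup>2))"

definition dist_A :: "real \<Rightarrow> (real \<Rightarrow> complex) \<Rightarrow> (real \<Rightarrow> complex) \<Rightarrow> real" where
  "dist_A A u w = L2_norm (\<lambda>x. weak_deriv u x - weak_deriv w x)
     + Linf_norm {-A..A} (\<lambda>x. u x - w x)
     + L2_norm (\<lambda>x. of_real ((cmod (u x))\<^sup>2 - (cmod (w x))\<^sup>2))"


section \<open>The Gross-Pitaevskii equation with a moving delta potential\<close>

definition pairing :: "(real \<Rightarrow> complex) \<Rightarrow> (real \<Rightarrow> complex) \<Rightarrow> complex" where
  "pairing f g = (LINT x|lborel. cnj (f x) * g x)"

definition nonlin :: "(real \<Rightarrow> complex) \<Rightarrow> real \<Rightarrow> complex" where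
  "nonlin u = (\<lambda>x. of_real (1 - (cmod (u x))\<^sup>2) * u x)"

text \<open>Global solutions of \<open>i u\<^sub>t + u\<^sub>x\<^sub>x - i v u\<^sub>x - \<gamma> \<delta>(x) u + (1 - |u|\<^sup>2) u = 0\<close>.\<close>

definition global_solution ::
    "real \<Rightarrow> real \<Rightarrow> (real \<Rightarrow> complex) \<Rightarrow> (real \<Rightarrow> real \<Rightarrow> complex) \<Rightarrow> bool" where
  "global_solution \<gamma> v u0 u \<longleftrightarrow>
     (\<forall>t. u t \<in> energy_space) \<and>
     (\<forall>t. ((\<lambda>s. dist_inf (u s) (u t)) \<longlongrightarrow> 0) (at t)) \<and>
     u 0 = u0 \<and>
     (\<forall>\<phi>. schwartz \<phi> \<longrightarrow>
        has_weak_deriv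
          (\<lambda>t. pairing (\<lambda>x. \<i> * u t x) \<phi>)
          (\<lambda>t. pairing (weak_deriv (u t)) (vderiv \<phi>)
             + pairing (\<lambda>x. \<i> * of_real v * weak_deriv (u t) x) \<phi>
             + of_real \<gamma> * cnj (u t 0) * \<phi> 0
             - pairing (nonlin (u t)) \<phi>))"


section \<open>Critical velocity and stationary solutions\<close>

definition xi_equation :: "real \<Rightarrow> real \<Rightarrow> real \<Rightarrow> bool" where
  "xi_equation \<gamma> v \<xi> \<longleftrightarrow>
     \<gamma> = sqrt 2 * (1 - v\<^sup>2 / 2) powr (3 / 2) *
         (tanh (sqrt (1 / 2 - v\<^sup>2 / 4) * \<xi>) /
          (v\<^sup>2 / 2 + (sinh (sqrt (1 / 2 - v\<^sup>2 / 4) * \<xi>))\<^sup>2))"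

definition xi_solutions :: "real \<Rightarrow> real \<Rightarrow> real set" where
  "xi_solutions \<gamma> v = {\<xi>. 0 < \<xi> \<and> xi_equation \<gamma> v \<xi>}"

definition v_cr :: "real \<Rightarrow> real" where
  "v_cr \<gamma> = (THE c. 0 < c \<and> c < sqrt 2 \<and>
     (\<forall>v. 0 < v \<and> v < c \<longrightarrow> card (xi_solutions \<gamma> v) = 2) \<and>
     card (xi_solutions \<gamma> c) = 1 \<and>
     (\<forall>v. c < v \<and> v < sqrt 2 \<longrightarrow> xi_solutions \<gamma> v = {}))"

definition stat_r :: "real \<Rightarrow> real \<Rightarrow> real \<Rightarrow> real" where
  "stat_r v \<xi> x = -1 + sqrt (v\<^sup>2 / 2 + (1 - v\<^sup>2 / 2) *
     (tanh (sqrt ((2 - v\<^sup>2) / 4) * (if 0 \<le> x then x + \<xi> else x - \<xi>)))\<^sup>2)"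

definition stat_theta :: "real \<Rightarrow> real \<Rightarrow> real \<Rightarrow> real" where
  "stat_theta v \<xi> = (THE \<theta>. \<theta> 0 = 0 \<and>
     (\<forall>x. (\<theta> has_real_derivative v / 2 * (1 - 1 / (1 + stat_r v \<xi> x)\<^sup>2)) (at x)))"

definition stat_sol :: "real \<Rightarrow> real \<Rightarrow> real \<Rightarrow> complex" where
  "stat_sol v \<xi> x = of_real (1 + stat_r v \<xi> x) * exp (\<i> * of_real (stat_theta v \<xi> x))"

end

theory Submission
  imports Defs "HOL-Probability.Probability"
begin

text \<open>With \<open>m = |u|\<^sup>2\<close>, \<open>J = Im (cnj u * u\<^sub>x)\<close>, \<open>c = 1 - v\<^sup>2/2\<close> and \<open>m = v\<^sup>2/2 + c T\<^sup>2\<close>, the stationary solution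
  solves the first-order equations \<open>T\<^sub>x = sgn x k (1 - T\<^sup>2)\<close> and \<open>J = v/2 (m - 1)\<close>, where \<open>k = sqrt (1/2 - v\<^sup>2/4)\<close>.
  As long as \<open>u\<close> does not vanish, completing the squares (Bogomolny's trick) turns the energy, with the
  momentum renormalized to \<open>\<integral> (1 - 1/m) J\<close>, into a weighted \<open>L\<^sup>2\<close> norm of the defects
  \<open>T\<^sub>x - sgn x k (1 - T\<^sup>2)\<close> and \<open>J - v/2 (m - 1)\<close> plus a function \<open>g\<close> of the single number \<open>T 0\<close>. Up to a
  positive factor, \<open>g'\<close> is a cubic with the roots \<open>tanh (k \<xi>\<^sub>1)\<close> and \<open>tanh (k \<xi>\<^sub>2)\<close>, and \<open>g\<close> has a
  nondegenerate minimum at the larger one. So a small energy excess makes both defects and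
  \<open>T 0 - tanh (k \<xi>\<^sub>1)\<close> small; since the equation for \<open>T\<close> is dissipative away from the origin, \<open>u\<close> is then
  close to the orbit of the stationary solution, first in modulus and then, by integrating the
  logarithmic derivative of the quotient, in phase. A continuity argument in time concludes.

  The energy is conserved although solutions are only known in the distributional sense: they are
  curves in the dual of \<open>H\<^sup>1\<close>, and the first-order terms of an energy increment are the symplectic form
  of the increment and the equation, which integrates to zero by antisymmetry.\<close>

section \<open>Smooth bump functions\<close>

text \<open>The momentum makes sense only while u has no zeros, so the energy can be compared only
  between times at which |u| stays away from 0. This forces the bootstrap, which is run on the
  modulus alone, in a neighbourhood so small that T stays above the smaller root, below which g
  falls off again. Energy conservation rests on one rate: the increment D of u over a time step h
  has squared L^2 norm o(h), since D is O(h) in the dual of H^1 and its derivative is o(1) in L^2. A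
  remainder quadratic in D thus disappears after summing 1/h steps. Expanding with the equation at
  both ends of the step leaves just such a remainder. As u itself is not in L^2, it has to be shown
  first that D is. The phase is recovered by integrating from the origin a function that is merely
  square integrable, so its error may grow like sqrt|x|. Hence the sup norm over [-A, A] only, and
  hence the weight 1 + sqrt|x| against the exponentially decaying derivative of the profile.\<close>

lemma vderivI:
  assumes "\<And>x. (f has_vector_derivative f' x) (at x)"
  shows "vderiv f = f'"
  using assms by (auto simp: vderiv_def vector_derivative_at)

lemma smooth_has_vector_derivative:
  assumes "smooth f"
  shows "((vderiv ^^ n) f has_vector_derivative (vderiv ^^ Suc n) f x) (at x)"
  using assms by (simp add: smooth_def vderiv_def vector_derivative_works)

lemma smooth_vderiv: "smooth f \<Longrightarrow> smooth (vderiv f)"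
  unfolding smooth_def by (metis funpow_Suc_right o_apply)

lemma smooth_of_vector_derivative:
  assumes "\<And>x. (f has_vector_derivative q x) (at x)" "smooth q"
  shows "smooth f"
  unfolding smooth_def
proof (intro allI)
  fix n x
  show "(vderiv ^^ n) f differentiable at x"
  proof (cases n)
    case 0
    then show ?thesis using differentiableI_vector[OF assms(1)] by simp
  next
    case (Suc m)
    have "(vderiv ^^ n) f = (vderiv ^^ m) q"
      using vderivI[OF assms(1)] by (simp add: Suc funpow_Suc_right del: funpow.simps)
    then show ?thesis using assms(2) by (simp add: smooth_def)
  qed
qed

text \<open>Closure under differentiation puts every iterate of \<open>vderiv\<close> into S, so
  smoothness of a parametrised family needs no formula for the n-th derivative.\<close>

lemma smooth_by_invariance:
  assumes "f \<in> S" and step: "\<And>g. g \<in> S \<Longrightarrow> \<exists>g'\<in>S. \<forall>x. (g has_vector_derivative g' x) (at x)"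
  shows "smooth f"
proof -
  have in_S: "(vderiv ^^ n) f \<in> S" for n
  proof (induction n)
    case 0
    then show ?case using assms(1) by simp
  next
    case (Suc n)
    then show ?case using step[OF Suc] vderivI by fastforce
  qed
  show ?thesis
    unfolding smooth_def using step[OF in_S] differentiableI_vector by blast
qed

text \<open>The case n = 0 is the standard mollifier. The power of the denominator is a parameter
  because each differentiation raises it.\<close>

definition bump :: "real \<Rightarrow> nat \<Rightarrow> real \<Rightarrow> real" where
  "bump R n x = (if \<bar>x\<bar> < R then exp (- 1 / (R\<^sup>2 - x\<^sup>2)) / (R\<^sup>2 - x\<^sup>2) ^ n else 0)"

lemma bump_nonneg: "0 \<le> bump R n x"
proof (cases "\<bar>x\<bar> < R")
  case True
  then have "x\<^sup>2 < R\<^sup>2" by (metis abs_ge_zero power2_abs power_strict_mono zero_less_numeral)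
  then show ?thesis by (simp add: bump_def)
qed (simp add: bump_def)

text \<open>The exponential series dominates each of its terms. The term of order n + 2 cancels the
  denominator and leaves the square that makes the function flat at |x| = R.\<close>

lemma bump_le_power:
  assumes "\<bar>x\<bar> < R"
  shows "bump R n x \<le> fact (n + 2) * (R\<^sup>2 - x\<^sup>2)\<^sup>2"
proof -
  define y where "y = R\<^sup>2 - x\<^sup>2"
  have "x\<^sup>2 < R\<^sup>2" using assms by (metis abs_ge_zero power2_abs power_strict_mono zero_less_numeral)
  then have y: "y > 0" by (simp add: y_def)
  have "(1 / y) ^ (n + 2) / fact (n + 2) \<le> exp (1 / y)"
  proof -
    have "(\<Sum>k\<in>{n+2}. (1 / y) ^ k /\<^sub>R fact k) \<le> (\<Sum>k. (1 / y) ^ k /\<^sub>R fact k)"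
      by (rule sum_le_suminf) (use y summable_exp_generic[of "1/y"] in auto)
    then show ?thesis by (simp add: exp_def divide_inverse mult.commute)
  qed
  then have "exp (- 1 / y) \<le> fact (n + 2) * y ^ (n + 2)"
    using y by (simp add: exp_minus field_simps del: power_Suc fact_Suc add_2_eq_Suc')
  then have "exp (- 1 / y) / y ^ n \<le> fact (n + 2) * y\<^sup>2"
    using y by (simp add: divide_le_eq power_add mult_ac del: fact_Suc add_2_eq_Suc')
  then show ?thesis using assms by (simp add: bump_def y_def)
qed

lemma has_vector_derivative_zero_quadratic:
  fixes f :: "real \<Rightarrow> 'a::real_normed_vector"
  assumes "\<And>x. norm (f x) \<le> K * (x - x0)\<^sup>2"
  shows "(f has_vector_derivative 0) (at x0)"
proof -
  have f0: "f x0 = 0" using assms[of x0] by simp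
  have "((\<lambda>h. norm (f (x0 + h) - f x0 - h *\<^sub>R 0) / norm h) \<longlongrightarrow> 0) (at 0)"
  proof (rule tendsto_sandwich[OF _ _ tendsto_const])
    show "\<forall>\<^sub>F h in at 0. 0 \<le> norm (f (x0 + h) - f x0 - h *\<^sub>R 0) / norm h" by simp
    show "\<forall>\<^sub>F h in at 0. norm (f (x0 + h) - f x0 - h *\<^sub>R 0) / norm h \<le> K * \<bar>h\<bar>"
      unfolding eventually_at
    proof (intro exI[of _ 1] conjI ballI impI, goal_cases)
      case (2 h)
      then have h: "\<bar>h\<bar> > 0" by simp
      have "norm (f (x0 + h)) \<le> K * (\<bar>h\<bar> * \<bar>h\<bar>)" using assms[of "x0 + h"] by (simp add: power2_eq_square)
      then show ?case using h f0 by (simp add: field_simps)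
    qed simp
    show "((\<lambda>h. K * \<bar>h\<bar>) \<longlongrightarrow> 0) (at 0)"
      by (rule tendsto_eq_intros refl | simp)+
  qed
  then show ?thesis
    by (simp add: has_vector_derivative_def has_derivative_at bounded_linear_scaleR_left)
qed

definition poly_bump :: "real \<Rightarrow> complex poly \<Rightarrow> nat \<Rightarrow> real \<Rightarrow> complex" where
  "poly_bump R P n x = of_real (bump R n x) * poly P (of_real x)"

text \<open>With y = R^2 - x^2 both the exponential and the power of y contribute inverse powers of
  y. Over the common denominator y^(n+2) the numerator is again a polynomial, so the family is
  closed under differentiation.\<close>

lemma poly_bump_has_vector_derivative:
  assumes "0 < R"
  defines "Y \<equiv> [:of_real (R\<^sup>2), 0, -1:] :: complex poly"
  shows "(poly_bump R P n has_vector_derivative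
     poly_bump R (pderiv P * Y\<^sup>2 + [:0, of_nat (2*n):] * Y * P - [:0, 2:] * P) (n + 2) x) (at x)"
proof -
  consider "\<bar>x\<bar> < R" | "\<bar>x\<bar> > R" | "\<bar>x\<bar> = R" by linarith
  then show ?thesis
  proof cases
    case 1
    define y where "y = R\<^sup>2 - x\<^sup>2"
    have "x\<^sup>2 < R\<^sup>2" using 1 by (metis abs_ge_zero power2_abs power_strict_mono zero_less_numeral)
    then have y: "y > 0" by (simp add: y_def)
    define D where "D = (2 * real n * x * y - 2 * x) * (exp (- 1 / y) / y ^ (n + 2))"
    have der: "((\<lambda>x. exp (- 1 / (R\<^sup>2 - x\<^sup>2)) / (R\<^sup>2 - x\<^sup>2) ^ n) has_real_derivative D) (at x)"
    proof -
      have ny: "y \<noteq> 0" "R\<^sup>2 - x\<^sup>2 \<noteq> 0" using y by (auto simp: y_def)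
      have d1: "((\<lambda>x. exp (- 1 / (R\<^sup>2 - x\<^sup>2))) has_real_derivative exp (- 1 / y) * (- 2 * x / y\<^sup>2)) (at x)"
        using ny by (auto intro!: derivative_eq_intros simp: y_def power2_eq_square)
      have d2: "((\<lambda>x. inverse (R\<^sup>2 - x\<^sup>2) ^ n) has_real_derivative
          real n * inverse y ^ (n - 1) * (2 * x / y\<^sup>2)) (at x)"
        using ny by (auto intro!: derivative_eq_intros simp: y_def power2_eq_square divide_inverse)
      have eq: "(\<lambda>x. exp (- 1 / (R\<^sup>2 - x\<^sup>2)) / (R\<^sup>2 - x\<^sup>2) ^ n)
          = (\<lambda>x. exp (- 1 / (R\<^sup>2 - x\<^sup>2)) * inverse (R\<^sup>2 - x\<^sup>2) ^ n)"
        by (simp add: divide_inverse power_inverse)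
      have "exp (- 1 / y) * (- 2 * x / y\<^sup>2) * inverse (R\<^sup>2 - x\<^sup>2) ^ n +
          real n * inverse y ^ (n - 1) * (2 * x / y\<^sup>2) * exp (- 1 / (R\<^sup>2 - x\<^sup>2)) = D"
      proof (cases n)
        case 0
        then show ?thesis using ny by (simp add: D_def power2_eq_square)
      next
        case (Suc m)
        have "exp (- 1 / y) * (- 2 * x / y\<^sup>2) * inverse y ^ n +
          real n * inverse y ^ m * (2 * x / y\<^sup>2) * exp (- 1 / y) = D"
          using ny(1) by (simp add: D_def Suc power2_eq_square field_simps power_inverse)
        then show ?thesis by (simp add: Suc y_def)
      qed
      then show ?thesis unfolding eq using DERIV_mult[OF d1 d2] by simp
    qed
    have "((\<lambda>x. of_real (exp (- 1 / (R\<^sup>2 - x\<^sup>2)) / (R\<^sup>2 - x\<^sup>2) ^ n) * poly P (of_real x)) has_vector_derivative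
       of_real (exp (- 1 / y) / y ^ n) * poly (pderiv P) (of_real x) + of_real D * poly P (of_real x)) (at x)"
    proof -
      have "((\<lambda>x. complex_of_real (exp (- 1 / (R\<^sup>2 - x\<^sup>2)) / (R\<^sup>2 - x\<^sup>2) ^ n)) has_vector_derivative of_real D) (at x)"
        using der has_vector_derivative_of_real has_real_derivative_iff_has_vector_derivative by blast
      moreover have "((\<lambda>x. poly P (complex_of_real x)) has_vector_derivative poly (pderiv P) (of_real x)) (at x)"
        using field_vector_diff_chain_at[of complex_of_real 1 x "poly P" "poly (pderiv P) (of_real x)"]
          has_vector_derivative_of_real[OF DERIV_ident[where F="at x"]] poly_DERIV[of P]
        by (simp add: o_def)
      ultimately show ?thesis
        using has_vector_derivative_mult by (fastforce simp: y_def)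
    qed
    moreover have "of_real (exp (- 1 / y) / y ^ n) * poly (pderiv P) (of_real x) + of_real D * poly P (of_real x)
       = poly_bump R (pderiv P * Y\<^sup>2 + [:0, of_nat (2*n):] * Y * P - [:0, 2:] * P) (n + 2) x"
    proof -
      define E where "E = exp (- 1 / y) / y ^ (n + 2)"
      have Y: "poly Y (of_real x) = of_real y" by (simp add: Y_def y_def power2_eq_square algebra_simps)
      have E: "exp (- 1 / y) / y ^ n = E * y\<^sup>2" using y by (simp add: E_def power_add power2_eq_square)
      have b: "bump R (n + 2) x = E" using 1 by (simp add: bump_def E_def y_def)
      have D: "D = (2 * real n * x * y - 2 * x) * E" by (simp add: D_def E_def)
      show ?thesis
        unfolding poly_bump_def b E D
        by (simp add: Y algebra_simps power2_eq_square)
    qed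
    ultimately have "((\<lambda>x. of_real (exp (- 1 / (R\<^sup>2 - x\<^sup>2)) / (R\<^sup>2 - x\<^sup>2) ^ n) * poly P (of_real x)) has_vector_derivative
       poly_bump R (pderiv P * Y\<^sup>2 + [:0, of_nat (2*n):] * Y * P - [:0, 2:] * P) (n + 2) x) (at x)" by simp
    then show ?thesis
      by (rule has_vector_derivative_transform_within_open[where S="{-R<..<R}"])
        (use 1 in \<open>auto simp: poly_bump_def bump_def\<close>)
  next
    case 2
    have "((\<lambda>x. 0::complex) has_vector_derivative 0) (at x)" by simp
    then have "(poly_bump R P n has_vector_derivative 0) (at x)"
      by (rule has_vector_derivative_transform_within_open[where S="{x. \<bar>x\<bar> > R}"])
        (use 2 in \<open>auto simp: poly_bump_def bump_def intro!: open_Collect_less continuous_intros\<close>)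
    then show ?thesis using 2 by (simp add: poly_bump_def bump_def)
  next
    case 3
    have "bounded ((\<lambda>x. poly P (of_real x)) ` {-R..R})"
      by (intro compact_imp_bounded compact_continuous_image continuous_intros) auto
    then obtain M where M: "\<And>z. \<bar>z\<bar> \<le> R \<Longrightarrow> cmod (poly P (of_real z)) \<le> M"
      unfolding bounded_iff by (force simp: abs_le_iff)
    have M0: "M \<ge> 0" using M[of 0] norm_ge_zero order_trans assms by (metis abs_zero less_imp_le)
    \<comment> \<open>At |x| = R the function is O((z - x)^2), because R^2 - z^2 is O(|z - x|); this
      settles both sides of the boundary point at once.\<close>
    have "cmod (poly_bump R P n z) \<le> (fact (n + 2) * (2 * R)\<^sup>2 * M) * (z - x)\<^sup>2" for z
    proof (cases "\<bar>z\<bar> < R")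
      case True
      have zx: "\<bar>R\<^sup>2 - z\<^sup>2\<bar> \<le> 2 * R * \<bar>z - x\<bar>"
      proof -
        have "\<bar>R\<^sup>2 - z\<^sup>2\<bar> = \<bar>(x - z) * (x + z)\<bar>" using 3 by (metis power2_abs square_diff_square_factored mult.commute power2_eq_square)
        also have "\<dots> = \<bar>z - x\<bar> * \<bar>x + z\<bar>" by (simp add: abs_mult abs_minus_commute)
        also have "\<dots> \<le> \<bar>z - x\<bar> * (2 * R)" by (rule mult_left_mono) (use True 3 in auto)
        finally show ?thesis by (simp add: mult.commute)
      qed
      have "cmod (poly_bump R P n z) = bump R n z * cmod (poly P (of_real z))"
        by (simp add: poly_bump_def norm_mult bump_nonneg)
      also have "\<dots> \<le> (fact (n + 2) * (R\<^sup>2 - z\<^sup>2)\<^sup>2) * M"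
        by (intro mult_mono bump_le_power M) (use True M0 in auto)
      also have "\<dots> \<le> (fact (n + 2) * (2 * R * \<bar>z - x\<bar>)\<^sup>2) * M"
        using zx M0 by (intro mult_right_mono mult_left_mono) (auto simp: abs_le_square_iff[symmetric] assms less_imp_le)
      finally show ?thesis by (simp add: power_mult_distrib mult_ac)
    next
      case False
      then show ?thesis using M0 assms by (simp add: poly_bump_def bump_def)
    qed
    then have "(poly_bump R P n has_vector_derivative 0) (at x)"
      by (rule has_vector_derivative_zero_quadratic)
    then show ?thesis using 3 by (simp add: poly_bump_def bump_def)
  qed
qed

lemma test_function_poly_bump:
  assumes "0 < R"
  shows "test_function (poly_bump R P n)"
proof -
  have "smooth (poly_bump R P n)"
    by (rule smooth_by_invariance[of _ "{poly_bump R P n |P n. True}"])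
      (use poly_bump_has_vector_derivative[OF assms] in blast)+
  moreover have "{x. poly_bump R P n x \<noteq> 0} \<subseteq> {-R..R}"
    by (auto simp: poly_bump_def bump_def split: if_splits)
  ultimately show ?thesis
    unfolding test_function_def using bounded_subset bounded_closed_interval by blast
qed

section \<open>Elementary properties of test functions\<close>

lemma vderiv_eq_0_outside:
  assumes "\<And>x. \<bar>x\<bar> > R \<Longrightarrow> f x = 0" "\<bar>x\<bar> > R"
  shows "vderiv f x = 0"
proof -
  have "((\<lambda>x. 0::complex) has_vector_derivative 0) (at x)" by simp
  then have "(f has_vector_derivative 0) (at x)"
    by (rule has_vector_derivative_transform_within_open[where S="{x. \<bar>x\<bar> > R}"])
      (use assms in \<open>auto intro!: open_Collect_less continuous_intros\<close>)
  then show ?thesis by (simp add: vderiv_def vector_derivative_at)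
qed

lemma test_function_support:
  assumes "test_function \<eta>"
  obtains R where "R > 0" "\<And>x. \<bar>x\<bar> > R \<Longrightarrow> \<eta> x = 0"
proof -
  obtain R where "R > 0" "\<forall>x\<in>{x. \<eta> x \<noteq> 0}. norm x \<le> R"
    using assms unfolding test_function_def bounded_pos by blast
  then show ?thesis using that[of R] by (metis (mono_tags) mem_Collect_eq not_le real_norm_def)
qed

lemma test_function_vderiv: "test_function \<eta> \<Longrightarrow> test_function (vderiv \<eta>)"
proof -
  assume t: "test_function \<eta>"
  obtain R where R: "R > 0" "\<And>x. \<bar>x\<bar> > R \<Longrightarrow> \<eta> x = 0" using test_function_support[OF t] by blast
  have "{x. vderiv \<eta> x \<noteq> 0} \<subseteq> {-R..R}"
    using vderiv_eq_0_outside[of R \<eta>] R by (force simp: not_less[symmetric])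
  then show ?thesis using t smooth_vderiv bounded_subset[OF bounded_closed_interval] unfolding test_function_def by blast
qed

lemma test_function_has_vector_derivative:
  "test_function \<eta> \<Longrightarrow> (\<eta> has_vector_derivative vderiv \<eta> x) (at x)"
  using smooth_has_vector_derivative[of \<eta> 0 x] by (simp add: test_function_def)

lemma test_function_continuous: "test_function \<eta> \<Longrightarrow> continuous_on S \<eta>"
  by (meson continuous_at_imp_continuous_on has_vector_derivative_continuous test_function_has_vector_derivative)

lemma test_function_bounded:
  assumes "test_function \<eta>"
  obtains B where "B > 0" "\<And>x. cmod (\<eta> x) \<le> B"
proof -
  obtain R where R: "R > 0" "\<And>x. \<bar>x\<bar> > R \<Longrightarrow> \<eta> x = 0" using test_function_support[OF assms] by blast
  have "bounded (\<eta> ` {-R..R})"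
    by (intro compact_imp_bounded compact_continuous_image test_function_continuous assms) auto
  then obtain B where "B > 0" "\<forall>x\<in>{-R..R}. cmod (\<eta> x) \<le> B" unfolding bounded_pos by auto
  then show ?thesis using that[of B] R
    by (metis abs_le_iff atLeastAtMost_iff less_eq_real_def linorder_not_less minus_le_iff norm_zero)
qed

text \<open>Tests of compact support are thus admissible in the definition of a solution; all other
  test functions are reached from them by density.\<close>

lemma schwartz_test_function:
  assumes "test_function \<eta>"
  shows "schwartz \<eta>"
proof -
  have t: "test_function ((vderiv ^^ n) \<eta>)" for n
    by (induction n) (use assms test_function_vderiv in auto)
  have "bounded (range (\<lambda>x. of_real (x ^ m) * (vderiv ^^ n) \<eta> x))" for m n
  proof -
    obtain R where R: "R > 0" "\<And>x. \<bar>x\<bar> > R \<Longrightarrow> (vderiv ^^ n) \<eta> x = 0" using test_function_support[OF t] by blast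
    obtain B where B: "B > 0" "\<And>x. cmod ((vderiv ^^ n) \<eta> x) \<le> B" using test_function_bounded[OF t] by blast
    have "cmod (of_real (x ^ m) * (vderiv ^^ n) \<eta> x) \<le> R ^ m * B" for x
    proof (cases "\<bar>x\<bar> > R")
      case False
      then show ?thesis using B R by (auto simp: norm_mult norm_power power_abs intro!: mult_mono power_mono)
    qed (use R B in simp)
    then show ?thesis unfolding bounded_iff by blast
  qed
  then show ?thesis using assms by (simp add: schwartz_def test_function_def)
qed

section \<open>Absolutely continuous functions on the line\<close>

definition has_ac_deriv :: "(real \<Rightarrow> 'a::euclidean_space) \<Rightarrow> (real \<Rightarrow> 'a) \<Rightarrow> bool" where
  "has_ac_deriv f g \<longleftrightarrow> g \<in> borel_measurable borel \<and> (\<forall>a b. set_integrable lborel {a..b} g) \<and>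
     (\<forall>a b. a \<le> b \<longrightarrow> (g has_integral f b - f a) {a..b})"

lemma ac_borel: "has_ac_deriv f g \<Longrightarrow> g \<in> borel_measurable borel"
  and ac_set_integrable: "has_ac_deriv f g \<Longrightarrow> set_integrable lborel {a..b} g"
  and ac_has_integral: "has_ac_deriv f g \<Longrightarrow> a \<le> b \<Longrightarrow> (g has_integral f b - f a) {a..b}"
  by (auto simp: has_ac_deriv_def)

lemma set_integrable_imp_integrable_on:
  fixes g :: "real \<Rightarrow> 'a::euclidean_space"
  shows "set_integrable lborel {a..b} g \<Longrightarrow> g integrable_on {a..b}"
  by (rule set_borel_integral_eq_integral(1))

lemma set_integrable_dominated:
  fixes g :: "real \<Rightarrow> 'a::euclidean_space" and h :: "real \<Rightarrow> 'b::euclidean_space"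
  assumes "set_integrable lborel {a..b} g" "h \<in> borel_measurable borel"
    and "\<And>x. x \<in> {a..b} \<Longrightarrow> norm (h x) \<le> K * norm (g x)"
  shows "set_integrable lborel {a..b} h"
  unfolding set_integrable_def
proof (rule Bochner_Integration.integrable_bound)
  show "integrable lborel (\<lambda>x. K * norm (indicat_real {a..b} x *\<^sub>R g x))"
    using assms(1) unfolding set_integrable_def by (intro integrable_mult_right integrable_norm)
  show "(\<lambda>x. indicat_real {a..b} x *\<^sub>R h x) \<in> borel_measurable lborel" using assms(2) by simp
  show "AE x in lborel. norm (indicat_real {a..b} x *\<^sub>R h x) \<le> norm (K * norm (indicat_real {a..b} x *\<^sub>R g x))"
    using assms(3) by (intro AE_I2) (auto simp: indicator_def intro: order_trans[OF _ abs_ge_self])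
qed

lemma set_integrable_continuous:
  fixes g :: "real \<Rightarrow> 'a::euclidean_space"
  assumes "continuous_on UNIV g"
  shows "set_integrable lborel {a..b} g"
  unfolding set_integrable_def
  by (rule borel_integrable_compact) (use assms continuous_on_subset in auto)

lemma ac_increment_le:
  assumes "has_ac_deriv f g" "a \<le> b"
  shows "norm (f b - f a) \<le> integral {a..b} (\<lambda>x. norm (g x))"
proof -
  have "norm (integral {a..b} g) \<le> integral {a..b} (\<lambda>x. norm (g x))"
    by (intro integral_norm_bound_integral set_integrable_imp_integrable_on set_integrable_norm ac_set_integrable[OF assms(1)]) auto
  then show ?thesis using integral_unique[OF ac_has_integral[OF assms]] by simp
qed

lemma ac_continuous:
  assumes "has_ac_deriv f g"
  shows "continuous_on S f"
proof -
  have "continuous (at x) f" for x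
  proof -
    have "continuous_on {x-1..x+1} (\<lambda>y. f (x-1) + integral {x-1..y} g)"
      using indefinite_integral_continuous_1[OF set_integrable_imp_integrable_on[OF ac_set_integrable[OF assms]]]
      by (intro continuous_intros) auto
    then have "continuous_on {x-1..x+1} f"
      by (rule continuous_on_eq) (simp add: integral_unique[OF ac_has_integral[OF assms]])
    then have "continuous_on {x-1<..<x+1} f" by (rule continuous_on_subset) auto
    then show ?thesis by (simp add: continuous_on_eq_continuous_at)
  qed
  then show ?thesis by (intro continuous_at_imp_continuous_on) blast
qed

lemma ac_borel_fun: "has_ac_deriv f g \<Longrightarrow> f \<in> borel_measurable borel"
  by (rule borel_measurable_continuous_onI) (rule ac_continuous)

text \<open>Telescoping over a fine equidistant partition bounds the total increment of I by
  \<epsilon> times that of N, for every \<epsilon>.\<close>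

lemma increments_zero:
  fixes I :: "real \<Rightarrow> 'a::real_normed_vector" and N :: "real \<Rightarrow> real"
  assumes "a \<le> b"
    and inc: "\<And>\<epsilon>. \<epsilon> > 0 \<Longrightarrow> \<exists>\<delta>>0. \<forall>x y. a \<le> x \<and> x \<le> y \<and> y \<le> b \<and> y - x < \<delta> \<longrightarrow> norm (I y - I x) \<le> \<epsilon> * (N y - N x)"
  shows "I b = I a"
proof -
  have *: "norm (I b - I a) \<le> \<epsilon> * (N b - N a)" if \<epsilon>: "\<epsilon> > 0" for \<epsilon>
  proof -
    obtain \<delta> where \<delta>: "\<delta> > 0" "\<And>x y. a \<le> x \<Longrightarrow> x \<le> y \<Longrightarrow> y \<le> b \<Longrightarrow> y - x < \<delta> \<Longrightarrow> norm (I y - I x) \<le> \<epsilon> * (N y - N x)"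
      using inc[OF \<epsilon>] by blast
    obtain n :: nat where n: "real n > (b - a) / \<delta>" using reals_Archimedean2 by blast
    have n0: "n > 0" using n \<delta>(1) assms(1) by (cases n) (auto simp: divide_less_0_iff)
    define p where "p i = a + real i * ((b - a) / n)" for i
    have step: "(b - a) / n < \<delta>" "(b - a) / n \<ge> 0" using n n0 \<delta>(1) assms(1) by (auto simp: field_simps)
    have "i \<le> n \<Longrightarrow> norm (I (p i) - I a) \<le> \<epsilon> * (N (p i) - N a)" for i
    proof (induction i)
      case 0
      then show ?case by (simp add: p_def)
    next
      case (Suc i)
      have ps: "p (Suc i) = p i + (b - a) / n" by (simp only: p_def of_nat_Suc distrib_right mult_1 add_ac)
      have "real (Suc i) * ((b - a) / n) \<le> real n * ((b - a) / n)"
        using Suc.prems step(2) by (intro mult_right_mono) auto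
      then have "p (Suc i) \<le> b" using n0 by (simp add: p_def)
      moreover have "a \<le> p i" using mult_nonneg_nonneg[OF of_nat_0_le_iff step(2)] by (simp add: p_def)
      ultimately have "norm (I (p (Suc i)) - I (p i)) \<le> \<epsilon> * (N (p (Suc i)) - N (p i))"
        using \<delta>(2)[of "p i" "p (Suc i)"] ps step by auto
      moreover have "norm (I (p (Suc i)) - I a) \<le> norm (I (p (Suc i)) - I (p i)) + norm (I (p i) - I a)"
        using norm_triangle_ineq[of "I (p (Suc i)) - I (p i)" "I (p i) - I a"] by simp
      ultimately show ?case using Suc by (simp add: algebra_simps)
    qed
    from this[of n] show ?thesis using n0 by (simp add: p_def)
  qed
  show ?thesis
  proof (rule ccontr)
    assume "I b \<noteq> I a"
    then have pos: "norm (I b - I a) > 0" by simp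
    then have N: "N b - N a > 0" using *[of 1] order_less_le_trans[OF pos, of "N b - N a"] by simp
    have "norm (I b - I a) \<le> norm (I b - I a) / (2 * (N b - N a)) * (N b - N a)"
      using pos N by (intro *) simp
    then show False using pos N by (simp add: field_simps)
  qed
qed

text \<open>F minus the integral of h has increments that are small compared with those of the
  integral of w, hence is constant. Product and chain rule reduce to such a local estimate, without
  differentiating at points.\<close>

lemma ac_criterion:
  fixes F :: "real \<Rightarrow> 'a::euclidean_space" and w :: "real \<Rightarrow> real"
  assumes h: "h \<in> borel_measurable borel" "\<And>a b. set_integrable lborel {a..b} h"
    and w: "\<And>a b. set_integrable lborel {a..b} w"
    and inc: "\<And>a b \<epsilon>. \<epsilon> > 0 \<Longrightarrow> a \<le> b \<Longrightarrow> \<exists>\<delta>>0. \<forall>x y. a \<le> x \<and> x \<le> y \<and> y \<le> b \<and> y - x < \<delta> \<longrightarrow>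
       norm (F y - F x - integral {x..y} h) \<le> \<epsilon> * integral {x..y} w"
  shows "has_ac_deriv F h"
  unfolding has_ac_deriv_def
proof (intro conjI allI impI h)
  fix a b :: real assume ab: "a \<le> b"
  note hi = set_integrable_imp_integrable_on[OF h(2)] and wi = set_integrable_imp_integrable_on[OF w]
  have "F b - integral {a..b} h = F a - integral {a..a} h"
  proof (rule increments_zero[OF ab, where N="\<lambda>x. integral {a..x} w"], goal_cases)
    case (1 \<epsilon>)
    from inc[OF this ab] obtain \<delta> where \<delta>: "\<delta> > 0" "\<And>x y. a \<le> x \<Longrightarrow> x \<le> y \<Longrightarrow> y \<le> b \<Longrightarrow> y - x < \<delta> \<Longrightarrow>
       norm (F y - F x - integral {x..y} h) \<le> \<epsilon> * integral {x..y} w" by blast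
    show ?case
    proof (intro exI[of _ \<delta>] conjI allI impI \<delta>(1))
      fix x y assume *: "a \<le> x \<and> x \<le> y \<and> y \<le> b \<and> y - x < \<delta>"
      then have "integral {a..x} h + integral {x..y} h = integral {a..y} h"
        "integral {a..x} w + integral {x..y} w = integral {a..y} w"
        by (auto intro!: Henstock_Kurzweil_Integration.integral_combine hi wi)
      then have e: "F y - integral {a..y} h - (F x - integral {a..x} h) = F y - F x - integral {x..y} h"
        "integral {a..y} w - integral {a..x} w = integral {x..y} w"
        by (auto simp: algebra_simps)
      show "norm (F y - integral {a..y} h - (F x - integral {a..x} h)) \<le> \<epsilon> * (integral {a..y} w - integral {a..x} w)"
        unfolding e using \<delta>(2)[of x y] * by simp
    qed
  qed
  then have "integral {a..b} h = F b - F a" by (simp add: algebra_simps)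
  then show "(h has_integral F b - F a) {a..b}" using hi by (metis integrable_integral)
qed

lemma ac_bounded_linear:
  fixes L :: "'a::euclidean_space \<Rightarrow> 'b::euclidean_space"
  assumes "has_ac_deriv f g" "bounded_linear L"
  shows "has_ac_deriv (\<lambda>x. L (f x)) (\<lambda>x. L (g x))"
  unfolding has_ac_deriv_def
proof (intro conjI allI impI)
  have Lb: "L \<in> borel_measurable borel"
    using assms(2) linear_continuous_on borel_measurable_continuous_onI by blast
  show Lm: "(\<lambda>x. L (g x)) \<in> borel_measurable borel" using measurable_compose[OF ac_borel[OF assms(1)] Lb] .
  fix a b :: real
  obtain K where K: "\<And>x. norm (L x) \<le> norm x * K" using bounded_linear.bounded[OF assms(2)] by blast
  show "set_integrable lborel {a..b} (\<lambda>x. L (g x))"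
    by (rule set_integrable_dominated[OF ac_set_integrable[OF assms(1)] Lm, of _ _ K]) (use K in \<open>auto simp: mult.commute\<close>)
  assume "a \<le> b"
  from has_integral_linear[OF ac_has_integral[OF assms(1) this] assms(2)]
  show "((\<lambda>x. L (g x)) has_integral L (f b) - L (f a)) {a..b}"
    by (simp add: o_def linear_diff[OF bounded_linear.linear[OF assms(2)]])
qed

lemma ac_add:
  assumes "has_ac_deriv f f'" "has_ac_deriv g g'"
  shows "has_ac_deriv (\<lambda>x. f x + g x) (\<lambda>x. f' x + g' x)"
  unfolding has_ac_deriv_def
proof (intro conjI allI impI)
  show "(\<lambda>x. f' x + g' x) \<in> borel_measurable borel"
    by (intro borel_measurable_add ac_borel[OF assms(1)] ac_borel[OF assms(2)])
  fix a b :: real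
  show "set_integrable lborel {a..b} (\<lambda>x. f' x + g' x)"
    by (intro set_integral_add ac_set_integrable[OF assms(1)] ac_set_integrable[OF assms(2)])
  assume "a \<le> b"
  from has_integral_add[OF ac_has_integral[OF assms(1) this] ac_has_integral[OF assms(2) this]]
  show "((\<lambda>x. f' x + g' x) has_integral f b + g b - (f a + g a)) {a..b}"
    by (simp add: add_diff_add)
qed

lemma ac_diff:
  assumes "has_ac_deriv f f'" "has_ac_deriv g g'"
  shows "has_ac_deriv (\<lambda>x. f x - g x) (\<lambda>x. f' x - g' x)"
  using ac_add[OF assms(1) ac_bounded_linear[OF assms(2), of "\<lambda>x. - x"]]
  by (simp add: bounded_linear_minus[OF bounded_linear_ident])

lemma ac_const: "has_ac_deriv (\<lambda>x. c) (\<lambda>x. 0)"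
  by (simp add: has_ac_deriv_def set_integrable_def)

lemma ac_exceptional:
  fixes f :: "real \<Rightarrow> 'a::euclidean_space"
  assumes "finite S" "continuous_on UNIV f" "\<And>x. x \<notin> S \<Longrightarrow> (f has_vector_derivative f' x) (at x)"
    and "f' \<in> borel_measurable borel" "\<And>a b. set_integrable lborel {a..b} f'"
  shows "has_ac_deriv f f'"
  unfolding has_ac_deriv_def
  using assms(4,5)
proof (intro conjI allI impI)
  fix a b :: real assume "a \<le> b"
  then show "(f' has_integral f b - f a) {a..b}"
    by (rule fundamental_theorem_of_calculus_interior_strong[OF assms(1)])
      (use assms(3) continuous_on_subset[OF assms(2)] in auto)
qed

lemma ac_C1:
  fixes f :: "real \<Rightarrow> 'a::euclidean_space"
  assumes "\<And>x. (f has_vector_derivative f' x) (at x)" "continuous_on UNIV f'"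
  shows "has_ac_deriv f f'"
  using assms
  by (intro ac_exceptional[of "{}"] set_integrable_continuous borel_measurable_continuous_onI)
    (auto intro!: continuous_at_imp_continuous_on has_vector_derivative_continuous)

lemma continuous_bounded_on_interval:
  fixes g :: "real \<Rightarrow> 'a::real_normed_vector"
  assumes "continuous_on UNIV g"
  obtains K where "K > 0" "\<And>x. x \<in> {a..b} \<Longrightarrow> norm (g x) \<le> K"
proof -
  have "bounded (g ` {a..b})"
    by (intro compact_imp_bounded compact_continuous_image) (use assms continuous_on_subset in auto)
  then obtain K where "K > 0" "\<forall>y\<in>g ` {a..b}. norm y \<le> K" unfolding bounded_pos by blast
  then show ?thesis using that[of K] by blast
qed

lemma uniformly_close_on_interval:
  fixes g :: "real \<Rightarrow> 'a::real_normed_vector"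
  assumes "continuous_on UNIV g" "\<epsilon> > 0"
  obtains \<delta> where "\<delta> > 0" "\<And>x y. x \<in> {a..b} \<Longrightarrow> y \<in> {a..b} \<Longrightarrow> \<bar>y - x\<bar> < \<delta> \<Longrightarrow> norm (g y - g x) < \<epsilon>"
proof -
  have "uniformly_continuous_on {a..b} g"
    by (intro compact_uniformly_continuous) (use assms continuous_on_subset in auto)
  then obtain d where "d > 0" "\<forall>x\<in>{a..b}. \<forall>y\<in>{a..b}. dist y x < d \<longrightarrow> dist (g y) (g x) < \<epsilon>"
    using assms(2) unfolding uniformly_continuous_on_def by blast
  then show ?thesis using that[of d] by (simp add: dist_norm)
qed

lemma ac_mult:
  fixes f g :: "real \<Rightarrow> 'a::{real_normed_field,euclidean_space}"
  assumes f: "has_ac_deriv f f'" and g: "has_ac_deriv g g'"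
  shows "has_ac_deriv (\<lambda>x. f x * g x) (\<lambda>x. f' x * g x + f x * g' x)"
proof -
  note [measurable] = ac_borel[OF f] ac_borel[OF g] ac_borel_fun[OF f] ac_borel_fun[OF g]
  have i1: "set_integrable lborel {a..b} (\<lambda>x. f' x * g x)" for a b
  proof -
    obtain K where "K > 0" "\<And>x. x \<in> {a..b} \<Longrightarrow> norm (g x) \<le> K"
      using continuous_bounded_on_interval[OF ac_continuous[OF g]] by blast
    then show ?thesis
      by (intro set_integrable_dominated[OF ac_set_integrable[OF f], of _ _ _ K])
        (auto simp: norm_mult mult.commute[of K] intro!: mult_left_mono)
  qed
  have i2: "set_integrable lborel {a..b} (\<lambda>x. f x * g' x)" for a b
  proof -
    obtain K where "K > 0" "\<And>x. x \<in> {a..b} \<Longrightarrow> norm (f x) \<le> K"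
      using continuous_bounded_on_interval[OF ac_continuous[OF f]] by blast
    then show ?thesis
      by (intro set_integrable_dominated[OF ac_set_integrable[OF g], of _ _ _ K])
        (auto simp: norm_mult intro!: mult_right_mono)
  qed
  note n1 = set_integrable_norm[OF ac_set_integrable[OF f]]
  note n2 = set_integrable_norm[OF ac_set_integrable[OF g]]
  show ?thesis
  proof (rule ac_criterion[where w="\<lambda>x. norm (f' x) + norm (g' x)"], goal_cases)
    case 1 show ?case by measurable
  next
    case 2 show ?case by (intro set_integral_add i1 i2)
  next
    case 3 show ?case by (intro set_integral_add n1 n2)
  next
    case (4 a b \<epsilon>)
    obtain d1 where d1: "d1 > 0" "\<And>x y. x \<in> {a..b} \<Longrightarrow> y \<in> {a..b} \<Longrightarrow> \<bar>y - x\<bar> < d1 \<Longrightarrow> norm (g y - g x) < \<epsilon>"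
      using uniformly_close_on_interval[OF ac_continuous[OF g] 4(1)] by blast
    obtain d2 where d2: "d2 > 0" "\<And>x y. x \<in> {a..b} \<Longrightarrow> y \<in> {a..b} \<Longrightarrow> \<bar>y - x\<bar> < d2 \<Longrightarrow> norm (f y - f x) < \<epsilon>"
      using uniformly_close_on_interval[OF ac_continuous[OF f] 4(1)] by blast
    show ?case
    proof (intro exI[of _ "min d1 d2"] conjI allI impI)
      show "0 < min d1 d2" using d1 d2 by simp
      fix x y assume xy: "a \<le> x \<and> x \<le> y \<and> y \<le> b \<and> y - x < min d1 d2"
      let ?h = "\<lambda>s. f' s * g s + f s * g' s"
      have hi: "(?h has_integral integral {x..y} ?h) {x..y}"
        by (intro integrable_integral set_integrable_imp_integrable_on set_integral_add i1 i2)
      \<comment> \<open>Freezing g at the right end and f at the left end reproduces the increment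
        of the product exactly; only the oscillation of f and g on the short interval remains as an
        error.\<close>
      have A: "((\<lambda>s. f' s * g y + f x * g' s) has_integral (f y - f x) * g y + f x * (g y - g x)) {x..y}"
        using xy by (intro has_integral_add has_integral_mult_left has_integral_mult_right ac_has_integral f g) auto
      have B: "((\<lambda>s. (f' s * g y + f x * g' s) - ?h s) has_integral f y * g y - f x * g x - integral {x..y} ?h) {x..y}"
        using has_integral_diff[OF A hi] by (simp add: algebra_simps)
      have "norm (integral {x..y} (\<lambda>s. (f' s * g y + f x * g' s) - ?h s)) \<le> integral {x..y} (\<lambda>s. \<epsilon> * (norm (f' s) + norm (g' s)))"
      proof (rule integral_norm_bound_integral)
        show "(\<lambda>s. (f' s * g y + f x * g' s) - ?h s) integrable_on {x..y}" using B by blast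
        show "(\<lambda>s. \<epsilon> * (norm (f' s) + norm (g' s))) integrable_on {x..y}"
          by (intro set_integrable_imp_integrable_on set_integral_add n1 n2 set_integrable_mult_right)
        fix s assume s: "s \<in> {x..y}"
        have "(f' s * g y + f x * g' s) - ?h s = f' s * (g y - g s) + (f x - f s) * g' s" by (simp add: algebra_simps)
        then have "norm ((f' s * g y + f x * g' s) - ?h s) \<le> norm (f' s) * norm (g y - g s) + norm (f x - f s) * norm (g' s)"
          by (metis norm_mult norm_triangle_ineq)
        also have "\<dots> \<le> norm (f' s) * \<epsilon> + \<epsilon> * norm (g' s)"
          using d1(2)[of s y] d2(2)[of s x] s xy
          by (intro add_mono mult_left_mono mult_right_mono) auto
        finally show "norm ((f' s * g y + f x * g' s) - ?h s) \<le> \<epsilon> * (norm (f' s) + norm (g' s))" by (simp add: algebra_simps)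
      qed
      then show "norm (f y * g y - f x * g x - integral {x..y} ?h) \<le> \<epsilon> * integral {x..y} (\<lambda>x. norm (f' x) + norm (g' x))"
        using integral_unique[OF B] by simp
    qed
  qed
qed

text \<open>Convexity of U keeps the convex hull of the range of f over {a..b} inside U. On this
  compact hull \<Phi>' is uniformly continuous and the mean value inequality applies, for real and
  complex values alike.\<close>

lemma ac_compose:
  fixes f :: "real \<Rightarrow> 'a::{real_normed_field,euclidean_space}"
  assumes f: "has_ac_deriv f f'" and U: "open U" "convex U" "\<And>x. f x \<in> U"
    and d: "\<And>z. z \<in> U \<Longrightarrow> (\<Phi> has_field_derivative \<Phi>' z) (at z)" and c: "continuous_on U \<Phi>'"
  shows "has_ac_deriv (\<lambda>x. \<Phi> (f x)) (\<lambda>x. \<Phi>' (f x) * f' x)"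
proof -
  have cf: "continuous_on UNIV (\<lambda>x. \<Phi>' (f x))"
    by (rule continuous_on_compose2[OF c ac_continuous[OF f]]) (use U in auto)
  note [measurable] = ac_borel[OF f] borel_measurable_continuous_onI[OF cf]
  have i1: "set_integrable lborel {a..b} (\<lambda>x. \<Phi>' (f x) * f' x)" for a b
  proof -
    obtain K where "K > 0" "\<And>x. x \<in> {a..b} \<Longrightarrow> norm (\<Phi>' (f x)) \<le> K"
      using continuous_bounded_on_interval[OF cf] by blast
    then show ?thesis
      by (intro set_integrable_dominated[OF ac_set_integrable[OF f], of _ _ _ K])
        (auto simp: norm_mult intro!: mult_right_mono)
  qed
  note n1 = set_integrable_norm[OF ac_set_integrable[OF f]]
  show ?thesis
  proof (rule ac_criterion[where w="\<lambda>x. norm (f' x)"], goal_cases)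
    case 1 show ?case by measurable
  next
    case 2 show ?case by (rule i1)
  next
    case 3 show ?case by (rule n1)
  next
    case (4 a b \<epsilon>)
    define C where "C = convex hull (f ` {a..b})"
    have C: "compact C" "convex C" "C \<subseteq> U" "\<And>x. x \<in> {a..b} \<Longrightarrow> f x \<in> C"
    proof -
      show "compact C" unfolding C_def
        by (intro compact_convex_hull compact_continuous_image ac_continuous[OF f] compact_Icc)
      show "convex C" by (simp add: C_def)
      show "C \<subseteq> U" unfolding C_def using U by (intro hull_minimal) auto
      show "f x \<in> C" if "x \<in> {a..b}" for x using that by (auto simp: C_def intro!: hull_inc)
    qed
    have "uniformly_continuous_on C \<Phi>'"
      by (rule compact_uniformly_continuous[OF continuous_on_subset[OF c C(3)] C(1)])
    then obtain r where r: "r > 0" "\<And>z w. z \<in> C \<Longrightarrow> w \<in> C \<Longrightarrow> norm (w - z) < r \<Longrightarrow> norm (\<Phi>' w - \<Phi>' z) < \<epsilon> / 2"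
      unfolding uniformly_continuous_on_def dist_norm using half_gt_zero[OF 4(1)] by blast
    obtain \<delta> where \<delta>: "\<delta> > 0" "\<And>x y. x \<in> {a..b} \<Longrightarrow> y \<in> {a..b} \<Longrightarrow> \<bar>y - x\<bar> < \<delta> \<Longrightarrow> norm (f y - f x) < r"
      using uniformly_close_on_interval[OF ac_continuous[OF f] r(1)] by blast
    show ?case
    proof (intro exI[of _ "\<delta>"] conjI allI impI \<delta>(1))
      fix x y assume xy: "a \<le> x \<and> x \<le> y \<and> y \<le> b \<and> y - x < \<delta>"
      let ?h = "\<lambda>s. \<Phi>' (f s) * f' s"
      have hi: "(?h has_integral integral {x..y} ?h) {x..y}"
        by (intro integrable_integral set_integrable_imp_integrable_on i1)
      have A: "((\<lambda>s. \<Phi>' (f x) * f' s) has_integral \<Phi>' (f x) * (f y - f x)) {x..y}"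
        using xy by (intro has_integral_mult_right ac_has_integral f) auto
      have B: "((\<lambda>s. \<Phi>' (f x) * f' s - ?h s) has_integral \<Phi>' (f x) * (f y - f x) - integral {x..y} ?h) {x..y}"
        using has_integral_diff[OF A hi] by simp
      have "norm (integral {x..y} (\<lambda>s. \<Phi>' (f x) * f' s - ?h s)) \<le> integral {x..y} (\<lambda>s. \<epsilon> / 2 * norm (f' s))"
      proof (rule integral_norm_bound_integral)
        show "(\<lambda>s. \<Phi>' (f x) * f' s - ?h s) integrable_on {x..y}" using B by blast
        show "(\<lambda>s. \<epsilon> / 2 * norm (f' s)) integrable_on {x..y}"
          by (intro set_integrable_imp_integrable_on n1 set_integrable_mult_right)
        fix s assume s: "s \<in> {x..y}"
        have "\<Phi>' (f x) * f' s - ?h s = (\<Phi>' (f x) - \<Phi>' (f s)) * f' s" by (simp add: algebra_simps)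
        then have "norm (\<Phi>' (f x) * f' s - ?h s) = norm (\<Phi>' (f x) - \<Phi>' (f s)) * norm (f' s)"
          by (simp add: norm_mult)
        also have "\<dots> \<le> \<epsilon> / 2 * norm (f' s)"
          using r(2)[of "f s" "f x"] \<delta>(2)[of s x] s xy C(4)[of s] C(4)[of x]
          by (intro mult_right_mono) auto
        finally show "norm (\<Phi>' (f x) * f' s - ?h s) \<le> \<epsilon> / 2 * norm (f' s)" .
      qed
      then have E1: "norm (\<Phi>' (f x) * (f y - f x) - integral {x..y} ?h) \<le> \<epsilon> / 2 * integral {x..y} (\<lambda>s. norm (f' s))"
        using integral_unique[OF B] by simp
      \<comment> \<open>The mean value inequality for \<Phi> minus its linearisation at f x, on the
        convex part of the hull close to f x.\<close>
      have E2: "norm ((\<Phi> (f y) - \<Phi>' (f x) * f y) - (\<Phi> (f x) - \<Phi>' (f x) * f x)) \<le> \<epsilon> / 2 * norm (f y - f x)"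
      proof (rule field_differentiable_bound[where S="C \<inter> ball (f x) r" and f'="\<lambda>z. \<Phi>' z - \<Phi>' (f x)"])
        show "convex (C \<inter> ball (f x) r)" using C by (intro convex_Int) auto
        show "f y \<in> C \<inter> ball (f x) r" "f x \<in> C \<inter> ball (f x) r"
          using C(4)[of x] C(4)[of y] xy \<delta>(2)[of x y] r(1) by (auto simp: dist_norm norm_minus_commute)
        fix z assume z: "z \<in> C \<inter> ball (f x) r"
        show "norm (\<Phi>' z - \<Phi>' (f x)) \<le> \<epsilon> / 2"
          using r(2)[of "f x" z] z C(4)[of x] xy by (auto simp: dist_norm norm_minus_commute)
        have "(\<Phi> has_field_derivative \<Phi>' z) (at z)" using d z C(3) by blast
        from DERIV_diff[OF has_field_derivative_at_within[OF this] DERIV_cmult_Id]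
        show "((\<lambda>z. \<Phi> z - \<Phi>' (f x) * z) has_field_derivative \<Phi>' z - \<Phi>' (f x)) (at z within C \<inter> ball (f x) r)"
          by simp
      qed
      have E3: "\<epsilon> / 2 * norm (f y - f x) \<le> \<epsilon> / 2 * integral {x..y} (\<lambda>s. norm (f' s))"
        using ac_increment_le[OF f, of x y] xy 4(1) by (intro mult_left_mono) auto
      have eq: "\<Phi> (f y) - \<Phi> (f x) - integral {x..y} ?h =
         ((\<Phi> (f y) - \<Phi>' (f x) * f y) - (\<Phi> (f x) - \<Phi>' (f x) * f x)) + (\<Phi>' (f x) * (f y - f x) - integral {x..y} ?h)"
        by (simp add: algebra_simps)
      have "norm (\<Phi> (f y) - \<Phi> (f x) - integral {x..y} ?h) \<le> \<epsilon> / 2 * integral {x..y} (\<lambda>s. norm (f' s)) + \<epsilon> / 2 * integral {x..y} (\<lambda>s. norm (f' s))"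
        unfolding eq using norm_triangle_ineq[of "(\<Phi> (f y) - \<Phi>' (f x) * f y) - (\<Phi> (f x) - \<Phi>' (f x) * f x)" "\<Phi>' (f x) * (f y - f x) - integral {x..y} ?h"] E1 E2 E3 by linarith
      then show "norm (\<Phi> (f y) - \<Phi> (f x) - integral {x..y} ?h) \<le> \<epsilon> * integral {x..y} (\<lambda>s. norm (f' s))"
        by simp
    qed
  qed
qed

section \<open>Integrals of derivatives over half-lines and the line\<close>

lemma integrable_limit_zero_at_top:
  fixes f :: "real \<Rightarrow> real"
  assumes "integrable lborel f" "(f \<longlongrightarrow> l) at_top" "\<And>x. f x \<ge> 0"
  shows "l = 0"
proof (rule ccontr)
  assume "l \<noteq> 0"
  moreover have "l \<ge> 0" using assms(3) by (intro tendsto_lowerbound[OF assms(2)]) auto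
  ultimately have l: "l > 0" by simp
  then have "\<forall>\<^sub>F x in at_top. f x > l / 2" by (intro order_tendstoD(1)[OF assms(2)]) simp
  then obtain M where M: "\<And>x. x \<ge> M \<Longrightarrow> f x > l / 2" unfolding eventually_at_top_linorder by blast
  have i: "integrable lborel (\<lambda>x. indicat_real {M..} x * (l / 2))"
    by (rule Bochner_Integration.integrable_bound[OF assms(1)])
      (use M assms(3) l in \<open>auto intro!: AE_I2 simp: indicator_def less_imp_le abs_of_pos\<close>)
  have "integrable lborel (indicat_real {M..})"
  proof -
    from integrable_mult_right[where c="2 / l", OF i]
    have "integrable lborel (\<lambda>x. 2 / l * (indicat_real {M..} x * (l / 2)))" by blast
    moreover have "(\<lambda>x. 2 / l * (indicat_real {M..} x * (l / 2))) = indicat_real {M..}" using l by auto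
    ultimately show ?thesis by metis
  qed
  then have fin: "emeasure lborel {M..} < \<infinity>" by (simp add: integrable_indicator_iff)
  have "emeasure lborel {M..} \<ge> ennreal (real n)" for n
  proof -
    have "emeasure lborel {M..M + real n} \<le> emeasure lborel {M..}" by (rule emeasure_mono) auto
    then show ?thesis by (simp add: ennreal_of_nat_eq_real_of_nat)
  qed
  then have "emeasure lborel {M..} = \<infinity>"
    using fin ennreal_Ex_less_of_nat[of "emeasure lborel {M..}"]
    by (metis ennreal_of_nat_eq_real_of_nat infinity_ennreal_def linorder_not_less)
  then show False using fin by simp
qed

lemma integrable_limit_zero_at_bot:
  fixes f :: "real \<Rightarrow> real"
  assumes "integrable lborel f" "(f \<longlongrightarrow> l) at_bot" "\<And>x. f x \<ge> 0"
  shows "l = 0"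
proof (rule integrable_limit_zero_at_top[of "\<lambda>x. f (- x)"])
  show "integrable lborel (\<lambda>x. f (- x))"
    using lborel_integrable_real_affine_iff[of "-1" f 0] assms(1) by simp
  show "((\<lambda>x. f (- x)) \<longlongrightarrow> l) at_top" using assms(2) by (simp add: filterlim_at_bot_mirror)
qed (use assms in auto)

text \<open>Integrability of h' gives h limits at both ends, and integrability of |h|^2 forces these
  limits to be 0.\<close>

lemma ac_integral_halfline:
  fixes h :: "real \<Rightarrow> 'a::euclidean_space"
  assumes h: "has_ac_deriv h h'" and i: "integrable lborel h'" and s: "integrable lborel (\<lambda>x. (norm (h x))\<^sup>2)"
  shows "(LINT x:{0..}|lborel. h' x) = - h 0" "(LINT x:{..0}|lborel. h' x) = h 0"
proof -
  have si: "set_integrable lborel S h'" if "S \<in> sets borel" for S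
    using i that unfolding set_integrable_def by (intro integrable_mult_indicator) auto
  have eq: "(LINT x:{a..b}|lborel. h' x) = h b - h a" if "a \<le> b" for a b
    using set_borel_integral_eq_integral(2)[OF si, of "{a..b}"] integral_unique[OF ac_has_integral[OF h that]] by simp
  have "((\<lambda>b. LINT x:{0..b}|lborel. h' x) \<longlongrightarrow> (LINT x:{0..}|lborel. h' x)) at_top"
    by (intro tendsto_set_lebesgue_integral_at_top si) auto
  then have "((\<lambda>b. h b - h 0) \<longlongrightarrow> (LINT x:{0..}|lborel. h' x)) at_top"
    by (rule Lim_transform_eventually) (use eq in \<open>auto intro!: eventually_at_top_linorderI[of 0]\<close>)
  then have "((\<lambda>b. h 0 + (h b - h 0)) \<longlongrightarrow> h 0 + (LINT x:{0..}|lborel. h' x)) at_top" by (intro tendsto_intros)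
  then have t: "(h \<longlongrightarrow> h 0 + (LINT x:{0..}|lborel. h' x)) at_top" by simp
  then have "((\<lambda>x. (norm (h x))\<^sup>2) \<longlongrightarrow> (norm (h 0 + (LINT x:{0..}|lborel. h' x)))\<^sup>2) at_top" by (intro tendsto_intros)
  then have "(norm (h 0 + (LINT x:{0..}|lborel. h' x)))\<^sup>2 = 0" by (rule integrable_limit_zero_at_top[OF s]) simp
  then show "(LINT x:{0..}|lborel. h' x) = - h 0" by (simp add: add_eq_0_iff)
  have "((\<lambda>a. LINT x:{a..0}|lborel. h' x) \<longlongrightarrow> (LINT x:{..0}|lborel. h' x)) at_bot"
    by (intro tendsto_set_lebesgue_integral_at_bot si) auto
  then have "((\<lambda>a. h 0 - h a) \<longlongrightarrow> (LINT x:{..0}|lborel. h' x)) at_bot"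
    by (rule Lim_transform_eventually) (use eq in \<open>auto simp: eventually_at_bot_linorder intro!: exI[of _ 0]\<close>)
  then have "((\<lambda>a. h 0 - (h 0 - h a)) \<longlongrightarrow> h 0 - (LINT x:{..0}|lborel. h' x)) at_bot" by (intro tendsto_intros)
  then have t: "(h \<longlongrightarrow> h 0 - (LINT x:{..0}|lborel. h' x)) at_bot" by simp
  then have "((\<lambda>x. (norm (h x))\<^sup>2) \<longlongrightarrow> (norm (h 0 - (LINT x:{..0}|lborel. h' x)))\<^sup>2) at_bot" by (intro tendsto_intros)
  then have "(norm (h 0 - (LINT x:{..0}|lborel. h' x)))\<^sup>2 = 0" by (rule integrable_limit_zero_at_bot[OF s]) simp
  then show "(LINT x:{..0}|lborel. h' x) = h 0" by simp
qed

text \<open>The weight sgn jumps by 2 at the origin, which leaves -2 h 0. This is the source of the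
  boundary terms at the position of the delta potential.\<close>

lemma ac_integral_line:
  fixes h :: "real \<Rightarrow> 'a::euclidean_space"
  assumes h: "has_ac_deriv h h'" and i: "integrable lborel h'" and s: "integrable lborel (\<lambda>x. (norm (h x))\<^sup>2)"
  shows "(LINT x|lborel. h' x) = 0" "(LINT x|lborel. sgn x *\<^sub>R h' x) = - 2 *\<^sub>R h 0"
proof -
  have si: "set_integrable lborel S h'" if "S \<in> sets borel" for S
    using i that unfolding set_integrable_def by (intro integrable_mult_indicator) auto
  note p = ac_integral_halfline[OF h i s]
  have [measurable]: "h' \<in> borel_measurable borel" using ac_borel[OF h] .
  have ae: "AE x in lborel. x \<noteq> (0::real)" by (rule AE_lborel_singleton)
  have "(LINT x|lborel. h' x) = (LINT x|lborel. indicat_real {0..} x *\<^sub>R h' x + indicat_real {..0} x *\<^sub>R h' x)"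
    by (rule integral_cong_AE) (use ae in \<open>auto elim!: eventually_mono simp: indicator_def\<close>)
  also have "\<dots> = (LINT x:{0..}|lborel. h' x) + (LINT x:{..0}|lborel. h' x)"
    unfolding set_lebesgue_integral_def
    by (intro Bochner_Integration.integral_add) (use si in \<open>auto simp: set_integrable_def\<close>)
  finally show "(LINT x|lborel. h' x) = 0" using p by simp
  have "(LINT x|lborel. sgn x *\<^sub>R h' x) = (LINT x|lborel. indicat_real {0..} x *\<^sub>R h' x - indicat_real {..0} x *\<^sub>R h' x)"
    by (rule integral_cong_AE) (use ae in \<open>auto elim!: eventually_mono simp: indicator_def sgn_if\<close>)
  also have "\<dots> = (LINT x:{0..}|lborel. h' x) - (LINT x:{..0}|lborel. h' x)"
    unfolding set_lebesgue_integral_def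
    by (intro Bochner_Integration.integral_diff) (use si in \<open>auto simp: set_integrable_def\<close>)
  finally show "(LINT x|lborel. sgn x *\<^sub>R h' x) = - 2 *\<^sub>R h 0" using p by (simp add: scaleR_2)
qed

section \<open>Square integrable functions\<close>

text \<open>The notion \<open>in_L2\<close> for values in any Euclidean space: fields are complex
  valued, but densities such as mass and current are real valued.\<close>

definition sq_integrable :: "(real \<Rightarrow> 'a::euclidean_space) \<Rightarrow> bool" where
  "sq_integrable f \<longleftrightarrow> f \<in> borel_measurable borel \<and> integrable lborel (\<lambda>x. (norm (f x))\<^sup>2)"

definition l2norm :: "(real \<Rightarrow> 'a::euclidean_space) \<Rightarrow> real" where
  "l2norm f = sqrt (LINT x|lborel. (norm (f x))\<^sup>2)"

lemma in_L2_iff_sq_integrable: "in_L2 f \<longleftrightarrow> sq_integrable f"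
  by (simp add: in_L2_def sq_integrable_def)

lemma L2_norm_eq_l2norm: "L2_norm = l2norm"
  by (simp add: fun_eq_iff L2_norm_def l2norm_def)

lemma sqi_borel: "sq_integrable f \<Longrightarrow> f \<in> borel_measurable borel"
  by (simp add: sq_integrable_def)

lemma l2norm_nonneg [simp]: "0 \<le> l2norm f"
  by (simp add: l2norm_def)

lemma l2norm_power2: "(l2norm f)\<^sup>2 = (LINT x|lborel. (norm (f x))\<^sup>2)"
  by (simp add: l2norm_def)

lemma l2norm_AE_cong:
  assumes "f \<in> borel_measurable borel" "g \<in> borel_measurable borel" "AE x in lborel. f x = g x"
  shows "l2norm f = l2norm g"
  unfolding l2norm_def
  by (intro arg_cong[where f=sqrt] integral_cong_AE) (use assms in auto)

lemma sqi_dominated: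
  fixes f :: "real \<Rightarrow> 'a::euclidean_space" and g :: "real \<Rightarrow> 'b::euclidean_space"
  assumes g: "sq_integrable g" and f: "f \<in> borel_measurable borel"
    and le: "\<And>x. norm (f x) \<le> K * norm (g x)"
  shows "sq_integrable f" "0 \<le> K \<Longrightarrow> l2norm f \<le> K * l2norm g"
proof -
  have le2: "(norm (f x))\<^sup>2 \<le> K\<^sup>2 * (norm (g x))\<^sup>2" for x
    using power_mono[OF le[of x], of 2] by (simp add: power_mult_distrib)
  have i: "integrable lborel (\<lambda>x. K\<^sup>2 * (norm (g x))\<^sup>2)" using g by (simp add: sq_integrable_def)
  have "integrable lborel (\<lambda>x. (norm (f x))\<^sup>2)"
    by (rule Bochner_Integration.integrable_bound[OF i]) (use f le2 in auto)
  then show sq: "sq_integrable f" using f by (simp add: sq_integrable_def)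
  assume K: "0 \<le> K"
  have "(LINT x|lborel. (norm (f x))\<^sup>2) \<le> (LINT x|lborel. K\<^sup>2 * (norm (g x))\<^sup>2)"
    by (rule integral_mono) (use sq i le2 in \<open>auto simp: sq_integrable_def\<close>)
  also have "\<dots> = (K * l2norm g)\<^sup>2" by (simp add: l2norm_power2 power_mult_distrib)
  finally show "l2norm f \<le> K * l2norm g"
    unfolding l2norm_def using real_le_lsqrt K l2norm_nonneg real_sqrt_le_iff
    by (metis l2norm_def mult_nonneg_nonneg real_sqrt_abs abs_of_nonneg)
qed

lemma sqi_mono:
  fixes f :: "real \<Rightarrow> 'a::euclidean_space" and g :: "real \<Rightarrow> 'b::euclidean_space"
  assumes "sq_integrable g" "f \<in> borel_measurable borel" "\<And>x. norm (f x) \<le> norm (g x)"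
  shows "sq_integrable f" "l2norm f \<le> l2norm g"
  using sqi_dominated[of g f 1] assms by auto

lemma sqi_norm: "sq_integrable f \<Longrightarrow> sq_integrable (\<lambda>x. norm (f x))"
  by (auto simp: sq_integrable_def)

lemma l2norm_norm: "l2norm (\<lambda>x. norm (f x)) = l2norm f"
  by (simp add: l2norm_def)

lemma sqi_product:
  fixes f :: "real \<Rightarrow> 'a::euclidean_space" and g :: "real \<Rightarrow> 'b::euclidean_space"
  assumes f: "sq_integrable f" and g: "sq_integrable g"
  shows "integrable lborel (\<lambda>x. norm (f x) * norm (g x))"
    and "(LINT x|lborel. norm (f x) * norm (g x)) \<le> l2norm f * l2norm g"
proof -
  note [measurable] = sqi_borel[OF f] sqi_borel[OF g]
  have fi: "integrable lborel (\<lambda>x. (norm (f x))\<^sup>2)" and gi: "integrable lborel (\<lambda>x. (norm (g x))\<^sup>2)"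
    using f g by (auto simp: sq_integrable_def)
  have "integrable lborel (\<lambda>x. (norm (f x))\<^sup>2 + (norm (g x))\<^sup>2)" using fi gi by simp
  then show i: "integrable lborel (\<lambda>x. norm (f x) * norm (g x))"
  proof (rule Bochner_Integration.integrable_bound)
    have "norm (f x) * norm (g x) \<le> (norm (f x))\<^sup>2 + (norm (g x))\<^sup>2" for x
      using sum_squares_bound[of "norm (f x)" "norm (g x)"]
        mult_nonneg_nonneg[OF norm_ge_zero[of "f x"] norm_ge_zero[of "g x"]] by linarith
    then show "AE x in lborel. norm (norm (f x) * norm (g x)) \<le> norm ((norm (f x))\<^sup>2 + (norm (g x))\<^sup>2)" by simp
  qed simp
  define P where "P = (LINT x|lborel. norm (f x) * norm (g x))"
  \<comment> \<open>The integral of (|f| - s|g|)^2 is nonnegative for every s, and a suitable s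
    yields Cauchy-Schwarz. Vanishing norms are treated apart because the optimal s is a quotient of
    the two norms.\<close>
  have q: "2 * s * P \<le> (l2norm f)\<^sup>2 + s\<^sup>2 * (l2norm g)\<^sup>2" for s
  proof -
    have "0 \<le> (LINT x|lborel. (norm (f x) - s * norm (g x))\<^sup>2)" by simp
    also have "\<dots> = (LINT x|lborel. (norm (f x))\<^sup>2 + s\<^sup>2 * (norm (g x))\<^sup>2 - 2 * s * (norm (f x) * norm (g x)))"
      by (intro Bochner_Integration.integral_cong) (auto simp: power2_eq_square algebra_simps)
    also have "\<dots> = (l2norm f)\<^sup>2 + s\<^sup>2 * (l2norm g)\<^sup>2 - 2 * s * P"
      using fi gi i by (simp add: l2norm_power2 P_def)
    finally show ?thesis by simp
  qed
  show "P \<le> l2norm f * l2norm g"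
  proof (cases "l2norm g = 0")
    case True
    have "P \<le> 0"
    proof (rule ccontr)
      assume "\<not> P \<le> 0"
      then have "2 * (((l2norm f)\<^sup>2 + 1) / (2 * P)) * P = (l2norm f)\<^sup>2 + 1" by simp
      then show False using q[of "((l2norm f)\<^sup>2 + 1) / (2 * P)"] True by simp
    qed
    then show ?thesis using True by simp
  next
    case False
    then have pos: "l2norm g > 0" using l2norm_nonneg[of g] by linarith
    have "2 * (l2norm f / l2norm g) * P \<le> 2 * (l2norm f)\<^sup>2"
      using q[of "l2norm f / l2norm g"] False by (simp add: power_divide)
    then have *: "l2norm f * P \<le> l2norm f * (l2norm f * l2norm g)"
      using pos by (simp add: field_simps power2_eq_square)
    show ?thesis
    proof (cases "l2norm f = 0")
      case True
      have "P \<le> 0"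
      proof (rule ccontr)
        assume P: "\<not> P \<le> 0"
        have "2 * (P / (l2norm g)\<^sup>2) * P \<le> (P / (l2norm g)\<^sup>2)\<^sup>2 * (l2norm g)\<^sup>2"
          using q[of "P / (l2norm g)\<^sup>2"] True by simp
        then have "2 * (P * P) \<le> P * P" using pos by (simp add: power2_eq_square field_simps)
        then show False using P by (auto simp: mult_le_0_iff)
      qed
      then show ?thesis using True by simp
    next
      case False
      then show ?thesis using * l2norm_nonneg[of f] by (simp add: less_le)
    qed
  qed
qed

lemma sqi_mult:
  fixes f g :: "real \<Rightarrow> 'a::{real_normed_field,euclidean_space}"
  assumes f: "sq_integrable f" and g: "sq_integrable g"
  shows "integrable lborel (\<lambda>x. f x * g x)" "norm (LINT x|lborel. f x * g x) \<le> l2norm f * l2norm g"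
proof -
  show i: "integrable lborel (\<lambda>x. f x * g x)"
    by (rule Bochner_Integration.integrable_bound[OF sqi_product(1)[OF f g]])
      (use sqi_borel[OF f] sqi_borel[OF g] in \<open>auto simp: norm_mult\<close>)
  have "norm (LINT x|lborel. f x * g x) \<le> (LINT x|lborel. norm (f x * g x))" by (rule integral_norm_bound)
  then show "norm (LINT x|lborel. f x * g x) \<le> l2norm f * l2norm g"
    using sqi_product(2)[OF f g] by (simp add: norm_mult)
qed

lemma sqi_add:
  fixes f g :: "real \<Rightarrow> 'a::euclidean_space"
  assumes f: "sq_integrable f" and g: "sq_integrable g"
  shows "sq_integrable (\<lambda>x. f x + g x)" "l2norm (\<lambda>x. f x + g x) \<le> l2norm f + l2norm g"
proof -
  note [measurable] = sqi_borel[OF f] sqi_borel[OF g]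
  have fi: "integrable lborel (\<lambda>x. (norm (f x))\<^sup>2)" and gi: "integrable lborel (\<lambda>x. (norm (g x))\<^sup>2)"
    using f g by (auto simp: sq_integrable_def)
  note p = sqi_product[OF f g]
  have i: "integrable lborel (\<lambda>x. (norm (f x))\<^sup>2 + (norm (g x))\<^sup>2 + 2 * (norm (f x) * norm (g x)))"
    using fi gi p(1) by simp
  have le: "(norm (f x + g x))\<^sup>2 \<le> (norm (f x))\<^sup>2 + (norm (g x))\<^sup>2 + 2 * (norm (f x) * norm (g x))" for x
    using power_mono[OF norm_triangle_ineq[of "f x" "g x"], of 2] by (simp add: power2_sum)
  have i2: "integrable lborel (\<lambda>x. (norm (f x + g x))\<^sup>2)"
    by (rule Bochner_Integration.integrable_bound[OF i]) (use le in \<open>auto intro: order_trans[OF _ abs_ge_self]\<close>)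
  then show "sq_integrable (\<lambda>x. f x + g x)" by (simp add: sq_integrable_def)
  have "(l2norm (\<lambda>x. f x + g x))\<^sup>2 \<le> (LINT x|lborel. (norm (f x))\<^sup>2 + (norm (g x))\<^sup>2 + 2 * (norm (f x) * norm (g x)))"
    unfolding l2norm_power2 by (rule integral_mono[OF i2 i]) (rule le)
  also have "\<dots> = (l2norm f)\<^sup>2 + (l2norm g)\<^sup>2 + 2 * (LINT x|lborel. norm (f x) * norm (g x))"
    using fi gi p(1) by (simp add: l2norm_power2)
  also have "\<dots> \<le> (l2norm f + l2norm g)\<^sup>2" using p(2) by (simp add: power2_sum)
  finally show "l2norm (\<lambda>x. f x + g x) \<le> l2norm f + l2norm g" by (rule power2_le_imp_le) simp
qed

lemma sqi_minus: "sq_integrable f \<Longrightarrow> sq_integrable (\<lambda>x. - f x)"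
  and l2norm_minus: "l2norm (\<lambda>x. - f x) = l2norm f"
  by (auto simp: sq_integrable_def l2norm_def)

lemma sqi_diff:
  fixes f g :: "real \<Rightarrow> 'a::euclidean_space"
  assumes f: "sq_integrable f" and g: "sq_integrable g"
  shows "sq_integrable (\<lambda>x. f x - g x)" "l2norm (\<lambda>x. f x - g x) \<le> l2norm f + l2norm g"
  using sqi_add[OF f sqi_minus[OF g]] by (auto simp: l2norm_minus)

lemma l2norm_commute: "l2norm (\<lambda>x. f x - g x) = l2norm (\<lambda>x. g x - f x)"
  by (simp add: l2norm_def norm_minus_commute)

lemma l2norm_triangle_diff:
  fixes f g :: "real \<Rightarrow> 'a::euclidean_space"
  assumes f: "sq_integrable f" and g: "sq_integrable g"
  shows "\<bar>l2norm f - l2norm g\<bar> \<le> l2norm (\<lambda>x. f x - g x)"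
  using sqi_add(2)[OF sqi_diff(1)[OF f g] g] sqi_add(2)[OF sqi_diff(1)[OF g f] f]
  by (simp add: l2norm_commute[of g f])

lemma sqi_scale:
  fixes f :: "real \<Rightarrow> 'a::{real_normed_field,euclidean_space}"
  assumes "sq_integrable f"
  shows "sq_integrable (\<lambda>x. c * f x)" "l2norm (\<lambda>x. c * f x) = norm c * l2norm f"
  using assms by (auto simp: sq_integrable_def l2norm_def norm_mult power_mult_distrib real_sqrt_mult)

lemma sqi_mult_bounded:
  fixes f g :: "real \<Rightarrow> 'a::{real_normed_field,euclidean_space}"
  assumes "sq_integrable f" "g \<in> borel_measurable borel" "\<And>x. norm (g x) \<le> K"
  shows "sq_integrable (\<lambda>x. g x * f x)" "l2norm (\<lambda>x. g x * f x) \<le> K * l2norm f"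
proof -
  have K: "0 \<le> K" using assms(3)[of 0] norm_ge_zero order_trans by blast
  have m: "(\<lambda>x. g x * f x) \<in> borel_measurable borel"
    using assms(2) sqi_borel[OF assms(1)] by measurable
  note d = sqi_dominated[OF assms(1) m, of K]
  show "sq_integrable (\<lambda>x. g x * f x)" "l2norm (\<lambda>x. g x * f x) \<le> K * l2norm f"
    using d K assms(3) by (auto simp: norm_mult mult_right_mono)
qed

lemma sqi_zero [simp]: "sq_integrable (\<lambda>x. 0)" "l2norm (\<lambda>x. 0) = 0"
  by (auto simp: sq_integrable_def l2norm_def)

lemma sqi_indicator: "sq_integrable (indicat_real {a..b})" "a \<le> b \<Longrightarrow> l2norm (indicat_real {a..b}) = sqrt (b - a)"
proof -
  have e: "(\<lambda>x. (norm (indicat_real {a..b} x))\<^sup>2) = indicat_real {a..b}" by (auto simp: indicator_def)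
  show "sq_integrable (indicat_real {a..b})" unfolding sq_integrable_def e
    using emeasure_compact_finite[of "{a..b}"] by (simp add: integrable_indicator_iff)
  show "a \<le> b \<Longrightarrow> l2norm (indicat_real {a..b}) = sqrt (b - a)" unfolding l2norm_def e by simp
qed

text \<open>Cauchy-Schwarz against the indicator of the interval. The growth sqrt|x| that results is
  the only control of the phase far from the origin.\<close>

lemma ac_holder:
  fixes f :: "real \<Rightarrow> 'a::euclidean_space"
  assumes f: "has_ac_deriv f g" and g: "sq_integrable g"
  shows "norm (f y - f x) \<le> sqrt \<bar>y - x\<bar> * l2norm g"
proof -
  have *: "norm (f y - f x) \<le> sqrt \<bar>y - x\<bar> * l2norm g" if xy: "x \<le> y" for x y
  proof -
    have "norm (f y - f x) \<le> integral {x..y} (\<lambda>s. norm (g s))" by (rule ac_increment_le[OF f xy])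
    also have "\<dots> = (LINT s:{x..y}|lborel. norm (g s))"
      by (rule set_borel_integral_eq_integral(2)[symmetric, OF set_integrable_norm[OF ac_set_integrable[OF f]]])
    also have "\<dots> = (LINT s|lborel. norm (indicat_real {x..y} s) * norm (g s))"
      unfolding set_lebesgue_integral_def by simp
    also have "\<dots> \<le> l2norm (indicat_real {x..y}) * l2norm g" by (rule sqi_product(2)[OF sqi_indicator(1) g])
    finally show ?thesis using sqi_indicator(2)[OF xy] xy by simp
  qed
  show ?thesis using *[of x y] *[of y x] by (cases "x \<le> y") (auto simp: norm_minus_commute abs_minus_commute)
qed

lemma sqi_set_integrable:
  assumes "sq_integrable f"
  shows "set_integrable lborel {a..b} f"
  unfolding set_integrable_def
  by (rule Bochner_Integration.integrable_bound[OF sqi_product(1)[OF sqi_indicator(1)[of a b] assms]])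
    (use sqi_borel[OF assms] in auto)

lemma exists_le_l2norm:
  fixes f :: "real \<Rightarrow> 'a::euclidean_space"
  assumes c: "continuous_on UNIV f" and sf: "sq_integrable f"
  shows "\<exists>y\<in>{x..x+1}. norm (f y) \<le> l2norm f"
proof (rule ccontr)
  assume n: "\<not> ?thesis"
  have "continuous_on {x..x+1} (\<lambda>y. norm (f y))"
    by (intro continuous_on_norm continuous_on_subset[OF c]) auto
  then obtain y0 where y0: "y0 \<in> {x..x+1}" "\<And>y. y \<in> {x..x+1} \<Longrightarrow> norm (f y0) \<le> norm (f y)"
    using continuous_attains_inf[of "{x..x+1}" "\<lambda>y. norm (f y)"] by auto
  have "integrable lborel (indicat_real {x..x+1})"
    using emeasure_compact_finite[of "{x..x+1}"] by (simp add: integrable_indicator_iff)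
  then have ii: "integrable lborel (\<lambda>s. (norm (f y0))\<^sup>2 * indicat_real {x..x+1} s)" by simp
  have "(LINT s|lborel. (norm (f y0))\<^sup>2 * indicat_real {x..x+1} s) \<le> (LINT s|lborel. (norm (f s))\<^sup>2)"
    by (rule integral_mono[OF ii])
      (use y0(2) sf in \<open>auto simp: sq_integrable_def indicator_def power_mono\<close>)
  then have "(norm (f y0))\<^sup>2 \<le> (l2norm f)\<^sup>2" by (simp add: l2norm_power2)
  then show False using n y0(1) power2_le_imp_le[OF _ l2norm_nonneg] by blast
qed

text \<open>Sobolev embedding on the line: some point of {x..x+1} has its value bounded by the L^2
  norm, and the Hoelder estimate carries the bound over to x.\<close>

lemma ac_sup_bound:
  fixes f :: "real \<Rightarrow> 'a::euclidean_space"
  assumes f: "has_ac_deriv f g" and sf: "sq_integrable f" and sg: "sq_integrable g"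
  shows "norm (f x) \<le> l2norm f + l2norm g"
proof -
  obtain y where y: "y \<in> {x..x+1}" "norm (f y) \<le> l2norm f"
    using exists_le_l2norm[OF ac_continuous[OF f] sf] by blast
  have "norm (f x - f y) \<le> sqrt \<bar>x - y\<bar> * l2norm g" by (rule ac_holder[OF f sg])
  also have "\<dots> \<le> 1 * l2norm g" using y by (intro mult_right_mono) auto
  finally show ?thesis using y(2) norm_triangle_sub[of "f x" "f y"] by simp
qed

section \<open>Approximation by test functions\<close>

lemma poly_complex_of_real_polynomial_function:
  assumes "real_polynomial_function h"
  obtains P :: "complex poly" where "\<And>x. poly P (of_real x) = of_real (h x)"
proof -
  obtain a n where "h = (\<lambda>x. \<Sum>i\<le>n. a i * x ^ i)"
    using real_polynomial_function_imp_sum[OF assms] by blast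
  then have "poly (\<Sum>i\<le>n. monom (of_real (a i)) i) (of_real x) = complex_of_real (h x)" for x
    by (simp add: poly_sum poly_monom)
  then show ?thesis using that by blast
qed

lemma complex_poly_approx:
  fixes g :: "real \<Rightarrow> complex"
  assumes "continuous_on {a..b} g" "0 < e"
  obtains P where "\<And>x. x \<in> {a..b} \<Longrightarrow> cmod (g x - poly P (of_real x)) < e"
proof -
  obtain h1 where h1: "real_polynomial_function h1" "\<And>x. x \<in> {a..b} \<Longrightarrow> \<bar>Re (g x) - h1 x\<bar> < e / 2"
    using Stone_Weierstrass_real_polynomial_function[of "{a..b}" "\<lambda>x. Re (g x)" "e / 2"]
      continuous_on_Re[OF assms(1)] assms(2) by auto
  obtain h2 where h2: "real_polynomial_function h2" "\<And>x. x \<in> {a..b} \<Longrightarrow> \<bar>Im (g x) - h2 x\<bar> < e / 2"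
    using Stone_Weierstrass_real_polynomial_function[of "{a..b}" "\<lambda>x. Im (g x)" "e / 2"]
      continuous_on_Im[OF assms(1)] assms(2) by auto
  obtain P1 :: "complex poly" where P1: "\<And>x. poly P1 (of_real x) = of_real (h1 x)"
    using poly_complex_of_real_polynomial_function[OF h1(1)] by blast
  obtain P2 :: "complex poly" where P2: "\<And>x. poly P2 (of_real x) = of_real (h2 x)"
    using poly_complex_of_real_polynomial_function[OF h2(1)] by blast
  have "cmod (g x - poly (P1 + smult \<i> P2) (of_real x)) < e" if "x \<in> {a..b}" for x
    using h1(2)[OF that] h2(2)[OF that]
      cmod_le[of "g x - poly (P1 + smult \<i> P2) (of_real x)"]
    by (simp add: P1 P2)
  then show ?thesis using that by blast
qed

lemma bump_le_1: "bump R 0 x \<le> 1"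
proof (cases "\<bar>x\<bar> < R")
  case True
  then have "x\<^sup>2 < R\<^sup>2" by (metis abs_ge_zero power2_abs power_strict_mono zero_less_numeral)
  then show ?thesis by (simp add: bump_def)
qed (simp add: bump_def)

lemma bump_pos: "\<bar>x\<bar> < R \<Longrightarrow> 0 < bump R 0 x"
  by (simp add: bump_def)

lemma bump_antimono:
  assumes "\<bar>x\<bar> \<le> \<bar>y\<bar>" "\<bar>y\<bar> < R"
  shows "bump R 0 y \<le> bump R 0 x"
proof -
  have "x\<^sup>2 \<le> y\<^sup>2" "y\<^sup>2 < R\<^sup>2" using assms
    by (auto simp: abs_le_square_iff[symmetric]) (metis abs_ge_zero power2_abs power_strict_mono zero_less_numeral)
  then have "1 / (R\<^sup>2 - x\<^sup>2) \<le> 1 / (R\<^sup>2 - y\<^sup>2)" by (intro divide_left_mono) auto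
  then show ?thesis using assms by (simp add: bump_def)
qed

lemma continuous_bump:
  assumes "0 < R"
  shows "continuous_on S (bump R 0)"
proof -
  have "continuous_on S (\<lambda>x. Re (poly_bump R 1 0 x))"
    by (intro continuous_on_Re test_function_continuous test_function_poly_bump assms)
  then show ?thesis by (simp add: poly_bump_def)
qed

lemma test_approx_continuous:
  fixes Q :: "real \<Rightarrow> complex"
  assumes "0 < r" "r < R" "0 < e" and Q: "continuous_on UNIV Q" "\<And>x. \<bar>x\<bar> \<ge> r \<Longrightarrow> Q x = 0"
  obtains \<eta> where "test_function \<eta>" "\<And>x. \<bar>x\<bar> \<ge> R \<Longrightarrow> \<eta> x = 0" "\<And>x. cmod (\<eta> x - Q x) \<le> e"
proof -
  have R: "R > 0" using assms by simp
  define c where "c = bump R 0 r"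
  have c: "c > 0" using assms by (simp add: c_def bump_pos)
  have bc: "bump R 0 x \<ge> c" if "\<bar>x\<bar> \<le> r" for x
    using bump_antimono[of x r R] assms that by (simp add: c_def)
  \<comment> \<open>The quotient of Q by the bump is what a polynomial approximates. Taking the
    maximum of the bump with c avoids a vanishing denominator near |x| = R and changes nothing where
    Q is nonzero.\<close>
  have "continuous_on {-R..R} (\<lambda>x. Q x / of_real (max (bump R 0 x) c))"
    using c by (intro continuous_intros continuous_on_subset[OF Q(1)] continuous_bump[OF R]) auto
  then obtain P where P: "\<And>x. x \<in> {-R..R} \<Longrightarrow> cmod (Q x / of_real (max (bump R 0 x) c) - poly P (of_real x)) < e"
    using complex_poly_approx assms(3) by blast
  have "cmod (poly_bump R P 0 x - Q x) \<le> e" for x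
  proof (cases "\<bar>x\<bar> < R")
    case True
    have "Q x = of_real (bump R 0 x) * (Q x / of_real (max (bump R 0 x) c))"
    proof (cases "\<bar>x\<bar> \<le> r")
      case True
      then have "max (bump R 0 x) c = bump R 0 x" using bc by (simp add: max_absorb1)
      then show ?thesis using bc[OF True] c by simp
    qed (use Q in simp)
    then have "poly_bump R P 0 x - Q x = of_real (bump R 0 x) * (poly P (of_real x) - Q x / of_real (max (bump R 0 x) c))"
      by (simp add: poly_bump_def algebra_simps)
    then have "cmod (poly_bump R P 0 x - Q x) = bump R 0 x * cmod (poly P (of_real x) - Q x / of_real (max (bump R 0 x) c))"
      by (simp add: norm_mult bump_nonneg)
    also have "\<dots> \<le> 1 * e"
      using P[of x] True by (intro mult_mono bump_le_1) (auto simp: norm_minus_commute less_imp_le)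
    finally show ?thesis by simp
  next
    case False
    then show ?thesis using Q(2)[of x] assms by (simp add: poly_bump_def bump_def)
  qed
  then show ?thesis using that[of "poly_bump R P 0"] test_function_poly_bump[OF R]
    by (simp add: poly_bump_def bump_def)
qed

text \<open>Measurability supplies continuous functions converging almost everywhere. They are
  truncated in modulus and in space and then replaced by test functions, so that dominated
  convergence becomes applicable.\<close>

lemma test_approx_bounded:
  fixes p :: "real \<Rightarrow> complex"
  assumes p: "p \<in> borel_measurable borel" "\<And>x. cmod (p x) \<le> M" "\<And>x. \<bar>x\<bar> \<ge> R \<Longrightarrow> p x = 0" and M: "0 < M" and R: "0 < R"
  obtains q :: "nat \<Rightarrow> real \<Rightarrow> complex" where "\<And>n. test_function (q n)" "\<And>n x. \<bar>x\<bar> \<ge> R \<Longrightarrow> q n x = 0"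
    "\<And>n x. cmod (q n x) \<le> M + 1" "AE x in lborel. (\<lambda>n. q n x) \<longlonglongrightarrow> p x"
proof -
  have "p measurable_on UNIV"
  proof -
    have "p \<in> borel_measurable (lebesgue_on UNIV)"
      unfolding lebesgue_on_UNIV_eq by (rule measurable_completion) (use p(1) in simp)
    then show ?thesis using measurable_on_iff_borel_measurable[of UNIV p] by simp
  qed
  then obtain N g where N: "negligible N" and g: "\<And>n. continuous_on UNIV (g n)" "\<And>x. x \<notin> N \<Longrightarrow> (\<lambda>n. g n x) \<longlonglongrightarrow> p x"
    unfolding measurable_on_def by auto
  \<comment> \<open>Radii increasing to R; the gap below R is the room that
    \<open>test_approx_continuous\<close> needs.\<close>
  define r where "r n = R * (n + 1) / (n + 2)" for n :: nat
  have r: "0 < r n" "r n < R" for n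
  proof -
    show "0 < r n" unfolding r_def using R by (intro divide_pos_pos mult_pos_pos) auto
    show "r n < R" unfolding r_def using R by (simp add: divide_less_eq)
  qed
  have rlim: "r \<longlonglongrightarrow> R"
  proof -
    have "(\<lambda>n. R - R * inverse (real (Suc (Suc n)))) \<longlonglongrightarrow> R - R * 0"
      by (intro tendsto_intros LIMSEQ_Suc[OF LIMSEQ_inverse_real_of_nat])
    moreover have "(\<lambda>n. R - R * inverse (real (Suc (Suc n)))) = r"
      by (rule ext) (simp add: r_def field_simps)
    ultimately show ?thesis by simp
  qed
  \<comment> \<open>The first factor is a ramp that vanishes beyond r n and is eventually 1 at each
    point of modulus below R. The last factor clips the modulus at M and leaves the limit unchanged,
    as p is bounded by M.\<close>
  define Q where "Q n x = of_real (max 0 (min 1 ((real n + 1) * (r n - \<bar>x\<bar>)))) * (g n x * of_real (M / max M (cmod (g n x))))" for n x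
  have Qc: "continuous_on UNIV (Q n)" for n
    unfolding Q_def using M by (intro continuous_intros g(1)) auto
  have Q0: "Q n x = 0" if "\<bar>x\<bar> \<ge> r n" for n x
  proof -
    have "(real n + 1) * (r n - \<bar>x\<bar>) \<le> 0" using that by (intro mult_nonneg_nonpos) auto
    then show ?thesis by (simp add: Q_def)
  qed
  have QM: "cmod (Q n x) \<le> M" for n x
  proof -
    have "cmod (g n x * of_real (M / max M (cmod (g n x)))) \<le> M"
      using M mult_left_mono[OF max.cobounded2[of "cmod (g n x)" M], of M]
      by (simp add: norm_mult norm_divide divide_le_eq mult.commute abs_of_pos less_max_iff_disj)
    then have "cmod (Q n x) \<le> 1 * M"
      unfolding Q_def norm_mult[of "of_real _"] norm_of_real by (intro mult_mono) auto
    then show ?thesis by simp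
  qed
  have Qlim: "(\<lambda>n. Q n x) \<longlonglongrightarrow> p x" if "x \<notin> N" for x
  proof (cases "\<bar>x\<bar> < R")
    case True
    have "eventually (\<lambda>n. r n > (R + \<bar>x\<bar>) / 2) sequentially" using order_tendstoD(1)[OF rlim, of "(R + \<bar>x\<bar>) / 2"] True by simp
    moreover have "eventually (\<lambda>n. real n \<ge> 2 / (R - \<bar>x\<bar>)) sequentially"
      by (rule eventually_compose_filterlim[OF eventually_ge_at_top filterlim_real_sequentially])
    ultimately have "eventually (\<lambda>n. max 0 (min 1 ((real n + 1) * (r n - \<bar>x\<bar>))) = 1) sequentially"
    proof eventually_elim
      case (elim n)
      have "1 = 2 / (R - \<bar>x\<bar>) * ((R + \<bar>x\<bar>) / 2 - \<bar>x\<bar>)" using True by (simp add: field_simps)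
      also have "\<dots> \<le> (real n + 1) * (r n - \<bar>x\<bar>)"
        using elim True by (intro mult_mono) auto
      finally show ?case by simp
    qed
    then have "(\<lambda>n. max 0 (min 1 ((real n + 1) * (r n - \<bar>x\<bar>)))) \<longlonglongrightarrow> 1" by (simp add: tendsto_eventually)
    then have "(\<lambda>n. Q n x) \<longlonglongrightarrow> of_real 1 * (p x * of_real (M / max M (cmod (p x))))"
      unfolding Q_def using M by (intro tendsto_intros g(2)[OF that]) auto
    moreover have "of_real 1 * (p x * of_real (M / max M (cmod (p x)))) = p x"
      using p(2)[of x] M by (simp add: max_absorb1)
    ultimately show ?thesis by metis
  next
    case False
    then have "Q n x = 0" for n using Q0[of n x] r(2)[of n] by simp
    then show ?thesis using p(3)[of x] False by simp
  qed
  have "\<exists>\<eta>. test_function \<eta> \<and> (\<forall>x. \<bar>x\<bar> \<ge> R \<longrightarrow> \<eta> x = 0) \<and> (\<forall>x. cmod (\<eta> x - Q n x) \<le> 1 / (real n + 1))" for n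
    using test_approx_continuous[OF r(1) r(2) _ Qc Q0, of "1 / (real n + 1)" n]
    by (metis (no_types, lifting) divide_pos_pos of_nat_0_le_iff add_nonneg_pos zero_less_one)
  then obtain q where q: "\<And>n. test_function (q n)" "\<And>n x. \<bar>x\<bar> \<ge> R \<Longrightarrow> q n x = 0"
     "\<And>n x. cmod (q n x - Q n x) \<le> 1 / (real n + 1)" by metis
  have q1: "cmod (q n x) \<le> M + 1" for n x
  proof -
    have "1 / (real n + 1) \<le> 1" by simp
    then show ?thesis using q(3)[of n x] QM[of n x] norm_triangle_sub[of "q n x" "Q n x"] by linarith
  qed
  have "(\<lambda>n. q n x) \<longlonglongrightarrow> p x" if "x \<notin> N" for x
  proof -
    have "(\<lambda>n. 1 / (real n + 1)) \<longlonglongrightarrow> 0"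
      using LIMSEQ_inverse_real_of_nat by (simp add: inverse_eq_divide add.commute)
    then have "(\<lambda>n. q n x - Q n x) \<longlonglongrightarrow> 0"
      by (rule Lim_null_comparison[rotated]) (use q(3) in auto)
    from tendsto_add[OF this Qlim[OF that]] show ?thesis by simp
  qed
  moreover have "AE x in lborel. x \<notin> N"
    using N AE_not_in[of N "completion lborel"] by (simp add: negligible_iff_null_sets AE_completion_iff)
  ultimately have "AE x in lborel. (\<lambda>n. q n x) \<longlonglongrightarrow> p x" by (auto elim: eventually_mono)
  then show ?thesis using that q q1 by blast
qed

lemma set_integrable_support:
  fixes f :: "real \<Rightarrow> 'a::euclidean_space"
  assumes "set_integrable lborel {a..b} f" "\<And>x. x \<notin> {a..b} \<Longrightarrow> f x = 0"
  shows "integrable lborel f"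
proof -
  have "(\<lambda>x. indicat_real {a..b} x *\<^sub>R f x) = f" using assms(2) by (auto simp: indicator_def)
  then show ?thesis using assms(1) by (simp add: set_integrable_def)
qed

text \<open>Test functions approximating the conjugate of sgn h on a bounded interval turn the
  tested integral into the integral of |h| over that interval.\<close>

lemma AE_zero_of_test_functions:
  fixes h :: "real \<Rightarrow> complex"
  assumes h: "h \<in> borel_measurable borel" "\<And>a b. set_integrable lborel {a..b} h"
    and t: "\<And>\<eta>. test_function \<eta> \<Longrightarrow> (LINT x|lborel. h x * \<eta> x) = 0"
  shows "AE x in lborel. h x = 0"
proof -
  note [measurable] = h(1)
  have "AE x in lborel. \<bar>x\<bar> < real N + 1 \<longrightarrow> h x = 0" for N
  proof -
    define R where "R = real N + 1"
    have R: "R > 0" by (simp add: R_def)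
    define p where "p x = (if \<bar>x\<bar> < R then cnj (sgn (h x)) else 0)" for x
    have p1: "p \<in> borel_measurable borel" 
    proof -
      have "(\<lambda>x. cnj (h x /\<^sub>R cmod (h x))) = (\<lambda>x. inverse (cmod (h x)) *\<^sub>R cnj (h x))" by simp
      moreover have "(\<lambda>x. cnj (h x)) \<in> borel_measurable borel"
        by (intro borel_measurable_continuous_on[OF _ h(1)] continuous_intros)
      ultimately have "(\<lambda>x. cnj (h x /\<^sub>R cmod (h x))) \<in> borel_measurable borel" by simp
      then show ?thesis unfolding p_def sgn_div_norm by (intro measurable_If) auto
    qed
    have p2: "cmod (p x) \<le> 1" for x by (simp add: p_def norm_sgn)
    have p3: "\<bar>x\<bar> \<ge> R \<Longrightarrow> p x = 0" for x by (simp add: p_def)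
    obtain q where q: "\<And>n. test_function (q n)" "\<And>n x. \<bar>x\<bar> \<ge> R \<Longrightarrow> q n x = 0"
      "\<And>n x. cmod (q n x) \<le> 1 + 1" "AE x in lborel. (\<lambda>n. q n x) \<longlonglongrightarrow> p x"
      using test_approx_bounded[OF p1 p2 p3 zero_less_one R] by blast
    have qm [measurable]: "q n \<in> borel_measurable borel" for n
      by (rule borel_measurable_continuous_onI) (rule test_function_continuous[OF q(1)])
    have hi: "integrable lborel (\<lambda>x. indicat_real {-R..R} x *\<^sub>R h x)" using h(2) by (simp add: set_integrable_def)
    have "(\<lambda>n. LINT x|lborel. h x * q n x) \<longlonglongrightarrow> (LINT x|lborel. h x * p x)"
    proof (rule integral_dominated_convergence)
      show "(\<lambda>x. h x * p x) \<in> borel_measurable lborel" using p1 by simp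
      show "integrable lborel (\<lambda>x. 2 * norm (indicat_real {-R..R} x *\<^sub>R h x))" using hi by (intro integrable_mult_right integrable_norm)
      show "AE x in lborel. (\<lambda>n. h x * q n x) \<longlonglongrightarrow> h x * p x"
        using q(4) by (auto elim!: eventually_mono intro: tendsto_mult_left)
      show "AE x in lborel. norm (h x * q n x) \<le> 2 * norm (indicat_real {-R..R} x *\<^sub>R h x)" for n
      proof (rule AE_I2)
        fix x
        show "norm (h x * q n x) \<le> 2 * norm (indicat_real {-R..R} x *\<^sub>R h x)"
        proof (cases "\<bar>x\<bar> \<ge> R")
          case True then show ?thesis using q(2) by simp
        next
          case False
          then have "cmod (h x) * cmod (q n x) \<le> cmod (h x) * 2" using q(3)[of n x] by (intro mult_left_mono) auto
          moreover have "indicat_real {-R..R} x = 1" using False by (auto simp: indicator_def)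
          ultimately show ?thesis by (simp add: norm_mult mult.commute)
        qed
      qed
    qed simp
    then have "(LINT x|lborel. h x * p x) = 0" by (simp add: t[OF q(1)] LIMSEQ_const_iff)
    moreover have e: "h x * p x = of_real (cmod (indicat_real {x. \<bar>x\<bar> < R} x *\<^sub>R h x))" for x
    proof (cases "\<bar>x\<bar> < R")
      case True
      have "h x * cnj (sgn (h x)) = (h x * cnj (h x)) / of_real (cmod (h x))"
        by (simp add: sgn_eq)
      also have "\<dots> = of_real (cmod (h x))"
        by (simp add: complex_norm_square[symmetric] power2_eq_square)
      finally show ?thesis using True by (simp add: p_def)
    qed (simp add: p_def)
    ultimately have z: "(LINT x|lborel. cmod (indicat_real {x. \<bar>x\<bar> < R} x *\<^sub>R h x)) = 0"
      unfolding e integral_complex_of_real by simp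
    have "integrable lborel (\<lambda>x. cmod (indicat_real {x. \<bar>x\<bar> < R} x *\<^sub>R h x))"
      by (rule Bochner_Integration.integrable_bound[OF hi]) (auto simp: indicator_def)
    then have "AE x in lborel. cmod (indicat_real {x. \<bar>x\<bar> < R} x *\<^sub>R h x) = 0"
      using z by (subst (asm) integral_nonneg_eq_0_iff_AE) auto
    then show ?thesis by (auto elim!: eventually_mono simp: R_def indicator_def)
  qed
  then have "AE x in lborel. \<forall>N. \<bar>x\<bar> < real N + 1 \<longrightarrow> h x = 0" by (subst AE_all_countable) blast
  then show ?thesis
  proof (rule eventually_mono)
    fix x :: real assume *: "\<forall>N. \<bar>x\<bar> < real N + 1 \<longrightarrow> h x = 0"
    obtain N :: nat where "\<bar>x\<bar> < real N" using reals_Archimedean2 by blast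
    then have "\<bar>x\<bar> < real N + 1" by linarith
    then show "h x = 0" using * by blast
  qed
qed

lemma indicator_scale_support:
  fixes f :: "real \<Rightarrow> 'a::real_vector"
  assumes "\<And>x. R \<le> \<bar>x\<bar> \<Longrightarrow> f x = 0"
  shows "indicat_real {-R..R} x *\<^sub>R f x = f x"
proof (cases "R \<le> \<bar>x\<bar>")
  case True
  then show ?thesis by (simp add: assms)
next
  case False
  then have "x \<in> {-R..R}" by auto
  then show ?thesis by simp
qed

lemma continuous_support_integrable:
  fixes f :: "real \<Rightarrow> 'a::euclidean_space"
  assumes "continuous_on UNIV f" "\<And>x. \<bar>x\<bar> > R \<Longrightarrow> f x = 0"
  shows "integrable lborel f"
  by (rule set_integrable_support[OF set_integrable_continuous[OF assms(1), of "-R" R]])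
    (use assms(2) in auto)

lemma test_function_ac: "test_function \<eta> \<Longrightarrow> has_ac_deriv \<eta> (vderiv \<eta>)"
  by (rule ac_C1) (auto intro: test_function_has_vector_derivative test_function_continuous test_function_vderiv)

lemma test_function_sqi:
  assumes "test_function \<eta>"
  shows "sq_integrable \<eta>"
proof -
  obtain R where R: "R > 0" "\<And>x. \<bar>x\<bar> > R \<Longrightarrow> \<eta> x = 0" using test_function_support[OF assms] by blast
  have "integrable lborel (\<lambda>x. (cmod (\<eta> x))\<^sup>2)"
    by (rule continuous_support_integrable[where R=R])
      (use R in \<open>auto intro!: continuous_intros test_function_continuous assms\<close>)
  then show ?thesis
    unfolding sq_integrable_def by (auto intro: borel_measurable_continuous_onI test_function_continuous assms)
qed

lemma integrable_mult_test_function: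
  fixes g :: "real \<Rightarrow> complex"
  assumes g: "g \<in> borel_measurable borel" "\<And>a b. set_integrable lborel {a..b} g" and "test_function \<eta>"
  shows "integrable lborel (\<lambda>x. g x * \<eta> x)"
proof -
  obtain R where R: "R > 0" "\<And>x. \<bar>x\<bar> > R \<Longrightarrow> \<eta> x = 0" using test_function_support[OF assms(3)] by blast
  obtain B where B: "B > 0" "\<And>x. cmod (\<eta> x) \<le> B" using test_function_bounded[OF assms(3)] by blast
  have [measurable]: "\<eta> \<in> borel_measurable borel" by (intro borel_measurable_continuous_onI test_function_continuous assms)
  have "set_integrable lborel {-R..R} (\<lambda>x. g x * \<eta> x)"
    by (rule set_integrable_dominated[OF g(2), of _ _ _ B])
      (use g B in \<open>auto simp: norm_mult mult.commute[of B] intro!: mult_left_mono\<close>)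
  then show ?thesis by (rule set_integrable_support) (use R in auto)
qed

section \<open>Weak derivatives and absolutely continuous representatives\<close>

lemma ac_test_by_parts:
  fixes G :: "real \<Rightarrow> complex"
  assumes G: "has_ac_deriv G g" and t: "test_function \<eta>"
  shows "(LINT x|lborel. G x * vderiv \<eta> x) = - (LINT x|lborel. g x * \<eta> x)"
proof -
  obtain R where R: "R > 0" "\<And>x. \<bar>x\<bar> > R \<Longrightarrow> \<eta> x = 0" using test_function_support[OF t] by blast
  have cG: "continuous_on UNIV G" by (rule ac_continuous[OF G])
  have i1: "integrable lborel (\<lambda>x. g x * \<eta> x)"
    by (rule integrable_mult_test_function[OF ac_borel[OF G] ac_set_integrable[OF G] t])
  have i2: "integrable lborel (\<lambda>x. G x * vderiv \<eta> x)"
    by (rule integrable_mult_test_function[OF ac_borel_fun[OF G] set_integrable_continuous[OF cG] test_function_vderiv[OF t]])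
  have i3: "integrable lborel (\<lambda>x. (cmod (G x * \<eta> x))\<^sup>2)"
    by (rule continuous_support_integrable[where R=R])
      (use R in \<open>auto intro!: continuous_intros cG test_function_continuous[OF t]\<close>)
  have "(LINT x|lborel. g x * \<eta> x + G x * vderiv \<eta> x) = 0"
    by (rule ac_integral_line(1)[OF ac_mult[OF G test_function_ac[OF t]] _ i3]) (use i1 i2 in simp)
  then show ?thesis using i1 i2 by (simp add: add_eq_0_iff)
qed

lemma ac_imp_has_weak_deriv:
  assumes f: "has_ac_deriv f g"
  shows "has_weak_deriv f g"
  unfolding has_weak_deriv_def locally_integrable_def
  using ac_test_by_parts[OF f] ac_borel[OF f] ac_set_integrable[OF f] ac_borel_fun[OF f]
    set_integrable_continuous[OF ac_continuous[OF f]] by auto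

lemma ac_antiderivative_exists:
  fixes g :: "real \<Rightarrow> 'a::euclidean_space"
  assumes g: "g \<in> borel_measurable borel" "\<And>a b. set_integrable lborel {a..b} g"
  obtains G where "has_ac_deriv G g"
proof -
  note gi = set_integrable_imp_integrable_on[OF g(2)]
  define G where "G x = (if 0 \<le> x then integral {0..x} g else - integral {x..0} g)" for x
  have "(g has_integral G b - G a) {a..b}" if "a \<le> b" for a b
  proof -
    consider "0 \<le> a" | "a < 0" "0 \<le> b" | "b < 0" by linarith
    then have "integral {a..b} g = G b - G a"
    proof cases
      case 1
      then show ?thesis using that Henstock_Kurzweil_Integration.integral_combine[OF 1 that gi] by (simp add: G_def algebra_simps)
    next
      case 2
      then show ?thesis using Henstock_Kurzweil_Integration.integral_combine[of a 0 b g, OF _ _ gi] by (simp add: G_def add.commute)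
    next
      case 3
      then show ?thesis using that Henstock_Kurzweil_Integration.integral_combine[of a b 0 g, OF _ _ gi] by (simp add: G_def algebra_simps)
    qed
    then show ?thesis using gi by (metis integrable_integral)
  qed
  then show ?thesis using that[of G] g by (simp add: has_ac_deriv_def)
qed

lemma smooth_diff_scale:
  assumes "smooth f" "smooth g"
  shows "smooth (\<lambda>x. f x - c * g x)"
proof (rule smooth_by_invariance[where S="{\<lambda>x. a x - c * b x |a b. smooth a \<and> smooth b}"])
  show "(\<lambda>x. f x - c * g x) \<in> {\<lambda>x. a x - c * b x |a b. smooth a \<and> smooth b}" using assms by blast
  fix h assume "h \<in> {\<lambda>x. a x - c * b x |a b. smooth a \<and> smooth b}"
  then obtain a b where h: "h = (\<lambda>x. a x - c * b x)" and ab: "smooth a" "smooth b" by blast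
  have "(h has_vector_derivative (vderiv a x - c * vderiv b x)) (at x)" for x
    unfolding h using smooth_has_vector_derivative[OF ab(1), of 0 x] smooth_has_vector_derivative[OF ab(2), of 0 x]
    by (auto intro!: has_vector_derivative_diff has_vector_derivative_mult_right)
  then show "\<exists>g'\<in>{\<lambda>x. a x - c * b x |a b. smooth a \<and> smooth b}. \<forall>x. (h has_vector_derivative g' x) (at x)"
    using smooth_vderiv[OF ab(1)] smooth_vderiv[OF ab(2)]
    by (intro bexI[of _ "\<lambda>x. vderiv a x - c * vderiv b x"]) auto
qed

lemma test_function_diff_scale:
  assumes "test_function f" "test_function g"
  shows "test_function (\<lambda>x. f x - c * g x)"
proof -
  have "{x. f x - c * g x \<noteq> 0} \<subseteq> {x. f x \<noteq> 0} \<union> {x. g x \<noteq> 0}" by auto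
  then show ?thesis
    using assms smooth_diff_scale unfolding test_function_def by (meson bounded_Un bounded_subset)
qed

text \<open>Zero mean is exactly what lets the primitive that vanishes to the left of -R vanish also
  to the right of R.\<close>

lemma test_antiderivative:
  assumes q: "test_function q" "(LINT x|lborel. q x) = 0" "\<And>x. \<bar>x\<bar> \<ge> R \<Longrightarrow> q x = 0" and R: "R > 0"
  obtains Y where "test_function Y" "vderiv Y = q" "\<And>x. \<bar>x\<bar> \<ge> R \<Longrightarrow> Y x = 0"
proof -
  have cq: "continuous_on UNIV q" by (rule test_function_continuous[OF q(1)])
  have "\<exists>F. \<forall>x. - \<infinity> < ereal x \<longrightarrow> ereal x < \<infinity> \<longrightarrow> (F has_vector_derivative q x) (at x)"
    by (rule einterval_antiderivative) (use cq in \<open>auto simp: continuous_on_eq_continuous_at\<close>)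
  then obtain F where F: "\<And>x. (F has_vector_derivative q x) (at x)" by auto
  define Y where "Y x = F x - F (-R)" for x
  have Yd: "(Y has_vector_derivative q x) (at x)" for x
    unfolding Y_def by (auto intro!: derivative_eq_intros F)
  have Yac: "has_ac_deriv Y q" by (rule ac_C1[OF Yd cq])
  have inc: "Y b - Y a = integral {a..b} q" if "a \<le> b" for a b
    using ac_has_integral[OF Yac that] by (simp add: integral_unique)
  have z: "integral {a..b} q = 0" if "b \<le> -R \<or> R \<le> a" for a b
  proof -
    have "integral {a..b} q = integral {a..b} (\<lambda>x. 0)"
      by (rule integral_cong) (use that q(3) R in auto)
    then show ?thesis by simp
  qed
  have "Y R - Y (-R) = (LINT x:{-R..R}|lborel. q x)"
    using inc[of "-R" R] R set_borel_integral_eq_integral(2)[OF ac_set_integrable[OF Yac]] by simp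
  also have "\<dots> = (LINT x|lborel. q x)"
    unfolding set_lebesgue_integral_def
  proof (rule Bochner_Integration.integral_cong)
    show "indicat_real {-R..R} x *\<^sub>R q x = q x" for x
      by (rule indicator_scale_support) (rule q(3))
  qed simp
  finally have YR: "Y R = 0" "Y (-R) = 0" using q(2) by (auto simp: Y_def)
  have Y0: "Y x = 0" if "\<bar>x\<bar> \<ge> R" for x
  proof (cases "x \<ge> R")
    case True
    then show ?thesis using inc[OF True] z[of x R] YR by simp
  next
    case False
    then have "x \<le> -R" using that by simp
    then show ?thesis using inc[of x "-R"] z[of "-R" x] YR by simp
  qed
  have "{x. Y x \<noteq> 0} \<subseteq> {-R..R}" using Y0 by force
  then have "test_function Y"
    using smooth_of_vector_derivative[OF Yd] q(1) bounded_subset[OF bounded_closed_interval]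
    unfolding test_function_def by blast
  then show ?thesis using that vderivI[OF Yd] Y0 by blast
qed

lemma normalized_bump:
  assumes "R > 0"
  obtains \<beta> where "test_function \<beta>" "(LINT x|lborel. \<beta> x) = 1" "\<And>x. \<bar>x\<bar> \<ge> R \<Longrightarrow> \<beta> x = 0"
proof -
  have c: "continuous_on UNIV (bump R 0)" by (rule continuous_bump[OF assms])
  have i: "integrable lborel (bump R 0)"
    by (rule continuous_support_integrable[OF c, of R]) (simp add: bump_def)
  define J where "J = (LINT x|lborel. bump R 0 x)"
  have "J \<noteq> 0"
  proof
    assume "J = 0"
    then have "AE x in lborel. bump R 0 x = 0"
      using integral_nonneg_eq_0_iff_AE[OF i] by (simp add: J_def bump_nonneg)
    then have "AE x in lborel. x \<notin> {-R<..<R}"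
    proof (rule eventually_mono)
      fix x assume "bump R 0 x = 0"
      then show "x \<notin> {-R<..<R}" using bump_pos[of x R] by (auto simp: abs_less_iff)
    qed
    then have "emeasure lborel {-R<..<R} = 0"
      by (subst (asm) AE_iff_measurable[of "{-R<..<R}"]) auto
    then show False using assms by simp
  qed
  have e: "poly_bump R [:of_real (1 / J):] 0 x = of_real (bump R 0 x / J)" for x
    by (simp add: poly_bump_def)
  have "(LINT x|lborel. poly_bump R [:of_real (1 / J):] 0 x) = of_real (LINT x|lborel. bump R 0 x / J)"
    unfolding e by (rule integral_complex_of_real)
  also have "\<dots> = 1" using \<open>J \<noteq> 0\<close> by (simp add: J_def)
  finally show ?thesis
    using that[of "poly_bump R [:of_real (1 / J):] 0"] test_function_poly_bump[OF assms]
    by (simp add: poly_bump_def bump_def)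
qed

lemma continuous_AE_eq:
  fixes f g :: "real \<Rightarrow> 'a::euclidean_space"
  assumes "continuous_on UNIV f" "continuous_on UNIV g" "AE x in lborel. f x = g x"
  shows "f x = g x"
proof (rule ccontr)
  assume ne: "f x \<noteq> g x"
  have o: "open {x. f x \<noteq> g x}" by (intro open_Collect_neq assms)
  have "{x. f x \<noteq> g x} \<in> null_sets lborel"
    using assms(3) o AE_iff_null_sets[of "{x. f x \<noteq> g x}" lborel] by (simp add: borel_open)
  then have "negligible {x. f x \<noteq> g x}"
    by (simp add: negligible_iff_null_sets null_sets_completionI)
  then show False using open_not_negligible[OF o] ne by blast
qed

text \<open>The difference between f and a primitive G of g is orthogonal to all derivatives of test
  functions, that is, to all test functions of zero mean. Hence it is constant almost everywhere,
  and everywhere by continuity.\<close>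

lemma has_weak_deriv_imp_ac:
  assumes cf: "continuous_on UNIV f" and w: "has_weak_deriv f g"
  shows "has_ac_deriv f g"
proof -
  have g: "g \<in> borel_measurable borel" "\<And>a b. set_integrable lborel {a..b} g"
    using w by (auto simp: has_weak_deriv_def locally_integrable_def)
  obtain G where G: "has_ac_deriv G g" using ac_antiderivative_exists[OF g] by blast
  have cG: "continuous_on UNIV G" by (rule ac_continuous[OF G])
  note bm = borel_measurable_continuous_onI
  have cF: "continuous_on UNIV (\<lambda>x. f x - G x)" by (intro continuous_intros cf cG)
  obtain \<beta> where \<beta>: "test_function \<beta>" "(LINT x|lborel. \<beta> x) = 1" "\<And>x. \<bar>x\<bar> \<ge> 1 \<Longrightarrow> \<beta> x = 0"
    using normalized_bump[of 1] by auto
  define c where "c = (LINT x|lborel. (f x - G x) * \<beta> x)"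
  have i: "integrable lborel (\<lambda>x. F x * \<eta> x)" if "continuous_on UNIV F" "test_function \<eta>" for F \<eta>
    by (rule integrable_mult_test_function[OF bm[OF that(1)] set_integrable_continuous[OF that(1)] that(2)])
  have it: "integrable lborel \<eta>" if "test_function \<eta>" for \<eta>
    using i[of "\<lambda>x. 1", OF _ that] by simp
  have "AE x in lborel. (f x - G x) - c = 0"
  proof (rule AE_zero_of_test_functions)
    have "continuous_on UNIV (\<lambda>x. f x - G x - c)" by (intro continuous_intros cf cG)
    then show "(\<lambda>x. f x - G x - c) \<in> borel_measurable borel" "\<And>a b. set_integrable lborel {a..b} (\<lambda>x. f x - G x - c)"
      using bm set_integrable_continuous by blast+
    fix \<eta> assume t: "test_function \<eta>"
    define J where "J = (LINT x|lborel. \<eta> x)"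
    \<comment> \<open>Subtracting a multiple of the normalized bump makes the mean zero, so that q
      is the derivative of a test function.\<close>
    define q where "q x = \<eta> x - J * \<beta> x" for x
    have q: "test_function q" unfolding q_def by (rule test_function_diff_scale[OF t \<beta>(1)])
    have "(LINT x|lborel. q x) = 0" unfolding q_def using it[OF t] it[OF \<beta>(1)] \<beta>(2) by (simp add: J_def)
    moreover obtain R where "R > 0" "\<And>x. \<bar>x\<bar> > R \<Longrightarrow> q x = 0" using test_function_support[OF q] by blast
    ultimately obtain Y where Y: "test_function Y" "vderiv Y = q"
      using test_antiderivative[OF q, of "R + 1"] by (metis abs_ge_zero add_pos_pos less_add_one order_less_le_trans zero_less_one)
    have "(LINT x|lborel. f x * q x) = (LINT x|lborel. G x * q x)"
      
    proof -
      have "(LINT x|lborel. f x * vderiv Y x) = - (LINT x|lborel. g x * Y x)"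
        using w Y(1) unfolding has_weak_deriv_def by blast
      then show ?thesis using ac_test_by_parts[OF G Y(1)] unfolding Y(2) by simp
    qed
    then have "(LINT x|lborel. (f x - G x) * q x) = 0"
      using i[OF cf q] i[OF cG q] by (simp add: algebra_simps)
    then have "(LINT x|lborel. (f x - G x) * \<eta> x - J * ((f x - G x) * \<beta> x)) = 0"
      by (simp add: q_def algebra_simps)
    then have "(LINT x|lborel. (f x - G x) * \<eta> x) = J * c"
      using i[OF cF t] i[OF cF \<beta>(1)] by (simp add: c_def)
    then have "(LINT x|lborel. (f x - G x) * \<eta> x - c * \<eta> x) = 0"
      using i[OF cF t] it[OF t] by (simp add: J_def)
    then show "(LINT x|lborel. (f x - G x - c) * \<eta> x) = 0"
      by (simp only: left_diff_distrib)
  qed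
  then have "AE x in lborel. f x = G x + c" by (auto elim!: eventually_mono simp: algebra_simps)
  then have "f x = G x + c" for x
    by (rule continuous_AE_eq[OF cf, rotated]) (intro continuous_intros cG)
  then have "f = (\<lambda>x. G x + c)" by blast
  then show ?thesis using ac_add[OF G ac_const, of c] by simp
qed

lemma ac_deriv_AE_unique:
  fixes f :: "real \<Rightarrow> complex"
  assumes "has_ac_deriv f g" "has_ac_deriv f h"
  shows "AE x in lborel. g x = h x"
proof -
  have "AE x in lborel. g x - h x = 0"
  proof (rule AE_zero_of_test_functions)
    have d: "has_ac_deriv (\<lambda>x. f x - f x) (\<lambda>x. g x - h x)" by (rule ac_diff[OF assms])
    show "(\<lambda>x. g x - h x) \<in> borel_measurable borel" "\<And>a b. set_integrable lborel {a..b} (\<lambda>x. g x - h x)"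
      using ac_borel[OF d] ac_set_integrable[OF d] by auto
    fix \<eta> assume "test_function \<eta>"
    from ac_test_by_parts[OF d this] show "(LINT x|lborel. (g x - h x) * \<eta> x) = 0" by simp
  qed
  then show ?thesis by simp
qed

text \<open>\<open>weak_deriv\<close> is a choice of representative, so its values can be identified
  only almost everywhere.\<close>

lemma ac_weak_deriv:
  assumes "has_ac_deriv f g"
  shows "has_ac_deriv f (weak_deriv f)" "AE x in lborel. weak_deriv f x = g x"
proof -
  have "has_weak_deriv f (weak_deriv f)"
    unfolding weak_deriv_def by (rule someI[of _ g]) (rule ac_imp_has_weak_deriv[OF assms])
  then show *: "has_ac_deriv f (weak_deriv f)" by (rule has_weak_deriv_imp_ac[OF ac_continuous[OF assms]])
  show "AE x in lborel. weak_deriv f x = g x" by (rule ac_deriv_AE_unique[OF * assms])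
qed

section \<open>Density of test functions among H^1 functions of compact support\<close>

lemma l2norm_dominated_convergence:
  fixes f :: "nat \<Rightarrow> real \<Rightarrow> 'a::euclidean_space" and w :: "real \<Rightarrow> 'b::euclidean_space"
  assumes "\<And>n. f n \<in> borel_measurable borel" "AE x in lborel. (\<lambda>n. f n x) \<longlonglongrightarrow> 0"
    and "\<And>n x. norm (f n x) \<le> norm (w x)" and w: "sq_integrable w"
  shows "(\<lambda>n. l2norm (f n)) \<longlonglongrightarrow> 0"
proof -
  have "(\<lambda>n. LINT x|lborel. (norm (f n x))\<^sup>2) \<longlonglongrightarrow> (LINT x|(lborel :: real measure). (0::real))"
  proof (rule integral_dominated_convergence[where w="\<lambda>x. (norm (w x))\<^sup>2"])
    show "integrable lborel (\<lambda>x. (norm (w x))\<^sup>2)" using w by (simp add: sq_integrable_def)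
    show "AE x in lborel. (\<lambda>n. (norm (f n x))\<^sup>2) \<longlonglongrightarrow> 0"
      using assms(2) by (rule eventually_mono) (auto intro!: tendsto_eq_intros)
    show "AE x in lborel. norm ((norm (f n x))\<^sup>2) \<le> (norm (w x))\<^sup>2" for n
      using assms(3) by (intro AE_I2) (simp add: power_mono)
  qed (use assms(1) in auto)
  from tendsto_real_sqrt[OF this] show ?thesis by (simp add: l2norm_def)
qed

lemma sqi_test_approx:
  fixes p :: "real \<Rightarrow> complex"
  assumes p: "sq_integrable p" "\<And>x. \<bar>x\<bar> \<ge> R \<Longrightarrow> p x = 0" and R: "R > 0" and e: "\<epsilon> > 0"
  obtains q where "test_function q" "\<And>x. \<bar>x\<bar> \<ge> R \<Longrightarrow> q x = 0" "l2norm (\<lambda>x. q x - p x) < \<epsilon>"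
proof -
  note [measurable] = sqi_borel[OF p(1)]
  \<comment> \<open>Truncation in height comes first, since \<open>test_approx_bounded\<close> asks
    for a bounded function.\<close>
  define pk where "pk k x = (if cmod (p x) \<le> real k then p x else 0)" for k :: nat and x
  have pkm [measurable]: "pk k \<in> borel_measurable borel" for k unfolding pk_def by measurable
  have "(\<lambda>k. l2norm (\<lambda>x. pk k x - p x)) \<longlonglongrightarrow> 0"
  proof (rule l2norm_dominated_convergence[OF _ _ _ p(1)])
    show "AE x in lborel. (\<lambda>k. pk k x - p x) \<longlonglongrightarrow> 0"
    proof (rule AE_I2)
      fix x
      have "eventually (\<lambda>k. cmod (p x) \<le> real k) sequentially"
        by (rule eventually_compose_filterlim[OF eventually_ge_at_top filterlim_real_sequentially])
      then have "eventually (\<lambda>k. pk k x - p x = 0) sequentially" by (rule eventually_mono) (simp add: pk_def)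
      then show "(\<lambda>k. pk k x - p x) \<longlonglongrightarrow> 0" by (rule tendsto_eventually)
    qed
  qed (auto simp: pk_def)
  then have "eventually (\<lambda>k. l2norm (\<lambda>x. pk k x - p x) < \<epsilon> / 2) sequentially"
    by (rule order_tendstoD(2)) (use e in simp)
  then obtain k where k: "l2norm (\<lambda>x. pk k x - p x) < \<epsilon> / 2" by (auto simp: eventually_sequentially)
  have pk_le: "cmod (pk k x) \<le> real k + 1" for x by (simp add: pk_def)
  have pk_0: "\<bar>x\<bar> \<ge> R \<Longrightarrow> pk k x = 0" for x using p(2) by (simp add: pk_def)
  have k0: "0 < real k + 1" by simp
  obtain q where q: "\<And>n. test_function (q n)" "\<And>n x. \<bar>x\<bar> \<ge> R \<Longrightarrow> q n x = 0"
    "\<And>n x. cmod (q n x) \<le> real k + 1 + 1" "AE x in lborel. (\<lambda>n. q n x) \<longlonglongrightarrow> pk k x"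
    using test_approx_bounded[OF pkm pk_le pk_0 k0 R] by blast
  have qm [measurable]: "q n \<in> borel_measurable borel" for n
    by (rule borel_measurable_continuous_onI) (rule test_function_continuous[OF q(1)])
  \<comment> \<open>The factor is the sum of the bounds k + 2 for q n and k + 1 for the truncated
    function.\<close>
  have w: "sq_integrable (\<lambda>x. (2 * real k + 3) * indicat_real {-R..R} x)"
    by (rule sqi_scale(1)[OF sqi_indicator(1)])
  have "(\<lambda>n. l2norm (\<lambda>x. q n x - pk k x)) \<longlonglongrightarrow> 0"
  proof (rule l2norm_dominated_convergence[OF _ _ _ w])
    show "AE x in lborel. (\<lambda>n. q n x - pk k x) \<longlonglongrightarrow> 0"
      using q(4) by (rule eventually_mono) (simp add: LIM_zero)
    fix n x
    show "norm (q n x - pk k x) \<le> norm ((2 * real k + 3) * indicat_real {- R..R} x)"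
    proof (cases "\<bar>x\<bar> \<ge> R")
      case True
      then show ?thesis using q(2) pk_0 by simp
    next
      case False
      then show ?thesis
        using norm_triangle_ineq4[of "q n x" "pk k x"] q(3)[of n x] pk_le[of x] by (auto simp: indicator_def)
    qed
  qed measurable
  then have "eventually (\<lambda>n. l2norm (\<lambda>x. q n x - pk k x) < \<epsilon> / 2) sequentially"
    by (rule order_tendstoD(2)) (use e in simp)
  then obtain n where n: "l2norm (\<lambda>x. q n x - pk k x) < \<epsilon> / 2" by (auto simp: eventually_sequentially)
  have spk: "sq_integrable (pk k)" by (rule sqi_mono(1)[OF p(1) pkm]) (simp add: pk_def)
  have "l2norm (\<lambda>x. (q n x - pk k x) + (pk k x - p x)) \<le> l2norm (\<lambda>x. q n x - pk k x) + l2norm (\<lambda>x. pk k x - p x)"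
    by (rule sqi_add(2)[OF sqi_diff(1)[OF test_function_sqi[OF q(1)] spk] sqi_diff(1)[OF spk p(1)]])
  then have "l2norm (\<lambda>x. q n x - p x) < \<epsilon>" using k n by simp
  then show ?thesis using that q by blast
qed

lemma l2norm_indicator_integral:
  fixes f :: "real \<Rightarrow> complex"
  assumes f: "sq_integrable f" "\<And>x. \<bar>x\<bar> \<ge> R \<Longrightarrow> f x = 0" and R: "R > 0"
  shows "integrable lborel f" "cmod (LINT x|lborel. f x) \<le> sqrt (2 * R) * l2norm f"
proof -
  have z: "f x = 0" if "x \<notin> {-R..R}" for x
    by (rule f(2)) (use that in auto)
  then show i: "integrable lborel f"
    by (rule set_integrable_support[OF sqi_set_integrable[OF f(1)], of "-R" R])
  have "cmod (LINT x|lborel. f x) \<le> (LINT x|lborel. cmod (f x))" by (rule integral_norm_bound)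
  also have "\<dots> = (LINT x|lborel. norm (indicat_real {-R..R} x) * norm (f x))"
  proof (rule Bochner_Integration.integral_cong)
    show "cmod (f x) = norm (indicat_real {-R..R} x) * norm (f x)" for x
      by (cases "x \<in> {-R..R}") (simp_all add: z)
  qed simp
  also have "\<dots> \<le> l2norm (indicat_real {-R..R}) * l2norm f" by (rule sqi_product(2)[OF sqi_indicator(1) f(1)])
  finally show "cmod (LINT x|lborel. f x) \<le> sqrt (2 * R) * l2norm f" using R by (simp add: sqi_indicator)
qed

text \<open>The derivative is approximated in L^2, and the mean of the approximation is then
  corrected by a bump so that its primitive has compact support. The correction is small because p
  itself has mean 0.\<close>

lemma H1_compact_test_approx:
  fixes \<phi> p :: "real \<Rightarrow> complex"
  assumes \<phi>: "has_ac_deriv \<phi> p" "\<And>x. \<bar>x\<bar> \<ge> R \<Longrightarrow> \<phi> x = 0" "\<And>x. \<bar>x\<bar> \<ge> R \<Longrightarrow> p x = 0"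
    and p: "sq_integrable p" and R: "R > 0" and e: "\<epsilon> > 0"
  obtains \<eta> where "test_function \<eta>" "\<And>x. \<bar>x\<bar> \<ge> R \<Longrightarrow> \<eta> x = 0" "l2norm (\<lambda>x. vderiv \<eta> x - p x) < \<epsilon>"
proof -
  obtain \<beta> where \<beta>: "test_function \<beta>" "(LINT x|lborel. \<beta> x) = 1" "\<And>x. \<bar>x\<bar> \<ge> R \<Longrightarrow> \<beta> x = 0"
    using normalized_bump[OF R] by blast
  \<comment> \<open>The summand 1 accounts for the approximation of p, the rest for the correction
    of the mean, which Cauchy-Schwarz on {-R..R} bounds by the same error.\<close>
  define K where "K = 1 + sqrt (2 * R) * l2norm \<beta>"
  have K: "K > 0" using R by (simp add: K_def add_pos_nonneg)
  obtain q where q: "test_function q" "\<And>x. \<bar>x\<bar> \<ge> R \<Longrightarrow> q x = 0" "l2norm (\<lambda>x. q x - p x) < \<epsilon> / K"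
    using sqi_test_approx[OF p \<phi>(3) R, of "\<epsilon> / K"] e K by auto
  define J where "J = (LINT x|lborel. q x)"
  have sq: "sq_integrable q" and s\<beta>: "sq_integrable \<beta>" using test_function_sqi q(1) \<beta>(1) by auto
  have ip: "integrable lborel p" and iq: "integrable lborel q" and i\<beta>: "integrable lborel \<beta>"
    using l2norm_indicator_integral(1) p \<phi>(3) sq q(2) s\<beta> \<beta>(3) R by blast+
  have "(LINT x|lborel. p x) = (LINT x:{-R..R}|lborel. p x)"
    unfolding set_lebesgue_integral_def
    
  proof (rule Bochner_Integration.integral_cong)
    show "p x = indicat_real {-R..R} x *\<^sub>R p x" for x
      by (rule indicator_scale_support[symmetric]) (rule \<phi>(3))
  qed simp
  also have "\<dots> = integral {-R..R} p" by (rule set_borel_integral_eq_integral(2)[OF ac_set_integrable[OF \<phi>(1)]])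
  also have "\<dots> = \<phi> R - \<phi> (-R)" using ac_has_integral[OF \<phi>(1), of "-R" R] R by (simp add: integral_unique)
  finally have "(LINT x|lborel. p x) = 0" using \<phi>(2) R by simp
  then have "J = (LINT x|lborel. q x - p x)" using ip iq by (simp add: J_def)
  then have J: "cmod J \<le> sqrt (2 * R) * l2norm (\<lambda>x. q x - p x)"
    using l2norm_indicator_integral(2)[OF sqi_diff(1)[OF sq p] _ R] q(2) \<phi>(3) by simp
  define h where "h x = q x - J * \<beta> x" for x
  have h: "test_function h" unfolding h_def by (rule test_function_diff_scale[OF q(1) \<beta>(1)])
  have hz: "(LINT x|lborel. h x) = 0" unfolding h_def using iq i\<beta> \<beta>(2) by (simp add: J_def)
  have h0: "\<bar>x\<bar> \<ge> R \<Longrightarrow> h x = 0" for x using q(2) \<beta>(3) by (simp add: h_def)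
  obtain Y where Y: "test_function Y" "vderiv Y = h" "\<And>x. \<bar>x\<bar> \<ge> R \<Longrightarrow> Y x = 0"
    using test_antiderivative[OF h hz h0 R] by blast
  have "l2norm (\<lambda>x. (q x - p x) - J * \<beta> x) \<le> l2norm (\<lambda>x. q x - p x) + l2norm (\<lambda>x. J * \<beta> x)"
    by (rule sqi_diff(2)[OF sqi_diff(1)[OF sq p] sqi_scale(1)[OF s\<beta>]])
  also have "\<dots> \<le> l2norm (\<lambda>x. q x - p x) + sqrt (2 * R) * l2norm (\<lambda>x. q x - p x) * l2norm \<beta>"
    unfolding sqi_scale(2)[OF s\<beta>] by (intro add_left_mono mult_right_mono J) simp
  also have "\<dots> = K * l2norm (\<lambda>x. q x - p x)" by (simp add: K_def algebra_simps)
  also have "\<dots> < \<epsilon>" using q(3) K by (simp add: field_simps)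
  finally have "l2norm (\<lambda>x. vderiv Y x - p x) < \<epsilon>" unfolding Y(2) h_def by (simp add: algebra_simps)
  then show ?thesis using that Y by blast
qed

section \<open>The energy space\<close>

lemma energy_space_continuous: "u \<in> energy_space \<Longrightarrow> continuous_on S u"
  unfolding energy_space_def using continuous_on_subset by blast

lemma energy_space_ac:
  assumes "u \<in> energy_space"
  shows "has_ac_deriv u (weak_deriv u)"
proof -
  obtain g where "has_weak_deriv u g" using assms unfolding energy_space_def in_H1_loc_def by blast
  then have "has_weak_deriv u (weak_deriv u)" unfolding weak_deriv_def by (metis someI)
  then show ?thesis by (rule has_weak_deriv_imp_ac[OF energy_space_continuous[OF assms]])
qed

lemma energy_space_sqi_deriv: "u \<in> energy_space \<Longrightarrow> sq_integrable (weak_deriv u)"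
  by (simp add: energy_space_def in_L2_iff_sq_integrable)

lemma energy_space_borel: "u \<in> energy_space \<Longrightarrow> u \<in> borel_measurable borel"
  by (intro borel_measurable_continuous_onI energy_space_continuous)

lemma energy_space_sqi_mass:
  assumes "u \<in> energy_space"
  shows "sq_integrable (\<lambda>x. 1 - (cmod (u x))\<^sup>2)"
proof -
  have "sq_integrable (\<lambda>x. complex_of_real (1 - (cmod (u x))\<^sup>2))"
    using assms by (simp add: energy_space_def in_L2_iff_sq_integrable)
  moreover have "(\<lambda>x. 1 - (cmod (u x))\<^sup>2) \<in> borel_measurable borel"
    using energy_space_borel[OF assms] by measurable
  ultimately show ?thesis by (rule sqi_mono(1)) (simp only: norm_of_real real_norm_def order_refl)
qed

definition sup_bound :: "(real \<Rightarrow> complex) \<Rightarrow> real" where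
  "sup_bound u = sqrt (1 + l2norm (\<lambda>x. 1 - (cmod (u x))\<^sup>2)) + l2norm (weak_deriv u)"

text \<open>As u is not square integrable, the argument of \<open>ac_sup_bound\<close> is applied to
  1 - |u|^2, which yields a nearby point of controlled modulus.\<close>

lemma energy_space_bounded:
  assumes u: "u \<in> energy_space"
  shows "cmod (u x) \<le> sup_bound u"
proof -
  have c: "continuous_on UNIV (\<lambda>x. 1 - (cmod (u x))\<^sup>2)"
    by (intro continuous_intros energy_space_continuous u)
  obtain y where y: "y \<in> {x..x+1}" "norm (1 - (cmod (u y))\<^sup>2) \<le> l2norm (\<lambda>x. 1 - (cmod (u x))\<^sup>2)"
    using exists_le_l2norm[OF c energy_space_sqi_mass[OF u]] by blast
  have "cmod (u y) \<le> sqrt (1 + l2norm (\<lambda>x. 1 - (cmod (u x))\<^sup>2))"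
    by (rule real_le_rsqrt) (use y(2) in simp)
  moreover have "norm (u x - u y) \<le> 1 * l2norm (weak_deriv u)"
  proof (rule order_trans[OF ac_holder[OF energy_space_ac[OF u] energy_space_sqi_deriv[OF u]]])
    show "sqrt \<bar>x - y\<bar> * l2norm (weak_deriv u) \<le> 1 * l2norm (weak_deriv u)"
      using y(1) by (intro mult_right_mono) auto
  qed
  ultimately show ?thesis
    unfolding sup_bound_def using norm_triangle_sub[of "u x" "u y"] by simp
qed

lemma sup_bound_pos: "sup_bound u \<ge> 1"
proof -
  have "sqrt (1 + l2norm (\<lambda>x. 1 - (cmod (u x))\<^sup>2)) \<ge> 1" by simp
  then show ?thesis unfolding sup_bound_def by (simp add: add_increasing2)
qed

lemma energy_space_sqi_mass_diff:
  assumes "u \<in> energy_space" "w \<in> energy_space"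
  shows "sq_integrable (\<lambda>x. (cmod (u x))\<^sup>2 - (cmod (w x))\<^sup>2)"
  using sqi_diff(1)[OF energy_space_sqi_mass[OF assms(2)] energy_space_sqi_mass[OF assms(1)]] by simp

section \<open>The essential supremum and the two distances\<close>

lemma AE_le_imp_le_interior:
  fixes g :: "real \<Rightarrow> real"
  assumes "continuous_on UNIV g" "AE x in lborel. x \<in> S \<longrightarrow> g x \<le> c" "x \<in> interior S"
  shows "g x \<le> c"
proof (rule ccontr)
  assume n: "\<not> g x \<le> c"
  define T where "T = interior S \<inter> {x. c < g x}"
  have o: "open T" unfolding T_def by (intro open_Int open_interior open_Collect_less assms continuous_on_const)
  have "AE x in lborel. x \<notin> T"
    using assms(2) by (rule eventually_mono) (use interior_subset in \<open>auto simp: T_def\<close>)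
  then have "T \<in> null_sets lborel" using o AE_iff_null_sets[of T lborel] by (simp add: borel_open)
  then have "negligible T" by (simp add: negligible_iff_null_sets null_sets_completionI)
  then have "T = {}" using open_not_negligible[OF o] by blast
  moreover have "x \<in> T" using n assms(3) by (simp add: T_def)
  ultimately show False by blast
qed

lemma Linf_norm_ge:
  assumes c: "continuous_on UNIV f" and S: "S \<in> sets borel" and K: "\<And>x. x \<in> S \<Longrightarrow> cmod (f x) \<le> K" and x: "x \<in> interior S"
  shows "cmod (f x) \<le> Linf_norm S f"
proof -
  define e where "e = esssup (restrict_space lborel S) (\<lambda>x. ereal (cmod (f x)))"
  have m: "(\<lambda>x. ereal (cmod (f x))) \<in> borel_measurable (restrict_space lborel S)"
    by (intro measurable_restrict_space1) (use borel_measurable_continuous_onI[OF c] in measurable)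
  have sp: "S \<inter> space lborel \<in> sets lborel" using S by simp
  \<comment> \<open>Infinite values of the essential supremum have to be excluded, since
    \<open>real_of_ereal\<close> maps them to 0.\<close>
  have "e \<le> ereal K" unfolding e_def
    by (rule esssup_I[OF m], subst AE_restrict_space_iff[OF sp]) (use K in auto)
  then have e1: "e \<noteq> \<infinity>" by auto
  have ae: "AE x in lborel. x \<in> S \<longrightarrow> ereal (cmod (f x)) \<le> e"
    using esssup_AE[of "\<lambda>x. ereal (cmod (f x))" "restrict_space lborel S"] 
    unfolding e_def AE_restrict_space_iff[OF sp] .
  have e2: "e \<noteq> -\<infinity>"
  proof
    assume "e = -\<infinity>"
    then have "AE x in lborel. x \<in> S \<longrightarrow> cmod (f x) \<le> -1"
      using ae by (auto elim!: eventually_mono)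
    from AE_le_imp_le_interior[OF continuous_on_norm[OF c] this x] show False using norm_ge_zero[of "f x"] by linarith
  qed
  obtain r where r: "e = ereal r" using e1 e2 by (cases e) auto
  have "AE x in lborel. x \<in> S \<longrightarrow> cmod (f x) \<le> r" using ae by (simp add: r)
  from AE_le_imp_le_interior[OF continuous_on_norm[OF c] this x]
  show ?thesis by (simp add: Linf_norm_def e_def[symmetric] r)
qed

lemma Linf_norm_le:
  assumes c: "continuous_on UNIV f" and S: "S \<in> sets borel" and K: "\<And>x. x \<in> S \<Longrightarrow> cmod (f x) \<le> K" "0 \<le> K"
  shows "Linf_norm S f \<le> K"
proof -
  have m: "(\<lambda>x. ereal (cmod (f x))) \<in> borel_measurable (restrict_space lborel S)"
    by (intro measurable_restrict_space1) (use borel_measurable_continuous_onI[OF c] in measurable)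
  have sp: "S \<inter> space lborel \<in> sets lborel" using S by simp
  have "esssup (restrict_space lborel S) (\<lambda>x. ereal (cmod (f x))) \<le> ereal K"
    by (rule esssup_I[OF m], subst AE_restrict_space_iff[OF sp]) (use K in auto)
  then show ?thesis unfolding Linf_norm_def using K(2)
    by (cases "esssup (restrict_space lborel S) (\<lambda>x. ereal (cmod (f x)))") auto
qed

lemma energy_space_diff_bounded:
  assumes "u \<in> energy_space" "w \<in> energy_space"
  shows "cmod (u x - w x) \<le> sup_bound u + sup_bound w"
  using norm_triangle_ineq4[of "u x" "w x"] energy_space_bounded[OF assms(1), of x] energy_space_bounded[OF assms(2), of x]
  by linarith

lemma Linf_norm_diff_ge:
  assumes "u \<in> energy_space" "w \<in> energy_space" "S \<in> sets borel" "x \<in> interior S"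
  shows "cmod (u x - w x) \<le> Linf_norm S (\<lambda>x. u x - w x)"
  using Linf_norm_ge[OF _ assms(3) _ assms(4), of "\<lambda>x. u x - w x" "sup_bound u + sup_bound w"]
    energy_space_diff_bounded[OF assms(1,2)] energy_space_continuous[OF assms(1)] energy_space_continuous[OF assms(2)]
  by (simp add: continuous_on_diff)

lemma dist_inf_bounds:
  assumes "u \<in> energy_space" "w \<in> energy_space"
  shows "l2norm (\<lambda>x. weak_deriv u x - weak_deriv w x) \<le> dist_inf u w"
    and "cmod (u x - w x) \<le> dist_inf u w"
    and "l2norm (\<lambda>x. (cmod (u x))\<^sup>2 - (cmod (w x))\<^sup>2) \<le> dist_inf u w"
    and "0 \<le> dist_inf u w"
proof -
  have L: "cmod (u x - w x) \<le> Linf_norm UNIV (\<lambda>x. u x - w x)" for x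
    by (rule Linf_norm_diff_ge[OF assms]) auto
  have L0: "0 \<le> Linf_norm UNIV (\<lambda>x. u x - w x)" using L[of 0] norm_ge_zero order_trans by blast
  have e: "l2norm (\<lambda>x. complex_of_real ((cmod (u x))\<^sup>2 - (cmod (w x))\<^sup>2)) = l2norm (\<lambda>x. (cmod (u x))\<^sup>2 - (cmod (w x))\<^sup>2)"
    unfolding l2norm_def norm_of_real real_norm_def ..
  note n = l2norm_nonneg[of "\<lambda>x. weak_deriv u x - weak_deriv w x"] l2norm_nonneg[of "\<lambda>x. (cmod (u x))\<^sup>2 - (cmod (w x))\<^sup>2"]
  show "l2norm (\<lambda>x. weak_deriv u x - weak_deriv w x) \<le> dist_inf u w"
    "cmod (u x - w x) \<le> dist_inf u w" "l2norm (\<lambda>x. (cmod (u x))\<^sup>2 - (cmod (w x))\<^sup>2) \<le> dist_inf u w"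
    "0 \<le> dist_inf u w"
    unfolding dist_inf_def L2_norm_eq_l2norm e using n L0 L[of x] by linarith+
qed

text \<open>Of the sup norm on [-A, A] only the value at the origin is extracted: together with the
  derivatives it controls the difference everywhere, up to growth like sqrt|x|, and with constants
  independent of A.\<close>

lemma dist_A_bounds:
  assumes "u \<in> energy_space" "w \<in> energy_space" "A > 0"
  shows "l2norm (\<lambda>x. weak_deriv u x - weak_deriv w x) \<le> dist_A A u w"
    and "cmod (u 0 - w 0) \<le> dist_A A u w"
    and "l2norm (\<lambda>x. (cmod (u x))\<^sup>2 - (cmod (w x))\<^sup>2) \<le> dist_A A u w"
proof -
  have L: "cmod (u 0 - w 0) \<le> Linf_norm {-A..A} (\<lambda>x. u x - w x)"
    by (rule Linf_norm_diff_ge[OF assms(1,2)]) (use assms(3) in auto)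
  have L0: "0 \<le> Linf_norm {-A..A} (\<lambda>x. u x - w x)" using L norm_ge_zero order_trans by blast
  have e: "l2norm (\<lambda>x. complex_of_real ((cmod (u x))\<^sup>2 - (cmod (w x))\<^sup>2)) = l2norm (\<lambda>x. (cmod (u x))\<^sup>2 - (cmod (w x))\<^sup>2)"
    unfolding l2norm_def norm_of_real real_norm_def ..
  note n = l2norm_nonneg[of "\<lambda>x. weak_deriv u x - weak_deriv w x"] l2norm_nonneg[of "\<lambda>x. (cmod (u x))\<^sup>2 - (cmod (w x))\<^sup>2"]
  show "l2norm (\<lambda>x. weak_deriv u x - weak_deriv w x) \<le> dist_A A u w"
    "cmod (u 0 - w 0) \<le> dist_A A u w" "l2norm (\<lambda>x. (cmod (u x))\<^sup>2 - (cmod (w x))\<^sup>2) \<le> dist_A A u w"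
    unfolding dist_A_def L2_norm_eq_l2norm e using n L0 L by linarith+
qed

section \<open>The weak formulation as a form on the Sobolev space\<close>

lemma cnj_borel: "f \<in> borel_measurable borel \<Longrightarrow> (\<lambda>x. cnj (f x)) \<in> borel_measurable borel"
  by (erule borel_measurable_continuous_on[rotated]) (intro continuous_intros)

lemma sqi_cnj: "sq_integrable f \<Longrightarrow> sq_integrable (\<lambda>x. cnj (f x))"
  and l2norm_cnj: "l2norm (\<lambda>x. cnj (f x)) = l2norm f"
  by (auto simp: sq_integrable_def l2norm_def intro: cnj_borel)

lemma pairing_integrable:
  assumes "sq_integrable f" "sq_integrable g"
  shows "integrable lborel (\<lambda>x. cnj (f x) * g x)"
  by (rule sqi_mult(1)[OF sqi_cnj[OF assms(1)] assms(2)])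

lemma pairing_bound:
  assumes "sq_integrable f" "sq_integrable g"
  shows "cmod (pairing f g) \<le> l2norm f * l2norm g"
  using sqi_mult(2)[OF sqi_cnj[OF assms(1)] assms(2)] by (simp add: pairing_def l2norm_cnj)

lemma pairing_diff_left:
  assumes "sq_integrable f" "sq_integrable g" "sq_integrable h"
  shows "pairing (\<lambda>x. f x - g x) h = pairing f h - pairing g h"
  unfolding pairing_def using pairing_integrable[OF assms(1,3)] pairing_integrable[OF assms(2,3)]
  by (simp add: left_diff_distrib)

lemma pairing_diff_right:
  assumes "sq_integrable f" "sq_integrable g" "sq_integrable h"
  shows "pairing f (\<lambda>x. g x - h x) = pairing f g - pairing f h"
  unfolding pairing_def using pairing_integrable[OF assms(1,2)] pairing_integrable[OF assms(1,3)]
  by (simp add: right_diff_distrib)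

text \<open>The point value \<^term>\<open>b\<close> stands for \<^term>\<open>u 0\<close>, the functions \<^term>\<open>a\<close> and \<^term>\<open>c\<close> for the derivative of
  \<^term>\<open>u\<close> and for the nonlinearity.\<close>

definition weak_form :: "real \<Rightarrow> real \<Rightarrow> (real \<Rightarrow> complex) \<Rightarrow> complex \<Rightarrow> (real \<Rightarrow> complex) \<Rightarrow> (real \<Rightarrow> complex) \<Rightarrow> (real \<Rightarrow> complex) \<Rightarrow> complex" where
  "weak_form \<gamma> v a b c \<phi> \<phi>' = pairing a \<phi>' + pairing (\<lambda>x. \<i> * of_real v * a x) \<phi> + of_real \<gamma> * cnj b * \<phi> 0 - pairing c \<phi>"

lemma weak_form_diff_left:
  assumes "sq_integrable a1" "sq_integrable a2" "sq_integrable c1" "sq_integrable c2" "sq_integrable \<phi>" "sq_integrable \<phi>'"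
  shows "weak_form \<gamma> v (\<lambda>x. a1 x - a2 x) (b1 - b2) (\<lambda>x. c1 x - c2 x) \<phi> \<phi>' = weak_form \<gamma> v a1 b1 c1 \<phi> \<phi>' - weak_form \<gamma> v a2 b2 c2 \<phi> \<phi>'"
proof -
  have "pairing (\<lambda>x. \<i> * of_real v * (a1 x - a2 x)) \<phi> = pairing (\<lambda>x. \<i> * of_real v * a1 x) \<phi> - pairing (\<lambda>x. \<i> * of_real v * a2 x) \<phi>"
    unfolding right_diff_distrib by (rule pairing_diff_left) (intro sqi_scale assms)+
  then show ?thesis
    unfolding weak_form_def pairing_diff_left[OF assms(1,2,6)] pairing_diff_left[OF assms(3,4,5)]
    by (simp add: algebra_simps)
qed

lemma weak_form_diff_right:
  assumes "sq_integrable a" "sq_integrable c" "sq_integrable \<phi>" "sq_integrable \<phi>'" "sq_integrable \<eta>" "sq_integrable \<eta>'"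
  shows "weak_form \<gamma> v a b c (\<lambda>x. \<phi> x - \<eta> x) (\<lambda>x. \<phi>' x - \<eta>' x) = weak_form \<gamma> v a b c \<phi> \<phi>' - weak_form \<gamma> v a b c \<eta> \<eta>'"
  unfolding weak_form_def pairing_diff_right[OF assms(1,4,6)] pairing_diff_right[OF assms(2,3,5)]
    pairing_diff_right[OF sqi_scale(1)[OF assms(1)] assms(3,5)]
  by (simp add: algebra_simps)

text \<open>A bound in the dual of H^1; the delta term is covered because evaluation at the origin
  is continuous on H^1.\<close>

lemma weak_form_bound:
  assumes a: "sq_integrable a" and c: "sq_integrable c" and \<phi>: "sq_integrable \<phi>" "sq_integrable \<phi>'" "has_ac_deriv \<phi> \<phi>'"
  shows "cmod (weak_form \<gamma> v a b c \<phi> \<phi>') \<le> ((1 + \<bar>v\<bar>) * l2norm a + \<bar>\<gamma>\<bar> * cmod b + l2norm c) * (l2norm \<phi> + l2norm \<phi>')"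
proof -
  have 1: "cmod (pairing a \<phi>') \<le> l2norm a * (l2norm \<phi> + l2norm \<phi>')"
    by (rule order_trans[OF pairing_bound[OF a \<phi>(2)]]) (intro mult_left_mono, auto)
  have 2: "cmod (pairing (\<lambda>x. \<i> * of_real v * a x) \<phi>) \<le> \<bar>v\<bar> * l2norm a * (l2norm \<phi> + l2norm \<phi>')"
  proof -
    have "cmod (pairing (\<lambda>x. \<i> * of_real v * a x) \<phi>) \<le> cmod (\<i> * of_real v) * l2norm a * l2norm \<phi>"
      using pairing_bound[OF sqi_scale(1)[OF a] \<phi>(1)] sqi_scale(2)[OF a] by metis
    also have "\<dots> \<le> \<bar>v\<bar> * l2norm a * (l2norm \<phi> + l2norm \<phi>')"
      by (simp add: norm_mult) (intro mult_left_mono, auto)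
    finally show ?thesis .
  qed
  have 3: "cmod (of_real \<gamma> * cnj b * \<phi> 0) \<le> \<bar>\<gamma>\<bar> * cmod b * (l2norm \<phi> + l2norm \<phi>')"
    unfolding norm_mult using ac_sup_bound[OF \<phi>(3,1,2), of 0] by (simp add: mult_left_mono)
  have 4: "cmod (pairing c \<phi>) \<le> l2norm c * (l2norm \<phi> + l2norm \<phi>')"
    by (rule order_trans[OF pairing_bound[OF c \<phi>(1)]]) (intro mult_left_mono, auto)
  have "cmod (weak_form \<gamma> v a b c \<phi> \<phi>') \<le> cmod (pairing a \<phi>') + cmod (pairing (\<lambda>x. \<i> * of_real v * a x) \<phi>)
      + cmod (of_real \<gamma> * cnj b * \<phi> 0) + cmod (pairing c \<phi>)"
    unfolding weak_form_def
    by (intro order_trans[OF norm_triangle_ineq4] add_right_mono norm_triangle_le[OF order_refl] order_trans[OF norm_triangle_ineq])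
  then show ?thesis using 1 2 3 4 by (simp add: algebra_simps)
qed

lemma nonlin_sqi:
  assumes "u \<in> energy_space"
  shows "sq_integrable (nonlin u)" "l2norm (nonlin u) \<le> sup_bound u * l2norm (\<lambda>x. 1 - (cmod (u x))\<^sup>2)"
proof -
  have m: "nonlin u \<in> borel_measurable borel"
    unfolding nonlin_def using energy_space_borel[OF assms] by measurable
  have le: "cmod (nonlin u x) \<le> sup_bound u * norm (1 - (cmod (u x))\<^sup>2)" for x
    using energy_space_bounded[OF assms, of x] unfolding nonlin_def norm_mult norm_of_real
    by (simp add: mult.commute mult_right_mono)
  show "sq_integrable (nonlin u)" "l2norm (nonlin u) \<le> sup_bound u * l2norm (\<lambda>x. 1 - (cmod (u x))\<^sup>2)"
    using sqi_dominated[OF energy_space_sqi_mass[OF assms] m le] sup_bound_pos[of u] by auto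
qed

text \<open>The difference splits into (|w|^2 - |u|^2) u and (1 - |w|^2) (u - w). In each product
  one factor is controlled by the distance, in L^2 or in the sup norm.\<close>

lemma nonlin_diff:
  assumes u: "u \<in> energy_space" and w: "w \<in> energy_space"
  shows "l2norm (\<lambda>x. nonlin u x - nonlin w x) \<le> (sup_bound w + dist_inf u w + l2norm (\<lambda>x. 1 - (cmod (w x))\<^sup>2)) * dist_inf u w"
proof -
  define d where "d = dist_inf u w"
  note db = dist_inf_bounds[OF u w, folded d_def]
  note [measurable] = energy_space_borel[OF u] energy_space_borel[OF w]
  have ub: "cmod (u x) \<le> sup_bound w + d" for x
    using energy_space_bounded[OF w, of x] db(2)[of x] norm_triangle_sub[of "u x" "w x"] by linarith
  have 1: "sq_integrable (\<lambda>x. (complex_of_real ((cmod (w x))\<^sup>2 - (cmod (u x))\<^sup>2)) * u x)"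
    "l2norm (\<lambda>x. (complex_of_real ((cmod (w x))\<^sup>2 - (cmod (u x))\<^sup>2)) * u x) \<le> (sup_bound w + d) * d"
  proof -
    have m: "(\<lambda>x. (complex_of_real ((cmod (w x))\<^sup>2 - (cmod (u x))\<^sup>2)) * u x) \<in> borel_measurable borel" by measurable
    have le: "cmod ((complex_of_real ((cmod (w x))\<^sup>2 - (cmod (u x))\<^sup>2)) * u x) \<le> (sup_bound w + d) * norm ((cmod (u x))\<^sup>2 - (cmod (w x))\<^sup>2)" for x
      using ub[of x] unfolding norm_mult norm_of_real by (simp add: mult.commute mult_right_mono abs_minus_commute)
    have "l2norm (\<lambda>x. (complex_of_real ((cmod (w x))\<^sup>2 - (cmod (u x))\<^sup>2)) * u x) \<le> (sup_bound w + d) * l2norm (\<lambda>x. (cmod (u x))\<^sup>2 - (cmod (w x))\<^sup>2)"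
      using sqi_dominated(2)[OF energy_space_sqi_mass_diff[OF u w] m le] sup_bound_pos[of w] db(4) by simp
    also have "\<dots> \<le> (sup_bound w + d) * d"
      using db(3) sup_bound_pos[of w] db(4) by (intro mult_left_mono) auto
    finally show "l2norm (\<lambda>x. (complex_of_real ((cmod (w x))\<^sup>2 - (cmod (u x))\<^sup>2)) * u x) \<le> (sup_bound w + d) * d" .
    show "sq_integrable (\<lambda>x. (complex_of_real ((cmod (w x))\<^sup>2 - (cmod (u x))\<^sup>2)) * u x)"
      by (rule sqi_dominated(1)[OF energy_space_sqi_mass_diff[OF u w] m le])
  qed
  have 2: "sq_integrable (\<lambda>x. of_real (1 - (cmod (w x))\<^sup>2) * (u x - w x))"
    "l2norm (\<lambda>x. of_real (1 - (cmod (w x))\<^sup>2) * (u x - w x)) \<le> d * l2norm (\<lambda>x. 1 - (cmod (w x))\<^sup>2)"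
  proof -
    have m: "(\<lambda>x. of_real (1 - (cmod (w x))\<^sup>2) * (u x - w x)) \<in> borel_measurable borel" by measurable
    have le: "cmod (of_real (1 - (cmod (w x))\<^sup>2) * (u x - w x)) \<le> d * norm (1 - (cmod (w x))\<^sup>2)" for x
      using db(2)[of x] unfolding norm_mult norm_of_real by (simp add: mult.commute mult_right_mono)
    show "sq_integrable (\<lambda>x. of_real (1 - (cmod (w x))\<^sup>2) * (u x - w x))"
      "l2norm (\<lambda>x. of_real (1 - (cmod (w x))\<^sup>2) * (u x - w x)) \<le> d * l2norm (\<lambda>x. 1 - (cmod (w x))\<^sup>2)"
      using sqi_dominated[OF energy_space_sqi_mass[OF w] m le] db(4) by auto
  qed
  have "(\<lambda>x. nonlin u x - nonlin w x) = (\<lambda>x. (complex_of_real ((cmod (w x))\<^sup>2 - (cmod (u x))\<^sup>2)) * u x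
      + of_real (1 - (cmod (w x))\<^sup>2) * (u x - w x))"
    by (simp add: nonlin_def fun_eq_iff algebra_simps)
  then have "l2norm (\<lambda>x. nonlin u x - nonlin w x) \<le> (sup_bound w + d) * d + d * l2norm (\<lambda>x. 1 - (cmod (w x))\<^sup>2)"
    using sqi_add(2)[OF 1(1) 2(1)] 1(2) 2(2) by simp
  then show ?thesis by (simp add: d_def algebra_simps)
qed

section \<open>Cutoff functions\<close>

text \<open>Used through its square, which is C^1 with a derivative bounded by a multiple of
  \<open>cutoff\<close> itself. Errors from differentiating the truncation are thereby absorbed into
  the truncated norm that is being estimated.\<close>

definition cutoff :: "nat \<Rightarrow> real \<Rightarrow> real" where
  "cutoff n x = max 0 (1 - (x / (real n + 1))\<^sup>2)"

lemma cutoff_range: "0 \<le> cutoff n x" "cutoff n x \<le> 1"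
  by (auto simp: cutoff_def)

lemma cutoff_continuous [continuous_intros]: "continuous_on S (cutoff n)"
  unfolding cutoff_def by (intro continuous_intros) auto

lemma cutoff_outside: "\<bar>x\<bar> \<ge> real n + 1 \<Longrightarrow> cutoff n x = 0"
proof -
  assume "\<bar>x\<bar> \<ge> real n + 1"
  then have "1 \<le> \<bar>x / (real n + 1)\<bar>" by (simp add: abs_divide)
  then have "1\<^sup>2 \<le> (x / (real n + 1))\<^sup>2" by (metis abs_le_square_iff abs_one)
  then show ?thesis by (simp add: cutoff_def)
qed

lemma cutoff_tendsto: "(\<lambda>n. cutoff n x) \<longlonglongrightarrow> 1"
proof -
  have "(\<lambda>n. x * inverse (real (Suc n))) \<longlonglongrightarrow> x * 0"
    by (rule tendsto_mult_left[OF LIMSEQ_inverse_real_of_nat])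
  then have "(\<lambda>n. max 0 (1 - (x * inverse (real (Suc n)))\<^sup>2)) \<longlonglongrightarrow> max 0 (1 - (x * 0)\<^sup>2)"
    by (intro tendsto_max tendsto_diff tendsto_power tendsto_const)
  then show ?thesis by (simp add: cutoff_def divide_inverse add.commute)
qed

lemma cutoff_mono: "m \<le> n \<Longrightarrow> cutoff m x \<le> cutoff n x"
proof -
  assume "m \<le> n"
  then have "\<bar>x / (real n + 1)\<bar> \<le> \<bar>x / (real m + 1)\<bar>" by (simp add: abs_divide frac_le)
  then have "(x / (real n + 1))\<^sup>2 \<le> (x / (real m + 1))\<^sup>2" by (simp only: abs_le_square_iff)
  then show ?thesis by (simp add: cutoff_def)
qed

lemma positive_part_square_DERIV: "((\<lambda>y. (max 0 y)\<^sup>2) has_real_derivative 2 * max 0 y) (at y)"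
proof -
  consider "y > 0" | "y < 0" | "y = 0" by linarith
  then show ?thesis
  proof cases
    case 1
    have "((\<lambda>y. y\<^sup>2) has_real_derivative 2 * y) (at y)" by (auto intro!: derivative_eq_intros)
    then show ?thesis
      using 1 has_field_derivative_transform_within_open[of "\<lambda>y. y\<^sup>2" "2 * y" y "{0<..}" "\<lambda>y. (max 0 y)\<^sup>2"] by (auto simp: max_def)
  next
    case 2
    have "((\<lambda>y. 0) has_real_derivative 0) (at y)" by simp
    then show ?thesis
      using 2 has_field_derivative_transform_within_open[of "\<lambda>y. 0" "0" y "{..<0}" "\<lambda>y. (max 0 y)\<^sup>2"] by (auto simp: max_def)
  next
    case 3
    have "((\<lambda>y. (max 0 y)\<^sup>2) has_vector_derivative 0) (at (y::real))"
      by (rule has_vector_derivative_zero_quadratic[where K=1]) (auto simp: max_def 3)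
    then show ?thesis using 3 by (simp add: has_real_derivative_iff_has_vector_derivative)
  qed
qed

definition cutoff_deriv :: "nat \<Rightarrow> real \<Rightarrow> real" where
  "cutoff_deriv n x = - 4 * x / (real n + 1)\<^sup>2 * cutoff n x"

lemma cutoff_sq_ac: "has_ac_deriv (\<lambda>x. (cutoff n x)\<^sup>2) (cutoff_deriv n)"
proof (rule ac_C1)
  show "((\<lambda>x. (cutoff n x)\<^sup>2) has_vector_derivative cutoff_deriv n x) (at x)" for x
  proof -
    have "((\<lambda>x. 1 - (x / (real n + 1))\<^sup>2) has_real_derivative - 2 * x / (real n + 1)\<^sup>2) (at x)"
      by (auto intro!: derivative_eq_intros simp: power2_eq_square)
    from DERIV_chain2[OF positive_part_square_DERIV this]
    have "((\<lambda>x. (cutoff n x)\<^sup>2) has_real_derivative cutoff_deriv n x) (at x)"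
      by (simp add: cutoff_def cutoff_deriv_def mult_ac)
    then show ?thesis by (simp add: has_real_derivative_iff_has_vector_derivative)
  qed
  show "continuous_on UNIV (cutoff_deriv n)" unfolding cutoff_deriv_def by (intro continuous_intros) auto
qed

lemma cutoff_deriv_bound: "\<bar>cutoff_deriv n x\<bar> \<le> 4 / (real n + 1) * cutoff n x"
proof (cases "\<bar>x\<bar> \<ge> real n + 1")
  case True
  then show ?thesis by (simp add: cutoff_deriv_def cutoff_outside)
next
  case False
  have "\<bar>cutoff_deriv n x\<bar> = 4 * (\<bar>x\<bar> / (real n + 1)) / (real n + 1) * cutoff n x"
    using cutoff_range[of n x] by (simp add: cutoff_deriv_def abs_mult power2_eq_square)
  also have "\<dots> \<le> 4 * 1 / (real n + 1) * cutoff n x"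
    using False cutoff_range[of n x] by (intro mult_right_mono divide_right_mono mult_left_mono) auto
  finally show ?thesis by simp
qed

lemma cutoff_deriv_outside: "\<bar>x\<bar> \<ge> real n + 1 \<Longrightarrow> cutoff_deriv n x = 0"
  by (simp add: cutoff_deriv_def cutoff_outside)

lemma cutoff_deriv_continuous: "continuous_on S (cutoff_deriv n)"
  unfolding cutoff_deriv_def by (intro continuous_intros) auto

lemma cutoff_mult_ac:
  fixes f :: "real \<Rightarrow> complex"
  assumes "has_ac_deriv f f'"
  shows "has_ac_deriv (\<lambda>x. of_real ((cutoff n x)\<^sup>2) * f x) (\<lambda>x. of_real (cutoff_deriv n x) * f x + of_real ((cutoff n x)\<^sup>2) * f' x)"
  by (rule ac_mult[OF ac_bounded_linear[OF cutoff_sq_ac bounded_linear_of_real] assms])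

section \<open>Solutions as curves in the dual of the Sobolev space\<close>

text \<open>Only tests of compact support are retained; that the equation can be tested with all of
  H^1 is recovered in \<open>increment_H1\<close>.\<close>

locale gp_solution =
  fixes \<gamma> v :: real and u :: "real \<Rightarrow> real \<Rightarrow> complex"
  assumes energy: "\<And>t. u t \<in> energy_space"
    and cont: "\<And>t. ((\<lambda>s. dist_inf (u s) (u t)) \<longlongrightarrow> 0) (at t)"
    and weak: "\<And>\<phi>. test_function \<phi> \<Longrightarrow> has_weak_deriv (\<lambda>t. pairing (\<lambda>x. \<i> * u t x) \<phi>)
       (\<lambda>t. weak_form \<gamma> v (weak_deriv (u t)) (u t 0) (nonlin (u t)) \<phi> (vderiv \<phi>))"

lemma global_solution_gp_solution:
  assumes "global_solution \<gamma> v u0 u"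
  shows "gp_solution \<gamma> v u"
  using assms unfolding global_solution_def gp_solution_def weak_form_def
  by (auto intro: schwartz_test_function)

context gp_solution
begin

abbreviation ux :: "real \<Rightarrow> real \<Rightarrow> complex" where "ux t \<equiv> weak_deriv (u t)"

text \<open>As a functional on H^1 this is the time derivative of the pairing with i u(t). The
  derivative of the argument is passed separately, so that any representative of it can be
  used.\<close>

definition L :: "real \<Rightarrow> (real \<Rightarrow> complex) \<Rightarrow> (real \<Rightarrow> complex) \<Rightarrow> complex" where
  "L t \<phi> \<phi>' = weak_form \<gamma> v (ux t) (u t 0) (nonlin (u t)) \<phi> \<phi>'"

lemma ux_sqi [simp]: "sq_integrable (ux t)" and nonlin_u_sqi [simp]: "sq_integrable (nonlin (u t))"
  using energy_space_sqi_deriv[OF energy] nonlin_sqi(1)[OF energy] by auto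

lemma u_ac: "has_ac_deriv (u t) (ux t)"
  by (rule energy_space_ac[OF energy])

definition Lnorm :: "real \<Rightarrow> real" where
  "Lnorm t = (1 + \<bar>v\<bar>) * l2norm (ux t) + \<bar>\<gamma>\<bar> * cmod (u t 0) + l2norm (nonlin (u t))"

lemma L_bound:
  assumes "sq_integrable \<phi>" "sq_integrable \<phi>'" "has_ac_deriv \<phi> \<phi>'"
  shows "cmod (L t \<phi> \<phi>') \<le> Lnorm t * (l2norm \<phi> + l2norm \<phi>')"
  unfolding L_def Lnorm_def by (rule weak_form_bound) (use assms in auto)

lemma Lnorm_nonneg: "0 \<le> Lnorm t"
  by (simp add: Lnorm_def)

text \<open>Bounds the norm of L s - L t in the dual of H^1. Since it tends to 0 as s approaches t,
  the solution is a C^1 curve in that dual.\<close>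

definition modulus :: "real \<Rightarrow> real \<Rightarrow> real" where
  "modulus s t = (1 + \<bar>v\<bar>) * l2norm (\<lambda>x. ux s x - ux t x) + \<bar>\<gamma>\<bar> * cmod (u s 0 - u t 0)
     + l2norm (\<lambda>x. nonlin (u s) x - nonlin (u t) x)"

lemma modulus_nonneg: "0 \<le> modulus s t"
  by (simp add: modulus_def)

lemma modulus_commute: "modulus s t = modulus t s"
  unfolding modulus_def by (simp add: l2norm_commute[of "ux s"] l2norm_commute[of "nonlin (u s)"] norm_minus_commute)

lemma L_diff_bound:
  assumes "sq_integrable \<phi>" "sq_integrable \<phi>'" "has_ac_deriv \<phi> \<phi>'"
  shows "cmod (L s \<phi> \<phi>' - L t \<phi> \<phi>') \<le> modulus s t * (l2norm \<phi> + l2norm \<phi>')"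
proof -
  have "L s \<phi> \<phi>' - L t \<phi> \<phi>' = weak_form \<gamma> v (\<lambda>x. ux s x - ux t x) (u s 0 - u t 0) (\<lambda>x. nonlin (u s) x - nonlin (u t) x) \<phi> \<phi>'"
    unfolding L_def by (rule weak_form_diff_left[symmetric]) (use assms in auto)
  then show ?thesis unfolding modulus_def using weak_form_bound assms by (simp add: sqi_diff(1))
qed

lemma L_diff_right:
  assumes "sq_integrable \<phi>" "sq_integrable \<phi>'" "sq_integrable \<eta>" "sq_integrable \<eta>'"
  shows "L t (\<lambda>x. \<phi> x - \<eta> x) (\<lambda>x. \<phi>' x - \<eta>' x) = L t \<phi> \<phi>' - L t \<eta> \<eta>'"
  unfolding L_def by (rule weak_form_diff_right) (use assms in auto)

lemma modulus_tendsto: "((\<lambda>s. modulus s t) \<longlongrightarrow> 0) (at t)"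
proof (rule tendsto_sandwich[OF _ _ tendsto_const])
  let ?d = "\<lambda>s. dist_inf (u s) (u t)"
  let ?N = "l2norm (\<lambda>x. 1 - (cmod (u t x))\<^sup>2)"
  show "\<forall>\<^sub>F s in at t. 0 \<le> modulus s t" by (simp add: modulus_nonneg)
  show "\<forall>\<^sub>F s in at t. modulus s t \<le> (1 + \<bar>v\<bar>) * ?d s + \<bar>\<gamma>\<bar> * ?d s + (sup_bound (u t) + ?d s + ?N) * ?d s"
  proof (rule always_eventually, rule allI)
    fix s
    show "modulus s t \<le> (1 + \<bar>v\<bar>) * ?d s + \<bar>\<gamma>\<bar> * ?d s + (sup_bound (u t) + ?d s + ?N) * ?d s"
      unfolding modulus_def
      by (intro add_mono mult_left_mono dist_inf_bounds nonlin_diff energy) auto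
  qed
  have "((\<lambda>s. (1 + \<bar>v\<bar>) * ?d s + \<bar>\<gamma>\<bar> * ?d s + (sup_bound (u t) + ?d s + ?N) * ?d s) \<longlongrightarrow>
     (1 + \<bar>v\<bar>) * 0 + \<bar>\<gamma>\<bar> * 0 + (sup_bound (u t) + 0 + ?N) * 0) (at t)"
    by (intro tendsto_intros cont)
  then show "((\<lambda>s. (1 + \<bar>v\<bar>) * ?d s + \<bar>\<gamma>\<bar> * ?d s + (sup_bound (u t) + ?d s + ?N) * ?d s) \<longlongrightarrow> 0) (at t)" by simp
qed

lemma sup_tendsto:
  assumes "\<epsilon> > 0"
  shows "\<exists>\<delta>>0. \<forall>s. \<bar>s - t\<bar> < \<delta> \<longrightarrow> (\<forall>x. cmod (u s x - u t x) < \<epsilon>)"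
proof -
  have "\<forall>\<^sub>F s in at t. dist_inf (u s) (u t) < \<epsilon>" using order_tendstoD(2)[OF cont assms] .
  then obtain \<delta> where \<delta>: "\<delta> > 0" "\<And>s. s \<noteq> t \<Longrightarrow> dist s t < \<delta> \<Longrightarrow> dist_inf (u s) (u t) < \<epsilon>"
    unfolding eventually_at by auto
  have "cmod (u s x - u t x) < \<epsilon>" if "\<bar>s - t\<bar> < \<delta>" for s x
    using \<delta>(2)[of s] that assms dist_inf_bounds(2)[OF energy energy, of s x t]
    by (cases "s = t") (auto simp: dist_real_def intro: order_le_less_trans)
  then show ?thesis using \<delta>(1) by blast
qed

text \<open>Continuity in time is what upgrades the distributional time derivative to
  \<open>has_ac_deriv\<close>.\<close>

lemma pairing_test_continuous:
  assumes \<eta>: "test_function \<eta>"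
  shows "continuous_on UNIV (\<lambda>t. pairing (\<lambda>x. \<i> * u t x) \<eta>)"
proof -
  have i: "integrable lborel (\<lambda>x. cnj (\<i> * u t x) * \<eta> x)" for t
  proof (rule integrable_mult_test_function[OF _ _ \<eta>])
    have "continuous_on UNIV (\<lambda>x. cnj (\<i> * u t x))" by (intro continuous_intros energy_space_continuous energy)
    then show "(\<lambda>x. cnj (\<i> * u t x)) \<in> borel_measurable borel" "\<And>a b. set_integrable lborel {a..b} (\<lambda>x. cnj (\<i> * u t x))"
      using borel_measurable_continuous_onI set_integrable_continuous by blast+
  qed
  have ie: "integrable lborel (\<lambda>x. cmod (\<eta> x))"
    using integrable_mult_test_function[of "\<lambda>x. 1", OF _ _ \<eta>] set_integrable_continuous[OF continuous_on_const] by (auto intro!: integrable_norm)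
  have bd: "cmod (pairing (\<lambda>x. \<i> * u s x) \<eta> - pairing (\<lambda>x. \<i> * u t x) \<eta>) \<le> dist_inf (u s) (u t) * (LINT x|lborel. cmod (\<eta> x))" for s t
  proof -
    have "pairing (\<lambda>x. \<i> * u s x) \<eta> - pairing (\<lambda>x. \<i> * u t x) \<eta> = (LINT x|lborel. cnj (\<i> * u s x) * \<eta> x - cnj (\<i> * u t x) * \<eta> x)"
      unfolding pairing_def by (rule Bochner_Integration.integral_diff[symmetric]) (rule i)+
    also have "cmod \<dots> \<le> (LINT x|lborel. cmod (cnj (\<i> * u s x) * \<eta> x - cnj (\<i> * u t x) * \<eta> x))" by (rule integral_norm_bound)
    also have "\<dots> \<le> (LINT x|lborel. dist_inf (u s) (u t) * cmod (\<eta> x))"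
    proof (rule integral_mono)
      show "integrable lborel (\<lambda>x. cmod (cnj (\<i> * u s x) * \<eta> x - cnj (\<i> * u t x) * \<eta> x))" by (intro integrable_norm Bochner_Integration.integrable_diff i)
      show "integrable lborel (\<lambda>x. dist_inf (u s) (u t) * cmod (\<eta> x))" using ie by simp
      fix x
      have "cnj (\<i> * u s x) * \<eta> x - cnj (\<i> * u t x) * \<eta> x = cnj (\<i> * (u s x - u t x)) * \<eta> x" by (simp add: algebra_simps)
      then have "cmod (cnj (\<i> * u s x) * \<eta> x - cnj (\<i> * u t x) * \<eta> x) = cmod (u s x - u t x) * cmod (\<eta> x)" by (simp only: norm_mult complex_mod_cnj norm_ii mult_1)
      also have "\<dots> \<le> dist_inf (u s) (u t) * cmod (\<eta> x)" by (intro mult_right_mono dist_inf_bounds energy) simp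
      finally show "cmod (cnj (\<i> * u s x) * \<eta> x - cnj (\<i> * u t x) * \<eta> x) \<le> dist_inf (u s) (u t) * cmod (\<eta> x)" .
    qed
    finally show ?thesis by simp
  qed
  have "isCont (\<lambda>t. pairing (\<lambda>x. \<i> * u t x) \<eta>) t" for t
  proof -
    have "((\<lambda>s. dist_inf (u s) (u t) * (LINT x|lborel. cmod (\<eta> x))) \<longlongrightarrow> 0) (at t)"
      using tendsto_mult_left_zero[OF cont] .
    then have "((\<lambda>s. pairing (\<lambda>x. \<i> * u s x) \<eta> - pairing (\<lambda>x. \<i> * u t x) \<eta>) \<longlongrightarrow> 0) (at t)"
      by (rule Lim_null_comparison[rotated]) (use bd in auto)
    then show ?thesis unfolding isCont_def by (simp add: LIM_zero_iff)
  qed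
  then show ?thesis by (simp add: continuous_at_imp_continuous_on)
qed

lemma ac_increment_const:
  fixes f :: "real \<Rightarrow> complex"
  assumes "has_ac_deriv f g" "a \<le> b" "\<And>x. x \<in> {a..b} \<Longrightarrow> cmod (g x) \<le> K"
  shows "cmod (f b - f a) \<le> K * (b - a)"
proof -
  have "cmod (f b - f a) \<le> integral {a..b} (\<lambda>x. norm (g x))" by (rule ac_increment_le[OF assms(1,2)])
  also have "\<dots> \<le> integral {a..b} (\<lambda>x. K)"
    by (rule integral_le) (use assms(3) set_integrable_imp_integrable_on[OF set_integrable_norm[OF ac_set_integrable[OF assms(1)]]] in auto)
  finally show ?thesis using assms(2) by (simp add: mult.commute)
qed

text \<open>The equation is integrated from s to t with its right-hand side frozen at s; K measures
  how far that side moves in between.\<close>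

lemma increment_test:
  assumes \<eta>: "test_function \<eta>" and K: "\<And>\<tau>. \<bar>\<tau> - s\<bar> \<le> \<bar>t - s\<bar> \<Longrightarrow> modulus \<tau> s \<le> K"
  shows "cmod (pairing (\<lambda>x. \<i> * (u t x - u s x)) \<eta> - of_real (t - s) * L s \<eta> (vderiv \<eta>)) \<le> \<bar>t - s\<bar> * K * (l2norm \<eta> + l2norm (vderiv \<eta>))"
proof -
  note e = test_function_sqi[OF \<eta>] test_function_sqi[OF test_function_vderiv[OF \<eta>]] test_function_ac[OF \<eta>]
  let ?c = "\<lambda>t. pairing (\<lambda>x. \<i> * u t x) \<eta>"
  have c: "has_ac_deriv ?c (\<lambda>t. L t \<eta> (vderiv \<eta>))"
    unfolding L_def by (rule has_weak_deriv_imp_ac[OF pairing_test_continuous[OF \<eta>] weak[OF \<eta>]])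
  have lin: "has_ac_deriv (\<lambda>t. of_real t * L s \<eta> (vderiv \<eta>)) (\<lambda>t. L s \<eta> (vderiv \<eta>))"
    by (rule ac_C1) (auto intro!: derivative_eq_intros has_vector_derivative_of_real continuous_intros)
  have f: "has_ac_deriv (\<lambda>t. ?c t - of_real t * L s \<eta> (vderiv \<eta>)) (\<lambda>t. L t \<eta> (vderiv \<eta>) - L s \<eta> (vderiv \<eta>))"
    by (rule ac_diff[OF c lin])
  have bd: "cmod (L \<tau> \<eta> (vderiv \<eta>) - L s \<eta> (vderiv \<eta>)) \<le> K * (l2norm \<eta> + l2norm (vderiv \<eta>))" if "\<bar>\<tau> - s\<bar> \<le> \<bar>t - s\<bar>" for \<tau>
    by (rule order_trans[OF L_diff_bound[OF e]]) (use K[OF that] in \<open>auto intro!: mult_right_mono\<close>)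
  have pd: "pairing (\<lambda>x. \<i> * (u t x - u s x)) \<eta> = ?c t - ?c s"
  proof -
    have i: "integrable lborel (\<lambda>x. cnj (\<i> * u t x) * \<eta> x)" for t
    proof (rule integrable_mult_test_function[OF _ _ \<eta>])
      have "continuous_on UNIV (\<lambda>x. cnj (\<i> * u t x))" by (intro continuous_intros energy_space_continuous energy)
      then show "(\<lambda>x. cnj (\<i> * u t x)) \<in> borel_measurable borel" "\<And>a b. set_integrable lborel {a..b} (\<lambda>x. cnj (\<i> * u t x))"
        using borel_measurable_continuous_onI set_integrable_continuous by blast+
    qed
    have "pairing (\<lambda>x. \<i> * (u t x - u s x)) \<eta> = (LINT x|lborel. cnj (\<i> * u t x) * \<eta> x - cnj (\<i> * u s x) * \<eta> x)"
      unfolding pairing_def by (rule Bochner_Integration.integral_cong) (auto simp: algebra_simps)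
    also have "\<dots> = ?c t - ?c s" unfolding pairing_def by (rule Bochner_Integration.integral_diff) (rule i)+
    finally show ?thesis .
  qed
  have "cmod ((?c t - of_real t * L s \<eta> (vderiv \<eta>)) - (?c s - of_real s * L s \<eta> (vderiv \<eta>))) \<le> K * (l2norm \<eta> + l2norm (vderiv \<eta>)) * \<bar>t - s\<bar>"
  proof (cases "s \<le> t")
    case True
    then show ?thesis using ac_increment_const[OF f True bd] by auto
  next
    case False
    then show ?thesis using ac_increment_const[OF f _ bd, of t s] by (auto simp: norm_minus_commute)
  qed
  then show ?thesis unfolding pd by (simp add: algebra_simps)
qed

end

lemma l2norm_support:
  fixes f :: "real \<Rightarrow> complex"
  assumes f: "f \<in> borel_measurable borel" "\<And>x. \<bar>x\<bar> \<ge> R \<Longrightarrow> f x = 0" "\<And>x. \<bar>x\<bar> < R \<Longrightarrow> cmod (f x) \<le> C" and R: "R > 0" and C: "0 \<le> C"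
  shows "sq_integrable f" "l2norm f \<le> C * sqrt (2 * R)"
proof -
  have le: "cmod (f x) \<le> C * norm (indicat_real {-R..R} x)" for x
  proof (cases "\<bar>x\<bar> \<ge> R")
    case True
    then show ?thesis using f(2) C by simp
  next
    case False
    then have "x \<in> {-R..R}" by auto
    then show ?thesis using f(3)[of x] False by simp
  qed
  show "sq_integrable f" "l2norm f \<le> C * sqrt (2 * R)"
    using sqi_dominated[OF sqi_indicator(1) f(1) le] C sqi_indicator(2)[of "-R" R] R by auto
qed

lemma le_of_le_add_small:
  fixes x y M :: real
  assumes "\<And>\<epsilon>. \<epsilon> > 0 \<Longrightarrow> x \<le> y + M * \<epsilon>"
  shows "x \<le> y"
proof (rule field_le_epsilon)
  fix e :: real assume e: "e > 0"
  have "x \<le> y + M * (e / (\<bar>M\<bar> + 1))" by (rule assms) (use e in simp)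
  also have "M * (e / (\<bar>M\<bar> + 1)) \<le> e"
  proof -
    have "M * e \<le> (\<bar>M\<bar> + 1) * e" using e by (intro mult_right_mono) auto
    then show ?thesis by (simp add: divide_le_eq mult.commute)
  qed
  finally show "x \<le> y + e" by simp
qed

context gp_solution
begin

lemma increment_ac: "has_ac_deriv (\<lambda>x. u t x - u s x) (\<lambda>x. ux t x - ux s x)"
  by (rule ac_diff) (rule u_ac)+

lemma increment_deriv_sqi [simp]: "sq_integrable (\<lambda>x. ux t x - ux s x)"
  by (rule sqi_diff(1)) simp_all

text \<open>Density of test functions. Compact support is kept because u t - u s is so far known to
  be bounded but not square integrable, so its pairing with a general H^1 function has no meaning
  yet.\<close>

lemma increment_compact:
  assumes \<phi>: "has_ac_deriv \<phi> \<phi>'" "sq_integrable \<phi>'" "\<And>x. \<bar>x\<bar> \<ge> R \<Longrightarrow> \<phi> x = 0" "\<And>x. \<bar>x\<bar> \<ge> R \<Longrightarrow> \<phi>' x = 0" and R: "R > 0"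
    and K: "\<And>\<tau>. \<bar>\<tau> - s\<bar> \<le> \<bar>t - s\<bar> \<Longrightarrow> modulus \<tau> s \<le> K"
  shows "cmod (pairing (\<lambda>x. \<i> * (u t x - u s x)) \<phi> - of_real (t - s) * L s \<phi> \<phi>') \<le> \<bar>t - s\<bar> * K * (l2norm \<phi> + l2norm \<phi>')"
proof (rule le_of_le_add_small)
  let ?B = "\<lambda>\<phi> \<phi>'. pairing (\<lambda>x. \<i> * (u t x - u s x)) \<phi> - of_real (t - s) * L s \<phi> \<phi>'"
  define Bd where "Bd = sup_bound (u t) + sup_bound (u s)"
  have Bd: "cmod (u t x - u s x) \<le> Bd" "0 \<le> Bd" for x
    using energy_space_diff_bounded[OF energy energy, of t x s] norm_ge_zero order_trans
    unfolding Bd_def by blast+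
  \<comment> \<open>Collects the errors of replacing \<phi> by a test function; for fixed R each of
    them is linear in \<epsilon>.\<close>
  define M where "M = \<bar>t - s\<bar> * K * (2 * R + 1) + sqrt (2 * R) * (Bd * (2 * R)) + \<bar>t - s\<bar> * (Lnorm s * (2 * R + 1))"
  have K0: "0 \<le> K" using K[of s] modulus_nonneg[of s s] by simp
  fix \<epsilon> :: real assume \<epsilon>: "\<epsilon> > 0"
  obtain \<eta> where \<eta>: "test_function \<eta>" "\<And>x. \<bar>x\<bar> \<ge> R \<Longrightarrow> \<eta> x = 0" "l2norm (\<lambda>x. vderiv \<eta> x - \<phi>' x) < \<epsilon>"
    using H1_compact_test_approx[OF \<phi>(1,3,4,2) R \<epsilon>] by blast
  have s\<eta>: "sq_integrable \<eta>" "sq_integrable (vderiv \<eta>)"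
    using test_function_sqi test_function_vderiv \<eta>(1) by blast+
  define \<psi> where "\<psi> x = \<phi> x - \<eta> x" for x
  define \<psi>' where "\<psi>' x = \<phi>' x - vderiv \<eta> x" for x
  have \<psi>: "has_ac_deriv \<psi> \<psi>'" unfolding \<psi>_def \<psi>'_def by (rule ac_diff[OF \<phi>(1) test_function_ac[OF \<eta>(1)]])
  have s\<psi>': "sq_integrable \<psi>'" unfolding \<psi>'_def by (rule sqi_diff(1)[OF \<phi>(2) s\<eta>(2)])
  have n\<psi>': "l2norm \<psi>' \<le> \<epsilon>" unfolding \<psi>'_def using \<eta>(3) l2norm_commute[of \<phi>' "vderiv \<eta>"] by simp
  have \<psi>0: "\<psi> x = 0" if "\<bar>x\<bar> \<ge> R" for x using \<phi>(3)[OF that] \<eta>(2)[OF that] by (simp add: \<psi>_def)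
  have \<psi>s: "cmod (\<psi> x) \<le> sqrt (2 * R) * \<epsilon>" if "\<bar>x\<bar> < R" for x
  proof -
    have "cmod (\<psi> x - \<psi> (-R)) \<le> sqrt \<bar>x - (-R)\<bar> * l2norm \<psi>'" by (rule ac_holder[OF \<psi> s\<psi>'])
    also have "\<dots> \<le> sqrt (2 * R) * \<epsilon>" using that n\<psi>' \<epsilon> by (intro mult_mono) auto
    finally show ?thesis using \<psi>0[of "-R"] R by simp
  qed
  note sup = l2norm_support[OF ac_borel_fun[OF \<psi>] \<psi>0 \<psi>s R]
  have s\<psi>: "sq_integrable \<psi>" using sup(1) \<epsilon> R by simp
  have n\<psi>: "l2norm \<psi> \<le> 2 * R * \<epsilon>"
  proof -
    have "l2norm \<psi> \<le> sqrt (2 * R) * \<epsilon> * sqrt (2 * R)" using sup(2) \<epsilon> R by simp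
    also have "\<dots> = (sqrt (2 * R))\<^sup>2 * \<epsilon>" by (simp only: power2_eq_square mult_ac)
    finally show ?thesis using R by simp
  qed
  have cD: "continuous_on UNIV (\<lambda>x. cnj (\<i> * (u t x - u s x)))"
    by (intro continuous_intros energy_space_continuous energy)
  have f: "sq_integrable (\<lambda>x. cnj (\<i> * (u t x - u s x)) * \<psi> x)"
    "l2norm (\<lambda>x. cnj (\<i> * (u t x - u s x)) * \<psi> x) \<le> Bd * l2norm \<psi>"
  proof -
    have "cmod (cnj (\<i> * (u t x - u s x))) \<le> Bd" for x
      by (simp only: complex_mod_cnj norm_mult norm_ii mult_1 Bd)
    note m = sqi_mult_bounded[OF s\<psi> borel_measurable_continuous_onI[OF cD] this]
    show "sq_integrable (\<lambda>x. cnj (\<i> * (u t x - u s x)) * \<psi> x)"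
      "l2norm (\<lambda>x. cnj (\<i> * (u t x - u s x)) * \<psi> x) \<le> Bd * l2norm \<psi>"
      by (rule m)+
  qed
  have f2: "integrable lborel (\<lambda>x. cnj (\<i> * (u t x - u s x)) * \<psi> x)"
    "cmod (pairing (\<lambda>x. \<i> * (u t x - u s x)) \<psi>) \<le> sqrt (2 * R) * l2norm (\<lambda>x. cnj (\<i> * (u t x - u s x)) * \<psi> x)"
    unfolding pairing_def using l2norm_indicator_integral[OF f(1) _ R] \<psi>0 by simp_all
  have "sqrt (2 * R) * l2norm (\<lambda>x. cnj (\<i> * (u t x - u s x)) * \<psi> x) \<le> sqrt (2 * R) * (Bd * (2 * R * \<epsilon>))"
    using R f(2) mult_left_mono[OF n\<psi> Bd(2)] by (intro mult_left_mono) auto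
  then have p1: "cmod (pairing (\<lambda>x. \<i> * (u t x - u s x)) \<psi>) \<le> sqrt (2 * R) * (Bd * (2 * R)) * \<epsilon>"
    using f2(2) by (simp add: mult_ac)
  have i\<eta>: "integrable lborel (\<lambda>x. cnj (\<i> * (u t x - u s x)) * \<eta> x)"
    by (rule integrable_mult_test_function[OF borel_measurable_continuous_onI[OF cD] set_integrable_continuous[OF cD] \<eta>(1)])
  have \<phi>e: "\<phi> = (\<lambda>x. \<eta> x + \<psi> x)" "\<phi>' = (\<lambda>x. vderiv \<eta> x + \<psi>' x)" by (auto simp: \<psi>_def \<psi>'_def)
  have s\<phi>: "sq_integrable \<phi>" unfolding \<phi>e by (rule sqi_add(1)[OF s\<eta>(1) s\<psi>])
  have pe: "pairing (\<lambda>x. \<i> * (u t x - u s x)) \<phi> = pairing (\<lambda>x. \<i> * (u t x - u s x)) \<eta> + pairing (\<lambda>x. \<i> * (u t x - u s x)) \<psi>"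
    unfolding pairing_def \<phi>e(1) distrib_left by (rule Bochner_Integration.integral_add[OF i\<eta> f2(1)])
  have Le: "L s \<psi> \<psi>' = L s \<phi> \<phi>' - L s \<eta> (vderiv \<eta>)"
    unfolding \<psi>_def[abs_def] \<psi>'_def[abs_def] by (rule L_diff_right[OF s\<phi> \<phi>(2) s\<eta>])
  have Be: "?B \<phi> \<phi>' = ?B \<eta> (vderiv \<eta>) + (pairing (\<lambda>x. \<i> * (u t x - u s x)) \<psi> - of_real (t - s) * L s \<psi> \<psi>')"
    unfolding pe Le by (simp add: algebra_simps)
  have N\<psi>: "l2norm \<psi> + l2norm \<psi>' \<le> (2 * R + 1) * \<epsilon>" using n\<psi> n\<psi>' by (simp add: algebra_simps)
  have N\<eta>: "l2norm \<eta> + l2norm (vderiv \<eta>) \<le> (l2norm \<phi> + l2norm \<phi>') + (2 * R + 1) * \<epsilon>"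
    using sqi_diff(2)[OF s\<phi> s\<psi>] sqi_diff(2)[OF \<phi>(2) s\<psi>'] N\<psi> by (simp add: \<psi>_def \<psi>'_def)
  have b1: "cmod (?B \<eta> (vderiv \<eta>)) \<le> \<bar>t - s\<bar> * K * ((l2norm \<phi> + l2norm \<phi>') + (2 * R + 1) * \<epsilon>)"
    by (rule order_trans[OF increment_test[OF \<eta>(1) K]]) (use N\<eta> K0 in \<open>auto intro!: mult_left_mono\<close>)
  have b2: "cmod (of_real (t - s) * L s \<psi> \<psi>') \<le> \<bar>t - s\<bar> * (Lnorm s * (2 * R + 1)) * \<epsilon>"
  proof -
    have "cmod (L s \<psi> \<psi>') \<le> Lnorm s * ((2 * R + 1) * \<epsilon>)"
      by (rule order_trans[OF L_bound[OF s\<psi> s\<psi>' \<psi>]]) (intro mult_left_mono N\<psi> Lnorm_nonneg)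
    then show ?thesis unfolding norm_mult norm_of_real mult.assoc by (rule mult_left_mono) simp
  qed
  have "cmod (?B \<phi> \<phi>') \<le> cmod (?B \<eta> (vderiv \<eta>)) + (cmod (pairing (\<lambda>x. \<i> * (u t x - u s x)) \<psi>) + cmod (of_real (t - s) * L s \<psi> \<psi>'))"
    unfolding Be by (intro norm_triangle_mono order_refl norm_triangle_ineq4)
  also have "\<dots> \<le> \<bar>t - s\<bar> * K * (l2norm \<phi> + l2norm \<phi>') + M * \<epsilon>"
    using b1 b2 p1 by (simp add: M_def algebra_simps)
  finally show "cmod (?B \<phi> \<phi>') \<le> \<bar>t - s\<bar> * K * (l2norm \<phi> + l2norm \<phi>') + M * \<epsilon>" .
qed

lemma modulus_triangle: "modulus r t \<le> modulus r s + modulus s t"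
proof -
  have 1: "l2norm (\<lambda>x. ux r x - ux t x) \<le> l2norm (\<lambda>x. ux r x - ux s x) + l2norm (\<lambda>x. ux s x - ux t x)"
    using sqi_add(2)[of "\<lambda>x. ux r x - ux s x" "\<lambda>x. ux s x - ux t x"] by simp
  have 2: "l2norm (\<lambda>x. nonlin (u r) x - nonlin (u t) x) \<le> l2norm (\<lambda>x. nonlin (u r) x - nonlin (u s) x) + l2norm (\<lambda>x. nonlin (u s) x - nonlin (u t) x)"
    using sqi_add(2)[of "\<lambda>x. nonlin (u r) x - nonlin (u s) x" "\<lambda>x. nonlin (u s) x - nonlin (u t) x"] by (simp add: sqi_diff(1))
  have 3: "cmod (u r 0 - u t 0) \<le> cmod (u r 0 - u s 0) + cmod (u s 0 - u t 0)"
    using norm_triangle_ineq[of "u r 0 - u s 0" "u s 0 - u t 0"] by simp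
  have "modulus r t \<le> (1 + \<bar>v\<bar>) * (l2norm (\<lambda>x. ux r x - ux s x) + l2norm (\<lambda>x. ux s x - ux t x))
     + \<bar>\<gamma>\<bar> * (cmod (u r 0 - u s 0) + cmod (u s 0 - u t 0))
     + (l2norm (\<lambda>x. nonlin (u r) x - nonlin (u s) x) + l2norm (\<lambda>x. nonlin (u s) x - nonlin (u t) x))"
    unfolding modulus_def using 1 2 3 by (intro add_mono mult_left_mono) auto
  then show ?thesis unfolding modulus_def by (simp add: algebra_simps)
qed

lemma modulus_self [simp]: "modulus t t = 0"
  by (simp add: modulus_def)

lemma modulus_continuous: "continuous_on S (\<lambda>\<tau>. modulus \<tau> s)"
proof -
  have "isCont (\<lambda>\<tau>. modulus \<tau> s) t" for t
  proof -
    have "((\<lambda>\<tau>. modulus \<tau> s - modulus t s) \<longlongrightarrow> 0) (at t)"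
    proof (rule Lim_null_comparison[OF _ modulus_tendsto])
      show "\<forall>\<^sub>F \<tau> in at t. norm (modulus \<tau> s - modulus t s) \<le> modulus \<tau> t"
        using modulus_triangle[of _ s t] modulus_triangle[of t s] modulus_commute[of t]
        by (intro always_eventually allI) (smt (verit) real_norm_def)
    qed
    then show ?thesis unfolding isCont_def by (simp add: LIM_zero_iff)
  qed
  then show ?thesis by (intro continuous_at_imp_continuous_on) blast
qed

lemma modulus_locally_bounded: obtains K where "0 \<le> K" "\<And>\<tau>. \<bar>\<tau> - s\<bar> \<le> r \<Longrightarrow> modulus \<tau> s \<le> K"
proof -
  obtain K where K: "K > 0" "\<And>\<tau>. \<tau> \<in> {s-r..s+r} \<Longrightarrow> norm (modulus \<tau> s) \<le> K"
    using continuous_bounded_on_interval[OF modulus_continuous] by blast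
  have "modulus \<tau> s \<le> K" if "\<bar>\<tau> - s\<bar> \<le> r" for \<tau>
    using K(2)[of \<tau>] that by (auto simp: abs_le_iff)
  then show ?thesis using that[of K] K(1) by auto
qed

text \<open>Testing the increment D with the squared cutoff times D produces the squared L^2 norm of
  the truncated D, while the equation bounds the same pairing linearly in that norm. The bound is
  uniform in the cutoff, and monotone convergence removes the cutoff.\<close>

lemma increment_sqi [simp]: "sq_integrable (\<lambda>x. u t x - u s x)"
proof -
  define D where "D x = u t x - u s x" for x
  define D' where "D' x = ux t x - ux s x" for x
  have D: "has_ac_deriv D D'" unfolding D_def D'_def by (rule increment_ac)
  have sD': "sq_integrable D'" unfolding D'_def by simp
  obtain K where K: "0 \<le> K" "\<And>\<tau>. \<bar>\<tau> - s\<bar> \<le> \<bar>t - s\<bar> \<Longrightarrow> modulus \<tau> s \<le> K"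
    using modulus_locally_bounded by blast
  define M where "M = \<bar>t - s\<bar> * (K + Lnorm s)"
  have M0: "0 \<le> M" using K Lnorm_nonneg by (simp add: M_def)
  define Bd where "Bd = sup_bound (u t) + sup_bound (u s)"
  have Bd: "cmod (D x) \<le> Bd" "0 \<le> Bd" for x
    using energy_space_diff_bounded[OF energy energy, of t x s] norm_ge_zero order_trans
    unfolding Bd_def D_def by blast+
  note [measurable] = ac_borel_fun[OF D] ac_borel[OF D] borel_measurable_continuous_onI[OF cutoff_continuous]
    borel_measurable_continuous_onI[OF cutoff_deriv_continuous]
  \<comment> \<open>Large enough that X^2 \<le> M (5 X + N), with N the norm of D', rules out X > B.
    The 5 is 1 from \<phi> plus 4 from the derivative of the squared cutoff.\<close>
  define B where "B = 5 * M + M * l2norm D' + 1"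
  have X: "sq_integrable (\<lambda>x. of_real (cutoff n x) * D x)" "l2norm (\<lambda>x. of_real (cutoff n x) * D x) \<le> B" for n
  proof -
    let ?cD = "\<lambda>x. of_real (cutoff n x) * D x"
    have m: "?cD \<in> borel_measurable borel" by measurable
    have cl: "cmod (?cD x) \<le> Bd" for x
    proof -
      have "cmod (?cD x) = cutoff n x * cmod (D x)" using cutoff_range by (simp add: norm_mult)
      also have "\<dots> \<le> 1 * Bd" using cutoff_range Bd by (intro mult_mono) auto
      finally show ?thesis by simp
    qed
    show s: "sq_integrable ?cD"
      by (rule l2norm_support(1)[OF m, of "real n + 1" Bd]) (use cutoff_outside cl Bd in auto)
    define \<phi> where "\<phi> x = of_real ((cutoff n x)\<^sup>2) * D x" for x
    define \<phi>' where "\<phi>' x = of_real (cutoff_deriv n x) * D x + of_real ((cutoff n x)\<^sup>2) * D' x" for x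
    have \<phi>: "has_ac_deriv \<phi> \<phi>'" unfolding \<phi>_def \<phi>'_def by (rule cutoff_mult_ac[OF D])
    have m1: "\<phi> \<in> borel_measurable borel" unfolding \<phi>_def by measurable
    have \<phi>1: "sq_integrable \<phi>" "l2norm \<phi> \<le> l2norm ?cD"
    proof -
      have "cmod (\<phi> x) \<le> norm (?cD x)" for x
      proof -
        have "cmod (\<phi> x) = cutoff n x * cmod (?cD x)"
          using cutoff_range by (simp add: \<phi>_def norm_mult power2_eq_square)
        also have "\<dots> \<le> 1 * cmod (?cD x)" using cutoff_range by (intro mult_right_mono) auto
        finally show ?thesis by simp
      qed
      then show "sq_integrable \<phi>" "l2norm \<phi> \<le> l2norm ?cD" using sqi_mono[OF s m1] by auto
    qed
    have a: "sq_integrable (\<lambda>x. of_real (cutoff_deriv n x) * D x)" "l2norm (\<lambda>x. of_real (cutoff_deriv n x) * D x) \<le> 4 * l2norm ?cD"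
    proof -
      have ma: "(\<lambda>x. of_real (cutoff_deriv n x) * D x) \<in> borel_measurable borel" by measurable
      have le: "cmod (of_real (cutoff_deriv n x) * D x) \<le> 4 * norm (?cD x)" for x
      proof -
        have "\<bar>cutoff_deriv n x\<bar> \<le> 4 / (real n + 1) * cutoff n x" by (rule cutoff_deriv_bound)
        also have "\<dots> \<le> 4 * cutoff n x" using cutoff_range by (intro mult_right_mono) (auto simp: field_simps)
        finally have "\<bar>cutoff_deriv n x\<bar> * cmod (D x) \<le> 4 * cutoff n x * cmod (D x)" by (intro mult_right_mono) auto
        then show ?thesis using cutoff_range by (simp add: norm_mult)
      qed
      show "sq_integrable (\<lambda>x. of_real (cutoff_deriv n x) * D x)" "l2norm (\<lambda>x. of_real (cutoff_deriv n x) * D x) \<le> 4 * l2norm ?cD"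
        using sqi_dominated[OF s ma le] by auto
    qed
    have b: "sq_integrable (\<lambda>x. of_real ((cutoff n x)\<^sup>2) * D' x)" "l2norm (\<lambda>x. of_real ((cutoff n x)\<^sup>2) * D' x) \<le> 1 * l2norm D'"
    proof -
      have "norm (complex_of_real ((cutoff n x)\<^sup>2)) \<le> 1" for x
        using cutoff_range[of n x] by (simp add: power_le_one norm_power)
      moreover have "(\<lambda>x. complex_of_real ((cutoff n x)\<^sup>2)) \<in> borel_measurable borel" by measurable
      ultimately show "sq_integrable (\<lambda>x. of_real ((cutoff n x)\<^sup>2) * D' x)"
        "l2norm (\<lambda>x. of_real ((cutoff n x)\<^sup>2) * D' x) \<le> 1 * l2norm D'"
        using sqi_mult_bounded[OF sD'] by blast+
    qed
    have \<phi>2: "sq_integrable \<phi>'" "l2norm \<phi>' \<le> 4 * l2norm ?cD + l2norm D'"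
      unfolding \<phi>'_def using sqi_add[OF a(1) b(1)] a(2) b(2) by auto
    have z: "\<phi> x = 0" "\<phi>' x = 0" if "\<bar>x\<bar> \<ge> real n + 1" for x
      using cutoff_outside[OF that] cutoff_deriv_outside[OF that] by (auto simp: \<phi>_def \<phi>'_def)
    have c1: "cmod (pairing (\<lambda>x. \<i> * D x) \<phi> - of_real (t - s) * L s \<phi> \<phi>') \<le> \<bar>t - s\<bar> * K * (l2norm \<phi> + l2norm \<phi>')"
      unfolding D_def by (rule increment_compact[OF \<phi> \<phi>2(1) z(1) z(2) _ K(2), of "real n + 1"]) auto
    have c2: "cmod (of_real (t - s) * L s \<phi> \<phi>') \<le> \<bar>t - s\<bar> * Lnorm s * (l2norm \<phi> + l2norm \<phi>')"
      unfolding norm_mult norm_of_real mult.assoc by (intro mult_left_mono L_bound \<phi>1 \<phi>2 \<phi>) auto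
    have c3: "cmod (pairing (\<lambda>x. \<i> * D x) \<phi>) \<le> M * (l2norm \<phi> + l2norm \<phi>')"
      using norm_triangle_sub[of "pairing (\<lambda>x. \<i> * D x) \<phi>" "of_real (t - s) * L s \<phi> \<phi>'"] c1 c2
      by (simp add: M_def algebra_simps)
    have "pairing (\<lambda>x. \<i> * D x) \<phi> = (LINT x|lborel. - \<i> * of_real ((norm (?cD x))\<^sup>2))"
      unfolding pairing_def
    proof (rule Bochner_Integration.integral_cong)
      fix x
      have "cnj (\<i> * D x) * \<phi> x = - \<i> * (of_real ((cutoff n x)\<^sup>2) * (D x * cnj (D x)))" by (simp add: \<phi>_def mult_ac)
      also have "D x * cnj (D x) = of_real ((cmod (D x))\<^sup>2)" using complex_norm_square[of "D x"] by simp
      finally show "cnj (\<i> * D x) * \<phi> x = - \<i> * of_real ((norm (?cD x))\<^sup>2)" by (simp add: norm_mult power_mult_distrib)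
    qed simp
    also have "\<dots> = - \<i> * of_real ((l2norm ?cD)\<^sup>2)" by (simp only: l2norm_power2 integral_mult_right_zero integral_complex_of_real)
    finally have "(l2norm ?cD)\<^sup>2 \<le> M * (l2norm \<phi> + l2norm \<phi>')" using c3 by (simp add: norm_mult norm_power)
    also have "\<dots> \<le> M * (5 * l2norm ?cD + l2norm D')" using \<phi>1(2) \<phi>2(2) M0 by (intro mult_left_mono) auto
    finally have q: "(l2norm ?cD)\<^sup>2 \<le> M * (5 * l2norm ?cD + l2norm D')" .
    show "l2norm ?cD \<le> B"
    proof (rule ccontr)
      assume n: "\<not> l2norm ?cD \<le> B"
      have B1: "B \<ge> 1" using M0 by (simp add: B_def)
      have "B * l2norm ?cD \<le> l2norm ?cD * l2norm ?cD" using n by (intro mult_right_mono) auto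
      moreover have "B * l2norm ?cD = 5 * M * l2norm ?cD + M * l2norm D' * l2norm ?cD + l2norm ?cD" by (simp add: B_def algebra_simps)
      moreover have "M * l2norm D' * 1 \<le> M * l2norm D' * l2norm ?cD" using n B1 M0 by (intro mult_left_mono) auto
      ultimately show False using q n B1 by (simp add: power2_eq_square algebra_simps)
    qed
  qed
  define a where "a n = (LINT x|lborel. (norm (of_real (cutoff n x) * D x))\<^sup>2)" for n
  have ae: "a n = (l2norm (\<lambda>x. of_real (cutoff n x) * D x))\<^sup>2" for n by (simp add: a_def l2norm_power2)
  have mono: "(norm (of_real (cutoff m x) * D x))\<^sup>2 \<le> (norm (of_real (cutoff n x) * D x))\<^sup>2" if "m \<le> n" for m n x
    using cutoff_mono[OF that, of x] cutoff_range[of m x] cutoff_range[of n x]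
    by (intro power_mono) (auto simp: norm_mult intro!: mult_right_mono)
  have inc: "incseq a"
    unfolding incseq_def a_def
    by (intro allI impI integral_mono) (use X(1) mono in \<open>auto simp: sq_integrable_def\<close>)
  have bd: "a n \<le> B\<^sup>2" for n unfolding ae using X(2) by (intro power_mono) auto
  obtain l where l: "a \<longlonglongrightarrow> l" using incseq_convergent[OF inc] bd by blast
  have "integrable lborel (\<lambda>x. (norm (D x))\<^sup>2)"
  proof (rule integral_monotone_convergence_nonneg(1)[where f="\<lambda>n x. (norm (of_real (cutoff n x) * D x))\<^sup>2"])
    show "(\<lambda>n. LINT x|lborel. (norm (of_real (cutoff n x) * D x))\<^sup>2) \<longlonglongrightarrow> l" using l by (simp add: a_def[abs_def])
    show "AE x in lborel. (\<lambda>n. (norm (of_real (cutoff n x) * D x))\<^sup>2) \<longlonglongrightarrow> (norm (D x))\<^sup>2"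
    proof (rule AE_I2)
      fix x
      have "(\<lambda>n. (norm (of_real (cutoff n x) * D x))\<^sup>2) \<longlonglongrightarrow> (norm (of_real 1 * D x))\<^sup>2"
        by (intro tendsto_intros cutoff_tendsto)
      then show "(\<lambda>n. (norm (of_real (cutoff n x) * D x))\<^sup>2) \<longlonglongrightarrow> (norm (D x))\<^sup>2" by simp
    qed
    show "AE x in lborel. mono (\<lambda>n. (norm (of_real (cutoff n x) * D x))\<^sup>2)"
      by (intro AE_I2 monoI mono)
  qed (use X(1) in \<open>auto simp: sq_integrable_def\<close>)
  then show ?thesis unfolding sq_integrable_def D_def[symmetric] by simp
qed

text \<open>Now that the increment is square integrable, the pairing is continuous for the H^1 norm
  as well, and the truncations of \<phi> converge to \<phi> in that norm.\<close>

lemma increment_H1: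
  assumes \<phi>: "has_ac_deriv \<phi> \<phi>'" "sq_integrable \<phi>" "sq_integrable \<phi>'"
    and K: "\<And>\<tau>. \<bar>\<tau> - s\<bar> \<le> \<bar>t - s\<bar> \<Longrightarrow> modulus \<tau> s \<le> K"
  shows "cmod (pairing (\<lambda>x. \<i> * (u t x - u s x)) \<phi> - of_real (t - s) * L s \<phi> \<phi>') \<le> \<bar>t - s\<bar> * K * (l2norm \<phi> + l2norm \<phi>')"
proof -
  let ?B = "\<lambda>\<phi> \<phi>'. pairing (\<lambda>x. \<i> * (u t x - u s x)) \<phi> - of_real (t - s) * L s \<phi> \<phi>'"
  let ?D = "\<lambda>x. \<i> * (u t x - u s x)"
  have sD: "sq_integrable ?D" by (rule sqi_scale(1)) simp
  have K0: "0 \<le> K" using K[of s] by simp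
  note [measurable] = sqi_borel[OF \<phi>(2)] sqi_borel[OF \<phi>(3)] borel_measurable_continuous_onI[OF cutoff_continuous]
    borel_measurable_continuous_onI[OF cutoff_deriv_continuous]
  define \<phi>n where "\<phi>n n x = of_real ((cutoff n x)\<^sup>2) * \<phi> x" for n x
  define \<phi>n' where "\<phi>n' n x = of_real (cutoff_deriv n x) * \<phi> x + of_real ((cutoff n x)\<^sup>2) * \<phi>' x" for n x
  define \<psi> where "\<psi> n x = \<phi> x - \<phi>n n x" for n x
  define \<psi>' where "\<psi>' n x = \<phi>' x - \<phi>n' n x" for n x
  define e where "e n = l2norm (\<psi> n) + l2norm (\<psi>' n)" for n
  have acn: "has_ac_deriv (\<phi>n n) (\<phi>n' n)" for n unfolding \<phi>n_def \<phi>n'_def by (rule cutoff_mult_ac[OF \<phi>(1)])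
  have c01: "norm (complex_of_real (1 - (cutoff n x)\<^sup>2)) \<le> 1" for n x
    unfolding norm_of_real using cutoff_range[of n x] by (simp add: abs_le_iff power_le_one)
  have cd: "norm (complex_of_real (cutoff_deriv n x)) \<le> 4 / (real n + 1)" for n x
  proof -
    have "4 / (real n + 1) * cutoff n x \<le> 4 / (real n + 1) * 1" using cutoff_range by (intro mult_left_mono) auto
    then show ?thesis using cutoff_deriv_bound[of n x] by simp
  qed
  have A1: "sq_integrable (\<lambda>x. of_real (1 - (cutoff n x)\<^sup>2) * f x)"
    "(\<lambda>n. l2norm (\<lambda>x. of_real (1 - (cutoff n x)\<^sup>2) * f x)) \<longlonglongrightarrow> 0" if f: "sq_integrable f" for f :: "real \<Rightarrow> complex" and n
  proof -
    note [measurable] = sqi_borel[OF f]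
    show "sq_integrable (\<lambda>x. of_real (1 - (cutoff n x)\<^sup>2) * f x)" by (rule sqi_mult_bounded(1)[OF f _ c01]) measurable
    show "(\<lambda>n. l2norm (\<lambda>x. of_real (1 - (cutoff n x)\<^sup>2) * f x)) \<longlonglongrightarrow> 0"
    proof (rule l2norm_dominated_convergence[OF _ _ _ f])
      show "AE x in lborel. (\<lambda>n. of_real (1 - (cutoff n x)\<^sup>2) * f x) \<longlonglongrightarrow> 0"
      proof (rule AE_I2)
        fix x
        have "(\<lambda>n. of_real (1 - (cutoff n x)\<^sup>2) * f x) \<longlonglongrightarrow> of_real (1 - 1\<^sup>2) * f x"
          by (intro tendsto_intros cutoff_tendsto)
        then show "(\<lambda>n. of_real (1 - (cutoff n x)\<^sup>2) * f x) \<longlonglongrightarrow> 0" by simp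
      qed
      show "norm (of_real (1 - (cutoff n x)\<^sup>2) * f x) \<le> norm (f x)" for n x
        using mult_right_mono[OF c01, of "norm (f x)" n x] by (simp only: norm_mult norm_ge_zero mult_1)
    qed measurable
  qed
  have A2: "sq_integrable (\<lambda>x. of_real (cutoff_deriv n x) * \<phi> x)" "l2norm (\<lambda>x. of_real (cutoff_deriv n x) * \<phi> x) \<le> 4 / (real n + 1) * l2norm \<phi>" for n
    by (rule sqi_mult_bounded[OF \<phi>(2) _ cd], measurable)+
  have \<psi>e: "\<psi> n = (\<lambda>x. of_real (1 - (cutoff n x)\<^sup>2) * \<phi> x)"
    "\<psi>' n = (\<lambda>x. of_real (1 - (cutoff n x)\<^sup>2) * \<phi>' x - of_real (cutoff_deriv n x) * \<phi> x)" for n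
    by (auto simp: \<psi>_def \<psi>'_def \<phi>n_def \<phi>n'_def fun_eq_iff algebra_simps)
  have s\<psi>: "sq_integrable (\<psi> n)" "sq_integrable (\<psi>' n)" for n
    unfolding \<psi>e by (rule A1(1)[OF \<phi>(2)], rule sqi_diff(1)[OF A1(1)[OF \<phi>(3)] A2(1)])
  have s\<phi>n: "sq_integrable (\<phi>n n)" "sq_integrable (\<phi>n' n)" for n
    using sqi_diff(1)[OF \<phi>(2) s\<psi>(1)[of n]] sqi_diff(1)[OF \<phi>(3) s\<psi>(2)[of n]] by (auto simp: \<psi>_def \<psi>'_def)
  have e0: "e \<longlonglongrightarrow> 0"
  proof (rule tendsto_sandwich[OF _ _ tendsto_const])
    show "\<forall>\<^sub>F n in sequentially. 0 \<le> e n" by (simp add: e_def)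
    show "\<forall>\<^sub>F n in sequentially. e n \<le> l2norm (\<lambda>x. of_real (1 - (cutoff n x)\<^sup>2) * \<phi> x) +
       (l2norm (\<lambda>x. of_real (1 - (cutoff n x)\<^sup>2) * \<phi>' x) + 4 * inverse (real (Suc n)) * l2norm \<phi>)"
    proof (rule always_eventually, rule allI)
      fix n
      have "l2norm (\<psi>' n) \<le> l2norm (\<lambda>x. of_real (1 - (cutoff n x)\<^sup>2) * \<phi>' x) + l2norm (\<lambda>x. of_real (cutoff_deriv n x) * \<phi> x)"
        unfolding \<psi>e by (rule sqi_diff(2)[OF A1(1)[OF \<phi>(3)] A2(1)])
      then show "e n \<le> l2norm (\<lambda>x. of_real (1 - (cutoff n x)\<^sup>2) * \<phi> x) +
       (l2norm (\<lambda>x. of_real (1 - (cutoff n x)\<^sup>2) * \<phi>' x) + 4 * inverse (real (Suc n)) * l2norm \<phi>)"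
        unfolding e_def \<psi>e(1) using A2(2)[of n] by (simp add: divide_inverse add.commute)
    qed
    have "(\<lambda>n. l2norm (\<lambda>x. of_real (1 - (cutoff n x)\<^sup>2) * \<phi> x) +
       (l2norm (\<lambda>x. of_real (1 - (cutoff n x)\<^sup>2) * \<phi>' x) + 4 * inverse (real (Suc n)) * l2norm \<phi>)) \<longlonglongrightarrow> 0 + (0 + 4 * 0 * l2norm \<phi>)"
      by (intro tendsto_add tendsto_mult tendsto_const A1(2) \<phi> LIMSEQ_inverse_real_of_nat)
    then show "(\<lambda>n. l2norm (\<lambda>x. of_real (1 - (cutoff n x)\<^sup>2) * \<phi> x) +
       (l2norm (\<lambda>x. of_real (1 - (cutoff n x)\<^sup>2) * \<phi>' x) + 4 * inverse (real (Suc n)) * l2norm \<phi>)) \<longlonglongrightarrow> 0" by simp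
  qed
  define M where "M = \<bar>t - s\<bar> * K + l2norm ?D + \<bar>t - s\<bar> * Lnorm s"
  have "cmod (?B \<phi> \<phi>') \<le> \<bar>t - s\<bar> * K * (l2norm \<phi> + l2norm \<phi>') + M * e n" for n
  proof -
    have \<psi>ac: "has_ac_deriv (\<psi> n) (\<psi>' n)" unfolding \<psi>_def[abs_def] \<psi>'_def[abs_def] by (rule ac_diff[OF \<phi>(1) acn])
    have z: "\<phi>n n x = 0" "\<phi>n' n x = 0" if "\<bar>x\<bar> \<ge> real n + 1" for x
      using cutoff_outside[OF that] cutoff_deriv_outside[OF that] by (auto simp: \<phi>n_def \<phi>n'_def)
    have b1: "cmod (?B (\<phi>n n) (\<phi>n' n)) \<le> \<bar>t - s\<bar> * K * (l2norm (\<phi>n n) + l2norm (\<phi>n' n))"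
      by (rule increment_compact[OF acn s\<phi>n(2) z(1) z(2) _ K, of "real n + 1"]) auto
    have N: "l2norm (\<phi>n n) + l2norm (\<phi>n' n) \<le> l2norm \<phi> + l2norm \<phi>' + e n"
      using sqi_diff(2)[OF \<phi>(2) s\<psi>(1)[of n]] sqi_diff(2)[OF \<phi>(3) s\<psi>(2)[of n]] by (simp add: \<psi>_def \<psi>'_def e_def)
    have b1': "cmod (?B (\<phi>n n) (\<phi>n' n)) \<le> \<bar>t - s\<bar> * K * (l2norm \<phi> + l2norm \<phi>' + e n)"
      by (rule order_trans[OF b1]) (intro mult_left_mono N mult_nonneg_nonneg K0, auto)
    have b2: "cmod (pairing ?D (\<psi> n)) \<le> l2norm ?D * e n"
      by (rule order_trans[OF pairing_bound[OF sD s\<psi>(1)]]) (intro mult_left_mono, auto simp: e_def)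
    have b3: "cmod (of_real (t - s) * L s (\<psi> n) (\<psi>' n)) \<le> \<bar>t - s\<bar> * Lnorm s * e n"
      unfolding norm_mult norm_of_real mult.assoc e_def by (intro mult_left_mono L_bound s\<psi> \<psi>ac) auto
    have pe: "pairing ?D (\<psi> n) = pairing ?D \<phi> - pairing ?D (\<phi>n n)"
      unfolding \<psi>_def[abs_def] by (rule pairing_diff_right[OF sD \<phi>(2) s\<phi>n(1)])
    have Le: "L s (\<psi> n) (\<psi>' n) = L s \<phi> \<phi>' - L s (\<phi>n n) (\<phi>n' n)"
      unfolding \<psi>_def[abs_def] \<psi>'_def[abs_def] by (rule L_diff_right[OF \<phi>(2,3) s\<phi>n])
    have Be: "?B \<phi> \<phi>' = ?B (\<phi>n n) (\<phi>n' n) + (pairing ?D (\<psi> n) - of_real (t - s) * L s (\<psi> n) (\<psi>' n))"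
      unfolding pe Le by (simp add: algebra_simps)
    have "cmod (?B \<phi> \<phi>') \<le> cmod (?B (\<phi>n n) (\<phi>n' n)) + (cmod (pairing ?D (\<psi> n)) + cmod (of_real (t - s) * L s (\<psi> n) (\<psi>' n)))"
      unfolding Be by (intro norm_triangle_mono order_refl norm_triangle_ineq4)
    then show ?thesis using b1' b2 b3 by (simp add: M_def algebra_simps)
  qed
  moreover have "(\<lambda>n. \<bar>t - s\<bar> * K * (l2norm \<phi> + l2norm \<phi>') + M * e n) \<longlonglongrightarrow> \<bar>t - s\<bar> * K * (l2norm \<phi> + l2norm \<phi>') + M * 0"
    by (intro tendsto_intros e0)
  ultimately show ?thesis using LIMSEQ_le_const by fastforce
qed

end

section \<open>The energy in hydrodynamic variables and its conservation\<close>

definition mass :: "(real \<Rightarrow> complex) \<Rightarrow> real \<Rightarrow> real" where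
  "mass u x = (cmod (u x))\<^sup>2"

definition current :: "(real \<Rightarrow> complex) \<Rightarrow> real \<Rightarrow> real" where
  "current u x = Im (cnj (u x) * weak_deriv u x)"

text \<open>For \<^term>\<open>u = \<rho> * exp (\<i> * \<theta>)\<close> the density below is \<open>(\<rho>\<^sup>2 - 1) \<theta>'\<close>, the renormalized momentum density.\<close>

definition momentum :: "(real \<Rightarrow> complex) \<Rightarrow> real" where
  "momentum u = (LINT x|lborel. (1 - 1 / mass u x) * current u x)"

definition energy_fn :: "real \<Rightarrow> real \<Rightarrow> (real \<Rightarrow> complex) \<Rightarrow> real" where
  "energy_fn \<gamma> v u = (l2norm (weak_deriv u))\<^sup>2 / 2 + (l2norm (\<lambda>x. 1 - mass u x))\<^sup>2 / 4
     + \<gamma> / 2 * mass u 0 - v / 2 * momentum u"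

lemma energy_space_sqi_1_mass: "u \<in> energy_space \<Longrightarrow> sq_integrable (\<lambda>x. 1 - mass u x)"
  using energy_space_sqi_mass by (simp add: mass_def)

lemma mass_borel: "u \<in> energy_space \<Longrightarrow> mass u \<in> borel_measurable borel"
  unfolding mass_def[abs_def] using energy_space_borel by measurable

lemma current_borel: "u \<in> energy_space \<Longrightarrow> current u \<in> borel_measurable borel"
proof -
  assume u: "u \<in> energy_space"
  have "(\<lambda>x. cnj (u x) * weak_deriv u x) \<in> borel_measurable borel"
    by (intro borel_measurable_times cnj_borel energy_space_borel u sqi_borel energy_space_sqi_deriv)
  then show ?thesis unfolding current_def[abs_def] by measurable
qed

lemma current_sqi:
  assumes u: "u \<in> energy_space"
  shows "sq_integrable (current u)" "l2norm (current u) \<le> sup_bound u * l2norm (weak_deriv u)"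
proof -
  have le: "norm (current u x) \<le> sup_bound u * norm (weak_deriv u x)" for x
  proof -
    have "norm (current u x) \<le> cmod (u x) * cmod (weak_deriv u x)"
      unfolding current_def using abs_Im_le_cmod[of "cnj (u x) * weak_deriv u x"] by (simp add: norm_mult)
    also have "\<dots> \<le> sup_bound u * norm (weak_deriv u x)"
      by (intro mult_right_mono energy_space_bounded u) simp
    finally show ?thesis .
  qed
  show "sq_integrable (current u)" "l2norm (current u) \<le> sup_bound u * l2norm (weak_deriv u)"
    using sqi_dominated[OF energy_space_sqi_deriv[OF u] current_borel[OF u] le] sup_bound_pos[of u] by auto
qed

lemma momentum_integrable:
  assumes u: "u \<in> energy_space" and c: "c > 0" "\<And>x. c \<le> mass u x"
  shows "integrable lborel (\<lambda>x. (1 - 1 / mass u x) * current u x)"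
proof -
  have m: "(\<lambda>x. 1 - 1 / mass u x) \<in> borel_measurable borel" using mass_borel[OF u] by measurable
  have le: "norm (1 - 1 / mass u x) \<le> 1 / c * norm (1 - mass u x)" for x
  proof -
    have p: "mass u x > 0" using c(1) c(2)[of x] by linarith
    have "norm (1 - 1 / mass u x) = norm (1 - mass u x) * (1 / mass u x)"
      using p by (simp add: field_simps abs_divide abs_minus_commute)
    also have "\<dots> \<le> norm (1 - mass u x) * (1 / c)"
      using c p by (intro mult_left_mono divide_left_mono) auto
    finally show ?thesis by (simp add: mult.commute)
  qed
  have "sq_integrable (\<lambda>x. 1 - 1 / mass u x)"
    by (rule sqi_dominated(1)[OF energy_space_sqi_1_mass[OF u] m le])
  then show ?thesis using current_sqi(1)[OF u] by (rule sqi_mult(1))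
qed

lemma pairing_self: "pairing f f = of_real ((l2norm f)\<^sup>2)"
proof -
  have "cnj (f x) * f x = of_real ((cmod (f x))\<^sup>2)" for x
    using complex_norm_square[of "f x"] by (simp add: mult.commute)
  then show ?thesis unfolding pairing_def l2norm_power2 by (simp only: integral_complex_of_real)
qed

lemma pairing_cnj: "cnj (pairing f g) = pairing g f"
proof -
  have "cnj (pairing f g) = (LINT x|lborel. cnj (cnj (f x) * g x))"
    unfolding pairing_def by (simp only: Bochner_Integration.integral_cnj)
  then show ?thesis by (simp add: pairing_def mult.commute)
qed

lemma l2norm_power2_diff:
  assumes "sq_integrable f" "sq_integrable g"
  shows "(l2norm f)\<^sup>2 - (l2norm g)\<^sup>2 = Re (pairing f (\<lambda>x. f x - g x) + pairing g (\<lambda>x. f x - g x))"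
proof -
  have "Re (pairing g f) = Re (pairing f g)" using pairing_cnj[of f g] by (metis complex_cnj(1) cnj.sel(1))
  then show ?thesis
    unfolding pairing_diff_right[OF assms(1) assms] pairing_diff_right[OF assms(2) assms] pairing_self by simp
qed

text \<open>With y = cnj w * u, the difference of the two momentum densities differs from the
  bilinear expression by the derivative of Im (y - Ln y). This primitive is square integrable, so
  the derivative integrates to 0 and the formula holds without remainder.\<close>

lemma momentum_diff:
  assumes u: "u \<in> energy_space" and w: "w \<in> energy_space" and D: "sq_integrable (\<lambda>x. u x - w x)"
    and c: "c > 0" "\<And>x. c \<le> mass u x" "\<And>x. c \<le> mass w x" and small: "\<And>x. cmod (u x - w x) \<le> sqrt c / 2"
  shows "momentum u - momentum w = Im (pairing (\<lambda>x. u x - w x) (weak_deriv u) + pairing (\<lambda>x. u x - w x) (weak_deriv w))"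
proof -
  let ?ux = "weak_deriv u" and ?wx = "weak_deriv w"
  define y where "y x = cnj (w x) * u x" for x
  define y' where "y' x = cnj (?wx x) * u x + cnj (w x) * ?ux x" for x
  have y: "has_ac_deriv y y'"
    unfolding y_def y'_def
    by (rule ac_mult[OF ac_bounded_linear[OF energy_space_ac[OF w] bounded_linear_cnj] energy_space_ac[OF u]])
  have sc: "sqrt c \<le> cmod (w x)" for x
    by (rule real_le_lsqrt[THEN order_trans]) (use c(3)[of x] c(1) in \<open>auto simp: mass_def\<close>)
  \<comment> \<open>Smallness of u - w compared with |w| keeps y in the right half-plane, which is
    convex and on which the principal logarithm is holomorphic.\<close>
  have Rey: "Re (y x) \<ge> c / 2" for x
  proof -
    have "y x = of_real ((cmod (w x))\<^sup>2) + cnj (w x) * (u x - w x)"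
      using complex_norm_square[of "w x"] by (simp add: y_def algebra_simps)
    then have "Re (y x) \<ge> (cmod (w x))\<^sup>2 - cmod (w x) * cmod (u x - w x)"
      using complex_Re_le_cmod[of "- (cnj (w x) * (u x - w x))"] by (simp add: norm_mult)
    moreover have "cmod (w x) * cmod (u x - w x) \<le> cmod (w x) * (cmod (w x) / 2)"
      using small[of x] sc[of x] by (intro mult_left_mono) auto
    moreover have "c \<le> (cmod (w x))\<^sup>2" using c(3)[of x] by (simp add: mass_def)
    ultimately show ?thesis by (simp add: power2_eq_square)
  qed
  define U where "U = {z. Re z > 0}"
  have yU: "y x \<in> U" for x using Rey[of x] c(1) by (simp add: U_def)
  have h0: "has_ac_deriv (\<lambda>x. y x - Ln (y x)) (\<lambda>x. (1 - inverse (y x)) * y' x)"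
  proof (rule ac_compose[OF y, where U=U and \<Phi>="\<lambda>z. z - Ln z" and \<Phi>'="\<lambda>z. 1 - inverse z"])
    show "open U" unfolding U_def by (rule open_halfspace_Re_gt)
    show "convex U" unfolding U_def by (rule convex_halfspace_Re_gt)
    show "y x \<in> U" for x by (rule yU)
    show "((\<lambda>z. z - Ln z) has_field_derivative 1 - inverse z) (at z)" if "z \<in> U" for z
      using that by (intro DERIV_diff DERIV_ident has_field_derivative_Ln) (auto simp: U_def complex_nonpos_Reals_iff)
    show "continuous_on U (\<lambda>z. 1 - inverse z)" by (intro continuous_intros) (auto simp: U_def)
  qed
  define h where "h x = Im (y x - Ln (y x))" for x
  define h' where "h' x = Im ((1 - inverse (y x)) * y' x)" for x
  have h: "has_ac_deriv h h'" unfolding h_def h'_def by (rule ac_bounded_linear[OF h0 bounded_linear_Im])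
  define K where "K = sup_bound w * (1 + 2 / c)"
  \<comment> \<open>Im y = Im (cnj w * (u - w)), and the argument of y is at most |Im y| / Re y, so
    h inherits square integrability from u - w.\<close>
  have hb: "norm (h x) \<le> K * norm (u x - w x)" for x
  proof -
    have "Im (y x) = Im (cnj (w x) * (u x - w x))"
      by (simp add: y_def algebra_simps)
    then have iy: "\<bar>Im (y x)\<bar> \<le> sup_bound w * cmod (u x - w x)"
      using abs_Im_le_cmod[of "cnj (w x) * (u x - w x)"] mult_right_mono[OF energy_space_bounded[OF w, of x], of "cmod (u x - w x)"]
      by (simp add: norm_mult)
    have Rp: "Re (y x) > 0" using yU[of x] by (simp add: U_def)
    then have "Im (Ln (y x)) = arctan (Im (y x) / Re (y x))" using Im_Ln_eq[of "y x"] by fastforce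
    then have "\<bar>Im (Ln (y x))\<bar> \<le> \<bar>Im (y x)\<bar> / Re (y x)" using abs_arctan_le[of "Im (y x) / Re (y x)"] Rp by (simp add: abs_divide)
    also have "\<dots> \<le> \<bar>Im (y x)\<bar> / (c / 2)" using Rey[of x] c(1) by (intro divide_left_mono) auto
    finally have "\<bar>Im (Ln (y x))\<bar> \<le> 2 / c * \<bar>Im (y x)\<bar>" by (simp add: mult.commute)
    then have "norm (h x) \<le> (1 + 2 / c) * \<bar>Im (y x)\<bar>" by (simp add: h_def algebra_simps)
    also have "\<dots> \<le> (1 + 2 / c) * (sup_bound w * cmod (u x - w x))" using iy c(1) by (intro mult_left_mono) auto
    finally show ?thesis by (simp add: K_def mult_ac)
  qed
  have hs: "sq_integrable h" by (rule sqi_dominated(1)[OF D ac_borel_fun[OF h] hb])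
  let ?P = "\<lambda>u x. (1 - 1 / mass u x) * current u x"
  have iP: "integrable lborel (?P u)" "integrable lborel (?P w)"
    using momentum_integrable[OF u c(1,2)] momentum_integrable[OF w c(1,3)] by auto
  have iD: "integrable lborel (\<lambda>x. cnj (u x - w x) * ?ux x)" "integrable lborel (\<lambda>x. cnj (u x - w x) * ?wx x)"
    using pairing_integrable[OF D energy_space_sqi_deriv[OF u]] pairing_integrable[OF D energy_space_sqi_deriv[OF w]] by auto
  have h'e: "h' x = ?P u x - ?P w x - (Im (cnj (u x - w x) * ?ux x) + Im (cnj (u x - w x) * ?wx x))" for x
  proof -
    have ux0: "u x \<noteq> 0" "w x \<noteq> 0" using c(1) c(2)[of x] c(3)[of x] by (auto simp: mass_def)
    \<comment> \<open>The logarithmic derivative of y; its imaginary part is the difference of the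
      phase gradients current / mass.\<close>
    have A: "inverse (y x) * y' x = cnj (?wx x / w x) + ?ux x / u x"
      using ux0 by (simp add: y_def y'_def field_simps)
    have B: "Im (?ux x / u x) = current u x / mass u x" "Im (?wx x / w x) = current w x / mass w x"
      unfolding complex_div_cnj[of "?ux x"] complex_div_cnj[of "?wx x"]
      using ux0 by (simp_all add: current_def mass_def mult.commute)
    have C: "Im (y' x) = current u x - current w x - (Im (cnj (u x - w x) * ?ux x) + Im (cnj (u x - w x) * ?wx x))"
      by (simp add: y'_def current_def algebra_simps)
    have "h' x = Im (y' x) - Im (inverse (y x) * y' x)" by (simp add: h'_def left_diff_distrib)
    also have "Im (inverse (y x) * y' x) = current u x / mass u x - current w x / mass w x"
      unfolding A using B by (simp del: complex_cnj_divide)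
    finally show ?thesis unfolding C by (simp add: left_diff_distrib)
  qed
  have ih: "integrable lborel h'" unfolding h'e[abs_def] using iP iD by (intro Bochner_Integration.integrable_diff Bochner_Integration.integrable_add integrable_Im)
  have "(LINT x|lborel. h' x) = 0" by (rule ac_integral_line(1)[OF h ih]) (use hs in \<open>simp add: sq_integrable_def\<close>)
  moreover have "(LINT x|lborel. h' x) = momentum u - momentum w - (Im (pairing (\<lambda>x. u x - w x) ?ux) + Im (pairing (\<lambda>x. u x - w x) ?wx))"
    unfolding h'e momentum_def pairing_def
    by (simp only: Bochner_Integration.integral_diff Bochner_Integration.integral_add
        Bochner_Integration.integrable_diff Bochner_Integration.integrable_add iP
        integrable_Im[OF iD(1)] integrable_Im[OF iD(2)] integral_Im[OF iD(1)] integral_Im[OF iD(2)])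
  ultimately show ?thesis by simp
qed

text \<open>A quadratic form with symmetric bilinear form B satisfies q(u) - q(w) = B(u, u - w) +
  B(w, u - w), and \<open>momentum_diff\<close> has the same shape. Using the equation at both ends
  is thus exact except for the quartic potential, whose remainder is a multiple of the integral of
  (|u|^2 - |w|^2) |u - w|^2.\<close>

lemma energy_fn_diff:
  assumes u: "u \<in> energy_space" and w: "w \<in> energy_space" and D: "sq_integrable (\<lambda>x. u x - w x)"
    and c: "c > 0" "\<And>x. c \<le> mass u x" "\<And>x. c \<le> mass w x" and small: "\<And>x. cmod (u x - w x) \<le> sqrt c / 2"
    and M: "\<And>x. cmod (u x) \<le> M" "\<And>x. cmod (w x) \<le> M"
  defines "D' \<equiv> \<lambda>x. weak_deriv u x - weak_deriv w x"
  shows "\<bar>2 * (energy_fn \<gamma> v u - energy_fn \<gamma> v w)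
     - Re (weak_form \<gamma> v (weak_deriv u) (u 0) (nonlin u) (\<lambda>x. u x - w x) D' + weak_form \<gamma> v (weak_deriv w) (w 0) (nonlin w) (\<lambda>x. u x - w x) D')\<bar>
     \<le> M\<^sup>2 * (l2norm (\<lambda>x. u x - w x))\<^sup>2"
proof -
  let ?ux = "weak_deriv u" and ?wx = "weak_deriv w" and ?D = "\<lambda>x. u x - w x"
  note su = energy_space_sqi_deriv[OF u] and sw = energy_space_sqi_deriv[OF w]
  have 1: "(l2norm ?ux)\<^sup>2 - (l2norm ?wx)\<^sup>2 = Re (pairing ?ux D') + Re (pairing ?wx D')"
    using l2norm_power2_diff[OF su sw] by (simp add: D'_def)
  have 2: "\<gamma> * (mass u 0 - mass w 0) = Re (of_real \<gamma> * cnj (u 0) * (u 0 - w 0)) + Re (of_real \<gamma> * cnj (w 0) * (u 0 - w 0))"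
    unfolding mass_def cmod_power2 by (simp add: algebra_simps power2_eq_square)
  have 4: "v * (momentum u - momentum w) = - (Re (pairing (\<lambda>x. \<i> * of_real v * ?ux x) ?D) + Re (pairing (\<lambda>x. \<i> * of_real v * ?wx x) ?D))"
  proof -
    have e: "Re (pairing (\<lambda>x. \<i> * of_real v * f x) ?D) = - v * Im (pairing ?D f)" if "sq_integrable f" for f
    proof -
      have "pairing (\<lambda>x. \<i> * of_real v * f x) ?D = (- \<i> * of_real v) * pairing f ?D"
        unfolding pairing_def integral_mult_right_zero[symmetric]
        by (rule Bochner_Integration.integral_cong) (simp_all add: mult_ac)
      also have "pairing f ?D = cnj (pairing ?D f)" by (simp add: pairing_cnj)
      finally show ?thesis by simp
    qed
    show ?thesis unfolding e[OF su] e[OF sw] momentum_diff[OF u w D c small] by (simp add: algebra_simps)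
  qed
  define R where "R = (LINT x|lborel. (mass u x - mass w x) * (cmod (u x - w x))\<^sup>2)"
  have M0: "0 \<le> M" using M(1)[of 0] norm_ge_zero order_trans by blast
  have mm: "\<bar>mass u x - mass w x\<bar> \<le> M\<^sup>2" for x
    using power_mono[OF M(1)[of x], of 2] power_mono[OF M(2)[of x], of 2]
    by (simp add: mass_def abs_le_iff) (smt (verit) zero_le_power2)
  have iD: "integrable lborel (\<lambda>x. (cmod (u x - w x))\<^sup>2)" using D by (simp add: sq_integrable_def)
  note [measurable] = mass_borel[OF u] mass_borel[OF w] sqi_borel[OF D]
  have le: "norm ((mass u x - mass w x) * (cmod (u x - w x))\<^sup>2) \<le> M\<^sup>2 * (cmod (u x - w x))\<^sup>2" for x
    using mult_right_mono[OF mm[of x], of "(cmod (u x - w x))\<^sup>2"] by (simp add: abs_mult)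
  have iR: "integrable lborel (\<lambda>x. (mass u x - mass w x) * (cmod (u x - w x))\<^sup>2)"
  proof (rule Bochner_Integration.integrable_bound)
    show "integrable lborel (\<lambda>x. M\<^sup>2 * (cmod (u x - w x))\<^sup>2)" using iD by simp
    show "AE x in lborel. norm ((mass u x - mass w x) * (cmod (u x - w x))\<^sup>2) \<le> norm (M\<^sup>2 * (cmod (u x - w x))\<^sup>2)"
      using le by (intro AE_I2) (simp add: abs_mult)
  qed measurable
  have R: "\<bar>R\<bar> \<le> M\<^sup>2 * (l2norm ?D)\<^sup>2"
  proof -
    have "norm R \<le> (LINT x|lborel. M\<^sup>2 * (cmod (u x - w x))\<^sup>2)"
      unfolding R_def by (rule Bochner_Integration.integral_norm_bound_integral[OF iR]) (use iD le in auto)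
    then show ?thesis by (simp add: l2norm_power2)
  qed
  have 3: "(l2norm (\<lambda>x. 1 - mass u x))\<^sup>2 / 2 - (l2norm (\<lambda>x. 1 - mass w x))\<^sup>2 / 2 =
     - Re (pairing (nonlin u) ?D) - Re (pairing (nonlin w) ?D) - R / 2"
  proof -
    have pt: "(norm (1 - mass u x))\<^sup>2 / 2 - (norm (1 - mass w x))\<^sup>2 / 2 =
       - Re (cnj (nonlin u x) * (u x - w x)) - Re (cnj (nonlin w x) * (u x - w x)) - (mass u x - mass w x) * (cmod (u x - w x))\<^sup>2 / 2" for x
    proof -
      define a b c d where "a = Re (u x)" and "b = Im (u x)" and "c = Re (w x)" and "d = Im (w x)"
      show ?thesis
        unfolding mass_def cmod_power2 nonlin_def real_norm_def power2_abs
        by (simp add: a_def[symmetric] b_def[symmetric] c_def[symmetric] d_def[symmetric] cmod_power2)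
           (simp add: power2_eq_square field_simps)
    qed
    note i1 = energy_space_sqi_1_mass[OF u, unfolded sq_integrable_def, THEN conjunct2] energy_space_sqi_1_mass[OF w, unfolded sq_integrable_def, THEN conjunct2]
    note i2 = pairing_integrable[OF nonlin_sqi(1)[OF u] D] pairing_integrable[OF nonlin_sqi(1)[OF w] D]
    have "(l2norm (\<lambda>x. 1 - mass u x))\<^sup>2 / 2 - (l2norm (\<lambda>x. 1 - mass w x))\<^sup>2 / 2
      = (LINT x|lborel. (norm (1 - mass u x))\<^sup>2 / 2 - (norm (1 - mass w x))\<^sup>2 / 2)"
      unfolding l2norm_power2 using i1 by simp
    also have "\<dots> = - Re (pairing (nonlin u) ?D) - Re (pairing (nonlin w) ?D) - R / 2"
      unfolding pt R_def pairing_def using i2 iR by (simp add: integrable_Re del: complex_cnj_mult times_complex.sel)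
    finally show ?thesis .
  qed
  have "2 * (energy_fn \<gamma> v u - energy_fn \<gamma> v w)
     - Re (weak_form \<gamma> v ?ux (u 0) (nonlin u) ?D D' + weak_form \<gamma> v ?wx (w 0) (nonlin w) ?D D') = - R / 2"
  proof -
    have "2 * (energy_fn \<gamma> v u - energy_fn \<gamma> v w) = ((l2norm ?ux)\<^sup>2 - (l2norm ?wx)\<^sup>2)
       + ((l2norm (\<lambda>x. 1 - mass u x))\<^sup>2 / 2 - (l2norm (\<lambda>x. 1 - mass w x))\<^sup>2 / 2) + \<gamma> * (mass u 0 - mass w 0) - v * (momentum u - momentum w)"
      unfolding energy_fn_def by (simp add: field_simps)
    then show ?thesis unfolding 1 2 3 4 weak_form_def by simp
  qed
  then have "\<bar>2 * (energy_fn \<gamma> v u - energy_fn \<gamma> v w)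
     - Re (weak_form \<gamma> v ?ux (u 0) (nonlin u) ?D D' + weak_form \<gamma> v ?wx (w 0) (nonlin w) ?D D')\<bar> \<le> \<bar>R\<bar>" by simp
  then show ?thesis using R by linarith
qed

text \<open>If \<^term>\<open>A\<close> is the diagonal derivative of the antisymmetric form \<^term>\<open>X\<close>, integrating in \<^term>\<open>t\<close> makes both
  contributions of order \<^term>\<open>h\<close> cancel.\<close>

lemma conservation_calculus:
  fixes E A :: "real \<Rightarrow> real" and X Y :: "real \<Rightarrow> real \<Rightarrow> real"
  assumes ab: "a \<le> b" "lo < a" "b < hi"
    and cE: "continuous_on {lo<..<hi} E" and cA: "continuous_on {lo<..<hi} A"
    and dX: "\<And>h t. h > 0 \<Longrightarrow> ((\<lambda>t. X (t + h) t) has_real_derivative Y h t) (at t)"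
    and err: "\<And>\<epsilon>. \<epsilon> > 0 \<Longrightarrow> \<exists>h0>0. \<forall>h t. 0 < h \<and> h < h0 \<and> t \<in> {a..b} \<longrightarrow>
        \<bar>2 * (E (t + h) - E t) - (A (t + h) - A t - Y h t)\<bar> \<le> \<epsilon> * h"
    and bd: "\<And>\<tau>. ((\<lambda>h. X (\<tau> + h) \<tau> / h) \<longlongrightarrow> A \<tau>) (at_right 0)"
  shows "E a = E b"
proof -
  have "\<exists>Z. \<forall>x. ereal lo < ereal x \<longrightarrow> ereal x < ereal hi \<longrightarrow> (Z has_vector_derivative (2 * E x - A x)) (at x)"
  proof (rule einterval_antiderivative)
    have "continuous_on {lo<..<hi} (\<lambda>x. 2 * E x - A x)" by (intro continuous_intros cE cA)
    then show "isCont (\<lambda>x. 2 * E x - A x) x" if "ereal lo < ereal x" "ereal x < ereal hi" for x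
      using that by (simp add: continuous_on_eq_continuous_at)
  qed (use ab in auto)
  then obtain Z where Z: "\<And>x. lo < x \<Longrightarrow> x < hi \<Longrightarrow> (Z has_real_derivative (2 * E x - A x)) (at x)"
    by (auto simp: has_real_derivative_iff_has_vector_derivative)
  \<comment> \<open>As Z' = 2 E - A, the t-derivative of G h is the quantity bounded by \<epsilon> h
    in \<open>err\<close>, while G h t / h tends to 2 E t because the two occurrences of A
    cancel.\<close>
  define G where "G h t = Z (t + h) - Z t + X (t + h) t" for h t
  have lim: "((\<lambda>h. G h \<tau> / h) \<longlongrightarrow> 2 * E \<tau>) (at_right 0)" if "lo < \<tau>" "\<tau> < hi" for \<tau>
  proof -
    have "((\<lambda>h. (Z (\<tau> + h) - Z \<tau>) / h) \<longlongrightarrow> 2 * E \<tau> - A \<tau>) (at 0)" using Z[OF that] by (simp add: DERIV_def)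
    then have "((\<lambda>h. (Z (\<tau> + h) - Z \<tau>) / h) \<longlongrightarrow> 2 * E \<tau> - A \<tau>) (at_right 0)" by (rule tendsto_within_subset) simp
    from tendsto_add[OF this bd[of \<tau>]] show ?thesis by (simp add: G_def add_divide_distrib)
  qed
  have L: "((\<lambda>h. \<bar>G h b / h - G h a / h\<bar>) \<longlongrightarrow> \<bar>2 * E b - 2 * E a\<bar>) (at_right 0)"
    by (intro tendsto_intros lim) (use ab in auto)
  have "\<bar>2 * E b - 2 * E a\<bar> \<le> 0 + (b - a) * \<epsilon>" if \<epsilon>: "\<epsilon> > 0" for \<epsilon>
  proof -
    obtain h0 where h0: "h0 > 0" "\<And>h t. 0 < h \<Longrightarrow> h < h0 \<Longrightarrow> t \<in> {a..b} \<Longrightarrow>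
        \<bar>2 * (E (t + h) - E t) - (A (t + h) - A t - Y h t)\<bar> \<le> \<epsilon> * h" using err[OF \<epsilon>] by blast
    have bound: "\<bar>G h b / h - G h a / h\<bar> \<le> 0 + (b - a) * \<epsilon>" if h: "0 < h" "h < min h0 (hi - b)" for h
    proof -
      have "norm (G h b - G h a) \<le> \<epsilon> * h * norm (b - a)"
      proof (rule field_differentiable_bound[where S="{a..b}" and f'="\<lambda>t. (2 * E (t + h) - A (t + h)) - (2 * E t - A t) + Y h t"])
        fix t assume t: "t \<in> {a..b}"
        have "((\<lambda>t. Z (t + h)) has_real_derivative (2 * E (t + h) - A (t + h))) (at t)"
          using DERIV_shift[of Z "2 * E (t + h) - A (t + h)" t h] Z[of "t + h"] t h ab by simp
        then have "(G h has_real_derivative (2 * E (t + h) - A (t + h)) - (2 * E t - A t) + Y h t) (at t)"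
          unfolding G_def[abs_def] by (intro DERIV_add DERIV_diff dX Z) (use t h ab in auto)
        then show "(G h has_real_derivative (2 * E (t + h) - A (t + h)) - (2 * E t - A t) + Y h t) (at t within {a..b})"
          by (rule has_field_derivative_at_within)
        show "norm ((2 * E (t + h) - A (t + h)) - (2 * E t - A t) + Y h t) \<le> \<epsilon> * h"
          using h0(2)[of h t] h t by (simp add: algebra_simps)
      qed (use ab in auto)
      then have "norm (G h b - G h a) / h \<le> \<epsilon> * (b - a)" using h ab by (simp add: divide_le_eq mult_ac)
      moreover have "\<bar>G h b / h - G h a / h\<bar> = norm (G h b - G h a) / h" using h by (simp add: diff_divide_distrib[symmetric] abs_divide)
      ultimately show ?thesis by (simp add: mult.commute)
    qed
    show ?thesis
    proof (rule tendsto_upperbound[OF L])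
      show "\<forall>\<^sub>F h in at_right 0. \<bar>G h b / h - G h a / h\<bar> \<le> 0 + (b - a) * \<epsilon>"
        unfolding eventually_at_right_field
        by (rule exI[of _ "min h0 (hi - b)"]) (use bound h0(1) ab in auto)
    qed simp
  qed
  then have "\<bar>2 * E b - 2 * E a\<bar> \<le> 0" by (rule le_of_le_add_small)
  then show ?thesis by simp
qed

lemma Re_pairing_ii: "Re (pairing (\<lambda>x. \<i> * f x) g) = Im (pairing f g)"
proof -
  have "pairing (\<lambda>x. \<i> * f x) g = - \<i> * pairing f g"
    unfolding pairing_def integral_mult_right_zero[symmetric]
    by (rule Bochner_Integration.integral_cong) (simp_all add: mult_ac)
  then show ?thesis by simp
qed

lemma Im_pairing_commute: "Im (pairing f g) = - Im (pairing g f)"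
  using arg_cong[OF pairing_cnj[of f g], of Im] by simp

lemma DERIV_of_small_increments:
  fixes f :: "real \<Rightarrow> real"
  assumes "\<And>\<epsilon>. \<epsilon> > 0 \<Longrightarrow> \<exists>\<delta>>0. \<forall>k. \<bar>k\<bar> < \<delta> \<longrightarrow> \<bar>f (t + k) - f t - k * D\<bar> \<le> \<epsilon> * \<bar>k\<bar>"
  shows "(f has_real_derivative D) (at t)"
  unfolding DERIV_def
proof (rule LIM_I)
  fix r :: real assume r: "r > 0"
  obtain \<delta> where \<delta>: "\<delta> > 0" "\<And>k. \<bar>k\<bar> < \<delta> \<Longrightarrow> \<bar>f (t + k) - f t - k * D\<bar> \<le> r / 2 * \<bar>k\<bar>"
    using assms[of "r / 2"] r by auto
  have "norm ((f (t + k) - f t) / k - D) < r" if "k \<noteq> 0" "norm (k - 0) < \<delta>" for k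
  proof -
    have "\<bar>f (t + k) - f t - k * D\<bar> / \<bar>k\<bar> \<le> r / 2" using \<delta>(2)[of k] that by (simp add: divide_le_eq)
    moreover have "(f (t + k) - f t) / k - D = (f (t + k) - f t - k * D) / k" using that by (simp add: field_simps)
    ultimately have "norm ((f (t + k) - f t) / k - D) \<le> r / 2" by (simp only: real_norm_def abs_divide)
    then show ?thesis using r by linarith
  qed
  then show "\<exists>s>0. \<forall>x. x \<noteq> 0 \<and> norm (x - 0) < s \<longrightarrow> norm ((f (t + x) - f t) / x - D) < r" using \<delta>(1) by blast
qed

context gp_solution
begin

section \<open>Time regularity of the increments in H^1\<close>

definition dist_H1 :: "real \<Rightarrow> real \<Rightarrow> real" where
  "dist_H1 t s = l2norm (\<lambda>x. u t x - u s x) + l2norm (\<lambda>x. ux t x - ux s x)"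

lemma dist_H1_nonneg: "0 \<le> dist_H1 t s" by (simp add: dist_H1_def)

lemma dist_H1_triangle: "dist_H1 r t \<le> dist_H1 r s + dist_H1 s t"
  using sqi_add(2)[of "\<lambda>x. u r x - u s x" "\<lambda>x. u s x - u t x"] sqi_add(2)[of "\<lambda>x. ux r x - ux s x" "\<lambda>x. ux s x - ux t x"]
  by (simp add: dist_H1_def)

lemma dist_H1_commute: "dist_H1 t s = dist_H1 s t"
  by (simp add: dist_H1_def l2norm_commute[of "u t"] l2norm_commute[of "ux t"])

lemma sup_le_dist_H1: "cmod (u t x - u s x) \<le> dist_H1 t s"
  unfolding dist_H1_def by (rule ac_sup_bound[OF increment_ac increment_sqi increment_deriv_sqi])

lemma deriv_le_modulus: "l2norm (\<lambda>x. ux t x - ux s x) \<le> modulus t s"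
proof -
  have "1 * l2norm (\<lambda>x. ux t x - ux s x) \<le> (1 + \<bar>v\<bar>) * l2norm (\<lambda>x. ux t x - ux s x)" by (intro mult_right_mono) auto
  then show ?thesis unfolding modulus_def by (simp add: add_increasing2)
qed

lemma Lnorm_triangle: "Lnorm t \<le> Lnorm s + modulus t s"
proof -
  have 1: "l2norm (ux t) \<le> l2norm (ux s) + l2norm (\<lambda>x. ux t x - ux s x)"
    using l2norm_triangle_diff[of "ux t" "ux s"] by simp
  have 2: "l2norm (nonlin (u t)) \<le> l2norm (nonlin (u s)) + l2norm (\<lambda>x. nonlin (u t) x - nonlin (u s) x)"
    using l2norm_triangle_diff[of "nonlin (u t)" "nonlin (u s)"] by simp
  have 3: "cmod (u t 0) \<le> cmod (u s 0) + cmod (u t 0 - u s 0)" by (simp add: norm_triangle_sub)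
  have "Lnorm t \<le> (1 + \<bar>v\<bar>) * (l2norm (ux s) + l2norm (\<lambda>x. ux t x - ux s x)) + \<bar>\<gamma>\<bar> * (cmod (u s 0) + cmod (u t 0 - u s 0))
     + (l2norm (nonlin (u s)) + l2norm (\<lambda>x. nonlin (u t) x - nonlin (u s) x))"
    unfolding Lnorm_def using 1 2 3 by (intro add_mono mult_left_mono) auto
  then show ?thesis unfolding Lnorm_def modulus_def by (simp add: algebra_simps)
qed

text \<open>Interpolation: the increment is O(|t - s|) in the dual of H^1, so its pairing with
  itself bounds the squared L^2 norm by |t - s| times the H^1 norm. The L^2 part of the latter is
  absorbed.\<close>

lemma increment_l2_bound:
  assumes K: "\<And>\<tau>. \<bar>\<tau> - s\<bar> \<le> \<bar>t - s\<bar> \<Longrightarrow> modulus \<tau> s \<le> K"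
  defines "q \<equiv> \<bar>t - s\<bar> * (K + Lnorm s)"
  shows "(l2norm (\<lambda>x. u t x - u s x))\<^sup>2 \<le> q\<^sup>2 + 2 * q * l2norm (\<lambda>x. ux t x - ux s x)"
proof -
  let ?D = "\<lambda>x. u t x - u s x" and ?D' = "\<lambda>x. ux t x - ux s x"
  have "pairing (\<lambda>x. \<i> * (u t x - u s x)) ?D = - \<i> * pairing ?D ?D"
    unfolding pairing_def integral_mult_right_zero[symmetric]
    by (rule Bochner_Integration.integral_cong) (simp_all add: mult_ac)
  then have p: "cmod (pairing (\<lambda>x. \<i> * (u t x - u s x)) ?D) = (l2norm ?D)\<^sup>2"
    by (simp add: pairing_self norm_mult norm_power)
  have 1: "cmod (pairing (\<lambda>x. \<i> * (u t x - u s x)) ?D - of_real (t - s) * L s ?D ?D') \<le> \<bar>t - s\<bar> * K * (l2norm ?D + l2norm ?D')"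
    by (rule increment_H1[OF increment_ac increment_sqi increment_deriv_sqi K])
  have 2: "cmod (of_real (t - s) * L s ?D ?D') \<le> \<bar>t - s\<bar> * Lnorm s * (l2norm ?D + l2norm ?D')"
    unfolding norm_mult norm_of_real mult.assoc
    by (intro mult_left_mono L_bound increment_sqi increment_deriv_sqi increment_ac) auto
  have "(l2norm ?D)\<^sup>2 \<le> q * (l2norm ?D + l2norm ?D')"
    using 1 2 norm_triangle_sub[of "pairing (\<lambda>x. \<i> * (u t x - u s x)) ?D" "of_real (t - s) * L s ?D ?D'"]
    unfolding p q_def by (simp add: algebra_simps)
  moreover have "2 * (q * l2norm ?D) \<le> q\<^sup>2 + (l2norm ?D)\<^sup>2" using sum_squares_bound[of q "l2norm ?D"] by simp
  ultimately show ?thesis by (simp add: algebra_simps)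
qed

lemma modulus_small:
  assumes "\<epsilon> > 0"
  obtains \<delta> where "\<delta> > 0" "\<And>\<tau>. \<bar>\<tau> - s\<bar> < \<delta> \<Longrightarrow> modulus \<tau> s < \<epsilon>"
proof -
  obtain \<delta> where \<delta>: "\<delta> > 0" "\<And>\<tau>. \<tau> \<noteq> s \<Longrightarrow> dist \<tau> s < \<delta> \<Longrightarrow> modulus \<tau> s < \<epsilon>"
    using order_tendstoD(2)[OF modulus_tendsto[of s] assms] unfolding eventually_at by auto
  have "modulus \<tau> s < \<epsilon>" if "\<bar>\<tau> - s\<bar> < \<delta>" for \<tau>
    using \<delta>(2)[of \<tau>] that assms by (cases "\<tau> = s") (auto simp: dist_real_def)
  then show ?thesis using that \<delta>(1) by blast
qed

text \<open>A Lebesgue number for the covering by neighbourhoods on which \<open>modulus\<close> is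
  small; two times in one neighbourhood are compared through its centre.\<close>

lemma modulus_uniform:
  assumes "\<epsilon> > 0"
  obtains \<delta> where "\<delta> > 0" "\<And>t \<tau>. t \<in> {a..b} \<Longrightarrow> \<bar>\<tau> - t\<bar> < \<delta> \<Longrightarrow> modulus \<tau> t < \<epsilon>"
proof -
  have "\<forall>s. \<exists>\<delta>>0. \<forall>\<tau>. \<bar>\<tau> - s\<bar> < \<delta> \<longrightarrow> modulus \<tau> s < \<epsilon> / 2"
    using modulus_small[of "\<epsilon> / 2"] assms by (metis half_gt_zero)
  then obtain r where r: "\<And>s. r s > 0" "\<And>s \<tau>. \<bar>\<tau> - s\<bar> < r s \<Longrightarrow> modulus \<tau> s < \<epsilon> / 2" by metis
  have "{a..b} \<subseteq> \<Union> (range (\<lambda>s. ball s (r s)))"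
  proof
    fix x :: real
    have "x \<in> ball x (r x)" using r(1) by simp
    then show "x \<in> \<Union> (range (\<lambda>s. ball s (r s)))" by blast
  qed
  then obtain e where e: "e > 0" "\<And>x. x \<in> {a..b} \<Longrightarrow> \<exists>G\<in>range (\<lambda>s. ball s (r s)). ball x e \<subseteq> G"
    using Heine_Borel_lemma[OF compact_Icc, of a b "range (\<lambda>s. ball s (r s))"] by blast
  have "modulus \<tau> t < \<epsilon>" if t: "t \<in> {a..b}" "\<bar>\<tau> - t\<bar> < e" for t \<tau>
  proof -
    obtain s where s: "ball t e \<subseteq> ball s (r s)" using e(2)[OF t(1)] by blast
    have "\<tau> \<in> ball t e" "t \<in> ball t e" using t e(1) by (auto simp: dist_real_def abs_minus_commute)
    then have "\<tau> \<in> ball s (r s)" "t \<in> ball s (r s)" using s by blast+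
    then have "\<bar>\<tau> - s\<bar> < r s" "\<bar>t - s\<bar> < r s" by (auto simp: dist_real_def abs_minus_commute)
    then show ?thesis using r(2)[of \<tau> s] r(2)[of t s] modulus_triangle[of \<tau> t s] modulus_commute[of s t] by linarith
  qed
  then show ?thesis using that e(1) by blast
qed

text \<open>The derivative of the increment tends to 0 uniformly, so the interpolation bound is
  o(|h|). This makes remainders quadratic in the increment negligible against the time step.\<close>

lemma increment_small_uniform:
  assumes "\<epsilon> > 0"
  obtains \<delta> where "\<delta> > 0" "\<And>t h. t \<in> {a..b} \<Longrightarrow> \<bar>h\<bar> < \<delta> \<Longrightarrow> (l2norm (\<lambda>x. u (t + h) x - u t x))\<^sup>2 \<le> \<epsilon> * \<bar>h\<bar>"
proof -
  obtain K where K: "K > 0" "\<And>t. t \<in> {a..b} \<Longrightarrow> norm (modulus t a) \<le> K"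
    using continuous_bounded_on_interval[OF modulus_continuous] by blast
  define \<Lambda> where "\<Lambda> = 1 + Lnorm a + K"
  have \<Lambda>: "\<Lambda> > 0" using K(1) Lnorm_nonneg[of a] by (simp add: \<Lambda>_def)
  \<comment> \<open>The tolerance \<epsilon> is halved between the two terms of the interpolation
    bound: \<delta> takes care of q^2, and \<eta> of the product of q with the norm of the
    derivative.\<close>
  define \<eta> where "\<eta> = min 1 (\<epsilon> / (4 * \<Lambda>))"
  have \<eta>: "\<eta> > 0" "\<eta> \<le> 1" "4 * \<Lambda> * \<eta> \<le> \<epsilon>"
  proof -
    show "\<eta> > 0" "\<eta> \<le> 1" using assms \<Lambda> by (auto simp: \<eta>_def)
    have "4 * \<Lambda> * \<eta> \<le> 4 * \<Lambda> * (\<epsilon> / (4 * \<Lambda>))" using \<Lambda> by (intro mult_left_mono) (auto simp: \<eta>_def)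
    then show "4 * \<Lambda> * \<eta> \<le> \<epsilon>" using \<Lambda> by simp
  qed
  obtain d where d: "d > 0" "\<And>t \<tau>. t \<in> {a..b} \<Longrightarrow> \<bar>\<tau> - t\<bar> < d \<Longrightarrow> modulus \<tau> t < \<eta>"
    using modulus_uniform[OF \<eta>(1)] by blast
  define \<delta> where "\<delta> = min d (\<epsilon> / (2 * \<Lambda>\<^sup>2))"
  have \<delta>: "\<delta> > 0" using d(1) assms \<Lambda> by (simp add: \<delta>_def)
  have "(l2norm (\<lambda>x. u (t + h) x - u t x))\<^sup>2 \<le> \<epsilon> * \<bar>h\<bar>" if t: "t \<in> {a..b}" and h: "\<bar>h\<bar> < \<delta>" for t h
  proof -
    define q where "q = \<bar>h\<bar> * (1 + Lnorm t)"
    have mK: "modulus \<tau> t \<le> 1" if "\<bar>\<tau> - t\<bar> \<le> \<bar>(t + h) - t\<bar>" for \<tau>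
      using d(2)[OF t, of \<tau>] that h \<eta>(2) by (simp add: \<delta>_def)
    have "Lnorm t \<le> Lnorm a + K" using Lnorm_triangle[of t a] K(2)[OF t] by simp
    then have q: "0 \<le> q" "q \<le> \<bar>h\<bar> * \<Lambda>" using Lnorm_nonneg[of t] by (auto simp: q_def \<Lambda>_def intro!: mult_left_mono)
    have dm: "l2norm (\<lambda>x. ux (t + h) x - ux t x) \<le> \<eta>"
      using deriv_le_modulus[of "t + h" t] d(2)[OF t, of "t + h"] h by (simp add: \<delta>_def)
    have "(l2norm (\<lambda>x. u (t + h) x - u t x))\<^sup>2 \<le> q\<^sup>2 + 2 * q * l2norm (\<lambda>x. ux (t + h) x - ux t x)"
      using increment_l2_bound[where s=t and t="t + h" and K=1, OF mK] by (simp add: q_def)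
    also have "\<dots> \<le> (\<bar>h\<bar> * \<Lambda>)\<^sup>2 + 2 * (\<bar>h\<bar> * \<Lambda>) * \<eta>"
      using q dm \<eta>(1) by (intro add_mono power_mono mult_mono) auto
    also have "\<dots> = \<bar>h\<bar> * (\<bar>h\<bar> * \<Lambda>\<^sup>2 + 2 * \<Lambda> * \<eta>)" by (simp add: power2_eq_square algebra_simps)
    also have "\<dots> \<le> \<bar>h\<bar> * \<epsilon>"
    proof (intro mult_left_mono)
      have "\<bar>h\<bar> \<le> \<epsilon> / (2 * \<Lambda>\<^sup>2)" using h by (simp add: \<delta>_def)
      then have "\<bar>h\<bar> * \<Lambda>\<^sup>2 \<le> \<epsilon> / 2" using \<Lambda> by (simp add: field_simps)
      then show "\<bar>h\<bar> * \<Lambda>\<^sup>2 + 2 * \<Lambda> * \<eta> \<le> \<epsilon>" using \<eta>(3) by simp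
    qed simp
    finally show ?thesis by (simp add: mult.commute)
  qed
  then show ?thesis using that \<delta> by blast
qed

lemma dist_H1_tendsto: "((\<lambda>s. dist_H1 s t) \<longlongrightarrow> 0) (at t)"
proof (rule tendsto_sandwich[OF _ _ tendsto_const])
  show "\<forall>\<^sub>F s in at t. 0 \<le> dist_H1 s t" by (simp add: dist_H1_nonneg)
  obtain \<delta> where \<delta>: "\<delta> > 0" "\<And>\<tau> h. \<tau> \<in> {t..t} \<Longrightarrow> \<bar>h\<bar> < \<delta> \<Longrightarrow> (l2norm (\<lambda>x. u (\<tau> + h) x - u \<tau> x))\<^sup>2 \<le> 1 * \<bar>h\<bar>"
    using increment_small_uniform[OF zero_less_one] by blast
  show "\<forall>\<^sub>F s in at t. dist_H1 s t \<le> sqrt \<bar>s - t\<bar> + modulus s t"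
    unfolding eventually_at
  proof (intro exI[of _ \<delta>] conjI ballI impI \<delta>(1))
    fix s assume "s \<noteq> t \<and> dist s t < \<delta>"
    then have "(l2norm (\<lambda>x. u s x - u t x))\<^sup>2 \<le> \<bar>s - t\<bar>" using \<delta>(2)[of t "s - t"] by (simp add: dist_real_def)
    then have "l2norm (\<lambda>x. u s x - u t x) \<le> sqrt \<bar>s - t\<bar>" by (rule real_le_rsqrt)
    then show "dist_H1 s t \<le> sqrt \<bar>s - t\<bar> + modulus s t"
      using deriv_le_modulus[of s t] by (simp add: dist_H1_def)
  qed
  have "((\<lambda>s. sqrt \<bar>s - t\<bar> + modulus s t) \<longlongrightarrow> sqrt \<bar>t - t\<bar> + 0) (at t)"
    by (intro tendsto_intros modulus_tendsto)
  then show "((\<lambda>s. sqrt \<bar>s - t\<bar> + modulus s t) \<longlongrightarrow> 0) (at t)" by simp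
qed

lemma dist_H1_small:
  assumes "\<epsilon> > 0"
  obtains \<delta> where "\<delta> > 0" "\<And>\<tau>. \<bar>\<tau> - s\<bar> < \<delta> \<Longrightarrow> dist_H1 \<tau> s < \<epsilon>"
proof -
  obtain \<delta> where \<delta>: "\<delta> > 0" "\<And>\<tau>. \<tau> \<noteq> s \<Longrightarrow> dist \<tau> s < \<delta> \<Longrightarrow> dist_H1 \<tau> s < \<epsilon>"
    using order_tendstoD(2)[OF dist_H1_tendsto[of s] assms] unfolding eventually_at by auto
  have "dist_H1 \<tau> s < \<epsilon>" if "\<bar>\<tau> - s\<bar> < \<delta>" for \<tau>
    using \<delta>(2)[of \<tau>] that assms by (cases "\<tau> = s") (auto simp: dist_real_def dist_H1_def)
  then show ?thesis using that \<delta>(1) by blast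
qed

lemma dist_H1_continuous: "continuous_on S (\<lambda>t. dist_H1 t s)"
proof -
  have "isCont (\<lambda>\<tau>. dist_H1 \<tau> s) t" for t
  proof -
    have "((\<lambda>\<tau>. dist_H1 \<tau> s - dist_H1 t s) \<longlongrightarrow> 0) (at t)"
    proof (rule Lim_null_comparison[OF _ dist_H1_tendsto])
      show "\<forall>\<^sub>F \<tau> in at t. norm (dist_H1 \<tau> s - dist_H1 t s) \<le> dist_H1 \<tau> t"
        using dist_H1_triangle[of _ s t] dist_H1_triangle[of t s] dist_H1_commute[of t]
        by (intro always_eventually allI) (smt (verit) real_norm_def)
    qed
    then show ?thesis unfolding isCont_def by (simp add: LIM_zero_iff)
  qed
  then show ?thesis by (intro continuous_at_imp_continuous_on) blast
qed

lemma increment_small: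
  assumes "\<epsilon> > 0"
  obtains \<delta> where "\<delta> > 0" "\<And>t \<phi> \<phi>'. \<bar>t - s\<bar> < \<delta> \<Longrightarrow> has_ac_deriv \<phi> \<phi>' \<Longrightarrow> sq_integrable \<phi> \<Longrightarrow> sq_integrable \<phi>' \<Longrightarrow>
    cmod (pairing (\<lambda>x. \<i> * (u t x - u s x)) \<phi> - of_real (t - s) * L s \<phi> \<phi>') \<le> \<epsilon> * \<bar>t - s\<bar> * (l2norm \<phi> + l2norm \<phi>')"
proof -
  obtain \<delta> where \<delta>: "\<delta> > 0" "\<And>\<tau>. \<bar>\<tau> - s\<bar> < \<delta> \<Longrightarrow> modulus \<tau> s < \<epsilon>"
    using modulus_small[OF assms] by blast
  show ?thesis
  proof (rule that[OF \<delta>(1)])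
    fix t :: real and \<phi> \<phi>' :: "real \<Rightarrow> complex" assume t: "\<bar>t - s\<bar> < \<delta>" and \<phi>: "has_ac_deriv \<phi> \<phi>'" "sq_integrable \<phi>" "sq_integrable \<phi>'"
    have "modulus \<tau> s \<le> \<epsilon>" if "\<bar>\<tau> - s\<bar> \<le> \<bar>t - s\<bar>" for \<tau> using \<delta>(2)[of \<tau>] that t by simp
    then have "cmod (pairing (\<lambda>x. \<i> * (u t x - u s x)) \<phi> - of_real (t - s) * L s \<phi> \<phi>') \<le> \<bar>t - s\<bar> * \<epsilon> * (l2norm \<phi> + l2norm \<phi>')"
      using \<phi> by (intro increment_H1)
    then show "cmod (pairing (\<lambda>x. \<i> * (u t x - u s x)) \<phi> - of_real (t - s) * L s \<phi> \<phi>') \<le> \<epsilon> * \<bar>t - s\<bar> * (l2norm \<phi> + l2norm \<phi>')"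
      by (simp add: mult_ac)
  qed
qed

text \<open>The fields themselves are not square integrable. Subtracting the datum gives H^1
  functions and leaves increments in time unchanged.\<close>

definition w :: "real \<Rightarrow> real \<Rightarrow> complex" where "w t x = u t x - u 0 x"
definition wx :: "real \<Rightarrow> real \<Rightarrow> complex" where "wx t x = ux t x - ux 0 x"

lemma w_sqi [simp]: "sq_integrable (w t)" and wx_sqi [simp]: "sq_integrable (wx t)"
  and w_ac: "has_ac_deriv (w t) (wx t)"
  using increment_sqi[of t 0] increment_deriv_sqi[of t 0] increment_ac[of t 0]
  by (auto simp: w_def[abs_def] wx_def[abs_def])

lemma w_diff: "(\<lambda>x. w t x - w s x) = (\<lambda>x. u t x - u s x)" "(\<lambda>x. wx t x - wx s x) = (\<lambda>x. ux t x - ux s x)"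
  by (auto simp: w_def wx_def)

lemma w_norm: "l2norm (w t) + l2norm (wx t) = dist_H1 t 0"
  by (simp add: dist_H1_def w_def[abs_def] wx_def[abs_def])

lemma L_w_diff: "L r (w t) (wx t) - L r (w s) (wx s) = L r (\<lambda>x. u t x - u s x) (\<lambda>x. ux t x - ux s x)"
  using L_diff_right[of "w t" "wx t" "w s" "wx s" r] by (simp add: w_diff)

lemma L_increment_bound: "cmod (L r (\<lambda>x. u t x - u s x) (\<lambda>x. ux t x - ux s x)) \<le> Lnorm r * dist_H1 t s"
  unfolding dist_H1_def by (intro L_bound increment_sqi increment_deriv_sqi increment_ac)

text \<open>The symplectic form of two states shifted by the datum. \<open>Y h\<close> is the
  derivative of t \<mapsto> X (t + h) t, and \<open>A\<close> the derivative in the first argument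
  on the diagonal.\<close>

definition X :: "real \<Rightarrow> real \<Rightarrow> real" where "X t s = Im (pairing (w t) (w s))"
definition A :: "real \<Rightarrow> real" where "A t = Re (L t (w t) (wx t))"
definition Y :: "real \<Rightarrow> real \<Rightarrow> real" where "Y h t = Re (L (t + h) (w t) (wx t)) - Re (L t (w (t + h)) (wx (t + h)))"

lemma X_diff: "X t r - X s r = Re (pairing (\<lambda>x. \<i> * (u t x - u s x)) (w r))"
  unfolding X_def Re_pairing_ii using pairing_diff_left[of "w t" "w s" "w r"] by (simp add: w_diff)

lemma X_commute: "X t s = - X s t"
  unfolding X_def by (rule Im_pairing_commute)

text \<open>A product rule in which each factor is differentiable only in the dual of H^1; it is
  available because the other factor is continuous in H^1.\<close>

lemma X_deriv: "((\<lambda>t. X (t + h) t) has_real_derivative Y h t) (at t)"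
proof (rule DERIV_of_small_increments)
  fix \<epsilon> :: real assume \<epsilon>: "\<epsilon> > 0"
  define C where "C = dist_H1 t 0 + 1 + dist_H1 (t + h) 0 + Lnorm (t + h)"
  have C: "C > 0" using dist_H1_nonneg[of t 0] dist_H1_nonneg[of "t + h" 0] Lnorm_nonneg[of "t + h"] unfolding C_def by linarith
  define e where "e = min 1 (\<epsilon> / C)"
  have e: "e > 0" "e \<le> 1" "e * C \<le> \<epsilon>"
  proof -
    show "e > 0" "e \<le> 1" using \<epsilon> C by (auto simp: e_def)
    have "e * C \<le> \<epsilon> / C * C" using C by (intro mult_right_mono) (auto simp: e_def)
    then show "e * C \<le> \<epsilon>" using C by simp
  qed
  obtain d1 where d1: "d1 > 0" "\<And>s \<phi> \<phi>'. \<bar>s - (t + h)\<bar> < d1 \<Longrightarrow> has_ac_deriv \<phi> \<phi>' \<Longrightarrow> sq_integrable \<phi> \<Longrightarrow> sq_integrable \<phi>' \<Longrightarrow>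
    cmod (pairing (\<lambda>x. \<i> * (u s x - u (t + h) x)) \<phi> - of_real (s - (t + h)) * L (t + h) \<phi> \<phi>') \<le> e * \<bar>s - (t + h)\<bar> * (l2norm \<phi> + l2norm \<phi>')"
    using increment_small[OF e(1), of "t + h"] by blast
  obtain d2 where d2: "d2 > 0" "\<And>s \<phi> \<phi>'. \<bar>s - t\<bar> < d2 \<Longrightarrow> has_ac_deriv \<phi> \<phi>' \<Longrightarrow> sq_integrable \<phi> \<Longrightarrow> sq_integrable \<phi>' \<Longrightarrow>
    cmod (pairing (\<lambda>x. \<i> * (u s x - u t x)) \<phi> - of_real (s - t) * L t \<phi> \<phi>') \<le> e * \<bar>s - t\<bar> * (l2norm \<phi> + l2norm \<phi>')"
    using increment_small[OF e(1), of t] by blast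
  obtain d3 where d3: "d3 > 0" "\<And>s. \<bar>s - t\<bar> < d3 \<Longrightarrow> dist_H1 s t < e" using dist_H1_small[OF e(1)] by blast
  show "\<exists>\<delta>>0. \<forall>k. \<bar>k\<bar> < \<delta> \<longrightarrow> \<bar>X (t + k + h) (t + k) - X (t + h) t - k * Y h t\<bar> \<le> \<epsilon> * \<bar>k\<bar>"
  proof (intro exI[of _ "min d1 (min d2 d3)"] conjI allI impI)
    show "0 < min d1 (min d2 d3)" using d1 d2 d3 by simp
    fix k assume k: "\<bar>k\<bar> < min d1 (min d2 d3)"
    define T1 where "T1 = pairing (\<lambda>x. \<i> * (u (t + h + k) x - u (t + h) x)) (w (t + k)) - of_real k * L (t + h) (w (t + k)) (wx (t + k))"
    define T2 where "T2 = L (t + h) (\<lambda>x. u (t + k) x - u t x) (\<lambda>x. ux (t + k) x - ux t x)"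
    define T3 where "T3 = pairing (\<lambda>x. \<i> * (u (t + k) x - u t x)) (w (t + h)) - of_real k * L t (w (t + h)) (wx (t + h))"
    have dk: "dist_H1 (t + k) t < e" using d3(2)[of "t + k"] k by simp
    have b1: "cmod T1 \<le> e * \<bar>k\<bar> * (dist_H1 t 0 + 1)"
    proof -
      have "cmod T1 \<le> e * \<bar>k\<bar> * dist_H1 (t + k) 0"
        using d1(2)[of "t + h + k" "w (t + k)" "wx (t + k)"] k w_ac by (simp add: T1_def w_norm)
      also have "\<dots> \<le> e * \<bar>k\<bar> * (dist_H1 t 0 + 1)"
        using dist_H1_triangle[of "t + k" 0 t] dk e by (intro mult_left_mono) auto
      finally show ?thesis .
    qed
    have b2: "cmod T2 \<le> Lnorm (t + h) * e"
      unfolding T2_def by (rule order_trans[OF L_increment_bound]) (use dk Lnorm_nonneg in \<open>auto intro!: mult_left_mono\<close>)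
    have b3: "cmod T3 \<le> e * \<bar>k\<bar> * dist_H1 (t + h) 0"
      using d2(2)[of "t + k" "w (t + h)" "wx (t + h)"] k w_ac by (simp add: T3_def w_norm)
    \<comment> \<open>Antisymmetry moves the second increment into the first slot, where the
      equation can be applied.\<close>
    have "X (t + k + h) (t + k) - X (t + h) t = (X (t + h + k) (t + k) - X (t + h) (t + k)) - (X (t + k) (t + h) - X t (t + h))"
      using X_commute[of "t + h" "t + k"] X_commute[of "t + h" t] by (simp add: add_ac)
    also have "\<dots> = Re (pairing (\<lambda>x. \<i> * (u (t + h + k) x - u (t + h) x)) (w (t + k))) - Re (pairing (\<lambda>x. \<i> * (u (t + k) x - u t x)) (w (t + h)))"
      by (simp only: X_diff)
    finally have "X (t + k + h) (t + k) - X (t + h) t - k * Y h t = Re T1 + k * Re T2 - Re T3"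
      unfolding T1_def T2_def T3_def Y_def L_w_diff[of "t + h" "t + k" t, symmetric] by (simp add: algebra_simps)
    then have "\<bar>X (t + k + h) (t + k) - X (t + h) t - k * Y h t\<bar> \<le> cmod T1 + \<bar>k\<bar> * cmod T2 + cmod T3"
      using abs_Re_le_cmod[of T1] abs_Re_le_cmod[of T3] mult_left_mono[OF abs_Re_le_cmod[of T2], of "\<bar>k\<bar>"]
      by (simp add: abs_mult[symmetric])
    also have "\<dots> \<le> e * \<bar>k\<bar> * (dist_H1 t 0 + 1) + \<bar>k\<bar> * (Lnorm (t + h) * e) + e * \<bar>k\<bar> * dist_H1 (t + h) 0"
      using b1 b2 b3 by (intro add_mono mult_left_mono) auto
    also have "\<dots> = \<bar>k\<bar> * (e * C)" by (simp add: C_def algebra_simps)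
    also have "\<dots> \<le> \<bar>k\<bar> * \<epsilon>" using e(3) by (intro mult_left_mono) auto
    finally show "\<bar>X (t + k + h) (t + k) - X (t + h) t - k * Y h t\<bar> \<le> \<epsilon> * \<bar>k\<bar>" by (simp add: mult.commute)
  qed
qed

lemma A_diff_bound: "\<bar>A s - A t\<bar> \<le> modulus s t * (dist_H1 t 0 + dist_H1 s t) + Lnorm t * dist_H1 s t"
proof -
  have e: "A s - A t = Re (L s (w s) (wx s) - L t (w s) (wx s)) + Re (L t (\<lambda>x. u s x - u t x) (\<lambda>x. ux s x - ux t x))"
    unfolding A_def L_w_diff[of t s t, symmetric] minus_complex.sel by linarith
  have "\<bar>A s - A t\<bar> \<le> cmod (L s (w s) (wx s) - L t (w s) (wx s)) + cmod (L t (\<lambda>x. u s x - u t x) (\<lambda>x. ux s x - ux t x))"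
    unfolding e by (rule order_trans[OF abs_triangle_ineq]) (intro add_mono abs_Re_le_cmod)
  also have "\<dots> \<le> modulus s t * (l2norm (w s) + l2norm (wx s)) + Lnorm t * dist_H1 s t"
    by (intro add_mono L_diff_bound L_increment_bound w_sqi wx_sqi w_ac)
  also have "\<dots> \<le> modulus s t * (dist_H1 t 0 + dist_H1 s t) + Lnorm t * dist_H1 s t"
    unfolding w_norm using dist_H1_triangle[of s 0 t] modulus_nonneg by (intro add_right_mono mult_left_mono) auto
  finally show ?thesis .
qed

lemma A_continuous: "continuous_on S A"
proof -
  have "isCont A t" for t
  proof -
    have "((\<lambda>s. A s - A t) \<longlongrightarrow> 0) (at t)"
    proof (rule Lim_null_comparison)
      show "\<forall>\<^sub>F s in at t. norm (A s - A t) \<le> modulus s t * (dist_H1 t 0 + dist_H1 s t) + Lnorm t * dist_H1 s t"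
        using A_diff_bound by (intro always_eventually) simp
      have "((\<lambda>s. modulus s t * (dist_H1 t 0 + dist_H1 s t) + Lnorm t * dist_H1 s t) \<longlongrightarrow> 0 * (dist_H1 t 0 + 0) + Lnorm t * 0) (at t)"
        by (intro tendsto_intros modulus_tendsto dist_H1_tendsto)
      then show "((\<lambda>s. modulus s t * (dist_H1 t 0 + dist_H1 s t) + Lnorm t * dist_H1 s t) \<longlongrightarrow> 0) (at t)" by simp
    qed
    then show ?thesis unfolding isCont_def by (simp add: LIM_zero_iff)
  qed
  then show ?thesis by (intro continuous_at_imp_continuous_on) blast
qed

text \<open>Antisymmetry makes X vanish on the diagonal, so the quotient is a difference quotient of
  its first argument.\<close>

lemma X_boundary: "((\<lambda>h. X (\<tau> + h) \<tau> / h) \<longlongrightarrow> A \<tau>) (at_right 0)"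
proof -
  have X0: "X \<tau> \<tau> = 0" using X_commute[of \<tau> \<tau>] by simp
  have "((\<lambda>t. X t \<tau>) has_real_derivative A \<tau>) (at \<tau>)"
  proof (rule DERIV_of_small_increments)
    fix \<epsilon> :: real assume \<epsilon>: "\<epsilon> > 0"
    define e where "e = \<epsilon> / (dist_H1 \<tau> 0 + 1)"
    have e: "e > 0" "e * dist_H1 \<tau> 0 \<le> \<epsilon>"
    proof -
      have "\<epsilon> * dist_H1 \<tau> 0 \<le> \<epsilon> * (dist_H1 \<tau> 0 + 1)" using \<epsilon> by (intro mult_left_mono) auto
      then show "e > 0" "e * dist_H1 \<tau> 0 \<le> \<epsilon>" using \<epsilon> dist_H1_nonneg[of \<tau> 0] by (auto simp: e_def divide_le_eq)
    qed
    obtain d where d: "d > 0" "\<And>t \<phi> \<phi>'. \<bar>t - \<tau>\<bar> < d \<Longrightarrow> has_ac_deriv \<phi> \<phi>' \<Longrightarrow> sq_integrable \<phi> \<Longrightarrow> sq_integrable \<phi>' \<Longrightarrow>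
      cmod (pairing (\<lambda>x. \<i> * (u t x - u \<tau> x)) \<phi> - of_real (t - \<tau>) * L \<tau> \<phi> \<phi>') \<le> e * \<bar>t - \<tau>\<bar> * (l2norm \<phi> + l2norm \<phi>')"
      using increment_small[OF e(1), of \<tau>] by blast
    show "\<exists>\<delta>>0. \<forall>k. \<bar>k\<bar> < \<delta> \<longrightarrow> \<bar>X (\<tau> + k) \<tau> - X \<tau> \<tau> - k * A \<tau>\<bar> \<le> \<epsilon> * \<bar>k\<bar>"
    proof (intro exI[of _ d] conjI allI impI d(1))
      fix k assume k: "\<bar>k\<bar> < d"
      have "X (\<tau> + k) \<tau> - X \<tau> \<tau> - k * A \<tau> = Re (pairing (\<lambda>x. \<i> * (u (\<tau> + k) x - u \<tau> x)) (w \<tau>) - of_real k * L \<tau> (w \<tau>) (wx \<tau>))"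
        unfolding X_diff A_def by simp
      then have "\<bar>X (\<tau> + k) \<tau> - X \<tau> \<tau> - k * A \<tau>\<bar> \<le> cmod (pairing (\<lambda>x. \<i> * (u (\<tau> + k) x - u \<tau> x)) (w \<tau>) - of_real k * L \<tau> (w \<tau>) (wx \<tau>))"
        by (metis abs_Re_le_cmod)
      also have "\<dots> \<le> e * \<bar>k\<bar> * dist_H1 \<tau> 0"
        using d(2)[of "\<tau> + k" "w \<tau>" "wx \<tau>"] k w_ac by (simp add: w_norm)
      also have "\<dots> \<le> \<epsilon> * \<bar>k\<bar>" using mult_right_mono[OF e(2), of "\<bar>k\<bar>"] by (simp add: mult_ac)
      finally show "\<bar>X (\<tau> + k) \<tau> - X \<tau> \<tau> - k * A \<tau>\<bar> \<le> \<epsilon> * \<bar>k\<bar>" .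
    qed
  qed
  then have "((\<lambda>h. X (\<tau> + h) \<tau> / h) \<longlongrightarrow> A \<tau>) (at 0)" by (simp add: DERIV_def X0)
  then show ?thesis by (rule tendsto_within_subset) simp
qed

text \<open>The mixed terms of the linear expansion cancel. What remains is exactly the first-order
  part of twice the energy increment in \<open>energy_increment\<close>.\<close>

lemma A_Y_increment: "A (t + h) - A t - Y h t = Re (L (t + h) (\<lambda>x. u (t + h) x - u t x) (\<lambda>x. ux (t + h) x - ux t x)
   + L t (\<lambda>x. u (t + h) x - u t x) (\<lambda>x. ux (t + h) x - ux t x))"
  unfolding L_w_diff[of "t + h" "t + h" t, symmetric] L_w_diff[of t "t + h" t, symmetric] A_def Y_def
    plus_complex.sel minus_complex.sel by linarith

lemma energy_increment:
  assumes c: "c > 0" "\<And>x. c \<le> mass (u t) x" "\<And>x. c \<le> mass (u s) x" and small: "dist_H1 t s \<le> sqrt c / 2"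
    and M: "\<And>x. cmod (u t x) \<le> M" "\<And>x. cmod (u s x) \<le> M"
  shows "\<bar>2 * (energy_fn \<gamma> v (u t) - energy_fn \<gamma> v (u s))
     - Re (L t (\<lambda>x. u t x - u s x) (\<lambda>x. ux t x - ux s x) + L s (\<lambda>x. u t x - u s x) (\<lambda>x. ux t x - ux s x))\<bar>
     \<le> M\<^sup>2 * (l2norm (\<lambda>x. u t x - u s x))\<^sup>2"
proof -
  have sm: "cmod (u t x - u s x) \<le> sqrt c / 2" for x
    by (rule order_trans[OF sup_le_dist_H1 small])
  show ?thesis
    unfolding L_def
    using energy_fn_diff[where u="u t" and w="u s" and c=c and M=M and \<gamma>=\<gamma> and v=v, OF energy energy increment_sqi c sm M] .
qed

text \<open>The lower bound on the mass makes the momentum well defined and the increment formula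
  applicable. The time interval is open in order to leave room for the shift by h.\<close>

theorem energy_conservation:
  assumes c: "c > 0" "\<And>t x. lo < t \<Longrightarrow> t < hi \<Longrightarrow> c \<le> mass (u t) x" and ab: "a \<le> b" "lo < a" "b < hi"
  shows "energy_fn \<gamma> v (u a) = energy_fn \<gamma> v (u b)"
proof (rule conservation_calculus[where E="\<lambda>t. energy_fn \<gamma> v (u t)" and A=A and X=X and Y=Y, OF ab _ A_continuous X_deriv _ X_boundary])
  have sc: "sqrt c / 2 > 0" using c(1) by simp
  show "continuous_on {lo<..<hi} (\<lambda>t. energy_fn \<gamma> v (u t))"
  proof (rule continuous_at_imp_continuous_on, rule ballI)
    fix t assume t: "t \<in> {lo<..<hi}"
    define M where "M = sup_bound (u t) + 1"
    obtain d where d: "d > 0" "\<And>s. \<bar>s - t\<bar> < d \<Longrightarrow> dist_H1 s t < min 1 (sqrt c / 2)"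
      using dist_H1_small[of "min 1 (sqrt c / 2)" t] sc by auto
    define r where "r = min d (min (t - lo) (hi - t))"
    have r: "r > 0" using d t by (simp add: r_def)
    \<comment> \<open>Continuity of the energy in time also follows from the increment formula, with
      the first-order terms merely bounded.\<close>
    have bd: "\<bar>energy_fn \<gamma> v (u s) - energy_fn \<gamma> v (u t)\<bar> \<le> (2 * Lnorm t + modulus s t) * dist_H1 s t + M\<^sup>2 * (dist_H1 s t)\<^sup>2"
      if s: "\<bar>s - t\<bar> < r" for s
    proof -
      have sd: "dist_H1 s t < min 1 (sqrt c / 2)" using d(2) s by (simp add: r_def)
      have cs: "c \<le> mass (u s) x" "c \<le> mass (u t) x" for x using c(2) s t by (auto simp: r_def)
      have ut: "cmod (u t x) \<le> M" for x using energy_space_bounded[OF energy, of t x] by (simp add: M_def)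
      have us: "cmod (u s x) \<le> M" for x
        using energy_space_bounded[OF energy, of t x] sup_le_dist_H1[of s x t] sd norm_triangle_sub[of "u s x" "u t x"] by (simp add: M_def)
      have small: "dist_H1 s t \<le> sqrt c / 2" using sd by simp
      let ?Ls = "L s (\<lambda>x. u s x - u t x) (\<lambda>x. ux s x - ux t x)" and ?Lt = "L t (\<lambda>x. u s x - u t x) (\<lambda>x. ux s x - ux t x)"
      have 1: "\<bar>2 * (energy_fn \<gamma> v (u s) - energy_fn \<gamma> v (u t)) - Re (?Ls + ?Lt)\<bar> \<le> M\<^sup>2 * (l2norm (\<lambda>x. u s x - u t x))\<^sup>2"
        by (rule energy_increment[OF c(1) cs(1) cs(2) small us ut])
      have 2: "\<bar>Re (?Ls + ?Lt)\<bar> \<le> (Lnorm s + Lnorm t) * dist_H1 s t"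
        using abs_Re_le_cmod[of "?Ls + ?Lt"] norm_triangle_ineq[of ?Ls ?Lt] L_increment_bound[of s s t] L_increment_bound[of t s t]
        unfolding distrib_right by linarith
      have 3: "(Lnorm s + Lnorm t) * dist_H1 s t \<le> (2 * Lnorm t + modulus s t) * dist_H1 s t"
        using Lnorm_triangle[of s t] dist_H1_nonneg by (intro mult_right_mono) auto
      have 4: "M\<^sup>2 * (l2norm (\<lambda>x. u s x - u t x))\<^sup>2 \<le> M\<^sup>2 * (dist_H1 s t)\<^sup>2"
        by (intro mult_left_mono power_mono) (auto simp: dist_H1_def)
      have "\<bar>2 * (energy_fn \<gamma> v (u s) - energy_fn \<gamma> v (u t))\<bar> \<le> (2 * Lnorm t + modulus s t) * dist_H1 s t + M\<^sup>2 * (dist_H1 s t)\<^sup>2"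
        using 1 2 3 4 by linarith
      moreover have "\<bar>2 * a\<bar> \<le> b \<Longrightarrow> \<bar>a\<bar> \<le> b" for a b :: real by linarith
      ultimately show ?thesis by blast
    qed
    have "((\<lambda>s. energy_fn \<gamma> v (u s) - energy_fn \<gamma> v (u t)) \<longlongrightarrow> 0) (at t)"
    proof (rule Lim_null_comparison)
      show "\<forall>\<^sub>F s in at t. norm (energy_fn \<gamma> v (u s) - energy_fn \<gamma> v (u t)) \<le> (2 * Lnorm t + modulus s t) * dist_H1 s t + M\<^sup>2 * (dist_H1 s t)\<^sup>2"
        unfolding eventually_at using r bd by (intro exI[of _ r]) (simp add: dist_real_def)
      have "((\<lambda>s. (2 * Lnorm t + modulus s t) * dist_H1 s t + M\<^sup>2 * (dist_H1 s t)\<^sup>2) \<longlongrightarrow> (2 * Lnorm t + 0) * 0 + M\<^sup>2 * 0\<^sup>2) (at t)"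
        by (intro tendsto_intros modulus_tendsto dist_H1_tendsto)
      then show "((\<lambda>s. (2 * Lnorm t + modulus s t) * dist_H1 s t + M\<^sup>2 * (dist_H1 s t)\<^sup>2) \<longlongrightarrow> 0) (at t)" by simp
    qed
    then show "isCont (\<lambda>t. energy_fn \<gamma> v (u t)) t" unfolding isCont_def by (simp add: LIM_zero_iff)
  qed
  fix \<epsilon> :: real assume \<epsilon>: "\<epsilon> > 0"
  obtain K where K: "K > 0" "\<And>t. t \<in> {a..b + 1} \<Longrightarrow> norm (dist_H1 t a) \<le> K"
    using continuous_bounded_on_interval[OF dist_H1_continuous] by blast
  define M where "M = sup_bound (u a) + K"
  have M: "M \<ge> 1" using K sup_bound_pos[of "u a"] by (simp add: M_def)
  have uM: "cmod (u t x) \<le> M" if "t \<in> {a..b + 1}" for t x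
    using energy_space_bounded[OF energy, of a x] sup_le_dist_H1[of t x a] K(2)[OF that] norm_triangle_sub[of "u t x" "u a x"] by (simp add: M_def)
  \<comment> \<open>Compensates the factor M^2 in front of the quadratic remainder.\<close>
  define e where "e = \<epsilon> / M\<^sup>2"
  have e: "e > 0" "M\<^sup>2 * e = \<epsilon>" using \<epsilon> M by (auto simp: e_def)
  obtain d1 where d1: "d1 > 0" "\<And>t h. t \<in> {a..b} \<Longrightarrow> \<bar>h\<bar> < d1 \<Longrightarrow> (l2norm (\<lambda>x. u (t + h) x - u t x))\<^sup>2 \<le> e * \<bar>h\<bar>"
    using increment_small_uniform[OF e(1)] by blast
  \<comment> \<open>The two tolerances bound the increment and its derivative by sqrt c / 4 each,
    hence by sqrt c / 2 in H^1, as \<open>energy_increment\<close> requires.\<close>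
  have c16: "c / 16 > 0" "sqrt c / 4 > 0" using c(1) by auto
  obtain d2 where d2: "d2 > 0" "\<And>t h. t \<in> {a..b} \<Longrightarrow> \<bar>h\<bar> < d2 \<Longrightarrow> (l2norm (\<lambda>x. u (t + h) x - u t x))\<^sup>2 \<le> c / 16 * \<bar>h\<bar>"
    using increment_small_uniform[OF c16(1)] by blast
  obtain d3 where d3: "d3 > 0" "\<And>t \<tau>. t \<in> {a..b} \<Longrightarrow> \<bar>\<tau> - t\<bar> < d3 \<Longrightarrow> modulus \<tau> t < sqrt c / 4"
    using modulus_uniform[OF c16(2)] by blast
  define h0 where "h0 = min (min d1 d2) (min d3 (min 1 (hi - b)))"
  have h0: "h0 > 0" using d1 d2 d3 ab by (simp add: h0_def)
  show "\<exists>h0>0. \<forall>h t. 0 < h \<and> h < h0 \<and> t \<in> {a..b} \<longrightarrow>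
     \<bar>2 * (energy_fn \<gamma> v (u (t + h)) - energy_fn \<gamma> v (u t)) - (A (t + h) - A t - Y h t)\<bar> \<le> \<epsilon> * h"
  proof (intro exI[of _ h0] conjI allI impI h0)
    fix h t assume ht: "0 < h \<and> h < h0 \<and> t \<in> {a..b}"
    have cs: "c \<le> mass (u (t + h)) x" "c \<le> mass (u t) x" for x using c(2) ht ab by (auto simp: h0_def)
    have "(l2norm (\<lambda>x. u (t + h) x - u t x))\<^sup>2 \<le> c / 16 * h" using d2(2)[of t h] ht by (simp add: h0_def)
    also have "\<dots> \<le> c / 16 * 1" using ht c(1) by (intro mult_left_mono) (auto simp: h0_def)
    also have "\<dots> = (sqrt c / 4)\<^sup>2" using c(1) by (simp add: power_divide)
    finally have "l2norm (\<lambda>x. u (t + h) x - u t x) \<le> sqrt c / 4" by (rule power2_le_imp_le) (use c(1) in simp)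
    moreover have "l2norm (\<lambda>x. ux (t + h) x - ux t x) \<le> sqrt c / 4"
      using deriv_le_modulus[of "t + h" t] d3(2)[of t "t + h"] ht by (simp add: h0_def)
    ultimately have small: "dist_H1 (t + h) t \<le> sqrt c / 2" by (simp add: dist_H1_def)
    have "\<bar>2 * (energy_fn \<gamma> v (u (t + h)) - energy_fn \<gamma> v (u t)) - (A (t + h) - A t - Y h t)\<bar> \<le> M\<^sup>2 * (l2norm (\<lambda>x. u (t + h) x - u t x))\<^sup>2"
      unfolding A_Y_increment
      by (rule energy_increment[OF c(1) cs(1) cs(2) small]; rule uM) (use ht in \<open>auto simp: h0_def\<close>)
    also have "\<dots> \<le> M\<^sup>2 * (e * h)" using d1(2)[of t h] ht by (intro mult_left_mono) (auto simp: h0_def)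
    also have "\<dots> = \<epsilon> * h" using e(2) by (metis mult.assoc)
    finally show "\<bar>2 * (energy_fn \<gamma> v (u (t + h)) - energy_fn \<gamma> v (u t)) - (A (t + h) - A t - Y h t)\<bar> \<le> \<epsilon> * h" .
  qed
qed

end

section \<open>The stationary profile\<close>

text \<open>Since \<open>sqrt\<close> is odd, for v^2 \<ge> 2 the argument of tanh is nonpositive,
  and the right-hand side of the equation cannot be positive.\<close>

lemma xi_equation_imp_subsonic:
  assumes "0 < \<gamma>" "0 < \<xi>" "xi_equation \<gamma> v \<xi>"
  shows "v\<^sup>2 < 2"
proof (rule ccontr)
  assume "\<not> v\<^sup>2 < 2"
  then have "sqrt (1 / 2 - v\<^sup>2 / 4) \<le> 0" by simp
  then have "sqrt (1 / 2 - v\<^sup>2 / 4) * \<xi> \<le> 0" using assms(2) by (simp add: mult_le_0_iff)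
  then have t: "tanh (sqrt (1 / 2 - v\<^sup>2 / 4) * \<xi>) \<le> 0" by simp
  have "tanh (sqrt (1 / 2 - v\<^sup>2 / 4) * \<xi>) / (v\<^sup>2 / 2 + (sinh (sqrt (1 / 2 - v\<^sup>2 / 4) * \<xi>))\<^sup>2) \<le> 0"
    using t by (intro divide_nonpos_nonneg) auto
  then have "sqrt 2 * (1 - v\<^sup>2 / 2) powr (3 / 2) * (tanh (sqrt (1 / 2 - v\<^sup>2 / 4) * \<xi>) / (v\<^sup>2 / 2 + (sinh (sqrt (1 / 2 - v\<^sup>2 / 4) * \<xi>))\<^sup>2)) \<le> 0"
    by (intro mult_nonneg_nonpos) auto
  then show False using assms unfolding xi_equation_def by linarith
qed

lemma energy_spaceI:
  assumes u: "has_ac_deriv u g" and g: "sq_integrable g" and m: "sq_integrable (\<lambda>x. 1 - (cmod (u x))\<^sup>2)"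
  shows "u \<in> energy_space" "AE x in lborel. weak_deriv u x = g x" "weak_deriv u \<in> borel_measurable borel"
proof -
  show ae: "AE x in lborel. weak_deriv u x = g x" by (rule ac_weak_deriv(2)[OF u])
  show wm: "weak_deriv u \<in> borel_measurable borel" using ac_borel[OF ac_weak_deriv(1)[OF u]] .
  note [measurable] = wm sqi_borel[OF g] ac_borel_fun[OF u]
  have c: "continuous_on UNIV u" by (rule ac_continuous[OF u])
  have "integrable lborel (\<lambda>x. (cmod (weak_deriv u x))\<^sup>2)"
    by (rule integrable_cong_AE_imp[of _ "\<lambda>x. (cmod (g x))\<^sup>2"])
      (use g ae in \<open>auto simp: sq_integrable_def elim!: eventually_mono\<close>)
  then have 1: "in_L2 (weak_deriv u)" by (simp add: in_L2_def)
  have 2: "in_L2_loc u" unfolding in_L2_loc_def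
  proof (intro conjI allI)
    show "u \<in> borel_measurable lborel" by simp
    show "set_integrable lborel {a..b} (\<lambda>x. (cmod (u x))\<^sup>2)" for a b
      by (rule set_integrable_continuous) (intro continuous_intros c)
  qed
  have 3: "in_L2_loc g" unfolding in_L2_loc_def
  proof (intro conjI allI)
    show "g \<in> borel_measurable lborel" by simp
    show "set_integrable lborel {a..b} (\<lambda>x. (cmod (g x))\<^sup>2)" for a b
      unfolding set_integrable_def using g by (intro integrable_mult_indicator) (auto simp: sq_integrable_def)
  qed
  have "(\<lambda>x. (cmod (complex_of_real (1 - (cmod (u x))\<^sup>2)))\<^sup>2) = (\<lambda>x. (norm (1 - (cmod (u x))\<^sup>2))\<^sup>2)"
    by (simp only: norm_of_real real_norm_def)
  then have 4: "in_L2 (\<lambda>x. complex_of_real (1 - (cmod (u x))\<^sup>2))"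
    using m unfolding in_L2_def sq_integrable_def by simp
  show "u \<in> energy_space"
    unfolding energy_space_def in_H1_loc_def using c 1 2 3 4 ac_imp_has_weak_deriv[OF u] by blast
qed

text \<open>The exponential distribution gives integrability on the right half-line, its reflection
  on the left one.\<close>

lemma integrable_exp_abs:
  assumes a: "a > 0"
  shows "integrable lborel (\<lambda>x::real. exp (- a * \<bar>x\<bar>))"
proof -
  interpret prob_space "density lborel (exponential_density a)"
    by (rule prob_space_exponential_density[OF a])
  have "emeasure (density lborel (exponential_density a)) UNIV = 1" using emeasure_space_1 by simp
  then have "(\<integral>\<^sup>+ x. ennreal (exponential_density a x) \<partial>lborel) = 1" by (simp add: emeasure_density)
  then have i: "integrable lborel (exponential_density a)"
    by (intro integrableI_nonneg) (auto simp: exponential_density_nonneg[OF a])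
  have i2: "integrable lborel (\<lambda>x. exponential_density a (- x))"
    using lborel_integrable_real_affine_iff[of "-1" "exponential_density a" 0] i by simp
  have "integrable lborel (\<lambda>x. (1 / a) * (exponential_density a x + exponential_density a (- x)))"
    using i i2 by simp
  then show ?thesis
  proof (rule Bochner_Integration.integrable_bound)
    show "AE x in lborel. norm (exp (- a * \<bar>x\<bar>)) \<le> norm ((1 / a) * (exponential_density a x + exponential_density a (- x)))"
    proof (rule AE_I2)
      fix x :: real
      have "a * exp (- a * \<bar>x\<bar>) \<le> exponential_density a x + exponential_density a (- x)"
        using a by (simp add: erlang_density_def mult.commute abs_if)
      then have "exp (- a * \<bar>x\<bar>) \<le> (1 / a) * (exponential_density a x + exponential_density a (- x))"
        using a by (simp add: field_simps)
      then show "norm (exp (- a * \<bar>x\<bar>)) \<le> norm ((1 / a) * (exponential_density a x + exponential_density a (- x)))"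
        unfolding real_norm_def abs_exp_cancel by (rule order_trans[OF _ abs_ge_self])
    qed
  qed simp
qed

text \<open>The weight 1 + sqrt|x| is the growth that \<open>ac_holder\<close> allows; the
  exponential decay of the derivative of the profile absorbs it.\<close>

lemma sqi_weighted_exp:
  assumes a: "a > 0"
  shows "sq_integrable (\<lambda>x::real. (1 + sqrt \<bar>x\<bar>) * exp (- a * \<bar>x\<bar>))"
proof -
  have le: "((1 + sqrt \<bar>x\<bar>) * exp (- a * \<bar>x\<bar>))\<^sup>2 \<le> (2 + 2 / a) * exp (- a * \<bar>x\<bar>)" for x :: real
  proof -
    have "(1 + sqrt \<bar>x\<bar>)\<^sup>2 \<le> 2 + 2 * \<bar>x\<bar>"
      using sum_squares_bound[of 1 "sqrt \<bar>x\<bar>"] by (simp add: power2_sum)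
    moreover have "\<bar>x\<bar> \<le> exp (a * \<bar>x\<bar>) / a"
    proof -
      have "a * \<bar>x\<bar> \<le> exp (a * \<bar>x\<bar>)" using exp_ge_add_one_self[of "a * \<bar>x\<bar>"] by linarith
      then show ?thesis using a by (simp add: pos_le_divide_eq mult.commute)
    qed
    moreover have "1 \<le> exp (a * \<bar>x\<bar>)" using a by simp
    moreover have "(2 + 2 / a) * exp (a * \<bar>x\<bar>) = 2 * exp (a * \<bar>x\<bar>) + 2 * (exp (a * \<bar>x\<bar>) / a)" by (simp add: field_simps)
    ultimately have "(1 + sqrt \<bar>x\<bar>)\<^sup>2 \<le> (2 + 2 / a) * exp (a * \<bar>x\<bar>)" by linarith
    then have "(1 + sqrt \<bar>x\<bar>)\<^sup>2 * (exp (- a * \<bar>x\<bar>))\<^sup>2 \<le> (2 + 2 / a) * exp (a * \<bar>x\<bar>) * (exp (- a * \<bar>x\<bar>))\<^sup>2"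
      by (rule mult_right_mono) simp
    also have "\<dots> = (2 + 2 / a) * exp (- a * \<bar>x\<bar>)" by (simp add: power2_eq_square exp_minus field_simps)
    finally show ?thesis by (simp add: power_mult_distrib)
  qed
  have i: "integrable lborel (\<lambda>x::real. (2 + 2 / a) * exp (- a * \<bar>x\<bar>))" using integrable_exp_abs[OF a] by simp
  show ?thesis unfolding sq_integrable_def
  proof
    show "(\<lambda>x::real. (1 + sqrt \<bar>x\<bar>) * exp (- a * \<bar>x\<bar>)) \<in> borel_measurable borel" by measurable
    show "integrable lborel (\<lambda>x. (norm ((1 + sqrt \<bar>x\<bar>) * exp (- a * \<bar>x\<bar>)))\<^sup>2)"
    proof (rule Bochner_Integration.integrable_bound[OF i])
      show "AE x in lborel. norm ((norm ((1 + sqrt \<bar>x\<bar>) * exp (- a * \<bar>x\<bar>)))\<^sup>2) \<le> norm ((2 + 2 / a) * exp (- a * \<bar>x\<bar>))"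
        using le a by (intro AE_I2) (simp add: abs_mult[symmetric] abs_of_nonneg)
    qed measurable
  qed
qed

text \<open>Unlike \<open>sgn\<close> it takes the value 1 at the origin, so that its square is 1
  everywhere and pointwise identities need no exceptional point.\<close>

definition sg :: "real \<Rightarrow> real" where "sg x = (if 0 \<le> x then 1 else - 1)"

lemma sg_borel [measurable]: "sg \<in> borel_measurable borel"
  unfolding sg_def[abs_def] by measurable

lemma sg_simps [simp]: "\<bar>sg x\<bar> = 1" "sg x * sg x = 1" "(sg x)\<^sup>2 = 1" "sg x * (sg x * y) = y"
  by (auto simp: sg_def)

lemma abs_ac: "has_ac_deriv (\<lambda>x::real. \<bar>x\<bar>) sg"
proof (rule ac_exceptional[of "{0}"])
  show "continuous_on UNIV (\<lambda>x::real. \<bar>x\<bar>)" by (intro continuous_intros)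
  show "((\<lambda>x. \<bar>x\<bar>) has_vector_derivative sg x) (at x)" if "x \<notin> {0}" for x
  proof (cases "x > 0")
    case True
    have "((\<lambda>x. x) has_vector_derivative 1) (at x)" by simp
    then show ?thesis
      using has_vector_derivative_transform_within_open[of "\<lambda>x. x" 1 x "{0<..}" "\<lambda>x. \<bar>x\<bar>"] True by (auto simp: sg_def)
  next
    case False
    have "((\<lambda>x. - x) has_vector_derivative - 1) (at x)" by (auto intro!: derivative_eq_intros)
    then show ?thesis
      using has_vector_derivative_transform_within_open[of "\<lambda>x. - x" "-1" x "{..<0}" "\<lambda>x. \<bar>x\<bar>"] False that by (auto simp: sg_def)
  qed
  show "sg \<in> borel_measurable borel" by measurable
  show "set_integrable lborel {a..b} sg" for a b
    by (rule set_integrable_dominated[of _ _ "\<lambda>x. 1::real" _ 1]) (auto intro: set_integrable_continuous)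
qed simp

locale profile =
  fixes \<gamma> v \<xi>1 \<xi>2 :: real
  assumes \<gamma>: "0 < \<gamma>" and v: "0 < v" and v2: "v\<^sup>2 < 2" and \<xi>2: "0 < \<xi>2" and \<xi>12: "\<xi>2 < \<xi>1"
    and eq1: "xi_equation \<gamma> v \<xi>1" and eq2: "xi_equation \<gamma> v \<xi>2"
begin

section \<open>Parameters of the profile and the cubic\<close>

definition c :: real where "c = 1 - v\<^sup>2 / 2"
definition k :: real where "k = sqrt ((2 - v\<^sup>2) / 4)"
definition \<tau>1 :: real where "\<tau>1 = tanh (k * \<xi>1)"
definition \<tau>2 :: real where "\<tau>2 = tanh (k * \<xi>2)"

lemma c_pos: "0 < c" and c_le_1: "c \<le> 1" using v2 by (auto simp: c_def)
lemma k_pos: "0 < k" using v2 by (simp add: k_def)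
lemma k_sq: "k * k = c / 2" using v2 by (simp add: k_def c_def field_simps)
lemma v2_eq: "v\<^sup>2 / 2 = 1 - c" by (simp add: c_def)

lemma \<tau>_order: "0 < \<tau>2" "\<tau>2 < \<tau>1" "\<tau>1 < 1"
  using k_pos \<xi>2 \<xi>12 by (auto simp: \<tau>1_def \<tau>2_def tanh_real_lt_1)

definition mfun :: "real \<Rightarrow> real" where "mfun T = v\<^sup>2 / 2 + c * T\<^sup>2"

lemma mfun_pos: "0 < mfun T"
  using v c_pos by (simp add: mfun_def add_pos_nonneg)

text \<open>A zero expresses the jump condition at the origin: the modulus \<rho> has \<rho> \<rho>'
  = k c T (1 - T^2) on the right and the opposite value on the left, and the delta potential asks
  the jump of \<rho>' to be \<gamma> \<rho>.\<close>

definition pol :: "real \<Rightarrow> real" where "pol T = \<gamma> * mfun T - 2 * k * c * T * (1 - T\<^sup>2)"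

text \<open>In terms of T = tanh (k \<xi>) the denominator v^2/2 + sinh^2 equals m cosh^2, and 1 /
  cosh^2 = 1 - T^2.\<close>

lemma xi_equation_pol:
  assumes "xi_equation \<gamma> v \<xi>" "0 < \<xi>"
  shows "pol (tanh (k * \<xi>)) = 0"
proof -
  have k': "sqrt (1 / 2 - v\<^sup>2 / 4) = k" by (simp add: k_def field_simps)
  have c': "(1 - v\<^sup>2 / 2) powr (3 / 2) = c * sqrt c"
  proof -
    have "c powr (3 / 2) = c powr (1 + 1 / 2)" by simp
    also have "\<dots> = c powr 1 * c powr (1 / 2)" by (rule powr_add)
    also have "\<dots> = c * sqrt c" using c_pos by (simp add: powr_half_sqrt)
    finally show ?thesis by (simp add: c_def)
  qed
  have s2: "sqrt 2 * (c * sqrt c) = 2 * k * c"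
  proof -
    have "sqrt 2 * sqrt c = 2 * k"
    proof -
      have "2 * k = sqrt (4 * ((2 - v\<^sup>2) / 4))" unfolding real_sqrt_mult k_def by simp
      also have "4 * ((2 - v\<^sup>2) / 4) = 2 * c" by (simp add: c_def)
      finally show ?thesis by (simp add: real_sqrt_mult)
    qed
    then show ?thesis by (simp add: algebra_simps)
  qed
  define y where "y = k * \<xi>"
  define t where "t = tanh y"
  have ch: "cosh y > 0" by simp
  have tc: "t * cosh y = sinh y" using ch by (simp add: t_def tanh_def)
  have "(1 - t\<^sup>2) * (cosh y)\<^sup>2 = (cosh y)\<^sup>2 - (t * cosh y)\<^sup>2" by (simp only: power_mult_distrib left_diff_distrib mult_1)
  then have t2: "(1 - t\<^sup>2) * (cosh y)\<^sup>2 = 1" unfolding tc by (simp add: cosh_square_eq)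
  from tc have sh: "(sinh y)\<^sup>2 = t\<^sup>2 * (cosh y)\<^sup>2" by (metis power_mult_distrib)
  have den: "v\<^sup>2 / 2 + (sinh y)\<^sup>2 = mfun t * (cosh y)\<^sup>2"
  proof -
    have "mfun t * (cosh y)\<^sup>2 = v\<^sup>2 / 2 * ((1 - t\<^sup>2) * (cosh y)\<^sup>2) + t\<^sup>2 * (cosh y)\<^sup>2"
      by (simp add: mfun_def c_def algebra_simps)
    then show ?thesis unfolding t2 sh by simp
  qed
  have "\<gamma> = 2 * k * c * (t / (mfun t * (cosh y)\<^sup>2))"
    using assms(1) unfolding xi_equation_def k' c' s2 by (simp add: y_def[symmetric] t_def[symmetric] den)
  then have "\<gamma> * mfun t * (cosh y)\<^sup>2 = 2 * k * c * t" using mfun_pos[of t] ch by (simp add: field_simps)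
  then have "pol t * (cosh y)\<^sup>2 = 2 * k * c * t - 2 * k * c * t * ((1 - t\<^sup>2) * (cosh y)\<^sup>2)"
    by (simp add: pol_def algebra_simps)
  then have "pol t * (cosh y)\<^sup>2 = 0" unfolding t2 by simp
  then show ?thesis using ch by (simp add: t_def y_def)
qed

text \<open>Division by the two known roots in turn. The third root -(\<tau>1 + \<tau>2) - \<gamma>
  / (2 k) is negative, so to the right of \<tau>2 the cubic has the sign of T - \<tau>1.\<close>

lemma pol_factor: "pol T = (T - \<tau>1) * (T - \<tau>2) * (2 * k * c * (T + \<tau>1 + \<tau>2) + \<gamma> * c)"
proof -
  have p1: "pol \<tau>1 = 0" and p2: "pol \<tau>2 = 0"
    using xi_equation_pol eq1 eq2 \<xi>2 \<xi>12 by (auto simp: \<tau>1_def \<tau>2_def)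
  define b where "b T = 2 * k * c * (T\<^sup>2 + T * \<tau>1 + \<tau>1\<^sup>2) + \<gamma> * c * (T + \<tau>1) - 2 * k * c" for T
  have e: "pol T - pol \<tau>1 = (T - \<tau>1) * b T" for T
    by (simp add: pol_def mfun_def b_def power2_eq_square algebra_simps)
  have "(\<tau>2 - \<tau>1) * b \<tau>2 = 0" using e[of \<tau>2] p1 p2 by simp
  then have b2: "b \<tau>2 = 0" using \<tau>_order by simp
  have "b T - b \<tau>2 = (T - \<tau>2) * (2 * k * c * (T + \<tau>1 + \<tau>2) + \<gamma> * c)"
    by (simp add: b_def power2_eq_square algebra_simps)
  then show ?thesis using e[of T] p1 b2 by (simp add: mult.assoc)
qed

section \<open>The profile, its phase and its logarithmic derivative\<close>

definition Tp :: "real \<Rightarrow> real" where "Tp x = tanh (k * (\<bar>x\<bar> + \<xi>1))"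
definition Tp' :: "real \<Rightarrow> real" where "Tp' x = sg x * k * (1 - (Tp x)\<^sup>2)"

lemma Tp_bounds: "\<tau>1 \<le> Tp x" "Tp x < 1" "0 < Tp x"
proof -
  have "k * \<xi>1 \<le> k * (\<bar>x\<bar> + \<xi>1)" using k_pos by simp
  then show "\<tau>1 \<le> Tp x" by (simp add: Tp_def \<tau>1_def)
  then show "0 < Tp x" using \<tau>_order by linarith
  show "Tp x < 1" by (simp add: Tp_def tanh_real_lt_1)
qed

lemma Tp_0: "Tp 0 = \<tau>1"
  by (simp add: Tp_def \<tau>1_def)

lemma Tp_ac: "has_ac_deriv Tp Tp'"
proof -
  have 1: "has_ac_deriv (\<lambda>x. \<bar>x\<bar> + \<xi>1) (\<lambda>x. sg x + 0)" by (rule ac_add[OF abs_ac ac_const])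
  have 2: "has_ac_deriv (\<lambda>x. k * (\<bar>x\<bar> + \<xi>1)) (\<lambda>x. k * (sg x + 0))"
    by (rule ac_bounded_linear[OF 1 bounded_linear_mult_right])
  have "has_ac_deriv (\<lambda>x. tanh (k * (\<bar>x\<bar> + \<xi>1))) (\<lambda>x. (1 - (tanh (k * (\<bar>x\<bar> + \<xi>1)))\<^sup>2) * (k * (sg x + 0)))"
  proof (rule ac_compose[OF 2, where U=UNIV and \<Phi>'="\<lambda>z. 1 - (tanh z)\<^sup>2"])
    show "(tanh has_field_derivative 1 - (tanh z)\<^sup>2) (at z)" for z :: real
      by (auto intro!: derivative_eq_intros)
    show "continuous_on UNIV (\<lambda>z::real. 1 - (tanh z)\<^sup>2)" by (intro continuous_intros) auto
  qed auto
  moreover have "(\<lambda>x. (1 - (tanh (k * (\<bar>x\<bar> + \<xi>1)))\<^sup>2) * (k * (sg x + 0))) = Tp'"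
    by (auto simp: Tp'_def Tp_def mult_ac)
  ultimately show ?thesis by (simp add: Tp_def[abs_def])
qed

text \<open>Both bounds come from 1 - tanh^2 = 1 / cosh^2, the upper one with cosh y \<ge> exp y /
  2.\<close>

lemma Tp_decay: "1 - (Tp x)\<^sup>2 \<le> 4 * exp (- (2 * k) * \<bar>x\<bar>)" "0 \<le> 1 - (Tp x)\<^sup>2"
proof -
  define y where "y = k * (\<bar>x\<bar> + \<xi>1)"
  have ch: "cosh y > 0" by simp
  have Ty: "Tp x * cosh y = sinh y" using ch by (simp add: Tp_def y_def tanh_def)
  have "(1 - (Tp x)\<^sup>2) * (cosh y)\<^sup>2 = (cosh y)\<^sup>2 - (Tp x * cosh y)\<^sup>2" by (simp only: power_mult_distrib left_diff_distrib mult_1)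
  then have "(1 - (Tp x)\<^sup>2) * (cosh y)\<^sup>2 = 1" unfolding Ty by (simp add: cosh_square_eq)
  then have e: "1 - (Tp x)\<^sup>2 = 1 / (cosh y)\<^sup>2"
    using ch by (metis nonzero_eq_divide_eq less_irrefl power_not_zero)
  have "exp (k * \<bar>x\<bar>) / 2 \<le> cosh y"
  proof -
    have "exp (k * \<bar>x\<bar>) \<le> exp y" using k_pos \<xi>2 \<xi>12 by (simp add: y_def algebra_simps)
    then show ?thesis by (simp add: cosh_def field_simps add_increasing2)
  qed
  then have "(exp (k * \<bar>x\<bar>) / 2)\<^sup>2 \<le> (cosh y)\<^sup>2" by (rule power_mono) simp
  then have "1 / (cosh y)\<^sup>2 \<le> 1 / (exp (k * \<bar>x\<bar>) / 2)\<^sup>2" by (intro divide_left_mono) auto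
  also have "\<dots> = 4 * exp (- (2 * k) * \<bar>x\<bar>)"
    by (simp add: power_divide exp_double[symmetric] exp_minus field_simps)
  finally show "1 - (Tp x)\<^sup>2 \<le> 4 * exp (- (2 * k) * \<bar>x\<bar>)" unfolding e .
  show "0 \<le> 1 - (Tp x)\<^sup>2" unfolding e by simp
qed

definition \<rho> :: "real \<Rightarrow> real" where "\<rho> x = sqrt (mfun (Tp x))"
definition up :: "real \<Rightarrow> complex" where "up = stat_sol v \<xi>1"
definition \<theta> :: "real \<Rightarrow> real" where "\<theta> = stat_theta v \<xi>1"
text \<open>The value of u_x / u that the two first-order equations prescribe where T and the sign s
  of x are given: real part m_x / (2 m), imaginary part current / mass.\<close>

definition Gh :: "real \<Rightarrow> real \<Rightarrow> complex" where
  "Gh s T = of_real (c * (1 - T\<^sup>2) / mfun T) * Complex (s * k * T) (- v / 2)"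

lemma \<rho>_pos: "0 < \<rho> x" and \<rho>_sq: "(\<rho> x)\<^sup>2 = mfun (Tp x)"
  using mfun_pos by (auto simp: \<rho>_def less_imp_le)

lemma stat_r_eq: "1 + stat_r v \<xi>1 x = \<rho> x"
proof -
  have "(tanh (k * (if 0 \<le> x then x + \<xi>1 else x - \<xi>1)))\<^sup>2 = (Tp x)\<^sup>2"
  proof (cases "0 \<le> x")
    case False
    then have "k * (x - \<xi>1) = - (k * (\<bar>x\<bar> + \<xi>1))" by (simp add: algebra_simps)
    then show ?thesis using False by (simp add: Tp_def)
  qed (simp add: Tp_def)
  then show ?thesis by (simp add: stat_r_def \<rho>_def mfun_def k_def[symmetric] c_def)
qed

lemma Tp_continuous: "continuous_on S Tp" by (rule ac_continuous[OF Tp_ac])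

lemma mfun_continuous: "continuous_on S f \<Longrightarrow> continuous_on S (\<lambda>x. mfun (f x))"
  unfolding mfun_def by (intro continuous_intros)

definition \<theta>' :: "real \<Rightarrow> real" where "\<theta>' x = v / 2 * (1 - 1 / mfun (Tp x))"

lemma \<theta>'_continuous: "continuous_on S \<theta>'"
  unfolding \<theta>'_def using mfun_pos by (intro continuous_intros mfun_continuous Tp_continuous) (auto simp: less_imp_neq[symmetric])

text \<open>\<open>stat_theta\<close> is a definite description, so existence and uniqueness of the
  normalized primitive must both be shown before anything is known about it.\<close>

lemma \<theta>_deriv: "(\<theta> has_real_derivative \<theta>' x) (at x)" and \<theta>_0: "\<theta> 0 = 0"
proof -
  have e: "v / 2 * (1 - 1 / (1 + stat_r v \<xi>1 x)\<^sup>2) = \<theta>' x" for x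
    unfolding stat_r_eq \<rho>_sq \<theta>'_def ..
  have "\<exists>F. \<forall>x. - \<infinity> < ereal x \<longrightarrow> ereal x < \<infinity> \<longrightarrow> (F has_vector_derivative \<theta>' x) (at x)"
    by (rule einterval_antiderivative) (use \<theta>'_continuous[of UNIV] in \<open>auto simp: continuous_on_eq_continuous_at\<close>)
  then obtain F where F: "\<And>x. (F has_real_derivative \<theta>' x) (at x)"
    by (auto simp: has_real_derivative_iff_has_vector_derivative)
  have "\<exists>!f. f 0 = 0 \<and> (\<forall>x. (f has_real_derivative \<theta>' x) (at x))"
  proof (rule ex1I[of _ "\<lambda>x. F x - F 0"])
    show "F 0 - F 0 = 0 \<and> (\<forall>x. ((\<lambda>x. F x - F 0) has_real_derivative \<theta>' x) (at x))"
      using F by (auto intro!: derivative_eq_intros)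
    fix f assume f: "f 0 = 0 \<and> (\<forall>x. (f has_real_derivative \<theta>' x) (at x))"
    have "((\<lambda>x. f x - F x) has_real_derivative 0) (at x)" for x
      using DERIV_diff[OF f[THEN conjunct2, rule_format] F, of x] by simp
    then have "f x - F x = f 0 - F 0" for x by (rule DERIV_isconst_all[rule_format])
    then show "f = (\<lambda>x. F x - F 0)" using f by (auto simp: fun_eq_iff algebra_simps)
  qed
  from theI'[OF this] show "(\<theta> has_real_derivative \<theta>' x) (at x)" "\<theta> 0 = 0"
    unfolding \<theta>_def stat_theta_def e by auto
qed

lemma up_eq: "up x = of_real (\<rho> x) * exp (\<i> * of_real (\<theta> x))"
  by (simp add: up_def stat_sol_def stat_r_eq \<theta>_def)

lemma cmod_up: "cmod (up x) = \<rho> x"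
  unfolding up_eq norm_mult using \<rho>_pos[of x] by (simp add: less_imp_le)

lemma up_nz: "up x \<noteq> 0"
  using cmod_up[of x] \<rho>_pos[of x] by auto

lemma mfun_Tp_ac: "has_ac_deriv (\<lambda>x. mfun (Tp x)) (\<lambda>x. 2 * c * Tp x * Tp' x)"
proof -
  have "has_ac_deriv (\<lambda>x. v\<^sup>2 / 2 + c * (Tp x * Tp x)) (\<lambda>x. 0 + c * (Tp' x * Tp x + Tp x * Tp' x))"
    by (intro ac_add ac_const ac_bounded_linear[OF _ bounded_linear_mult_right] ac_mult Tp_ac)
  then show ?thesis by (simp add: mfun_def power2_eq_square mult_ac)
qed

text \<open>The factor a is 1 for the profile and -1 for its inverse.\<close>

lemma phase_ac: "has_ac_deriv (\<lambda>x. exp (\<i> * of_real (a * \<theta> x))) (\<lambda>x. \<i> * of_real (a * \<theta>' x) * exp (\<i> * of_real (a * \<theta> x)))"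
proof (rule ac_C1)
  fix x
  have "((\<lambda>x. a * \<theta> x) has_real_derivative a * \<theta>' x) (at x)" by (rule DERIV_cmult[OF \<theta>_deriv])
  then have "((\<lambda>x. complex_of_real (a * \<theta> x)) has_vector_derivative of_real (a * \<theta>' x)) (at x)"
    by (rule has_vector_derivative_of_real)
  then have "((\<lambda>x. \<i> * complex_of_real (a * \<theta> x)) has_vector_derivative \<i> * of_real (a * \<theta>' x)) (at x)"
    by (rule has_vector_derivative_mult_right)
  from field_vector_diff_chain_at[OF this DERIV_exp]
  show "((\<lambda>x. exp (\<i> * of_real (a * \<theta> x))) has_vector_derivative \<i> * of_real (a * \<theta>' x) * exp (\<i> * of_real (a * \<theta> x))) (at x)"
    by (simp add: o_def)
next
  have "continuous_on UNIV \<theta>"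
    using \<theta>_deriv DERIV_isCont by (intro continuous_at_imp_continuous_on) blast
  then show "continuous_on UNIV (\<lambda>x. \<i> * of_real (a * \<theta>' x) * exp (\<i> * of_real (a * \<theta> x)))"
    by (intro continuous_intros \<theta>'_continuous)
qed

lemma Gh_profile: "Gh (sg x) (Tp x) = of_real (c * Tp x * Tp' x / mfun (Tp x)) + \<i> * of_real (\<theta>' x)"
proof -
  have m: "mfun (Tp x) \<noteq> 0" using mfun_pos[of "Tp x"] by simp
  have m1: "mfun (Tp x) - 1 = - c * (1 - (Tp x)\<^sup>2)" unfolding mfun_def v2_eq by (simp add: algebra_simps)
  have "\<theta>' x = v / 2 * ((mfun (Tp x) - 1) / mfun (Tp x))" using m by (simp add: \<theta>'_def diff_divide_distrib)
  then have "\<theta>' x = c * (1 - (Tp x)\<^sup>2) / mfun (Tp x) * (- v / 2)" unfolding m1 by (simp add: mult_ac)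
  then show ?thesis by (intro complex_eqI) (simp_all only: Gh_def Tp'_def, simp_all)
qed

lemma \<rho>_ac: "has_ac_deriv \<rho> (\<lambda>x. c * Tp x * Tp' x / \<rho> x)"
proof -
  have "has_ac_deriv (\<lambda>x. sqrt (mfun (Tp x))) (\<lambda>x. (inverse (sqrt (mfun (Tp x))) / 2) * (2 * c * Tp x * Tp' x))"
  proof (rule ac_compose[OF mfun_Tp_ac, where U="{0<..}" and \<Phi>'="\<lambda>z. inverse (sqrt z) / 2"])
    show "mfun (Tp x) \<in> {0<..}" for x using mfun_pos by simp
    show "(sqrt has_field_derivative inverse (sqrt z) / 2) (at z)" if "z \<in> {0<..}" for z
      using that by (intro DERIV_real_sqrt) simp
    show "continuous_on {0<..} (\<lambda>z. inverse (sqrt z) / 2 :: real)"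
      by (intro continuous_on_divide continuous_on_inverse continuous_on_real_sqrt continuous_on_id continuous_on_const) auto
    show "open {0::real<..}" "convex {0::real<..}" by (rule open_greaterThan) (rule convex_real_interval)
  qed
  moreover have "(\<lambda>x. sqrt (mfun (Tp x))) = \<rho>" by (rule ext) (simp only: \<rho>_def)
  moreover have "(\<lambda>x. (inverse (sqrt (mfun (Tp x))) / 2) * (2 * c * Tp x * Tp' x)) = (\<lambda>x. c * Tp x * Tp' x / \<rho> x)"
    by (rule ext) (simp add: \<rho>_def field_simps)
  ultimately show ?thesis by metis
qed

lemma up_ac: "has_ac_deriv up (\<lambda>x. up x * Gh (sg x) (Tp x))"
proof -
  have "has_ac_deriv (\<lambda>x. of_real (\<rho> x) * exp (\<i> * of_real (1 * \<theta> x)))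
     (\<lambda>x. of_real (c * Tp x * Tp' x / \<rho> x) * exp (\<i> * of_real (1 * \<theta> x)) + of_real (\<rho> x) * (\<i> * of_real (1 * \<theta>' x) * exp (\<i> * of_real (1 * \<theta> x))))"
    by (rule ac_mult[OF ac_bounded_linear[OF \<rho>_ac bounded_linear_of_real] phase_ac])
  moreover have "(\<lambda>x. of_real (\<rho> x) * exp (\<i> * of_real (1 * \<theta> x))) = up" by (auto simp: up_eq)
  moreover have "of_real (c * Tp x * Tp' x / \<rho> x) * exp (\<i> * of_real (1 * \<theta> x)) + of_real (\<rho> x) * (\<i> * of_real (1 * \<theta>' x) * exp (\<i> * of_real (1 * \<theta> x)))
     = up x * Gh (sg x) (Tp x)" for x
  proof -
    have "c * Tp x * Tp' x / \<rho> x = \<rho> x * (c * Tp x * Tp' x / mfun (Tp x))"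
      using \<rho>_pos[of x] by (simp add: \<rho>_sq[symmetric] power2_eq_square)
    then show ?thesis unfolding up_eq Gh_profile by (simp add: algebra_simps)
  qed
  ultimately show ?thesis by simp
qed

text \<open>The chain rule \<open>ac_compose\<close> asks for a convex domain, and a convex set that
  contains the range of \<open>up\<close> need not avoid 0. The polar form is therefore inverted
  factor by factor.\<close>

lemma inverse_up_ac: "has_ac_deriv (\<lambda>x. inverse (up x)) (\<lambda>x. - inverse (up x) * Gh (sg x) (Tp x))"
proof -
  have i: "has_ac_deriv (\<lambda>x. inverse (\<rho> x)) (\<lambda>x. - ((inverse (\<rho> x))\<^sup>2) * (c * Tp x * Tp' x / \<rho> x))"
  proof (rule ac_compose[OF \<rho>_ac, where U="{0<..}" and \<Phi>'="\<lambda>z. - ((inverse z)\<^sup>2)"])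
    show "\<rho> x \<in> {0<..}" for x using \<rho>_pos by simp
    show "(inverse has_field_derivative - ((inverse z)\<^sup>2)) (at z)" if "z \<in> {0<..}" for z :: real
      using DERIV_inverse[of z] that by (simp add: numeral_2_eq_2)
    show "continuous_on {0<..} (\<lambda>z::real. - ((inverse z)\<^sup>2))"
      by (intro continuous_on_minus continuous_on_power continuous_on_inverse continuous_on_id) auto
    show "open {0::real<..}" "convex {0::real<..}" by (rule open_greaterThan) (rule convex_real_interval)
  qed
  have "has_ac_deriv (\<lambda>x. of_real (inverse (\<rho> x)) * exp (\<i> * of_real (- 1 * \<theta> x)))
     (\<lambda>x. of_real (- ((inverse (\<rho> x))\<^sup>2) * (c * Tp x * Tp' x / \<rho> x)) * exp (\<i> * of_real (- 1 * \<theta> x)) + of_real (inverse (\<rho> x)) * (\<i> * of_real (- 1 * \<theta>' x) * exp (\<i> * of_real (- 1 * \<theta> x))))"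
    by (rule ac_mult[OF ac_bounded_linear[OF i bounded_linear_of_real] phase_ac])
  moreover have ie: "of_real (inverse (\<rho> x)) * exp (\<i> * of_real (- 1 * \<theta> x)) = inverse (up x)" for x
    by (simp add: up_eq exp_minus)
  moreover have "of_real (- ((inverse (\<rho> x))\<^sup>2) * (c * Tp x * Tp' x / \<rho> x)) * exp (\<i> * of_real (- 1 * \<theta> x)) + of_real (inverse (\<rho> x)) * (\<i> * of_real (- 1 * \<theta>' x) * exp (\<i> * of_real (- 1 * \<theta> x)))
     = - inverse (up x) * Gh (sg x) (Tp x)" for x
  proof -
    have r: "- ((inverse (\<rho> x))\<^sup>2) * (c * Tp x * Tp' x / \<rho> x) = - inverse (\<rho> x) * (c * Tp x * Tp' x / mfun (Tp x))"
      using \<rho>_pos[of x] by (simp add: \<rho>_sq[symmetric] power2_eq_square field_simps)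
    show ?thesis unfolding ie[symmetric] Gh_profile r by (simp add: algebra_simps)
  qed
  ultimately show ?thesis by simp
qed

end

section \<open>The energy near the profile\<close>

context profile
begin

lemma mfun_le: "T\<^sup>2 \<le> S\<^sup>2 \<Longrightarrow> mfun T \<le> mfun S"
  using c_pos by (simp add: mfun_def mult_left_mono)

lemma cT_le_mfun: "c * T\<^sup>2 \<le> mfun T"
  using v by (simp add: mfun_def)

lemma one_minus_mfun: "1 - mfun T = c * (1 - T\<^sup>2)"
  unfolding mfun_def v2_eq by (simp add: algebra_simps)

text \<open>Halfway between the two roots: T \<ge> \<tau>l keeps a positive distance from \<tau>2.
  Accordingly \<kappa> is the drop in mass from \<tau>1 to \<tau>l.\<close>

definition \<tau>l :: real where "\<tau>l = (\<tau>1 + \<tau>2) / 2"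
definition \<kappa> :: real where "\<kappa> = c * (\<tau>1\<^sup>2 - \<tau>l\<^sup>2)"

lemma \<tau>l: "0 < \<tau>l" "\<tau>2 < \<tau>l" "\<tau>l < \<tau>1"
  using \<tau>_order by (auto simp: \<tau>l_def)

lemma \<kappa>_pos: "0 < \<kappa>" and \<kappa>_le: "\<kappa> \<le> c"
proof -
  have "\<tau>l\<^sup>2 < \<tau>1\<^sup>2" using \<tau>l by (intro power_strict_mono) auto
  then show "0 < \<kappa>" using c_pos by (simp add: \<kappa>_def)
  have "\<tau>1\<^sup>2 \<le> 1" using \<tau>_order by (simp add: power_le_one)
  then have "\<tau>1\<^sup>2 - \<tau>l\<^sup>2 \<le> 1" by (smt (verit) zero_le_power2)
  then have "c * (\<tau>1\<^sup>2 - \<tau>l\<^sup>2) \<le> c * 1" using c_pos by (intro mult_left_mono) auto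
  then show "\<kappa> \<le> c" by (simp add: \<kappa>_def)
qed

text \<open>Only the modulus is compared, uniformly in x. This is the condition that the bootstrap
  in time propagates, and it keeps T above \<tau>l.\<close>

definition near :: "(real \<Rightarrow> complex) \<Rightarrow> bool" where
  "near u \<longleftrightarrow> u \<in> energy_space \<and> (\<forall>x. \<bar>mass u x - mfun (Tp x)\<bar> \<le> \<kappa>)"

definition Tf :: "(real \<Rightarrow> complex) \<Rightarrow> real \<Rightarrow> real" where "Tf u x = sqrt ((mass u x - v\<^sup>2 / 2) / c)"
definition Tf' :: "(real \<Rightarrow> complex) \<Rightarrow> real \<Rightarrow> real" where
  "Tf' u x = Re (cnj (u x) * weak_deriv u x) / (c * Tf u x)"
definition ef :: "(real \<Rightarrow> complex) \<Rightarrow> real \<Rightarrow> real" where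
  "ef u x = Tf' u x - sg x * k * (1 - (Tf u x)\<^sup>2)"
definition jf :: "(real \<Rightarrow> complex) \<Rightarrow> real \<Rightarrow> real" where
  "jf u x = current u x - v / 2 * (mass u x - 1)"

lemma near_energy: "near u \<Longrightarrow> u \<in> energy_space" by (simp add: near_def)

lemma near_Tf:
  assumes "near u"
  shows "mfun (Tf u x) = mass u x" "\<tau>l \<le> Tf u x" "Tf u x \<le> 2" "mass u x \<le> 2" "mfun \<tau>l \<le> mass u x" "(Tf u x)\<^sup>2 = (mass u x - v\<^sup>2 / 2) / c"
    "v\<^sup>2 / 2 < mass u x"
proof -
  have d: "\<bar>mass u x - mfun (Tp x)\<bar> \<le> \<kappa>" using assms by (simp add: near_def)
  have Tp2: "\<tau>1\<^sup>2 \<le> (Tp x)\<^sup>2" "(Tp x)\<^sup>2 \<le> 1"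
    using Tp_bounds[of x] \<tau>_order by (auto intro!: power_mono power_le_one)
  have l: "c * \<tau>l\<^sup>2 \<le> mass u x - v\<^sup>2 / 2"
  proof -
    have "c * \<tau>1\<^sup>2 \<le> c * (Tp x)\<^sup>2" using Tp2 c_pos by (intro mult_left_mono) auto
    then show ?thesis using d by (simp add: mfun_def \<kappa>_def abs_le_iff algebra_simps)
  qed
  have r: "mass u x - v\<^sup>2 / 2 \<le> c * 2"
  proof -
    have "c * (Tp x)\<^sup>2 \<le> c * 1" using Tp2 c_pos by (intro mult_left_mono) auto
    then show ?thesis using d \<kappa>_le by (simp add: mfun_def abs_le_iff)
  qed
  have q: "\<tau>l\<^sup>2 \<le> (mass u x - v\<^sup>2 / 2) / c" "(mass u x - v\<^sup>2 / 2) / c \<le> 2"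
    using l r c_pos by (simp_all add: pos_le_divide_eq pos_divide_le_eq mult.commute)
  have "0 \<le> (mass u x - v\<^sup>2 / 2) / c" using q(1) by (smt (verit) zero_le_power2)
  then show t2: "(Tf u x)\<^sup>2 = (mass u x - v\<^sup>2 / 2) / c" by (simp add: Tf_def)
  then show "mfun (Tf u x) = mass u x" using c_pos by (simp add: mfun_def)
  show "\<tau>l \<le> Tf u x" unfolding Tf_def by (rule real_le_rsqrt[OF q(1)])
  show "Tf u x \<le> 2" unfolding Tf_def by (rule real_le_lsqrt) (use q(2) in auto)
  show "mass u x \<le> 2" using r v2_eq c_le_1 by simp
  show "mfun \<tau>l \<le> mass u x" using l by (simp add: mfun_def)
  have "0 < c * \<tau>l\<^sup>2" using c_pos \<tau>l by simp
  then show "v\<^sup>2 / 2 < mass u x" using l by linarith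
qed

lemma mass_ac:
  assumes "u \<in> energy_space"
  shows "has_ac_deriv (mass u) (\<lambda>x. 2 * Re (cnj (u x) * weak_deriv u x))"
proof -
  have "has_ac_deriv (\<lambda>x. Re (cnj (u x) * u x)) (\<lambda>x. Re (cnj (weak_deriv u x) * u x + cnj (u x) * weak_deriv u x))"
    by (intro ac_bounded_linear[OF _ bounded_linear_Re] ac_mult ac_bounded_linear[OF _ bounded_linear_cnj] energy_space_ac assms)
  moreover have "Re (cnj (u x) * u x) = mass u x" for x
    unfolding mass_def cmod_power2 by (simp add: power2_eq_square)
  moreover have "Re (cnj (weak_deriv u x) * u x + cnj (u x) * weak_deriv u x) = 2 * Re (cnj (u x) * weak_deriv u x)" for x by simp
  ultimately show ?thesis by (simp only:)
qed

lemma Tf_ac: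
  assumes "near u"
  shows "has_ac_deriv (Tf u) (Tf' u)"
proof -
  let ?U = "{v\<^sup>2 / 2 <..}"
  have "has_ac_deriv (\<lambda>x. sqrt ((mass u x - v\<^sup>2 / 2) / c)) (\<lambda>x. (inverse (sqrt ((mass u x - v\<^sup>2 / 2) / c)) / 2 / c) * (2 * Re (cnj (u x) * weak_deriv u x)))"
  proof (rule ac_compose[OF mass_ac[OF near_energy[OF assms]], where U="?U" and \<Phi>="\<lambda>z. sqrt ((z - v\<^sup>2 / 2) / c)" and \<Phi>'="\<lambda>z. inverse (sqrt ((z - v\<^sup>2 / 2) / c)) / 2 / c"])
    show "open ?U" "convex ?U" by (rule open_greaterThan) (rule convex_real_interval)
    show "mass u x \<in> ?U" for x using near_Tf(7)[OF assms] by simp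
    show "((\<lambda>z. sqrt ((z - v\<^sup>2 / 2) / c)) has_field_derivative inverse (sqrt ((z - v\<^sup>2 / 2) / c)) / 2 / c) (at z)" if "z \<in> ?U" for z
    proof -
      have "(z - v\<^sup>2 / 2) / c > 0" using that c_pos by simp
      moreover have "((\<lambda>z. (z - v\<^sup>2 / 2) / c) has_field_derivative 1 / c) (at z)"
        using c_pos by (auto intro!: derivative_eq_intros)
      ultimately show ?thesis using DERIV_chain2[OF DERIV_real_sqrt] by fastforce
    qed
    show "continuous_on ?U (\<lambda>z. inverse (sqrt ((z - v\<^sup>2 / 2) / c)) / 2 / c)"
      by (intro continuous_on_divide continuous_on_inverse continuous_on_real_sqrt continuous_on_id continuous_on_const continuous_on_diff)
        (use c_pos in auto)
  qed
  moreover have "(\<lambda>x. sqrt ((mass u x - v\<^sup>2 / 2) / c)) = Tf u" by (rule ext) (simp only: Tf_def)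
  moreover have "(\<lambda>x. (inverse (sqrt ((mass u x - v\<^sup>2 / 2) / c)) / 2 / c) * (2 * Re (cnj (u x) * weak_deriv u x))) = Tf' u"
  proof
    have "inverse S / 2 / c * (2 * R) = R / (c * S)" for R S :: real
      by (cases "S = 0") (use c_pos in \<open>auto simp: field_simps\<close>)
    then show "inverse (sqrt ((mass u x - v\<^sup>2 / 2) / c)) / 2 / c * (2 * Re (cnj (u x) * weak_deriv u x)) = Tf' u x" for x
      by (simp only: Tf_def Tf'_def)
  qed
  ultimately show ?thesis by metis
qed

lemma near_cmod:
  assumes "near u"
  shows "cmod (u x) \<le> 2"
proof -
  have "(cmod (u x))\<^sup>2 \<le> 2\<^sup>2" using near_Tf(4)[OF assms, of x] by (simp add: mass_def)
  then show ?thesis by (rule power2_le_imp_le) simp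
qed

lemma Tf'_sqi:
  assumes "near u"
  shows "sq_integrable (Tf' u)"
proof (rule sqi_dominated(1)[OF energy_space_sqi_deriv[OF near_energy[OF assms]] ac_borel[OF Tf_ac[OF assms]]])
  fix x
  have ct: "0 < c * \<tau>l" "c * \<tau>l \<le> c * Tf u x" using c_pos \<tau>l near_Tf(2)[OF assms, of x] by auto
  have "cmod (u x) * cmod (weak_deriv u x) \<le> 2 * cmod (weak_deriv u x)"
    by (intro mult_right_mono near_cmod assms) simp
  then have "\<bar>Re (cnj (u x) * weak_deriv u x)\<bar> \<le> 2 * cmod (weak_deriv u x)"
    using order_trans[OF abs_Re_le_cmod[of "cnj (u x) * weak_deriv u x"]] unfolding norm_mult complex_mod_cnj by blast
  then have "\<bar>Re (cnj (u x) * weak_deriv u x)\<bar> / (c * Tf u x) \<le> 2 * cmod (weak_deriv u x) / (c * \<tau>l)"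
    using ct by (intro frac_le) auto
  then show "norm (Tf' u x) \<le> 2 / (c * \<tau>l) * norm (weak_deriv u x)"
    using ct by (simp add: Tf'_def abs_divide abs_of_pos)
qed

lemma one_minus_Tf2:
  assumes "near u"
  shows "1 - (Tf u x)\<^sup>2 = (1 - mass u x) / c"
  using one_minus_mfun[of "Tf u x"] near_Tf(1)[OF assms, of x] c_pos by (simp add: field_simps)

lemma Tf_minus_1:
  assumes "near u"
  shows "\<bar>Tf u x - 1\<bar> \<le> 1 / c * \<bar>1 - mass u x\<bar>"
proof -
  have t: "Tf u x \<ge> 0" using near_Tf(2)[OF assms, of x] \<tau>l by linarith
  have "\<bar>Tf u x - 1\<bar> * 1 \<le> \<bar>Tf u x - 1\<bar> * (Tf u x + 1)" using t by (intro mult_left_mono) auto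
  also have "\<dots> = \<bar>(Tf u x - 1) * (Tf u x + 1)\<bar>" using t by (simp add: abs_mult)
  also have "(Tf u x - 1) * (Tf u x + 1) = - ((1 - mass u x) / c)"
    unfolding one_minus_Tf2[OF assms, symmetric] by (simp add: power2_eq_square algebra_simps)
  finally show ?thesis using c_pos by (simp add: abs_divide)
qed

lemma Tf_borel: "near u \<Longrightarrow> Tf u \<in> borel_measurable borel"
  by (rule ac_borel_fun[OF Tf_ac])

lemma one_minus_Tf2_sqi:
  assumes "near u"
  shows "sq_integrable (\<lambda>x. 1 - (Tf u x)\<^sup>2)"
proof -
  have "sq_integrable (\<lambda>x. 1 / c * (1 - mass u x))"
    by (rule sqi_scale(1)[OF energy_space_sqi_1_mass[OF near_energy[OF assms]]])
  then show ?thesis unfolding one_minus_Tf2[OF assms] by simp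
qed

lemma ef_sqi:
  assumes "near u"
  shows "sq_integrable (ef u)"
proof -
  have "sq_integrable (\<lambda>x. (sg x * k) * (1 - (Tf u x)\<^sup>2))"
    by (rule sqi_mult_bounded(1)[OF one_minus_Tf2_sqi[OF assms], of _ k]) (use k_pos in \<open>auto simp: abs_mult\<close>)
  from sqi_diff(1)[OF Tf'_sqi[OF assms] this] show ?thesis unfolding ef_def[abs_def] .
qed

lemma jf_sqi:
  assumes "u \<in> energy_space"
  shows "sq_integrable (jf u)"
proof -
  have "sq_integrable (\<lambda>x. (- v / 2) * (1 - mass u x))"
    by (rule sqi_scale(1)[OF energy_space_sqi_1_mass[OF assms]])
  from sqi_diff(1)[OF current_sqi(1)[OF assms] this] show ?thesis unfolding jf_def[abs_def] by (simp add: field_simps)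
qed

text \<open>With S = T_x and J the current, kinetic, potential and momentum density combine into two
  squares. The cross term left from completing the first square is s times the derivative of a
  function of T.\<close>

lemma density_identity:
  fixes s T S J :: real
  assumes s: "s * s = 1"
  defines "m \<equiv> mfun T"
  shows "((c * T * S)\<^sup>2 + J\<^sup>2) / m / 2 + (1 - m)\<^sup>2 / 4 - v / 2 * ((1 - 1 / m) * J)
    = (c\<^sup>2 * T\<^sup>2 / m * (S - s * k * (1 - T\<^sup>2))\<^sup>2 / 2 + (J - v / 2 * (m - 1))\<^sup>2 / m / 2) + s * (c\<^sup>2 * T\<^sup>2 / m * k * (1 - T\<^sup>2) * S)"
proof -
  have m: "m > 0" unfolding m_def by (rule mfun_pos)
  define a where "a = 1 - T\<^sup>2"
  have a: "c * a = 1 - m" unfolding a_def m_def one_minus_mfun ..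
  \<comment> \<open>The identity m / 2 = k^2 T^2 + v^2 / 4 divides the potential between the two
    squares.\<close>
  have kk: "T\<^sup>2 * (k * k) = m / 2 - v\<^sup>2 / 4" unfolding k_sq m_def mfun_def by (simp add: field_simps)
  have "2 * m * (((c * T * S)\<^sup>2 + J\<^sup>2) / m / 2 + (1 - m)\<^sup>2 / 4 - v / 2 * ((1 - 1 / m) * J))
     = (c * T * S)\<^sup>2 + J\<^sup>2 + m * (1 - m)\<^sup>2 / 2 - v * (m - 1) * J"
    using m by (simp add: field_simps)
  also have "m * (1 - m)\<^sup>2 / 2 = T\<^sup>2 * (k * k) * (c * a)\<^sup>2 + v\<^sup>2 / 4 * (m - 1)\<^sup>2"
  proof -
    show ?thesis unfolding a kk power2_commute[of 1 m] by (simp add: left_diff_distrib)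
  qed
  also have "(c * T * S)\<^sup>2 + J\<^sup>2 + (T\<^sup>2 * (k * k) * (c * a)\<^sup>2 + v\<^sup>2 / 4 * (m - 1)\<^sup>2) - v * (m - 1) * J
     = c\<^sup>2 * T\<^sup>2 * (S\<^sup>2 + (s * s) * (k * k) * a\<^sup>2 - 2 * s * k * a * S) + (J - v / 2 * (m - 1))\<^sup>2 + 2 * s * (c\<^sup>2 * T\<^sup>2 * k * a * S)"
    unfolding s by (simp add: power2_eq_square field_simps)
  also have "S\<^sup>2 + (s * s) * (k * k) * a\<^sup>2 - 2 * s * k * a * S = (S - s * k * a)\<^sup>2"
    by (simp add: power2_eq_square algebra_simps)
  also have "c\<^sup>2 * T\<^sup>2 * (S - s * k * a)\<^sup>2 + (J - v / 2 * (m - 1))\<^sup>2 + 2 * s * (c\<^sup>2 * T\<^sup>2 * k * a * S)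
     = 2 * m * ((c\<^sup>2 * T\<^sup>2 / m * (S - s * k * a)\<^sup>2 / 2 + (J - v / 2 * (m - 1))\<^sup>2 / m / 2) + s * (c\<^sup>2 * T\<^sup>2 / m * k * a * S))"
    using m by (simp add: field_simps)
  finally show ?thesis using m unfolding a_def by simp
qed

definition Hp' :: "real \<Rightarrow> real" where "Hp' T = c\<^sup>2 * T\<^sup>2 / mfun T * k * (1 - T\<^sup>2)"
text \<open>The primitive that makes the last term of \<open>density_identity\<close> exact. Only
  its differences occur, so the constant of integration is left open.\<close>

definition Hp :: "real \<Rightarrow> real" where "Hp = (SOME H. \<forall>T. (H has_real_derivative Hp' T) (at T))"

lemma Hp'_continuous: "continuous_on S Hp'"
  unfolding Hp'_def using mfun_pos by (intro continuous_intros mfun_continuous) (auto simp: less_imp_neq[symmetric])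

lemma Hp_deriv: "(Hp has_real_derivative Hp' T) (at T)"
proof -
  have "\<exists>F. \<forall>x. - \<infinity> < ereal x \<longrightarrow> ereal x < \<infinity> \<longrightarrow> (F has_vector_derivative Hp' x) (at x)"
    by (rule einterval_antiderivative) (use Hp'_continuous[of UNIV] in \<open>auto simp: continuous_on_eq_continuous_at\<close>)
  then have "\<exists>H. \<forall>T. (H has_real_derivative Hp' T) (at T)"
    by (auto simp: has_real_derivative_iff_has_vector_derivative)
  from someI_ex[OF this] show ?thesis unfolding Hp_def by blast
qed

lemma weight_bounds: "0 \<le> c\<^sup>2 * T\<^sup>2 / mfun T" "c\<^sup>2 * T\<^sup>2 / mfun T \<le> c"
proof -
  show "0 \<le> c\<^sup>2 * T\<^sup>2 / mfun T" using mfun_pos[of T] by simp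
  have "c * (c * T\<^sup>2) \<le> c * mfun T" using cT_le_mfun c_pos by (intro mult_left_mono) auto
  then show "c\<^sup>2 * T\<^sup>2 / mfun T \<le> c" using mfun_pos[of T] by (simp add: pos_divide_le_eq power2_eq_square mult_ac)
qed

lemma Hp'_bound: "\<bar>Hp' T\<bar> \<le> c * k * \<bar>1 - T\<^sup>2\<bar>"
proof -
  have "\<bar>Hp' T\<bar> = c\<^sup>2 * T\<^sup>2 / mfun T * (k * \<bar>1 - T\<^sup>2\<bar>)"
    using mfun_pos[of T] k_pos by (simp add: Hp'_def abs_mult)
  also have "\<dots> \<le> c * (k * \<bar>1 - T\<^sup>2\<bar>)" using weight_bounds k_pos by (intro mult_right_mono) auto
  finally show ?thesis by (simp add: mult.assoc)
qed

lemma Hp_lipschitz: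
  assumes "T \<in> {0..2}"
  shows "\<bar>Hp T - Hp 1\<bar> \<le> 3 * c * k * \<bar>T - 1\<bar>"
proof -
  have "norm (Hp T - Hp 1) \<le> 3 * c * k * norm (T - 1)"
  proof (rule field_differentiable_bound[where S="{0..2}" and f'=Hp'])
    fix z :: real assume z: "z \<in> {0..2}"
    show "(Hp has_field_derivative Hp' z) (at z within {0..2})" using Hp_deriv by (rule has_field_derivative_at_within)
    have "z\<^sup>2 \<le> 2\<^sup>2" using z by (intro power_mono) auto
    then have "\<bar>1 - z\<^sup>2\<bar> \<le> 3" by (simp add: abs_le_iff) (smt (verit) zero_le_power2)
    then have "c * k * \<bar>1 - z\<^sup>2\<bar> \<le> c * k * 3" using c_pos k_pos by (intro mult_left_mono) auto
    then show "norm (Hp' z) \<le> 3 * c * k" using Hp'_bound[of z] by simp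
  qed (use assms in auto)
  then show ?thesis by simp
qed

text \<open>The boundary contribution of the exact term, with T = 1 at infinity, plus the energy of
  the delta potential: what is left of the energy when both defects vanish.\<close>

definition gf :: "real \<Rightarrow> real" where "gf T = 2 * (Hp 1 - Hp T) + \<gamma> / 2 * mfun T"

definition Qf :: "(real \<Rightarrow> complex) \<Rightarrow> real" where
  "Qf u = (LINT x|lborel. c\<^sup>2 * (Tf u x)\<^sup>2 / mass u x * (ef u x)\<^sup>2 / 2 + (jf u x)\<^sup>2 / mass u x / 2)"

lemma Qf_integrable:
  assumes "near u"
  shows "integrable lborel (\<lambda>x. c\<^sup>2 * (Tf u x)\<^sup>2 / mass u x * (ef u x)\<^sup>2 / 2)" "integrable lborel (\<lambda>x. (jf u x)\<^sup>2 / mass u x / 2)"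
proof -
  note u = near_energy[OF assms]
  note [measurable] = Tf_borel[OF assms] mass_borel[OF u] sqi_borel[OF ef_sqi[OF assms]] sqi_borel[OF jf_sqi[OF u]]
  have mp: "0 < mfun \<tau>l" "mfun \<tau>l \<le> mass u x" for x using mfun_pos near_Tf(5)[OF assms] by auto
  have half_le: "a \<le> b \<Longrightarrow> 0 \<le> a \<Longrightarrow> \<bar>a / 2\<bar> \<le> \<bar>b\<bar>" for a b :: real by linarith
  show "integrable lborel (\<lambda>x. c\<^sup>2 * (Tf u x)\<^sup>2 / mass u x * (ef u x)\<^sup>2 / 2)"
  proof (rule Bochner_Integration.integrable_bound)
    show "integrable lborel (\<lambda>x. c * (norm (ef u x))\<^sup>2)" using ef_sqi[OF assms] by (simp add: sq_integrable_def)
    show "AE x in lborel. norm (c\<^sup>2 * (Tf u x)\<^sup>2 / mass u x * (ef u x)\<^sup>2 / 2) \<le> norm (c * (norm (ef u x))\<^sup>2)"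
    proof (rule AE_I2)
      fix x
      have w: "0 \<le> c\<^sup>2 * (Tf u x)\<^sup>2 / mass u x" "c\<^sup>2 * (Tf u x)\<^sup>2 / mass u x \<le> c"
        using weight_bounds[of "Tf u x"] near_Tf(1)[OF assms, of x] by auto
      have "c\<^sup>2 * (Tf u x)\<^sup>2 / mass u x * (ef u x)\<^sup>2 \<le> c * (ef u x)\<^sup>2" using w by (intro mult_right_mono) auto
      moreover have "0 \<le> c\<^sup>2 * (Tf u x)\<^sup>2 / mass u x * (ef u x)\<^sup>2" using w by (intro mult_nonneg_nonneg) auto
      ultimately show "norm (c\<^sup>2 * (Tf u x)\<^sup>2 / mass u x * (ef u x)\<^sup>2 / 2) \<le> norm (c * (norm (ef u x))\<^sup>2)"
        using half_le unfolding real_norm_def power2_abs by blast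
    qed
  qed measurable
  show "integrable lborel (\<lambda>x. (jf u x)\<^sup>2 / mass u x / 2)"
  proof (rule Bochner_Integration.integrable_bound)
    show "integrable lborel (\<lambda>x. (1 / mfun \<tau>l) * (norm (jf u x))\<^sup>2)" using jf_sqi[OF u] by (simp add: sq_integrable_def)
    show "AE x in lborel. norm ((jf u x)\<^sup>2 / mass u x / 2) \<le> norm ((1 / mfun \<tau>l) * (norm (jf u x))\<^sup>2)"
    proof (rule AE_I2)
      fix x
      have "(jf u x)\<^sup>2 / mass u x \<le> (jf u x)\<^sup>2 / mfun \<tau>l" using mp(1) mp(2)[of x] by (intro divide_left_mono) auto
      moreover have "0 \<le> (jf u x)\<^sup>2 / mass u x" using mp(1) mp(2)[of x] by simp
      ultimately show "norm ((jf u x)\<^sup>2 / mass u x / 2) \<le> norm ((1 / mfun \<tau>l) * (norm (jf u x))\<^sup>2)"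
        using half_le unfolding real_norm_def power2_abs times_divide_eq_left mult_1 by blast
    qed
  qed measurable
qed

text \<open>In the integral of \<open>density_identity\<close> the exact term carries the sign of x,
  so it contributes twice the rise of \<open>Hp\<close> from the origin to infinity.\<close>

lemma energy_identity:
  assumes "near u"
  shows "energy_fn \<gamma> v u = Qf u + gf (Tf u 0)"
proof -
  note u = near_energy[OF assms]
  note [measurable] = Tf_borel[OF assms] mass_borel[OF u] sqi_borel[OF Tf'_sqi[OF assms]]
  define h where "h x = Hp (Tf u x) - Hp 1" for x
  define h' where "h' x = Hp' (Tf u x) * Tf' u x" for x
  have "has_ac_deriv (\<lambda>x. Hp (Tf u x)) (\<lambda>x. Hp' (Tf u x) * Tf' u x)"
    by (rule ac_compose[OF Tf_ac[OF assms], where U=UNIV]) (use Hp_deriv Hp'_continuous in auto)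
  from ac_diff[OF this ac_const[of "Hp 1"]] have h: "has_ac_deriv h h'"
    by (simp add: h_def[abs_def] h'_def[abs_def])
  have T02: "Tf u x \<in> {0..2}" for x using near_Tf(2,3)[OF assms, of x] \<tau>l by auto
  \<comment> \<open>T - 1 is square integrable, so subtracting Hp 1 gives the primitive the decay
    that \<open>ac_integral_line\<close> requires.\<close>
  have hs: "sq_integrable h"
  proof (rule sqi_dominated(1)[OF energy_space_sqi_1_mass[OF u] ac_borel_fun[OF h]])
    fix x
    have "\<bar>h x\<bar> \<le> 3 * c * k * \<bar>Tf u x - 1\<bar>" unfolding h_def by (rule Hp_lipschitz[OF T02])
    also have "\<dots> \<le> 3 * c * k * (1 / c * \<bar>1 - mass u x\<bar>)" using c_pos k_pos by (intro mult_left_mono Tf_minus_1 assms) auto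
    finally show "norm (h x) \<le> 3 * k * norm (1 - mass u x)" using c_pos by simp
  qed
  have "sq_integrable (\<lambda>x. Hp' (Tf u x))"
  proof (rule sqi_dominated(1)[OF one_minus_Tf2_sqi[OF assms]])
    have "continuous_on UNIV (\<lambda>x. Hp' (Tf u x))"
      by (rule continuous_on_compose2[OF Hp'_continuous[of UNIV] ac_continuous[OF Tf_ac[OF assms]]]) auto
    then show "(\<lambda>x. Hp' (Tf u x)) \<in> borel_measurable borel" by (rule borel_measurable_continuous_onI)
    show "norm (Hp' (Tf u x)) \<le> c * k * norm (1 - (Tf u x)\<^sup>2)" for x using Hp'_bound by simp
  qed
  from sqi_mult(1)[OF this Tf'_sqi[OF assms]] have ih': "integrable lborel h'" by (simp add: h'_def[abs_def])
  have "(LINT x|lborel. sgn x *\<^sub>R h' x) = - 2 *\<^sub>R h 0"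
    by (rule ac_integral_line(2)[OF h ih']) (use hs in \<open>simp add: sq_integrable_def\<close>)
  moreover have "(LINT x|lborel. sg x * h' x) = (LINT x|lborel. sgn x *\<^sub>R h' x)"
  proof (rule integral_cong_AE)
    show "AE x in lborel. sg x * h' x = sgn x *\<^sub>R h' x"
      using AE_lborel_singleton[of "0::real"] by (rule eventually_mono) (auto simp: sg_def sgn_if)
  qed (use ac_borel[OF h] in measurable)
  ultimately have ish: "(LINT x|lborel. sg x * h' x) = 2 * (Hp 1 - Hp (Tf u 0))" by (simp add: h_def)
  have ish': "integrable lborel (\<lambda>x. sg x * h' x)"
    by (rule Bochner_Integration.integrable_bound[OF ih']) (use ac_borel[OF h] in \<open>auto simp: abs_mult\<close>)
  have mpos: "0 < mass u x" for x using near_Tf(1)[OF assms, of x] mfun_pos by metis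
  have pt: "(norm (weak_deriv u x))\<^sup>2 / 2 + (norm (1 - mass u x))\<^sup>2 / 4 - v / 2 * ((1 - 1 / mass u x) * current u x)
     = (c\<^sup>2 * (Tf u x)\<^sup>2 / mass u x * (ef u x)\<^sup>2 / 2 + (jf u x)\<^sup>2 / mass u x / 2) + sg x * h' x" for x
  proof -
    have Tn: "Tf u x \<noteq> 0" using near_Tf(2)[OF assms, of x] \<tau>l by linarith
    have ct: "c * Tf u x * Tf' u x = Re (cnj (u x) * weak_deriv u x)" using c_pos Tn by (simp add: Tf'_def)
    have "mass u x * (norm (weak_deriv u x))\<^sup>2 = (cmod (cnj (u x) * weak_deriv u x))\<^sup>2"
      by (simp add: norm_mult power_mult_distrib mass_def)
    also have "\<dots> = (c * Tf u x * Tf' u x)\<^sup>2 + (current u x)\<^sup>2" unfolding ct current_def by (rule cmod_power2)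
    finally have w: "(norm (weak_deriv u x))\<^sup>2 = ((c * Tf u x * Tf' u x)\<^sup>2 + (current u x)\<^sup>2) / mass u x"
      using mpos[of x] by (simp add: field_simps)
    show ?thesis
      using density_identity[of "sg x" "Tf u x" "Tf' u x" "current u x"]
      unfolding w near_Tf(1)[OF assms] ef_def jf_def h'_def Hp'_def by simp
  qed
  have i1: "integrable lborel (\<lambda>x. (norm (weak_deriv u x))\<^sup>2 / 2)" "integrable lborel (\<lambda>x. (norm (1 - mass u x))\<^sup>2 / 4)"
    "integrable lborel (\<lambda>x. v / 2 * ((1 - 1 / mass u x) * current u x))"
    using energy_space_sqi_deriv[OF u] energy_space_sqi_1_mass[OF u] momentum_integrable[OF u mfun_pos[of \<tau>l] near_Tf(5)[OF assms]]
    by (auto simp: sq_integrable_def)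
  have "energy_fn \<gamma> v u = (LINT x|lborel. (norm (weak_deriv u x))\<^sup>2 / 2 + (norm (1 - mass u x))\<^sup>2 / 4 - v / 2 * ((1 - 1 / mass u x) * current u x)) + \<gamma> / 2 * mass u 0"
    unfolding energy_fn_def l2norm_power2 momentum_def
    using i1 by simp
  also have "\<dots> = (LINT x|lborel. (c\<^sup>2 * (Tf u x)\<^sup>2 / mass u x * (ef u x)\<^sup>2 / 2 + (jf u x)\<^sup>2 / mass u x / 2) + sg x * h' x) + \<gamma> / 2 * mass u 0"
    by (simp only: pt)
  also have "\<dots> = Qf u + (LINT x|lborel. sg x * h' x) + \<gamma> / 2 * mass u 0"
    unfolding Qf_def by (subst Bochner_Integration.integral_add) (use Qf_integrable[OF assms] ish' in auto)
  finally show ?thesis unfolding ish gf_def near_Tf(1)[OF assms] by simp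
qed

text \<open>Lower bound for the weight c^2 T^2 / m of the first defect, from T \<ge> \<tau>l and m
  \<le> 2.\<close>

definition b0 :: real where "b0 = c\<^sup>2 * \<tau>l\<^sup>2 / 2"

lemma b0_pos: "0 < b0" using c_pos \<tau>l by (simp add: b0_def)

lemma Qf_lower:
  assumes "near u"
  shows "b0 / 2 * (l2norm (ef u))\<^sup>2 + (l2norm (jf u))\<^sup>2 / 4 \<le> Qf u"
proof -
  note u = near_energy[OF assms]
  have i: "integrable lborel (\<lambda>x. b0 / 2 * (norm (ef u x))\<^sup>2)" "integrable lborel (\<lambda>x. (norm (jf u x))\<^sup>2 / 4)"
    using ef_sqi[OF assms] jf_sqi[OF u] by (auto simp: sq_integrable_def)
  have "b0 / 2 * (l2norm (ef u))\<^sup>2 + (l2norm (jf u))\<^sup>2 / 4 = (LINT x|lborel. b0 / 2 * (norm (ef u x))\<^sup>2 + (norm (jf u x))\<^sup>2 / 4)"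
    unfolding l2norm_power2 using i by simp
  also have "\<dots> \<le> Qf u"
    unfolding Qf_def
  proof (rule integral_mono)
    show "integrable lborel (\<lambda>x. b0 / 2 * (norm (ef u x))\<^sup>2 + (norm (jf u x))\<^sup>2 / 4)" using i by simp
    show "integrable lborel (\<lambda>x. c\<^sup>2 * (Tf u x)\<^sup>2 / mass u x * (ef u x)\<^sup>2 / 2 + (jf u x)\<^sup>2 / mass u x / 2)"
      using Qf_integrable[OF assms] by simp
    fix x
    have mp: "0 < mass u x" "mass u x \<le> 2" using near_Tf(1,4)[OF assms, of x] mfun_pos by metis+
    have "\<tau>l\<^sup>2 \<le> (Tf u x)\<^sup>2" using near_Tf(2)[OF assms, of x] \<tau>l by (intro power_mono) auto
    then have "b0 \<le> c\<^sup>2 * (Tf u x)\<^sup>2 / mass u x"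
      unfolding b0_def using mp c_pos by (intro frac_le mult_left_mono) auto
    then have "b0 * (ef u x)\<^sup>2 \<le> c\<^sup>2 * (Tf u x)\<^sup>2 / mass u x * (ef u x)\<^sup>2" by (intro mult_right_mono) auto
    moreover have "(jf u x)\<^sup>2 / 2 \<le> (jf u x)\<^sup>2 / mass u x" using mp by (intro divide_left_mono) auto
    moreover have "x \<le> a \<Longrightarrow> y / 2 \<le> b \<Longrightarrow> x / 2 + y / 4 \<le> a / 2 + b / 2" for x y a b :: real by linarith
    ultimately have "b0 * (ef u x)\<^sup>2 / 2 + (jf u x)\<^sup>2 / 4 \<le> c\<^sup>2 * (Tf u x)\<^sup>2 / mass u x * (ef u x)\<^sup>2 / 2 + (jf u x)\<^sup>2 / mass u x / 2"
      by blast
    then show "b0 / 2 * (norm (ef u x))\<^sup>2 + (norm (jf u x))\<^sup>2 / 4 \<le> c\<^sup>2 * (Tf u x)\<^sup>2 / mass u x * (ef u x)\<^sup>2 / 2 + (jf u x)\<^sup>2 / mass u x / 2"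
      by simp
  qed
  finally show ?thesis .
qed

lemma Qf_upper:
  assumes "near u"
  shows "Qf u \<le> c * (l2norm (ef u))\<^sup>2 + 1 / mfun \<tau>l * (l2norm (jf u))\<^sup>2"
proof -
  note u = near_energy[OF assms]
  have i: "integrable lborel (\<lambda>x. c * (norm (ef u x))\<^sup>2)" "integrable lborel (\<lambda>x. 1 / mfun \<tau>l * (norm (jf u x))\<^sup>2)"
    using ef_sqi[OF assms] jf_sqi[OF u] by (auto simp: sq_integrable_def)
  have "Qf u \<le> (LINT x|lborel. c * (norm (ef u x))\<^sup>2 + 1 / mfun \<tau>l * (norm (jf u x))\<^sup>2)"
    unfolding Qf_def
  proof (rule integral_mono)
    show "integrable lborel (\<lambda>x. c * (norm (ef u x))\<^sup>2 + 1 / mfun \<tau>l * (norm (jf u x))\<^sup>2)" using i by simp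
    show "integrable lborel (\<lambda>x. c\<^sup>2 * (Tf u x)\<^sup>2 / mass u x * (ef u x)\<^sup>2 / 2 + (jf u x)\<^sup>2 / mass u x / 2)"
      using Qf_integrable[OF assms] by simp
    fix x
    have mp: "0 < mfun \<tau>l" "mfun \<tau>l \<le> mass u x" using mfun_pos near_Tf(5)[OF assms] by auto
    have w: "0 \<le> c\<^sup>2 * (Tf u x)\<^sup>2 / mass u x" "c\<^sup>2 * (Tf u x)\<^sup>2 / mass u x \<le> c"
      using weight_bounds[of "Tf u x"] near_Tf(1)[OF assms, of x] by auto
    have "c\<^sup>2 * (Tf u x)\<^sup>2 / mass u x * (ef u x)\<^sup>2 \<le> c * (ef u x)\<^sup>2" using w by (intro mult_right_mono) auto
    moreover have "0 \<le> c\<^sup>2 * (Tf u x)\<^sup>2 / mass u x * (ef u x)\<^sup>2" using w by (intro mult_nonneg_nonneg) auto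
    moreover have "(jf u x)\<^sup>2 / mass u x \<le> (jf u x)\<^sup>2 / mfun \<tau>l" using mp by (intro divide_left_mono) auto
    moreover have "0 \<le> (jf u x)\<^sup>2 / mass u x" using mp by simp
    moreover have "x \<le> a \<Longrightarrow> 0 \<le> x \<Longrightarrow> y \<le> b \<Longrightarrow> 0 \<le> y \<Longrightarrow> x / 2 + y / 2 \<le> a + b" for x y a b :: real by linarith
    ultimately have "c\<^sup>2 * (Tf u x)\<^sup>2 / mass u x * (ef u x)\<^sup>2 / 2 + (jf u x)\<^sup>2 / mass u x / 2 \<le> c * (ef u x)\<^sup>2 + (jf u x)\<^sup>2 / mfun \<tau>l"
      by blast
    then show "c\<^sup>2 * (Tf u x)\<^sup>2 / mass u x * (ef u x)\<^sup>2 / 2 + (jf u x)\<^sup>2 / mass u x / 2 \<le> c * (norm (ef u x))\<^sup>2 + 1 / mfun \<tau>l * (norm (jf u x))\<^sup>2"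
      by simp
  qed
  also have "\<dots> = c * (l2norm (ef u))\<^sup>2 + 1 / mfun \<tau>l * (l2norm (jf u))\<^sup>2"
    unfolding l2norm_power2 using i by simp
  finally show ?thesis .
qed

text \<open>Lower bound on [\<tau>l, 2] for the cofactor of T - \<tau>1 in the derivative of
  \<open>gf\<close>: increasing factors are taken at \<tau>l, the positive term 2 k c (T + \<tau>1 +
  \<tau>2) is dropped, and m is largest at 2.\<close>

definition q0 :: real where "q0 = c * \<tau>l * (\<tau>l - \<tau>2) * (\<gamma> * c) / mfun 2"

lemma q0_pos: "0 < q0"
  using c_pos \<tau>l \<gamma> mfun_pos[of 2] by (simp add: q0_def)

lemma gf_deriv: "(gf has_real_derivative c * T * pol T / mfun T) (at T)"
proof -
  have m: "(mfun has_real_derivative 2 * c * T) (at T)"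
    unfolding mfun_def[abs_def] by (auto intro!: derivative_eq_intros)
  have "(gf has_real_derivative 2 * (0 - Hp' T) + \<gamma> / 2 * (2 * c * T)) (at T)"
    unfolding gf_def[abs_def] by (intro DERIV_add DERIV_cmult DERIV_diff DERIV_const Hp_deriv m)
  moreover have "2 * (0 - Hp' T) + \<gamma> / 2 * (2 * c * T) = c * T * pol T / mfun T"
    using mfun_pos[of T] by (simp add: Hp'_def pol_def power2_eq_square field_simps)
  ultimately show ?thesis by simp
qed

text \<open>The derivative of \<open>gf\<close> minus the parabola is T - \<tau>1 times a
  nonnegative factor, so that difference is smallest at \<tau>1. The gap between \<tau>l and \<tau>2
  is essential, as the cofactor vanishes at \<tau>2.\<close>

lemma gf_lower:
  assumes "\<tau>l \<le> T" "T \<le> 2"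
  shows "q0 / 2 * (T - \<tau>1)\<^sup>2 \<le> gf T - gf \<tau>1"
proof -
  define \<phi> where "\<phi> s = gf s - q0 / 2 * (s - \<tau>1)\<^sup>2" for s
  define qf where "qf s = c * s * (s - \<tau>2) * (2 * k * c * (s + \<tau>1 + \<tau>2) + \<gamma> * c) / mfun s" for s
  have d: "(\<phi> has_real_derivative (s - \<tau>1) * (qf s - q0)) (at s)" for s
  proof -
    have "(\<phi> has_real_derivative c * s * pol s / mfun s - q0 * (s - \<tau>1)) (at s)"
      unfolding \<phi>_def by (auto intro!: derivative_eq_intros gf_deriv)
    moreover have "c * s * pol s / mfun s = (s - \<tau>1) * qf s" unfolding pol_factor qf_def by simp
    moreover have "(s - \<tau>1) * qf s - q0 * (s - \<tau>1) = (s - \<tau>1) * (qf s - q0)" by (simp add: algebra_simps)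
    ultimately show ?thesis by metis
  qed
  have q: "q0 \<le> qf s" if "\<tau>l \<le> s" "s \<le> 2" for s
  proof -
    have s2: "s\<^sup>2 \<le> 2\<^sup>2" using that \<tau>l by (intro power_mono) auto
    have "c * \<tau>l * (\<tau>l - \<tau>2) * (\<gamma> * c) \<le> c * s * (s - \<tau>2) * (2 * k * c * (s + \<tau>1 + \<tau>2) + \<gamma> * c)"
      using that \<tau>l c_pos k_pos \<gamma> \<tau>_order by (intro mult_mono mult_nonneg_nonneg) (auto intro: add_nonneg_nonneg)
    then show ?thesis
      unfolding q0_def qf_def using mfun_le[OF s2] mfun_pos[of s] that \<tau>l c_pos \<gamma> k_pos \<tau>_order
      by (intro frac_le) (auto intro!: mult_nonneg_nonneg add_nonneg_nonneg)
  qed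
  have "\<phi> \<tau>1 \<le> \<phi> T"
  proof (cases "\<tau>1 \<le> T")
    case True
    show ?thesis
    proof (rule DERIV_nonneg_imp_nondecreasing[OF True])
      fix s assume "\<tau>1 \<le> s" "s \<le> T"
      then show "\<exists>y. (\<phi> has_real_derivative y) (at s) \<and> 0 \<le> y"
        using d[of s] q[of s] assms \<tau>l by (intro exI[of _ "(s - \<tau>1) * (qf s - q0)"]) auto
    qed
  next
    case False
    show ?thesis
    proof (rule DERIV_nonpos_imp_nonincreasing[of T \<tau>1])
      show "T \<le> \<tau>1" using False by simp
      fix s assume "T \<le> s" "s \<le> \<tau>1"
      then show "\<exists>y. (\<phi> has_real_derivative y) (at s) \<and> y \<le> 0"
        using d[of s] q[of s] assms \<tau>_order by (intro exI[of _ "(s - \<tau>1) * (qf s - q0)"]) (auto simp: mult_le_0_iff)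
    qed
  qed
  then show ?thesis by (simp add: \<phi>_def)
qed

text \<open>Dominates 2 / q0, 2 / b0 and 4, the constants with which the energy excess controls the
  squares of the three deviations.\<close>

definition cst :: real where "cst = 4 + 4 / b0 + 2 / q0"

text \<open>The energy excess over gf \<tau>1 is bounded below by a sum of three nonnegative terms,
  each of which is then at most \<eta>.\<close>

lemma coercivity:
  assumes "near u" and \<eta>: "energy_fn \<gamma> v u - gf \<tau>1 \<le> \<eta>"
  shows "0 \<le> \<eta>" "\<bar>Tf u 0 - \<tau>1\<bar> \<le> sqrt (cst * \<eta>)" "l2norm (ef u) \<le> sqrt (cst * \<eta>)" "l2norm (jf u) \<le> sqrt (cst * \<eta>)"
proof -
  have e: "Qf u + (gf (Tf u 0) - gf \<tau>1) \<le> \<eta>" using energy_identity[OF assms(1)] \<eta> by simp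
  have g: "q0 / 2 * (Tf u 0 - \<tau>1)\<^sup>2 \<le> gf (Tf u 0) - gf \<tau>1"
    by (rule gf_lower) (use near_Tf[OF assms(1)] in auto)
  note Q = Qf_lower[OF assms(1)]
  have p: "0 \<le> q0 / 2 * (Tf u 0 - \<tau>1)\<^sup>2" "0 \<le> b0 / 2 * (l2norm (ef u))\<^sup>2" "0 \<le> (l2norm (jf u))\<^sup>2 / 4"
    using q0_pos b0_pos by auto
  show \<eta>0: "0 \<le> \<eta>" using e g Q p by linarith
  have 1: "q0 / 2 * (Tf u 0 - \<tau>1)\<^sup>2 \<le> \<eta>" and 2: "b0 / 2 * (l2norm (ef u))\<^sup>2 \<le> \<eta>" and 3: "(l2norm (jf u))\<^sup>2 / 4 \<le> \<eta>"
    using e g Q p by linarith+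
  have cb: "2 / q0 \<le> cst" "2 / b0 \<le> cst" "4 \<le> cst"
    using q0_pos b0_pos by (auto simp: cst_def field_simps)
  have "(Tf u 0 - \<tau>1)\<^sup>2 \<le> 2 / q0 * \<eta>" using 1 q0_pos by (simp add: field_simps)
  also have "\<dots> \<le> cst * \<eta>" using cb \<eta>0 by (intro mult_right_mono) auto
  finally show "\<bar>Tf u 0 - \<tau>1\<bar> \<le> sqrt (cst * \<eta>)" by (intro real_le_rsqrt) simp
  have "(l2norm (ef u))\<^sup>2 \<le> 2 / b0 * \<eta>" using 2 b0_pos by (simp add: field_simps)
  also have "\<dots> \<le> cst * \<eta>" using cb \<eta>0 by (intro mult_right_mono) auto
  finally show "l2norm (ef u) \<le> sqrt (cst * \<eta>)" by (rule real_le_rsqrt)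
  have "(l2norm (jf u))\<^sup>2 \<le> 4 * \<eta>" using 3 by simp
  also have "\<dots> \<le> cst * \<eta>" using cb \<eta>0 by (intro mult_right_mono) auto
  finally show "l2norm (jf u) \<le> sqrt (cst * \<eta>)" by (rule real_le_rsqrt)
qed

end

section \<open>Distance to the orbit of the profile\<close>

lemma l2_dominated_sum:
  fixes f :: "real \<Rightarrow> 'a::euclidean_space" and g :: "real \<Rightarrow> 'b::euclidean_space" and h :: "real \<Rightarrow> 'c::euclidean_space"
  assumes f: "f \<in> borel_measurable borel" and g: "sq_integrable g" and h: "sq_integrable h"
    and ab: "0 \<le> a" "0 \<le> b" and le: "\<And>x. norm (f x) \<le> a * norm (g x) + b * norm (h x)"
  shows "sq_integrable f" "l2norm f \<le> a * l2norm g + b * l2norm h"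
proof -
  have s: "sq_integrable (\<lambda>x. a * norm (g x))" "sq_integrable (\<lambda>x. b * norm (h x))"
    by (intro sqi_scale(1) sqi_norm g h)+
  have n: "norm (f x) \<le> norm (a * norm (g x) + b * norm (h x))" for x
    using le[of x] by simp
  show "sq_integrable f" by (rule sqi_mono(1)[OF sqi_add(1)[OF s] f n])
  have "l2norm f \<le> l2norm (\<lambda>x. a * norm (g x) + b * norm (h x))" by (rule sqi_mono(2)[OF sqi_add(1)[OF s] f n])
  also have "\<dots> \<le> l2norm (\<lambda>x. a * norm (g x)) + l2norm (\<lambda>x. b * norm (h x))" by (rule sqi_add(2)[OF s])
  also have "\<dots> = a * l2norm g + b * l2norm h"
    using ab by (simp add: sqi_scale(2)[OF sqi_norm[OF g]] sqi_scale(2)[OF sqi_norm[OF h]] l2norm_norm)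
  finally show "l2norm f \<le> a * l2norm g + b * l2norm h" .
qed

context profile
begin

section \<open>Bounds for the profile and its logarithmic derivative\<close>

definition dup :: "real \<Rightarrow> complex" where "dup x = up x * Gh (sg x) (Tp x)"
definition ml :: real where "ml = mfun \<tau>l"

lemma up_ac': "has_ac_deriv up dup"
  using up_ac by (simp add: dup_def[abs_def])

lemma ml_pos: "0 < ml" by (simp add: ml_def mfun_pos)

lemma ml_le_profile: "ml \<le> mfun (Tp x)" and profile_le_1: "mfun (Tp x) \<le> 1"
proof -
  have "\<tau>l\<^sup>2 \<le> (Tp x)\<^sup>2" using Tp_bounds[of x] \<tau>l by (intro power_mono) auto
  then show "ml \<le> mfun (Tp x)" unfolding ml_def by (rule mfun_le)
  have "0 \<le> c * (1 - (Tp x)\<^sup>2)" using Tp_decay(2)[of x] c_pos by simp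
  then show "mfun (Tp x) \<le> 1" using one_minus_mfun[of "Tp x"] by linarith
qed

lemma cmod_up_le_1: "cmod (up x) \<le> 1"
  unfolding cmod_up \<rho>_def using profile_le_1 by simp

lemma sqrt_ml_le: "sqrt ml \<le> cmod (up x)"
  unfolding cmod_up \<rho>_def using ml_le_profile by simp

lemma Gh_bound:
  assumes "\<bar>s\<bar> = 1" "0 \<le> T" "T \<le> 2" "ml \<le> mfun T"
  shows "cmod (Gh s T) \<le> c / ml * (2 * k + v) * \<bar>1 - T\<^sup>2\<bar>"
proof -
  have "cmod (Complex (s * k * T) (- v / 2)) \<le> \<bar>s * k * T\<bar> + \<bar>- v / 2\<bar>" by (rule order_trans[OF cmod_le]) simp
  also have "\<bar>s * k * T\<bar> = k * T" using assms k_pos by (simp add: abs_mult)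
  also have "k * T + \<bar>- v / 2\<bar> \<le> 2 * k + v"
  proof -
    have "k * T \<le> k * 2" using assms k_pos by (intro mult_left_mono) auto
    moreover have "\<bar>- v / 2\<bar> \<le> v" using v by simp
    ultimately show ?thesis by linarith
  qed
  finally have 1: "cmod (Complex (s * k * T) (- v / 2)) \<le> 2 * k + v" .
  have "cmod (of_real (c * (1 - T\<^sup>2) / mfun T)) = c * \<bar>1 - T\<^sup>2\<bar> / mfun T"
    unfolding norm_of_real using c_pos mfun_pos[of T] by (simp add: abs_mult)
  also have "\<dots> \<le> c * \<bar>1 - T\<^sup>2\<bar> / ml" using assms(4) ml_pos c_pos by (intro divide_left_mono) auto
  finally have 2: "cmod (of_real (c * (1 - T\<^sup>2) / mfun T)) \<le> c / ml * \<bar>1 - T\<^sup>2\<bar>" by simp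
  have "cmod (Gh s T) \<le> (c / ml * \<bar>1 - T\<^sup>2\<bar>) * (2 * k + v)"
    unfolding Gh_def norm_mult by (intro mult_mono 1 2) (use c_pos ml_pos in auto)
  then show ?thesis by (simp add: mult_ac)
qed

text \<open>Lipschitz constant of a quotient with denominator at least \<open>ml\<close>: that of
  the numerator over \<open>ml\<close>, plus the size of the numerator times the Lipschitz constant
  3 c of m over the square of \<open>ml\<close>.\<close>

definition Lc :: real where
  "Lc = (3 * c * (2 * k + v) + 3 * c * k) / ml + c * (2 * k + v) * (3 * c) / (ml * ml)"

lemma Gh_lipschitz:
  assumes s: "\<bar>s\<bar> = 1" and T: "0 \<le> T" "T \<le> 2" "ml \<le> mfun T" and S: "0 \<le> S" "S \<le> 1" "ml \<le> mfun S"
  shows "cmod (Gh s T - Gh s S) \<le> Lc * \<bar>T - S\<bar>"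
proof -
  define nT nS where "nT = of_real (c * (1 - T\<^sup>2)) * Complex (s * k * T) (- v / 2)" and "nS = of_real (c * (1 - S\<^sup>2)) * Complex (s * k * S) (- v / 2)"
  define mT mS where "mT = mfun T" and "mS = mfun S"
  have mp: "0 < mT" "0 < mS" "ml \<le> mT" "ml \<le> mS" using mfun_pos T S by (auto simp: mT_def mS_def)
  have sq: "\<bar>T\<^sup>2 - S\<^sup>2\<bar> \<le> 3 * \<bar>T - S\<bar>"
  proof -
    have "\<bar>T\<^sup>2 - S\<^sup>2\<bar> = \<bar>T - S\<bar> * (T + S)" using T S by (simp add: power2_eq_square square_diff_square_factored abs_mult)
    also have "\<dots> \<le> \<bar>T - S\<bar> * 3" using T S by (intro mult_left_mono) auto
    finally show ?thesis by simp
  qed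
  have aT: "cmod (Complex (s * k * T) (- v / 2)) \<le> 2 * k + v"
  proof -
    have "cmod (Complex (s * k * T) (- v / 2)) \<le> \<bar>s * k * T\<bar> + \<bar>- v / 2\<bar>" by (rule order_trans[OF cmod_le]) simp
    also have "\<bar>s * k * T\<bar> = k * T" using s T k_pos by (simp add: abs_mult)
    also have "k * T + \<bar>- v / 2\<bar> \<le> 2 * k + v"
    proof -
      have "k * T \<le> k * 2" using T k_pos by (intro mult_left_mono) auto
      moreover have "\<bar>- v / 2\<bar> \<le> v" using v by simp
      ultimately show ?thesis by linarith
    qed
    finally show ?thesis .
  qed
  have aS: "cmod (Complex (s * k * S) (- v / 2)) \<le> 2 * k + v"
  proof -
    have "cmod (Complex (s * k * S) (- v / 2)) \<le> \<bar>s * k * S\<bar> + \<bar>- v / 2\<bar>" by (rule order_trans[OF cmod_le]) simp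
    also have "\<bar>s * k * S\<bar> = k * S" using s S k_pos by (simp add: abs_mult)
    also have "k * S + \<bar>- v / 2\<bar> \<le> 2 * k + v"
    proof -
      have "k * S \<le> k * 2" using S k_pos by (intro mult_left_mono) auto
      moreover have "\<bar>- v / 2\<bar> \<le> v" using v by simp
      ultimately show ?thesis by linarith
    qed
    finally show ?thesis .
  qed
  have S1: "\<bar>1 - S\<^sup>2\<bar> \<le> 1" using S power_le_one[of S 2] by (simp add: abs_le_iff)
  have nd: "cmod (nT - nS) \<le> (3 * c * (2 * k + v) + 3 * c * k) * \<bar>T - S\<bar>"
  proof -
    have e: "nT - nS = of_real (c * (S\<^sup>2 - T\<^sup>2)) * Complex (s * k * T) (- v / 2) + of_real (c * (1 - S\<^sup>2)) * of_real (s * k * (T - S))"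
      by (simp add: nT_def nS_def complex_eq_iff algebra_simps)
    have "cmod (of_real (c * (S\<^sup>2 - T\<^sup>2)) * Complex (s * k * T) (- v / 2)) \<le> (c * (3 * \<bar>T - S\<bar>)) * (2 * k + v)"
      unfolding norm_mult norm_of_real abs_mult using sq c_pos
      by (intro mult_mono aT) (auto simp: abs_minus_commute)
    moreover have "cmod (of_real (c * (1 - S\<^sup>2)) * of_real (s * k * (T - S))) \<le> (c * 3) * (k * \<bar>T - S\<bar>)"
      unfolding norm_mult norm_of_real abs_mult s using S1 c_pos k_pos
      by (intro mult_mono) auto
    ultimately show ?thesis unfolding e
      by (intro order_trans[OF norm_triangle_ineq]) (simp add: algebra_simps)
  qed
  have nS: "cmod nS \<le> c * (2 * k + v)"
  proof -
    have "cmod nS \<le> (c * 1) * (2 * k + v)"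
      unfolding nS_def norm_mult norm_of_real abs_mult using S1 c_pos by (intro mult_mono aS) auto
    then show ?thesis by simp
  qed
  have md: "\<bar>mT - mS\<bar> \<le> 3 * c * \<bar>T - S\<bar>"
  proof -
    have "mT - mS = c * (T\<^sup>2 - S\<^sup>2)" by (simp add: mT_def mS_def mfun_def algebra_simps)
    then show ?thesis using sq c_pos by (simp add: abs_mult)
  qed
  have e: "Gh s T - Gh s S = (nT - nS) / of_real mT + nS * of_real ((mS - mT) / (mT * mS))"
  proof -
    have 1: "Gh s T = nT / of_real mT" "Gh s S = nS / of_real mS"
      by (simp_all add: Gh_def nT_def nS_def mT_def mS_def)
    show ?thesis unfolding 1 using mp by (simp add: field_simps)
  qed
  have 1: "cmod ((nT - nS) / of_real mT) \<le> (3 * c * (2 * k + v) + 3 * c * k) / ml * \<bar>T - S\<bar>"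
  proof -
    have "cmod ((nT - nS) / of_real mT) = cmod (nT - nS) / mT" using mp by (simp add: norm_divide)
    also have "\<dots> \<le> ((3 * c * (2 * k + v) + 3 * c * k) * \<bar>T - S\<bar>) / ml"
      using nd mp ml_pos by (intro frac_le) (auto intro: order_trans[OF norm_ge_zero])
    finally show ?thesis by simp
  qed
  have 2: "cmod (nS * of_real ((mS - mT) / (mT * mS))) \<le> c * (2 * k + v) * (3 * c) / (ml * ml) * \<bar>T - S\<bar>"
  proof -
    have "\<bar>(mS - mT) / (mT * mS)\<bar> = \<bar>mT - mS\<bar> / (mT * mS)" using mp by (simp add: abs_divide abs_mult abs_minus_commute)
    also have "\<dots> \<le> (3 * c * \<bar>T - S\<bar>) / (ml * ml)"
      using md mp ml_pos c_pos by (intro frac_le mult_mono) auto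
    finally have "cmod (nS * of_real ((mS - mT) / (mT * mS))) \<le> (c * (2 * k + v)) * ((3 * c * \<bar>T - S\<bar>) / (ml * ml))"
      unfolding norm_mult norm_of_real using nS c_pos k_pos v by (intro mult_mono) auto
    then show ?thesis by simp
  qed
  show ?thesis unfolding e Lc_def
    by (rule order_trans[OF norm_triangle_ineq]) (use 1 2 in \<open>simp only: distrib_right\<close>)
qed

lemma dup_decay: "cmod (dup x) \<le> c / ml * (2 * k + v) * 4 * exp (- (2 * k) * \<bar>x\<bar>)"
proof -
  have "cmod (Gh (sg x) (Tp x)) \<le> c / ml * (2 * k + v) * \<bar>1 - (Tp x)\<^sup>2\<bar>"
    using Tp_bounds[of x] by (intro Gh_bound ml_le_profile) auto
  also have "\<dots> \<le> c / ml * (2 * k + v) * (4 * exp (- (2 * k) * \<bar>x\<bar>))"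
    using Tp_decay[of x] c_pos ml_pos k_pos v by (intro mult_left_mono) auto
  finally have "cmod (up x) * cmod (Gh (sg x) (Tp x)) \<le> 1 * (c / ml * (2 * k + v) * (4 * exp (- (2 * k) * \<bar>x\<bar>)))"
    by (intro mult_mono cmod_up_le_1) auto
  then show ?thesis by (simp only: dup_def norm_mult mult_1 mult.assoc)
qed

lemma weighted_dup_sqi: "sq_integrable (\<lambda>x. (1 + sqrt \<bar>x\<bar>) * cmod (dup x))"
proof (rule sqi_dominated(1)[where g="\<lambda>x. (1 + sqrt \<bar>x\<bar>) * exp (- (2 * k) * \<bar>x\<bar>)"])
  show "sq_integrable (\<lambda>x. (1 + sqrt \<bar>x\<bar>) * exp (- (2 * k) * \<bar>x\<bar>))" using k_pos by (intro sqi_weighted_exp) simp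
  show "(\<lambda>x. (1 + sqrt \<bar>x\<bar>) * cmod (dup x)) \<in> borel_measurable borel" using ac_borel[OF up_ac'] by measurable
  fix x
  have "(1 + sqrt \<bar>x\<bar>) * cmod (dup x) \<le> (1 + sqrt \<bar>x\<bar>) * (c / ml * (2 * k + v) * 4 * exp (- (2 * k) * \<bar>x\<bar>))"
    by (intro mult_left_mono dup_decay) auto
  then show "norm ((1 + sqrt \<bar>x\<bar>) * cmod (dup x)) \<le> (c / ml * (2 * k + v) * 4) * norm ((1 + sqrt \<bar>x\<bar>) * exp (- (2 * k) * \<bar>x\<bar>))"
    by (simp add: abs_mult abs_of_nonneg mult_ac)
qed

definition Wn :: real where "Wn = l2norm (\<lambda>x. (1 + sqrt \<bar>x\<bar>) * cmod (dup x))"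

lemma dup_sqi: "sq_integrable dup"
  by (rule sqi_dominated(1)[OF weighted_dup_sqi ac_borel[OF up_ac'], of 1])
    (auto simp: abs_mult mult_right_mono[of 1 "1 + sqrt \<bar>x\<bar>" "cmod (dup x)" for x, simplified])

lemma one_minus_Tp2_sqi: "sq_integrable (\<lambda>x. 1 - (Tp x)\<^sup>2)"
proof (rule sqi_dominated(1)[where g="\<lambda>x. (1 + sqrt \<bar>x\<bar>) * exp (- (2 * k) * \<bar>x\<bar>)" and K=4])
  show "sq_integrable (\<lambda>x. (1 + sqrt \<bar>x\<bar>) * exp (- (2 * k) * \<bar>x\<bar>))" using k_pos by (intro sqi_weighted_exp) simp
  show "(\<lambda>x. 1 - (Tp x)\<^sup>2) \<in> borel_measurable borel" using ac_borel_fun[OF Tp_ac] by measurable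
  fix x
  have "1 * exp (- (2 * k) * \<bar>x\<bar>) \<le> (1 + sqrt \<bar>x\<bar>) * exp (- (2 * k) * \<bar>x\<bar>)" by (intro mult_right_mono) auto
  moreover have "\<bar>1 - (Tp x)\<^sup>2\<bar> \<le> 4 * exp (- (2 * k) * \<bar>x\<bar>)" using Tp_decay[of x] by simp
  ultimately have "\<bar>1 - (Tp x)\<^sup>2\<bar> \<le> 4 * ((1 + sqrt \<bar>x\<bar>) * exp (- (2 * k) * \<bar>x\<bar>))" by linarith
  then show "norm (1 - (Tp x)\<^sup>2) \<le> 4 * norm ((1 + sqrt \<bar>x\<bar>) * exp (- (2 * k) * \<bar>x\<bar>))"
    by (simp add: abs_mult abs_of_nonneg)
qed

lemma one_minus_mass_up_sqi: "sq_integrable (\<lambda>x. 1 - (cmod (up x))\<^sup>2)"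
proof -
  have "1 - (cmod (up x))\<^sup>2 = c * (1 - (Tp x)\<^sup>2)" for x
    unfolding cmod_up \<rho>_sq by (rule one_minus_mfun)
  then show ?thesis using sqi_scale(1)[OF one_minus_Tp2_sqi, of c] by simp
qed

lemma rotated:
  fixes \<phi> :: real
  defines "p \<equiv> \<lambda>x. exp (\<i> * of_real \<phi>) * up x"
  shows "p \<in> energy_space" "AE x in lborel. weak_deriv p x = exp (\<i> * of_real \<phi>) * dup x" "weak_deriv p \<in> borel_measurable borel"
    "\<And>x. cmod (p x) = cmod (up x)"
proof -
  have ac: "has_ac_deriv p (\<lambda>x. exp (\<i> * of_real \<phi>) * dup x)"
    unfolding p_def by (rule ac_bounded_linear[OF up_ac' bounded_linear_mult_right])
  show n: "cmod (p x) = cmod (up x)" for x by (simp add: p_def norm_mult)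
  note E = energy_spaceI[OF ac sqi_scale(1)[OF dup_sqi]]
  show "p \<in> energy_space" "AE x in lborel. weak_deriv p x = exp (\<i> * of_real \<phi>) * dup x" "weak_deriv p \<in> borel_measurable borel"
    using E one_minus_mass_up_sqi unfolding n by auto
qed

lemma l2norm_deriv_rotated:
  fixes \<phi> :: real
  assumes "u \<in> energy_space"
  shows "l2norm (\<lambda>x. weak_deriv u x - weak_deriv (\<lambda>x. exp (\<i> * of_real \<phi>) * up x) x) = l2norm (\<lambda>x. weak_deriv u x - exp (\<i> * of_real \<phi>) * dup x)"
proof (rule l2norm_AE_cong)
  note [measurable] = sqi_borel[OF energy_space_sqi_deriv[OF assms]] rotated(3)[of \<phi>] ac_borel[OF up_ac']
  show "(\<lambda>x. weak_deriv u x - weak_deriv (\<lambda>x. exp (\<i> * of_real \<phi>) * up x) x) \<in> borel_measurable borel" by measurable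
  show "(\<lambda>x. weak_deriv u x - exp (\<i> * of_real \<phi>) * dup x) \<in> borel_measurable borel" by measurable
  show "AE x in lborel. weak_deriv u x - weak_deriv (\<lambda>x. exp (\<i> * of_real \<phi>) * up x) x = weak_deriv u x - exp (\<i> * of_real \<phi>) * dup x"
    using rotated(2)[of \<phi>] by (auto elim: eventually_mono)
qed

lemma up_energy: "up \<in> energy_space"
  using rotated(1)[of 0] by simp

text \<open>The real part is half the derivative of the mass and the imaginary part the current;
  both defects of the profile vanish.\<close>

lemma cnj_up_dup: "cnj (up x) * dup x = of_real (c * Tp x * Tp' x) + \<i> * of_real (v / 2 * (mfun (Tp x) - 1))"
proof -
  have m: "mfun (Tp x) \<noteq> 0" using mfun_pos[of "Tp x"] by simp
  have "cnj (up x) * up x = of_real ((cmod (up x))\<^sup>2)" using complex_norm_square[of "up x"] by (simp add: mult.commute)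
  then have "cnj (up x) * dup x = of_real (mfun (Tp x)) * Gh (sg x) (Tp x)"
    unfolding dup_def cmod_up \<rho>_sq mult.assoc[symmetric] by simp
  also have "\<dots> = of_real (c * Tp x * Tp' x) + \<i> * of_real (v / 2 * (mfun (Tp x) - 1))"
  proof -
    have "mfun (Tp x) * \<theta>' x = v / 2 * (mfun (Tp x) - 1)" using m by (simp add: \<theta>'_def field_simps)
    moreover have "mfun (Tp x) * (c * Tp x * Tp' x / mfun (Tp x)) = c * Tp x * Tp' x" using m by simp
    ultimately show ?thesis unfolding Gh_profile distrib_left
      by (metis (no_types, lifting) mult.left_commute of_real_mult)
  qed
  finally show ?thesis .
qed

section \<open>Closeness in modulus\<close>

lemma sigma_ac:
  assumes "near u"
  shows "has_ac_deriv (\<lambda>x. Tf u x - Tp x) (\<lambda>x. Tf' u x - Tp' x)"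
    "Tf' u x - Tp' x = ef u x - sg x * k * (Tf u x + Tp x) * (Tf u x - Tp x)"
proof -
  show "has_ac_deriv (\<lambda>x. Tf u x - Tp x) (\<lambda>x. Tf' u x - Tp' x)"
    by (rule ac_diff[OF Tf_ac[OF assms] Tp_ac])
  \<comment> \<open>Subtracting the two Riccati equations leaves a difference of squares, hence an
    equation linear in T - Tp.\<close>
  show "Tf' u x - Tp' x = ef u x - sg x * k * (Tf u x + Tp x) * (Tf u x - Tp x)"
    by (simp add: ef_def Tp'_def power2_eq_square algebra_simps)
qed

lemma Tp_minus_1: "\<bar>Tp x - 1\<bar> \<le> \<bar>1 - (Tp x)\<^sup>2\<bar>"
proof -
  have "\<bar>Tp x - 1\<bar> * 1 \<le> \<bar>Tp x - 1\<bar> * (Tp x + 1)" using Tp_bounds[of x] by (intro mult_left_mono) auto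
  also have "\<dots> = \<bar>(Tp x - 1) * (Tp x + 1)\<bar>" using Tp_bounds[of x] by (simp add: abs_mult)
  also have "(Tp x - 1) * (Tp x + 1) = - (1 - (Tp x)\<^sup>2)" by (simp add: power2_eq_square algebra_simps)
  finally show ?thesis by simp
qed

lemma sigma_sqi:
  assumes "near u"
  shows "sq_integrable (\<lambda>x. Tf u x - Tp x)"
proof (rule l2_dominated_sum(1)[OF _ energy_space_sqi_1_mass[OF near_energy[OF assms]] one_minus_Tp2_sqi, of _ "1 / c" 1])
  show "(\<lambda>x. Tf u x - Tp x) \<in> borel_measurable borel" by (rule ac_borel_fun[OF sigma_ac(1)[OF assms]])
  show "norm (Tf u x - Tp x) \<le> 1 / c * norm (1 - mass u x) + 1 * norm (1 - (Tp x)\<^sup>2)" for x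
    using Tf_minus_1[OF assms, of x] Tp_minus_1[of x] by (simp add: abs_le_iff)
qed (use c_pos in auto)

text \<open>\<open>K1\<close> is such that k \<tau>l X^2 \<le> X z + z^2 implies X \<le> K1 z;
  \<open>K2\<close> then bounds the derivative through the linear equation.\<close>

definition K1 :: real where "K1 = 1 + 2 / (k * \<tau>l)"
definition K2 :: real where "K2 = 1 + 4 * k * K1"

lemma K1_pos: "1 \<le> K1" and K2_pos: "1 \<le> K2"
proof -
  show 1: "1 \<le> K1" using k_pos \<tau>l by (simp add: K1_def)
  show "1 \<le> K2" using 1 k_pos by (simp add: K2_def)
qed

lemma Tf_Tp_sum:
  assumes "near u"
  shows "\<tau>l \<le> Tf u x + Tp x" "Tf u x + Tp x \<le> 3" "0 \<le> Tf u x + Tp x"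
  using near_Tf(2,3)[OF assms, of x] Tp_bounds[of x] \<tau>l by auto

text \<open>Testing the linear equation for \<open>\<sigma> = T - T\<^sub>\<xi>\<close> with \<open>sgn x \<sigma>\<close> uses that the profile equation
  \<open>T' = sgn x k (1 - T\<^sup>2)\<close> is dissipative away from the origin.\<close>

lemma sigma_bound:
  assumes "near u" and z: "0 \<le> z" "\<bar>Tf u 0 - \<tau>1\<bar> \<le> z" "l2norm (ef u) \<le> z"
  shows "l2norm (\<lambda>x. Tf u x - Tp x) \<le> K1 * z" "\<bar>Tf u x - Tp x\<bar> \<le> (K1 + K2) * z"
proof -
  define \<sigma> where "\<sigma> x = Tf u x - Tp x" for x
  define \<sigma>' where "\<sigma>' x = Tf' u x - Tp' x" for x
  have ac: "has_ac_deriv \<sigma> \<sigma>'" using sigma_ac(1)[OF assms(1)] by (simp add: \<sigma>_def[abs_def] \<sigma>'_def[abs_def])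
  have \<sigma>'e: "\<sigma>' x = ef u x - sg x * k * (Tf u x + Tp x) * \<sigma> x" for x
    using sigma_ac(2)[OF assms(1)] by (simp add: \<sigma>_def \<sigma>'_def)
  have s: "sq_integrable \<sigma>" using sigma_sqi[OF assms(1)] by (simp add: \<sigma>_def[abs_def])
  note e = ef_sqi[OF assms(1)]
  have \<sigma>'le: "norm (\<sigma>' x) \<le> 1 * norm (ef u x) + 4 * k * norm (\<sigma> x)" for x
  proof -
    have "\<bar>sg x * k * (Tf u x + Tp x) * \<sigma> x\<bar> = k * (Tf u x + Tp x) * \<bar>\<sigma> x\<bar>"
      using k_pos Tf_Tp_sum[OF assms(1), of x] by (simp add: abs_mult)
    also have "\<dots> \<le> k * 4 * \<bar>\<sigma> x\<bar>" using k_pos Tf_Tp_sum[OF assms(1), of x] by (intro mult_right_mono mult_left_mono) auto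
    finally show ?thesis unfolding \<sigma>'e real_norm_def by (simp add: mult_ac) 
  qed
  have s': "sq_integrable \<sigma>'" "l2norm \<sigma>' \<le> 1 * l2norm (ef u) + 4 * k * l2norm \<sigma>"
    using l2_dominated_sum[OF ac_borel[OF ac] e s _ _ \<sigma>'le] k_pos by auto
  define X where "X = l2norm \<sigma>"
  have "has_ac_deriv (\<lambda>x. \<sigma> x * \<sigma> x) (\<lambda>x. \<sigma>' x * \<sigma> x + \<sigma> x * \<sigma>' x)" by (rule ac_mult[OF ac ac])
  moreover have i1: "integrable lborel (\<lambda>x. \<sigma>' x * \<sigma> x)" "integrable lborel (\<lambda>x. \<sigma> x * \<sigma>' x)"
    using sqi_mult(1)[OF s'(1) s] sqi_mult(1)[OF s s'(1)] .
  moreover have "integrable lborel (\<lambda>x. (norm (\<sigma> x * \<sigma> x))\<^sup>2)"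
  proof -
    have "sq_integrable (\<lambda>x. \<sigma> x * \<sigma> x)"
      by (rule sqi_mult_bounded(1)[OF s ac_borel_fun[OF ac], of "l2norm \<sigma> + l2norm \<sigma>'"]) (rule ac_sup_bound[OF ac s s'(1)])
    then show ?thesis by (simp add: sq_integrable_def)
  qed
  \<comment> \<open>The jump of the sign at the origin produces the boundary term for the square of
    \<sigma>.\<close>
  ultimately have "(LINT x|lborel. sgn x *\<^sub>R (\<sigma>' x * \<sigma> x + \<sigma> x * \<sigma>' x)) = - 2 *\<^sub>R (\<sigma> 0 * \<sigma> 0)"
    by (intro ac_integral_line(2)) auto
  moreover have "(LINT x|lborel. sg x * (2 * (\<sigma>' x * \<sigma> x))) = (LINT x|lborel. sgn x *\<^sub>R (\<sigma>' x * \<sigma> x + \<sigma> x * \<sigma>' x))"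
  proof (rule integral_cong_AE)
    show "AE x in lborel. sg x * (2 * (\<sigma>' x * \<sigma> x)) = sgn x *\<^sub>R (\<sigma>' x * \<sigma> x + \<sigma> x * \<sigma>' x)"
      using AE_lborel_singleton[of "0::real"] by (rule eventually_mono) (auto simp: sg_def sgn_if)
  qed (use ac_borel[OF ac] ac_borel_fun[OF ac] in measurable)
  moreover have "(LINT x|lborel. sg x * (2 * (\<sigma>' x * \<sigma> x))) = (LINT x|lborel. 2 * (sg x * (\<sigma>' x * \<sigma> x)))"
    by (simp only: mult.left_commute[of "sg _" 2])
  moreover have "(LINT x|lborel. 2 * (sg x * (\<sigma>' x * \<sigma> x))) = 2 * (LINT x|lborel. sg x * (\<sigma>' x * \<sigma> x))"
    by (rule integral_mult_right_zero)
  ultimately have "2 * (LINT x|lborel. sg x * (\<sigma>' x * \<sigma> x)) = - 2 * (\<sigma> 0 * \<sigma> 0)"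
    by simp
  then have I: "(LINT x|lborel. sg x * (\<sigma>' x * \<sigma> x)) = - (\<sigma> 0)\<^sup>2" by (simp add: power2_eq_square)
  \<comment> \<open>The sign of x squares away in the damping term, which is therefore of one sign
    on both half-lines and dominates k \<tau>l \<sigma>^2.\<close>
  have pt: "k * \<tau>l * (norm (\<sigma> x))\<^sup>2 \<le> norm (\<sigma> x) * norm (ef u x) - sg x * (\<sigma>' x * \<sigma> x)" for x
  proof -
    have "sg x * (\<sigma>' x * \<sigma> x) = sg x * (ef u x * \<sigma> x) - k * (Tf u x + Tp x) * (\<sigma> x)\<^sup>2"
      unfolding \<sigma>'e by (simp add: power2_eq_square algebra_simps)
    moreover have "sg x * (ef u x * \<sigma> x) \<le> norm (\<sigma> x) * norm (ef u x)"
      using abs_ge_self[of "sg x * (ef u x * \<sigma> x)"] by (simp add: abs_mult mult.commute)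
    moreover have "k * \<tau>l * (\<sigma> x)\<^sup>2 \<le> k * (Tf u x + Tp x) * (\<sigma> x)\<^sup>2"
      using k_pos Tf_Tp_sum[OF assms(1), of x] by (intro mult_right_mono mult_left_mono) auto
    ultimately show ?thesis unfolding real_norm_def power2_abs by linarith
  qed
  have isg: "integrable lborel (\<lambda>x. sg x * (\<sigma>' x * \<sigma> x))"
    by (rule Bochner_Integration.integrable_bound[OF i1(1)])
      (use ac_borel[OF ac] ac_borel_fun[OF ac] in \<open>auto simp: abs_mult\<close>)
  have i2: "integrable lborel (\<lambda>x. norm (\<sigma> x) * norm (ef u x))" by (rule sqi_product(1)[OF s e])
  have i3: "integrable lborel (\<lambda>x. k * \<tau>l * (norm (\<sigma> x))\<^sup>2)" using s by (simp add: sq_integrable_def)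
  have "k * \<tau>l * X\<^sup>2 = (LINT x|lborel. k * \<tau>l * (norm (\<sigma> x))\<^sup>2)" unfolding X_def l2norm_power2 by simp
  also have "\<dots> \<le> (LINT x|lborel. norm (\<sigma> x) * norm (ef u x) - sg x * (\<sigma>' x * \<sigma> x))"
    by (rule integral_mono[OF i3 _ pt]) (use i2 isg in auto)
  also have "\<dots> = (LINT x|lborel. norm (\<sigma> x) * norm (ef u x)) + (\<sigma> 0)\<^sup>2" using i2 isg I by simp
  also have "\<dots> \<le> X * l2norm (ef u) + (\<sigma> 0)\<^sup>2" unfolding X_def by (intro add_right_mono sqi_product(2)[OF s e])
  also have "\<dots> \<le> X * z + z\<^sup>2"
  proof (intro add_mono mult_left_mono z)
    have "\<bar>\<sigma> 0\<bar> \<le> z" using z(2) by (simp add: \<sigma>_def Tp_0)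
    then show "(\<sigma> 0)\<^sup>2 \<le> z\<^sup>2" using power_mono[of "\<bar>\<sigma> 0\<bar>" z 2] by simp
  qed (simp add: X_def)
  finally have q: "k * \<tau>l * X\<^sup>2 \<le> X * z + z\<^sup>2" .
  have kt: "k * \<tau>l > 0" using k_pos \<tau>l by simp
  have X: "X \<le> K1 * z"
  proof (rule ccontr)
    assume n: "\<not> X \<le> K1 * z"
    have "1 * z \<le> K1 * z" using K1_pos z by (intro mult_right_mono) auto
    then have zX: "z \<le> X" "0 < X" using n z by auto
    have "z * z \<le> X * z" using zX z by (intro mult_right_mono) auto
    then have "(k * \<tau>l * X) * X \<le> (2 * z) * X" using q by (simp add: power2_eq_square algebra_simps)
    then have "k * \<tau>l * X \<le> 2 * z" using zX(2) by simp
    then have "X \<le> 2 * z / (k * \<tau>l)" using kt by (simp add: pos_le_divide_eq mult.commute)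
    also have "\<dots> \<le> K1 * z" using z by (simp add: K1_def algebra_simps)
    finally show False using n by simp
  qed
  then show "l2norm (\<lambda>x. Tf u x - Tp x) \<le> K1 * z" by (simp add: X_def \<sigma>_def[abs_def])
  have "l2norm \<sigma>' \<le> z + 4 * k * (K1 * z)"
  proof -
    have "4 * k * l2norm \<sigma> \<le> 4 * k * (K1 * z)" using X k_pos unfolding X_def by (intro mult_left_mono) auto
    then show ?thesis using s'(2) z(3) by linarith
  qed
  then have "l2norm \<sigma>' \<le> K2 * z" by (simp add: K2_def algebra_simps)
  then show "\<bar>Tf u x - Tp x\<bar> \<le> (K1 + K2) * z"
    using ac_sup_bound[OF ac s s'(1), of x] X by (simp add: X_def \<sigma>_def algebra_simps)
qed

lemma mass_diff_bound:
  assumes "near u"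
  shows "\<bar>mass u x - mfun (Tp x)\<bar> \<le> 3 * \<bar>Tf u x - Tp x\<bar>"
proof -
  have "mass u x - mfun (Tp x) = c * ((Tf u x - Tp x) * (Tf u x + Tp x))"
    unfolding near_Tf(1)[OF assms, symmetric] mfun_def by (simp add: power2_eq_square algebra_simps)
  then have "\<bar>mass u x - mfun (Tp x)\<bar> = c * (Tf u x + Tp x) * \<bar>Tf u x - Tp x\<bar>"
    using c_pos Tf_Tp_sum[OF assms, of x] by (simp add: abs_mult)
  also have "\<dots> \<le> 1 * 3 * \<bar>Tf u x - Tp x\<bar>"
    using c_pos c_le_1 Tf_Tp_sum[OF assms, of x] by (intro mult_right_mono mult_mono) auto
  finally show ?thesis by simp
qed

text \<open>Real and imaginary part of cnj u * u_x are expressed by T and the two defects; dividing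
  by the mass splits u_x / u into the value prescribed by \<open>Gh\<close> and an error linear in
  the defects.\<close>

lemma log_deriv:
  assumes "near u"
  shows "weak_deriv u x = u x * (Gh (sg x) (Tf u x) + Complex (c * Tf u x * ef u x) (jf u x) / of_real (mass u x))"
proof -
  have m: "mass u x > 0" using near_Tf(1)[OF assms, of x] mfun_pos by metis
  have Tn: "Tf u x \<noteq> 0" using near_Tf(2)[OF assms, of x] \<tau>l by linarith
  have re: "Re (cnj (u x) * weak_deriv u x) = c * Tf u x * (ef u x + sg x * k * (1 - (Tf u x)\<^sup>2))"
    using c_pos Tn by (simp add: ef_def Tf'_def)
  have m1: "mass u x - 1 = - c * (1 - (Tf u x)\<^sup>2)"
    using one_minus_mfun[of "Tf u x"] near_Tf(1)[OF assms, of x] by simp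
  have im: "Im (cnj (u x) * weak_deriv u x) = jf u x - v / 2 * c * (1 - (Tf u x)\<^sup>2)"
    using m1 by (simp add: jf_def current_def)
  have "of_real (mass u x) * Gh (sg x) (Tf u x) = of_real (c * (1 - (Tf u x)\<^sup>2)) * Complex (sg x * k * Tf u x) (- v / 2)"
    unfolding Gh_def near_Tf(1)[OF assms] using m by simp
  then have "cnj (u x) * weak_deriv u x = of_real (mass u x) * Gh (sg x) (Tf u x) + Complex (c * Tf u x * ef u x) (jf u x)"
    by (intro complex_eqI) (simp_all only: plus_complex.sel re im, simp_all add: algebra_simps)
  then have "u x * (cnj (u x) * weak_deriv u x) = of_real (mass u x) * (u x * (Gh (sg x) (Tf u x) + Complex (c * Tf u x * ef u x) (jf u x) / of_real (mass u x)))"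
    using m by (simp add: field_simps)
  moreover have "u x * (cnj (u x) * weak_deriv u x) = of_real (mass u x) * weak_deriv u x"
    using complex_norm_square[of "u x"] by (simp add: mass_def mult.assoc[symmetric])
  ultimately show ?thesis using m by simp
qed

end

lemma l2norm_of_real: "l2norm (\<lambda>x. complex_of_real (f x)) = l2norm f"
  by (simp add: l2norm_def)

context profile
begin

lemma Lc_nonneg: "0 \<le> Lc"
proof -
  have "0 < 2 * k + v" "0 < ml" using k_pos v ml_pos by auto
  then show ?thesis unfolding Lc_def using c_pos k_pos
    by (intro add_nonneg_nonneg divide_nonneg_nonneg mult_nonneg_nonneg) (use v in auto)
qed

text \<open>\<open>Kq\<close> bounds the quotient q of u by the profile, \<open>K5\<close> the L^2
  norm of its logarithmic derivative per unit of z, and \<open>K6\<close> the growth of q - 1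
  against the weight 1 + sqrt|x|.\<close>

definition Kq :: real where "Kq = 2 / sqrt ml"
definition K5 :: real where "K5 = Lc * K1 + (2 * c + 1) / ml"
definition K6 :: real where "K6 = Kq * K5 + 3 * (K1 + K2) / ml"

lemma K_nonneg: "0 < Kq" "0 \<le> K5" "0 \<le> K6"
proof -
  show 1: "0 < Kq" using ml_pos by (simp add: Kq_def)
  show 2: "0 \<le> K5" unfolding K5_def
    using Lc_nonneg K1_pos c_pos ml_pos by (intro add_nonneg_nonneg mult_nonneg_nonneg divide_nonneg_nonneg) auto
  show "0 \<le> K6" unfolding K6_def
    using 1 2 K1_pos K2_pos ml_pos by (intro add_nonneg_nonneg mult_nonneg_nonneg divide_nonneg_nonneg) auto
qed

text \<open>The quotient \<open>q = e\<^sup>-\<^sup>i\<^sup>\<phi> u / u\<^sub>\<xi>\<close> solves the linear equation \<open>q' = q (G - G\<^sub>\<xi>)\<close>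
  with a square integrable coefficient, and the phase is chosen so that \<open>q 0\<close> is real.\<close>

lemma profile_close:
  assumes n: "near u" and z: "0 \<le> z" "\<bar>Tf u 0 - \<tau>1\<bar> \<le> z" "l2norm (ef u) \<le> z" "l2norm (jf u) \<le> z"
  shows "\<exists>\<phi>. \<forall>A>0. dist_A A u (\<lambda>x. exp (\<i> * of_real \<phi>) * up x) \<le> (Kq * K5 + K6 * Wn + K6 * (1 + sqrt A) + 3 * K1) * z"
proof -
  note E = near_energy[OF n]
  define \<phi> where "\<phi> = Arg (u 0)"
  define \<epsilon> where "\<epsilon> = exp (\<i> * of_real \<phi>)"
  have \<epsilon>: "cnj \<epsilon> * \<epsilon> = 1" "cmod \<epsilon> = 1"
    by (simp_all add: \<epsilon>_def exp_cnj exp_add[symmetric])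
  have m0: "0 < mass u x" for x using near_Tf(1)[OF n, of x] mfun_pos by metis
  have u0: "u 0 = of_real (cmod (u 0)) * \<epsilon>"
    using m0[of 0] Arg_eq[of "u 0"] by (simp add: mass_def \<epsilon>_def \<phi>_def)
  note \<sigma> = sigma_bound[OF n z(1-3)]
  define q where "q x = cnj \<epsilon> * (u x * inverse (up x))" for x
  define D where "D x = Gh (sg x) (Tf u x) + Complex (c * Tf u x * ef u x) (jf u x) / of_real (mass u x) - Gh (sg x) (Tp x)" for x
  have ud: "weak_deriv u x = u x * (Gh (sg x) (Tp x) + D x)" for x
    unfolding log_deriv[OF n, of x] D_def by (simp add: algebra_simps)
  have "has_ac_deriv q (\<lambda>x. cnj \<epsilon> * (weak_deriv u x * inverse (up x) + u x * (- inverse (up x) * Gh (sg x) (Tp x))))"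
    unfolding q_def[abs_def]
    by (rule ac_bounded_linear[OF ac_mult[OF energy_space_ac[OF E] inverse_up_ac] bounded_linear_mult_right])
  moreover have "cnj \<epsilon> * (weak_deriv u x * inverse (up x) + u x * (- inverse (up x) * Gh (sg x) (Tp x))) = q x * D x" for x
    unfolding ud q_def by (simp add: algebra_simps)
  ultimately have qac: "has_ac_deriv q (\<lambda>x. q x * D x)" by simp
  have uq: "u x = \<epsilon> * (up x * q x)" for x
  proof -
    have "\<epsilon> * (up x * q x) = (cnj \<epsilon> * \<epsilon>) * u x * (up x * inverse (up x))" by (simp add: q_def mult_ac)
    then show ?thesis using up_nz[of x] \<epsilon>(1) by simp
  qed
  have qb: "cmod (q x) \<le> Kq" for x
  proof -
    have "cmod (q x) = cmod (u x) / cmod (up x)" unfolding q_def norm_mult norm_inverse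
      using \<epsilon>(2) by (simp add: divide_inverse)
    also have "\<dots> \<le> 2 / sqrt ml" using near_cmod[OF n, of x] sqrt_ml_le[of x] ml_pos by (intro frac_le) auto
    finally show ?thesis by (simp add: Kq_def)
  qed
  define g where "g x = 2 * c / ml * norm (ef u x) + 1 / ml * norm (jf u x)" for x
  have gs: "sq_integrable g" "l2norm g \<le> 2 * c / ml * l2norm (ef u) + 1 / ml * l2norm (jf u)"
  proof -
    have b: "g \<in> borel_measurable borel" unfolding g_def[abs_def]
      using sqi_borel[OF ef_sqi[OF n]] sqi_borel[OF jf_sqi[OF E]] by measurable
    have le: "norm (g x) \<le> 2 * c / ml * norm (ef u x) + 1 / ml * norm (jf u x)" for x
      unfolding g_def using c_pos ml_pos by simp
    show "sq_integrable g" "l2norm g \<le> 2 * c / ml * l2norm (ef u) + 1 / ml * l2norm (jf u)"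
      using l2_dominated_sum[OF b ef_sqi[OF n] jf_sqi[OF E] _ _ le] c_pos ml_pos by auto
  qed
  have g0: "0 \<le> g x" for x unfolding g_def using c_pos ml_pos by simp
  have Db: "cmod (D x) \<le> Lc * norm (Tf u x - Tp x) + norm (g x)" for x
  proof -
    have mm: "ml \<le> mass u x" using near_Tf(5)[OF n] by (simp add: ml_def)
    have T: "0 \<le> Tf u x" "Tf u x \<le> 2" using near_Tf(2,3)[OF n, of x] \<tau>l by auto
    have 1: "cmod (Gh (sg x) (Tf u x) - Gh (sg x) (Tp x)) \<le> Lc * \<bar>Tf u x - Tp x\<bar>"
      using T near_Tf(1)[OF n] mm Tp_bounds[of x] ml_le_profile by (intro Gh_lipschitz) auto
    have "cmod (Complex (c * Tf u x * ef u x) (jf u x)) \<le> \<bar>c * Tf u x * ef u x\<bar> + \<bar>jf u x\<bar>"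
      by (rule order_trans[OF cmod_le]) simp
    also have "\<bar>c * Tf u x * ef u x\<bar> = c * Tf u x * \<bar>ef u x\<bar>" using c_pos T by (simp add: abs_mult)
    also have "\<dots> \<le> c * 2 * \<bar>ef u x\<bar>" using c_pos T by (intro mult_right_mono mult_left_mono) auto
    finally have "cmod (Complex (c * Tf u x * ef u x) (jf u x)) \<le> c * 2 * \<bar>ef u x\<bar> + \<bar>jf u x\<bar>" by simp
    then have "cmod (Complex (c * Tf u x * ef u x) (jf u x)) / mass u x \<le> (c * 2 * \<bar>ef u x\<bar> + \<bar>jf u x\<bar>) / ml"
      using mm ml_pos c_pos by (intro frac_le) auto
    also have "\<dots> = g x" by (simp add: g_def add_divide_distrib mult_ac)
    finally have 2: "cmod (Complex (c * Tf u x * ef u x) (jf u x) / of_real (mass u x)) \<le> g x"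
      using m0[of x] by (simp add: norm_divide)
    have "D x = (Gh (sg x) (Tf u x) - Gh (sg x) (Tp x)) + Complex (c * Tf u x * ef u x) (jf u x) / of_real (mass u x)"
      by (simp add: D_def)
    then have "cmod (D x) \<le> cmod (Gh (sg x) (Tf u x) - Gh (sg x) (Tp x)) + cmod (Complex (c * Tf u x * ef u x) (jf u x) / of_real (mass u x))"
      by (simp only: norm_triangle_ineq)
    then show ?thesis using 1 2 g0[of x] by simp
  qed
  have q'b: "norm (q x * D x) \<le> (Kq * Lc) * norm (Tf u x - Tp x) + Kq * norm (g x)" for x
  proof -
    have "norm (q x * D x) \<le> Kq * (Lc * norm (Tf u x - Tp x) + norm (g x))"
      unfolding norm_mult using K_nonneg(1) by (intro mult_mono qb Db) auto
    then show ?thesis by (simp add: algebra_simps)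
  qed
  have q's: "sq_integrable (\<lambda>x. q x * D x)" "l2norm (\<lambda>x. q x * D x) \<le> Kq * K5 * z"
  proof -
    note d = l2_dominated_sum[OF ac_borel[OF qac] sigma_sqi[OF n] gs(1) _ _ q'b]
    have p: "0 \<le> Kq * Lc" "0 \<le> Kq" using K_nonneg(1) Lc_nonneg by auto
    show "sq_integrable (\<lambda>x. q x * D x)" using d(1) p by blast
    have "l2norm (\<lambda>x. q x * D x) \<le> Kq * Lc * l2norm (\<lambda>x. Tf u x - Tp x) + Kq * l2norm g" using d(2) p by blast
    also have "\<dots> \<le> Kq * Lc * (K1 * z) + Kq * (2 * c / ml * z + 1 / ml * z)"
    proof (intro add_mono mult_left_mono \<sigma>(1) p)
      have "2 * c / ml * l2norm (ef u) + 1 / ml * l2norm (jf u) \<le> 2 * c / ml * z + 1 / ml * z"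
        using z c_pos ml_pos by (intro add_mono mult_left_mono) auto
      then show "l2norm g \<le> 2 * c / ml * z + 1 / ml * z" using gs(2) by linarith
    qed
    also have "\<dots> = Kq * K5 * z" by (simp add: K5_def add_divide_distrib algebra_simps)
    finally show "l2norm (\<lambda>x. q x * D x) \<le> Kq * K5 * z" .
  qed
  have q0: "cmod (q 0 - 1) \<le> 3 * (K1 + K2) / ml * z"
  proof -
    have up0: "up 0 = of_real (\<rho> 0)" by (simp add: up_eq \<theta>_0)
    have "q 0 = (cnj \<epsilon> * \<epsilon>) * of_real (cmod (u 0)) * inverse (of_real (\<rho> 0))"
      unfolding q_def up0 by (subst u0) (simp add: mult_ac)
    then have "q 0 - 1 = of_real ((cmod (u 0) - \<rho> 0) / \<rho> 0)"
      using \<epsilon>(1) \<rho>_pos[of 0] by (simp add: field_simps)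
    then have "cmod (q 0 - 1) = \<bar>cmod (u 0) - \<rho> 0\<bar> / \<rho> 0"
      using \<rho>_pos[of 0] by (simp only: norm_of_real abs_divide abs_of_pos)
    \<comment> \<open>The extra factor \<rho> 0 brings in the difference of the squared moduli, for
      which \<open>mass_diff_bound\<close> is available.\<close>
    also have "\<dots> = \<bar>cmod (u 0) - \<rho> 0\<bar> * \<rho> 0 / mfun (Tp 0)"
      unfolding \<rho>_sq[symmetric] using \<rho>_pos[of 0] by (simp add: power2_eq_square)
    also have "\<dots> \<le> (3 * (K1 + K2) * z) / ml"
    proof (intro frac_le ml_le_profile ml_pos)
      have "\<bar>cmod (u 0) - \<rho> 0\<bar> * \<rho> 0 \<le> \<bar>cmod (u 0) - \<rho> 0\<bar> * (cmod (u 0) + \<rho> 0)" by (intro mult_left_mono) auto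
      also have "\<dots> = \<bar>(cmod (u 0) - \<rho> 0) * (cmod (u 0) + \<rho> 0)\<bar>" using \<rho>_pos[of 0] by (simp add: abs_mult)
      also have "(cmod (u 0) - \<rho> 0) * (cmod (u 0) + \<rho> 0) = mass u 0 - mfun (Tp 0)"
        unfolding \<rho>_sq[symmetric] mass_def by (simp add: power2_eq_square algebra_simps)
      also have "\<bar>mass u 0 - mfun (Tp 0)\<bar> \<le> 3 * ((K1 + K2) * z)"
        by (rule order_trans[OF mass_diff_bound[OF n]]) (intro mult_left_mono \<sigma>(2), simp)
      finally show "\<bar>cmod (u 0) - \<rho> 0\<bar> * \<rho> 0 \<le> 3 * (K1 + K2) * z" by (simp only: mult.assoc)
    qed (use K1_pos K2_pos z in simp)
    finally show ?thesis by simp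
  qed
  \<comment> \<open>The phase is controlled only by integrating outwards from the origin, hence the
    growth in |x|. This is where a sup norm over the whole line is out of reach.\<close>
  have q1: "cmod (q x - 1) \<le> K6 * (1 + sqrt \<bar>x\<bar>) * z" for x
  proof -
    have "cmod (q x - q 0) \<le> sqrt \<bar>x - 0\<bar> * l2norm (\<lambda>x. q x * D x)" by (rule ac_holder[OF qac q's(1)])
    also have "\<dots> \<le> sqrt \<bar>x - 0\<bar> * (Kq * K5 * z)" by (intro mult_left_mono q's(2)) simp
    finally have "cmod (q x - 1) \<le> sqrt \<bar>x\<bar> * (Kq * K5 * z) + 3 * (K1 + K2) / ml * z"
      using norm_triangle_ineq[of "q x - q 0" "q 0 - 1"] q0 by simp
    also have "\<dots> \<le> (1 + sqrt \<bar>x\<bar>) * (Kq * K5 * z) + (1 + sqrt \<bar>x\<bar>) * (3 * (K1 + K2) / ml * z)"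
    proof (intro add_mono mult_right_mono)
      have "0 \<le> 3 * (K1 + K2) / ml * z" using K1_pos K2_pos ml_pos z by simp
      then have "1 * (3 * (K1 + K2) / ml * z) \<le> (1 + sqrt \<bar>x\<bar>) * (3 * (K1 + K2) / ml * z)" by (intro mult_right_mono) auto
      then show "3 * (K1 + K2) / ml * z \<le> (1 + sqrt \<bar>x\<bar>) * (3 * (K1 + K2) / ml * z)" by simp
    qed (use K_nonneg z in auto)
    also have "\<dots> = K6 * (1 + sqrt \<bar>x\<bar>) * z" by (simp add: K6_def algebra_simps)
    finally show ?thesis .
  qed
  have d1: "l2norm (\<lambda>x. weak_deriv u x - \<epsilon> * dup x) \<le> (Kq * K5 + K6 * Wn) * z"
  proof -
    \<comment> \<open>The first summand is small in L^2. In the second, the growth of q - 1 meets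
      the decay of the derivative of the profile.\<close>
    have e: "weak_deriv u x - \<epsilon> * dup x = \<epsilon> * (up x * (q x * D x) + (q x - 1) * dup x)" for x
      unfolding ud by (subst uq) (simp add: dup_def algebra_simps)
    have le: "norm (weak_deriv u x - \<epsilon> * dup x) \<le> 1 * norm (q x * D x) + (K6 * z) * norm ((1 + sqrt \<bar>x\<bar>) * cmod (dup x))" for x
    proof -
      have "cmod (up x * (q x * D x)) \<le> 1 * norm (q x * D x)" unfolding norm_mult[of "up x"] by (intro mult_right_mono cmod_up_le_1) simp
      moreover have "cmod ((q x - 1) * dup x) \<le> (K6 * (1 + sqrt \<bar>x\<bar>) * z) * cmod (dup x)"
        unfolding norm_mult by (intro mult_right_mono q1) simp
      moreover have "(K6 * (1 + sqrt \<bar>x\<bar>) * z) * cmod (dup x) = (K6 * z) * norm ((1 + sqrt \<bar>x\<bar>) * cmod (dup x))"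
        by (simp add: abs_mult abs_of_nonneg mult_ac)
      moreover have "norm (weak_deriv u x - \<epsilon> * dup x) \<le> cmod (up x * (q x * D x)) + cmod ((q x - 1) * dup x)"
        unfolding e norm_mult[of \<epsilon>] \<epsilon>(2) mult_1 by (rule norm_triangle_ineq)
      ultimately show ?thesis by linarith
    qed
    have b: "(\<lambda>x. weak_deriv u x - \<epsilon> * dup x) \<in> borel_measurable borel"
      using sqi_borel[OF energy_space_sqi_deriv[OF E]] ac_borel[OF up_ac'] by measurable
    have p: "0 \<le> K6 * z" using K_nonneg z by simp
    have "l2norm (\<lambda>x. weak_deriv u x - \<epsilon> * dup x) \<le> 1 * l2norm (\<lambda>x. q x * D x) + (K6 * z) * l2norm (\<lambda>x. (1 + sqrt \<bar>x\<bar>) * cmod (dup x))"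
      by (rule l2_dominated_sum(2)[OF b q's(1) weighted_dup_sqi _ p le]) simp
    also have "\<dots> \<le> (Kq * K5 + K6 * Wn) * z" using q's(2) by (simp add: Wn_def algebra_simps)
    finally show ?thesis .
  qed
  have d2: "Linf_norm {-A..A} (\<lambda>x. u x - \<epsilon> * up x) \<le> K6 * (1 + sqrt A) * z" if A: "A > 0" for A
  proof (rule Linf_norm_le)
    show "continuous_on UNIV (\<lambda>x. u x - \<epsilon> * up x)"
      by (intro continuous_intros energy_space_continuous[OF E] energy_space_continuous[OF up_energy])
    show "0 \<le> K6 * (1 + sqrt A) * z" using K_nonneg z A by simp
    fix x assume x: "x \<in> {-A..A}"
    have "u x - \<epsilon> * up x = \<epsilon> * (up x * (q x - 1))" by (subst uq) (simp add: algebra_simps)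
    then have "cmod (u x - \<epsilon> * up x) = cmod (up x) * cmod (q x - 1)" using \<epsilon>(2) by (simp add: norm_mult)
    also have "\<dots> \<le> 1 * (K6 * (1 + sqrt \<bar>x\<bar>) * z)" by (intro mult_mono cmod_up_le_1 q1) auto
    also have "\<dots> \<le> 1 * (K6 * (1 + sqrt A) * z)" using x K_nonneg z by (intro mult_left_mono mult_right_mono) auto
    finally show "cmod (u x - \<epsilon> * up x) \<le> K6 * (1 + sqrt A) * z" by simp
  qed simp
  have d3: "l2norm (\<lambda>x. (cmod (u x))\<^sup>2 - (cmod (\<epsilon> * up x))\<^sup>2) \<le> 3 * K1 * z"
  proof -
    have e: "(cmod (u x))\<^sup>2 - (cmod (\<epsilon> * up x))\<^sup>2 = mass u x - mfun (Tp x)" for x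
      by (simp add: norm_mult \<epsilon>(2) cmod_up \<rho>_sq mass_def)
    have "l2norm (\<lambda>x. mass u x - mfun (Tp x)) \<le> 3 * l2norm (\<lambda>x. Tf u x - Tp x)"
    proof (rule sqi_dominated(2)[OF sigma_sqi[OF n]])
      show "(\<lambda>x. mass u x - mfun (Tp x)) \<in> borel_measurable borel"
        using mass_borel[OF E] ac_borel_fun[OF mfun_Tp_ac] by measurable
    qed (use mass_diff_bound[OF n] in auto)
    then show ?thesis unfolding e using \<sigma>(1) by linarith
  qed
  show ?thesis
  proof (intro exI[of _ \<phi>] allI impI)
    fix A :: real assume A: "A > 0"
    have "dist_A A u (\<lambda>x. \<epsilon> * up x) = l2norm (\<lambda>x. weak_deriv u x - \<epsilon> * dup x) + Linf_norm {-A..A} (\<lambda>x. u x - \<epsilon> * up x)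
        + l2norm (\<lambda>x. (cmod (u x))\<^sup>2 - (cmod (\<epsilon> * up x))\<^sup>2)"
      unfolding dist_A_def L2_norm_eq_l2norm l2norm_of_real \<epsilon>_def l2norm_deriv_rotated[OF E] ..
    also have "\<dots> \<le> (Kq * K5 + K6 * Wn) * z + K6 * (1 + sqrt A) * z + 3 * K1 * z"
      by (intro add_mono d1 d2 d3 A)
    also have "\<dots> = (Kq * K5 + K6 * Wn + K6 * (1 + sqrt A) + 3 * K1) * z" by (simp add: algebra_simps)
    finally show "dist_A A u (\<lambda>x. exp (\<i> * of_real \<phi>) * up x) \<le> (Kq * K5 + K6 * Wn + K6 * (1 + sqrt A) + 3 * K1) * z"
      by (simp add: \<epsilon>_def)
  qed
qed

text \<open>Majorises \<open>sup_bound\<close> u for every u in the energy space at distance at most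
  1 from the profile.\<close>

definition Mb :: real where
  "Mb = sqrt (2 + l2norm (\<lambda>x. 1 - (cmod (up x))\<^sup>2)) + (l2norm dup + 1)"

text \<open>Converse direction: a small distance makes both defects small. The difference u - up may
  grow like sqrt|x|, but it is only multiplied by the derivative of the profile. The bound on the
  mass is stated without \<open>near\<close>, because it serves to establish
  \<open>near\<close>.\<close>

lemma datum_close:
  assumes E: "u \<in> energy_space" and A: "A > 0" and \<delta>: "dist_A A u up \<le> \<delta>" "\<delta> \<le> 1"
  shows "\<bar>mass u x - mfun (Tp x)\<bar> \<le> (1 + 2 * (Mb + Wn)) * \<delta>"
    and "near u \<Longrightarrow> \<bar>Tf u 0 - \<tau>1\<bar> \<le> (1 + 2 * (Mb + Wn)) / (c * \<tau>l) * \<delta>"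
    and "near u \<Longrightarrow> l2norm (ef u) \<le> (1 / (c * \<tau>l) * (Mb + Wn) + (k / \<tau>l + 3 * k) / (c * \<tau>l)) * \<delta>"
    and "near u \<Longrightarrow> l2norm (jf u) \<le> (Mb + Wn + v / 2) * \<delta>"
proof -
  note B = dist_A_bounds[OF E up_energy A]
  note ac = energy_space_ac[OF E]
  have d1: "l2norm (\<lambda>x. weak_deriv u x - dup x) \<le> \<delta>"
    using B(1) \<delta>(1) l2norm_deriv_rotated[OF E, of 0] by simp
  have d2: "cmod (u 0 - up 0) \<le> \<delta>" using B(2) \<delta>(1) by linarith
  have d3: "l2norm (\<lambda>x. (cmod (u x))\<^sup>2 - (cmod (up x))\<^sup>2) \<le> \<delta>" using B(3) \<delta>(1) by linarith
  have \<delta>0: "0 \<le> \<delta>" using d2 norm_ge_zero order_trans by blast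
  note sd = sqi_diff(1)[OF energy_space_sqi_deriv[OF E] dup_sqi]
  have ub: "cmod (u x) \<le> Mb" for x
  proof -
    have "l2norm (\<lambda>x. (1 - (cmod (up x))\<^sup>2) - ((cmod (u x))\<^sup>2 - (cmod (up x))\<^sup>2)) \<le> l2norm (\<lambda>x. 1 - (cmod (up x))\<^sup>2) + l2norm (\<lambda>x. (cmod (u x))\<^sup>2 - (cmod (up x))\<^sup>2)"
      by (rule sqi_diff(2)[OF one_minus_mass_up_sqi energy_space_sqi_mass_diff[OF E up_energy]])
    then have 1: "l2norm (\<lambda>x. 1 - (cmod (u x))\<^sup>2) \<le> l2norm (\<lambda>x. 1 - (cmod (up x))\<^sup>2) + 1"
      using d3 \<delta>(2) by simp
    have "l2norm (\<lambda>x. dup x + (weak_deriv u x - dup x)) \<le> l2norm dup + l2norm (\<lambda>x. weak_deriv u x - dup x)"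
      by (rule sqi_add(2)[OF dup_sqi sd])
    then have 2: "l2norm (weak_deriv u) \<le> l2norm dup + 1" using d1 \<delta>(2) by simp
    have "sqrt (1 + l2norm (\<lambda>x. 1 - (cmod (u x))\<^sup>2)) \<le> sqrt (2 + l2norm (\<lambda>x. 1 - (cmod (up x))\<^sup>2))"
      by (rule real_sqrt_le_mono) (use 1 in linarith)
    then have "sup_bound u \<le> Mb" unfolding sup_bound_def Mb_def using 2 by linarith
    then show ?thesis using energy_space_bounded[OF E, of x] by linarith
  qed
  have Mb0: "0 \<le> Mb" using ub[of 0] norm_ge_zero order_trans by blast
  have Wn0: "0 \<le> Wn" by (simp add: Wn_def)
  \<comment> \<open>The distance gives the value at the origin and the derivative; the rest is the
    Hoelder estimate, independently of A.\<close>
  have uu: "cmod (u x - up x) \<le> \<delta> * (1 + sqrt \<bar>x\<bar>)" for x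
  proof -
    have "cmod ((u x - up x) - (u 0 - up 0)) \<le> sqrt \<bar>x - 0\<bar> * l2norm (\<lambda>x. weak_deriv u x - dup x)"
      by (rule ac_holder[OF ac_diff[OF ac up_ac'] sd])
    also have "\<dots> \<le> sqrt \<bar>x - 0\<bar> * \<delta>" by (intro mult_left_mono d1) simp
    finally have "cmod ((u x - up x) - (u 0 - up 0)) \<le> sqrt \<bar>x\<bar> * \<delta>" by simp
    then have "cmod (u x - up x) \<le> sqrt \<bar>x\<bar> * \<delta> + \<delta>"
      using norm_triangle_ineq[of "(u x - up x) - (u 0 - up 0)" "u 0 - up 0"] d2 by simp
    then show ?thesis by (simp add: algebra_simps)
  qed
  \<comment> \<open>Contains both comparisons at once: twice its real part is the derivative of the
    difference of the masses, its imaginary part the difference of the currents.\<close>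
  define R where "R x = cnj (u x) * weak_deriv u x - cnj (up x) * dup x" for x
  have Rb: "R \<in> borel_measurable borel" unfolding R_def[abs_def]
    by (intro borel_measurable_diff borel_measurable_times sqi_borel[OF energy_space_sqi_deriv[OF E]] ac_borel[OF up_ac']
        borel_measurable_continuous_onI continuous_on_cnj energy_space_continuous E up_energy)
  have Rle: "norm (R x) \<le> Mb * norm (weak_deriv u x - dup x) + \<delta> * norm ((1 + sqrt \<bar>x\<bar>) * cmod (dup x))" for x
  proof -
    have e: "R x = cnj (u x) * (weak_deriv u x - dup x) + cnj (u x - up x) * dup x"
      by (simp add: R_def algebra_simps)
    have "cmod (cnj (u x) * (weak_deriv u x - dup x)) \<le> Mb * norm (weak_deriv u x - dup x)"
      unfolding norm_mult complex_mod_cnj by (intro mult_right_mono ub) simp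
    moreover have "cmod (cnj (u x - up x) * dup x) \<le> (\<delta> * (1 + sqrt \<bar>x\<bar>)) * cmod (dup x)"
      unfolding norm_mult complex_mod_cnj by (intro mult_right_mono uu) simp
    moreover have "(\<delta> * (1 + sqrt \<bar>x\<bar>)) * cmod (dup x) = \<delta> * norm ((1 + sqrt \<bar>x\<bar>) * cmod (dup x))"
      by (simp add: abs_mult abs_of_nonneg)
    moreover have "norm (R x) \<le> cmod (cnj (u x) * (weak_deriv u x - dup x)) + cmod (cnj (u x - up x) * dup x)"
      unfolding e by (rule norm_triangle_ineq)
    ultimately show ?thesis by linarith
  qed
  have Rs: "sq_integrable R" by (rule l2_dominated_sum(1)[OF Rb sd weighted_dup_sqi Mb0 \<delta>0 Rle])
  have R: "l2norm R \<le> (Mb + Wn) * \<delta>"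
  proof -
    have "l2norm R \<le> Mb * l2norm (\<lambda>x. weak_deriv u x - dup x) + \<delta> * Wn"
      unfolding Wn_def by (rule l2_dominated_sum(2)[OF Rb sd weighted_dup_sqi Mb0 \<delta>0 Rle])
    also have "\<dots> \<le> Mb * \<delta> + \<delta> * Wn" by (intro add_right_mono mult_left_mono d1 Mb0)
    finally show ?thesis by (simp add: algebra_simps)
  qed
  have ReR: "Re (R x) = Re (cnj (u x) * weak_deriv u x) - c * Tp x * Tp' x"
    and ImR: "Im (R x) = Im (cnj (u x) * weak_deriv u x) - v / 2 * (mfun (Tp x) - 1)" for x
    unfolding R_def cnj_up_dup by simp_all
  define \<mu> where "\<mu> x = mass u x - mfun (Tp x)" for x
  have \<mu>e: "(\<lambda>x. (cmod (u x))\<^sup>2 - (cmod (up x))\<^sup>2) = \<mu>"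
    by (simp add: fun_eq_iff \<mu>_def mass_def cmod_up \<rho>_sq)
  have \<mu>s: "sq_integrable \<mu>" "l2norm \<mu> \<le> \<delta>"
    using energy_space_sqi_mass_diff[OF E up_energy] d3 unfolding \<mu>e .
  have "has_ac_deriv \<mu> (\<lambda>x. 2 * Re (cnj (u x) * weak_deriv u x) - 2 * c * Tp x * Tp' x)"
    unfolding \<mu>_def[abs_def] by (rule ac_diff[OF mass_ac[OF E] mfun_Tp_ac])
  moreover have "2 * Re (cnj (u x) * weak_deriv u x) - 2 * c * Tp x * Tp' x = 2 * Re (R x)" for x
    unfolding ReR by simp
  ultimately have \<mu>ac: "has_ac_deriv \<mu> (\<lambda>x. 2 * Re (R x))" by simp
  have R2le: "norm (2 * Re (R x)) \<le> 2 * norm (R x)" for x using abs_Re_le_cmod[of "R x"] by simp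
  have R2: "sq_integrable (\<lambda>x. 2 * Re (R x))" "l2norm (\<lambda>x. 2 * Re (R x)) \<le> 2 * l2norm R"
    using sqi_dominated[OF Rs ac_borel[OF \<mu>ac] R2le] by auto
  have \<mu>sup: "\<bar>\<mu> x\<bar> \<le> (1 + 2 * (Mb + Wn)) * \<delta>" for x
  proof -
    have "\<bar>\<mu> x\<bar> \<le> l2norm \<mu> + l2norm (\<lambda>x. 2 * Re (R x))" using ac_sup_bound[OF \<mu>ac \<mu>s(1) R2(1), of x] by simp
    also have "\<dots> \<le> \<delta> + 2 * ((Mb + Wn) * \<delta>)" using \<mu>s(2) R2(2) R by linarith
    finally show ?thesis by (simp add: algebra_simps)
  qed
  then show "\<bar>mass u x - mfun (Tp x)\<bar> \<le> (1 + 2 * (Mb + Wn)) * \<delta>" by (simp add: \<mu>_def)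
  {
    assume n: "near u"
    have ct: "0 < c * \<tau>l" using c_pos \<tau>l by simp
    have \<sigma>\<mu>: "\<bar>Tf u x - Tp x\<bar> \<le> 1 / (c * \<tau>l) * \<bar>\<mu> x\<bar>" for x
    proof -
      have "\<mu> x = c * (Tf u x + Tp x) * (Tf u x - Tp x)"
        unfolding \<mu>_def near_Tf(1)[OF n, symmetric] mfun_def by (simp add: power2_eq_square algebra_simps)
      then have "\<bar>\<mu> x\<bar> = c * (Tf u x + Tp x) * \<bar>Tf u x - Tp x\<bar>"
        using c_pos Tf_Tp_sum[OF n, of x] by (simp add: abs_mult)
      moreover have "c * \<tau>l * \<bar>Tf u x - Tp x\<bar> \<le> c * (Tf u x + Tp x) * \<bar>Tf u x - Tp x\<bar>"
        using c_pos Tf_Tp_sum[OF n, of x] by (intro mult_right_mono mult_left_mono) auto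
      ultimately have "c * \<tau>l * \<bar>Tf u x - Tp x\<bar> \<le> \<bar>\<mu> x\<bar>" by simp
      then show ?thesis using ct by (simp add: pos_le_divide_eq mult.commute)
    qed
    have ct': "0 \<le> 1 / (c * \<tau>l)" using ct by simp
    have "\<bar>Tf u 0 - Tp 0\<bar> \<le> 1 / (c * \<tau>l) * ((1 + 2 * (Mb + Wn)) * \<delta>)"
      by (rule order_trans[OF \<sigma>\<mu>]) (intro mult_left_mono \<mu>sup ct')
    then show "\<bar>Tf u 0 - \<tau>1\<bar> \<le> (1 + 2 * (Mb + Wn)) / (c * \<tau>l) * \<delta>" by (simp add: Tp_0)
    have \<mu>b: "(\<lambda>x. Tf u x - Tp x) \<in> borel_measurable borel" by (rule ac_borel_fun[OF sigma_ac(1)[OF n]])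
    have \<sigma>2: "l2norm (\<lambda>x. Tf u x - Tp x) \<le> 1 / (c * \<tau>l) * \<delta>"
    proof -
      have "l2norm (\<lambda>x. Tf u x - Tp x) \<le> 1 / (c * \<tau>l) * l2norm \<mu>"
        by (rule sqi_dominated(2)[OF \<mu>s(1) \<mu>b _ ct']) (use \<sigma>\<mu> in simp)
      also have "\<dots> \<le> 1 / (c * \<tau>l) * \<delta>" by (intro mult_left_mono \<mu>s(2) ct')
      finally show ?thesis .
    qed
    have efle: "norm (ef u x) \<le> 1 / (c * \<tau>l) * norm (R x) + (k / \<tau>l + 3 * k) * norm (Tf u x - Tp x)" for x
    proof -
      have Tn: "\<tau>l \<le> Tf u x" "0 < Tf u x" using near_Tf(2)[OF n, of x] \<tau>l by auto
      \<comment> \<open>The derivative of the profile is multiplied here by the T of u instead of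
        its own, which costs a multiple of T - Tp and leaves Re R otherwise.\<close>
      have "c * Tf u x * (Tf' u x - Tp' x) = Re (R x) - c * (Tf u x - Tp x) * Tp' x"
      proof -
        have "c * Tf u x * Tf' u x = Re (cnj (u x) * weak_deriv u x)"
          using c_pos Tn by (simp only: Tf'_def) simp
        then show ?thesis unfolding ReR by (simp only: right_diff_distrib left_diff_distrib mult.assoc mult.left_commute)
      qed
      then have "c * Tf u x * \<bar>Tf' u x - Tp' x\<bar> = \<bar>Re (R x) - c * (Tf u x - Tp x) * Tp' x\<bar>"
        using abs_mult[of "c * Tf u x" "Tf' u x - Tp' x"] abs_of_pos[of "c * Tf u x"] c_pos Tn by simp
      also have "\<dots> \<le> cmod (R x) + c * \<bar>Tf u x - Tp x\<bar> * k"
      proof -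
        have "\<bar>Tp' x\<bar> \<le> k * 1" unfolding Tp'_def abs_mult sg_simps(1) mult_1
          using k_pos Tp_decay(2)[of x] by (simp add: mult_left_le)
        then have "\<bar>c * (Tf u x - Tp x) * Tp' x\<bar> \<le> c * \<bar>Tf u x - Tp x\<bar> * k"
          unfolding abs_mult using c_pos by (intro mult_mono) auto
        then show ?thesis using abs_Re_le_cmod[of "R x"] by linarith
      qed
      finally have "c * Tf u x * \<bar>Tf' u x - Tp' x\<bar> \<le> cmod (R x) + c * \<bar>Tf u x - Tp x\<bar> * k" .
      moreover have "c * \<tau>l * \<bar>Tf' u x - Tp' x\<bar> \<le> c * Tf u x * \<bar>Tf' u x - Tp' x\<bar>"
        using Tn c_pos by (intro mult_right_mono mult_left_mono) auto
      ultimately have "\<bar>Tf' u x - Tp' x\<bar> \<le> (cmod (R x) + c * \<bar>Tf u x - Tp x\<bar> * k) / (c * \<tau>l)"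
        using ct by (simp add: pos_le_divide_eq mult.commute)
      also have "\<dots> = 1 / (c * \<tau>l) * cmod (R x) + k / \<tau>l * \<bar>Tf u x - Tp x\<bar>"
        using c_pos \<tau>l by (simp add: add_divide_distrib)
      finally have 1: "\<bar>Tf' u x - Tp' x\<bar> \<le> 1 / (c * \<tau>l) * cmod (R x) + k / \<tau>l * \<bar>Tf u x - Tp x\<bar>" .
      have "\<bar>sg x * k * (Tf u x + Tp x) * (Tf u x - Tp x)\<bar> = k * (Tf u x + Tp x) * \<bar>Tf u x - Tp x\<bar>"
        using k_pos Tf_Tp_sum[OF n, of x] by (simp add: abs_mult)
      also have "\<dots> \<le> k * 3 * \<bar>Tf u x - Tp x\<bar>" using k_pos Tf_Tp_sum[OF n, of x] by (intro mult_right_mono mult_left_mono) auto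
      finally have 2: "\<bar>sg x * k * (Tf u x + Tp x) * (Tf u x - Tp x)\<bar> \<le> 3 * k * \<bar>Tf u x - Tp x\<bar>" by simp
      have "ef u x = (Tf' u x - Tp' x) + sg x * k * (Tf u x + Tp x) * (Tf u x - Tp x)" using sigma_ac(2)[OF n, of x] by simp
      then have "\<bar>ef u x\<bar> \<le> \<bar>Tf' u x - Tp' x\<bar> + \<bar>sg x * k * (Tf u x + Tp x) * (Tf u x - Tp x)\<bar>" by simp
      then show ?thesis using 1 2 unfolding real_norm_def distrib_right by linarith
    qed
    have kk: "0 \<le> k / \<tau>l + 3 * k" using k_pos \<tau>l by simp
    have "l2norm (ef u) \<le> 1 / (c * \<tau>l) * l2norm R + (k / \<tau>l + 3 * k) * l2norm (\<lambda>x. Tf u x - Tp x)"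
      by (rule l2_dominated_sum(2)[OF sqi_borel[OF ef_sqi[OF n]] Rs sigma_sqi[OF n] ct' kk efle])
    also have "\<dots> \<le> 1 / (c * \<tau>l) * ((Mb + Wn) * \<delta>) + (k / \<tau>l + 3 * k) * (1 / (c * \<tau>l) * \<delta>)"
      by (intro add_mono mult_left_mono R \<sigma>2 ct' kk)
    also have "\<dots> = (1 / (c * \<tau>l) * (Mb + Wn) + (k / \<tau>l + 3 * k) / (c * \<tau>l)) * \<delta>" by (simp add: distrib_right mult.assoc)
    finally show "l2norm (ef u) \<le> (1 / (c * \<tau>l) * (Mb + Wn) + (k / \<tau>l + 3 * k) / (c * \<tau>l)) * \<delta>" .
    have jle: "norm (jf u x) \<le> 1 * norm (R x) + v / 2 * norm (\<mu> x)" for x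
    proof -
      have "jf u x = Im (R x) - v / 2 * \<mu> x"
        unfolding ImR by (simp add: jf_def current_def \<mu>_def field_simps)
      then have "\<bar>jf u x\<bar> \<le> \<bar>Im (R x)\<bar> + \<bar>v / 2 * \<mu> x\<bar>" by simp
      also have "\<bar>v / 2 * \<mu> x\<bar> = v / 2 * \<bar>\<mu> x\<bar>" using v by (simp add: abs_mult)
      finally show ?thesis using abs_Im_le_cmod[of "R x"] by simp
    qed
    have "l2norm (jf u) \<le> 1 * l2norm R + v / 2 * l2norm \<mu>"
      by (rule l2_dominated_sum(2)[OF sqi_borel[OF jf_sqi[OF E]] Rs \<mu>s(1) _ _ jle]) (use v in auto)
    also have "\<dots> \<le> 1 * ((Mb + Wn) * \<delta>) + v / 2 * \<delta>"
      using v by (intro add_mono mult_left_mono R \<mu>s(2)) auto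
    finally show "l2norm (jf u) \<le> (Mb + Wn + v / 2) * \<delta>" by (simp add: algebra_simps)
  }
qed

end

section \<open>Orbital stability\<close>

lemma (in gp_solution) mass_tendsto:
  assumes "e > 0"
  shows "\<exists>d>0. \<forall>s. \<bar>s - t\<bar> < d \<longrightarrow> (\<forall>x. \<bar>mass (u s) x - mass (u t) x\<bar> < e)"
proof -
  define M where "M = sup_bound (u t)"
  have M: "1 \<le> M" "\<And>x. cmod (u t x) \<le> M" using sup_bound_pos energy_space_bounded[OF energy] by (auto simp: M_def)
  define e' where "e' = min 1 (e / (2 * M + 1))"
  have e': "e' > 0" "e' \<le> 1" "e' \<le> e / (2 * M + 1)" using assms M(1) by (auto simp: e'_def)
  obtain d where d: "d > 0" "\<And>s x. \<bar>s - t\<bar> < d \<Longrightarrow> cmod (u s x - u t x) < e'" using sup_tendsto[OF e'(1), of t] by blast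
  have "\<bar>mass (u s) x - mass (u t) x\<bar> < e" if "\<bar>s - t\<bar> < d" for s x
  proof -
    note h = d(2)[OF that, of x]
    have a: "\<bar>cmod (u s x) - cmod (u t x)\<bar> < e'" using h norm_triangle_ineq3[of "u s x" "u t x"] by linarith
    have b: "cmod (u s x) + cmod (u t x) \<le> 2 * M + 1" using a M(2)[of x] e'(2) by linarith
    have "\<bar>mass (u s) x - mass (u t) x\<bar> = \<bar>cmod (u s x) - cmod (u t x)\<bar> * (cmod (u s x) + cmod (u t x))"
      by (simp add: mass_def power2_eq_square square_diff_square_factored abs_mult)
    also have "\<dots> \<le> \<bar>cmod (u s x) - cmod (u t x)\<bar> * (2 * M + 1)" using b by (intro mult_left_mono) auto
    also have "\<dots> < e' * (2 * M + 1)" using a M(1) by (intro mult_strict_right_mono) auto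
    also have "\<dots> \<le> e" using e'(3) M(1) by (simp add: pos_le_divide_eq)
    finally show ?thesis .
  qed
  with d(1) show ?thesis by blast
qed

text \<open>Bootstrap in both time directions together. If the times up to which the bound r / 2
  holds were bounded, continuity, uniform in the parameter, would carry the weaker bound r beyond
  their supremum, and the step would turn it into r / 2 again.\<close>

lemma continuity_method:
  fixes f :: "real \<Rightarrow> 'b \<Rightarrow> real"
  assumes r: "0 < r" and cont: "\<And>t e. e > 0 \<Longrightarrow> \<exists>d>0. \<forall>s. \<bar>s - t\<bar> < d \<longrightarrow> (\<forall>x. \<bar>f s x - f t x\<bar> < e)"
    and 0: "\<And>x. \<bar>f 0 x\<bar> \<le> r / 2"
    and step: "\<And>h t x. (\<And>s y. \<bar>s\<bar> < h \<Longrightarrow> \<bar>f s y\<bar> \<le> r) \<Longrightarrow> \<bar>t\<bar> < h \<Longrightarrow> \<bar>f t x\<bar> \<le> r / 2"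
  shows "\<bar>f t x\<bar> \<le> r / 2"
proof -
  define D where "D = {T. 0 \<le> T \<and> (\<forall>t x. \<bar>t\<bar> \<le> T \<longrightarrow> \<bar>f t x\<bar> \<le> r / 2)}"
  have D0: "0 \<in> D" using 0 by (simp add: D_def)
  have "\<not> bdd_above D"
  proof
    assume b: "bdd_above D"
    define s where "s = Sup D"
    \<comment> \<open>Two oscillations of r / 4, from t to the supremum and from there to a time
      with bound r / 2, add up to r.\<close>
    obtain d1 where d1: "d1 > 0" "\<And>t x. \<bar>t - s\<bar> < d1 \<Longrightarrow> \<bar>f t x - f s x\<bar> < r / 4" using cont[of "r / 4" s] r by auto
    obtain d2 where d2: "d2 > 0" "\<And>t x. \<bar>t - (- s)\<bar> < d2 \<Longrightarrow> \<bar>f t x - f (- s) x\<bar> < r / 4" using cont[of "r / 4" "- s"] r by auto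
    define d where "d = min d1 d2"
    have d: "d > 0" "d \<le> d1" "d \<le> d2" using d1 d2 by (auto simp: d_def)
    have "s - d < Sup D" using d by (simp add: s_def)
    then obtain T where T: "T \<in> D" "s - d < T" using less_cSup_iff[of D "s - d"] D0 b by auto
    have Ts: "T \<le> s" unfolding s_def by (rule cSup_upper[OF T(1) b])
    have T0: "0 \<le> T" and PT: "\<And>t x. \<bar>t\<bar> \<le> T \<Longrightarrow> \<bar>f t x\<bar> \<le> r / 2" using T(1) by (auto simp: D_def)
    have near: "\<bar>f t y\<bar> \<le> r" if t: "\<bar>t\<bar> < s + d" for t y
    proof -
      consider "\<bar>t\<bar> \<le> T" | "T < t" | "t < - T" by linarith
      then show ?thesis
      proof cases
        case 1
        then show ?thesis using PT[of t y] r by linarith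
      next
        case 2
        then have "\<bar>t - s\<bar> < d1" "\<bar>T - s\<bar> < d1" using t T(2) Ts d T0 by linarith+
        from d1(2)[OF this(1), of y] d1(2)[OF this(2), of y] show ?thesis using PT[of T y] T0 by linarith
      next
        case 3
        then have "\<bar>t - (- s)\<bar> < d2" "\<bar>- T - (- s)\<bar> < d2" using t T(2) Ts d T0 by linarith+
        from d2(2)[OF this(1), of y] d2(2)[OF this(2), of y] show ?thesis using PT[of "- T" y] T0 by linarith
      qed
    qed
    have "s + d / 2 \<in> D" unfolding D_def
    proof (intro CollectI conjI allI impI)
      show "0 \<le> s + d / 2" using Ts T0 d by linarith
      fix t x assume "\<bar>t\<bar> \<le> s + d / 2"
      then have "\<bar>t\<bar> < s + d" using d by linarith
      then show "\<bar>f t x\<bar> \<le> r / 2" by (rule step[of "s + d", rotated]) (rule near)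
    qed
    then have "s + d / 2 \<le> s" unfolding s_def using b by (rule cSup_upper)
    then show False using d by simp
  qed
  then obtain T where "T \<in> D" "\<bar>t\<bar> < T" unfolding bdd_above_def by (meson not_le)
  then show ?thesis by (auto simp: D_def)
qed

context profile
begin

lemma cst_pos: "0 < cst"
  using b0_pos q0_pos by (simp add: cst_def add_pos_pos)

text \<open>The first conclusion returns to the modulus and closes the bootstrap; the second, which
  includes the phase, is the estimate of the theorem.\<close>

lemma small_energy_close:
  assumes n: "near u" and en: "energy_fn \<gamma> v u - gf \<tau>1 \<le> \<eta>" and s: "cst * \<eta> \<le> s\<^sup>2" "0 \<le> s"
  shows "\<bar>mass u x - mfun (Tp x)\<bar> \<le> 3 * (K1 + K2) * s"
    and "\<exists>\<phi>. \<forall>A>0. dist_A A u (\<lambda>x. exp (\<i> * of_real \<phi>) * up x) \<le> (Kq * K5 + K6 * Wn + K6 * (1 + sqrt A) + 3 * K1) * s"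
proof -
  have "sqrt (cst * \<eta>) \<le> s" using real_sqrt_le_mono[OF s(1)] s(2) by simp
  then have b: "\<bar>Tf u 0 - \<tau>1\<bar> \<le> s" "l2norm (ef u) \<le> s" "l2norm (jf u) \<le> s"
    using coercivity(2-4)[OF n en] by linarith+
  show "\<exists>\<phi>. \<forall>A>0. dist_A A u (\<lambda>x. exp (\<i> * of_real \<phi>) * up x) \<le> (Kq * K5 + K6 * Wn + K6 * (1 + sqrt A) + 3 * K1) * s"
    by (rule profile_close[OF n s(2) b])
  have "\<bar>mass u x - mfun (Tp x)\<bar> \<le> 3 * ((K1 + K2) * s)"
    by (rule order_trans[OF mass_diff_bound[OF n]]) (intro mult_left_mono sigma_bound(2)[OF n s(2) b(1,2)], simp)
  then show "\<bar>mass u x - mfun (Tp x)\<bar> \<le> 3 * (K1 + K2) * s" by (simp only: mult.assoc)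
qed

text \<open>Close to the profile the energy excess is quadratic in the defects, up to the variation
  of \<open>gf\<close> near \<tau>1. No A enters \<delta>, because only the value at the origin is
  taken from the sup norm.\<close>

lemma small_datum_energy:
  assumes "\<eta> > 0"
  shows "\<exists>\<delta>>0. \<forall>A>0. \<forall>u\<in>energy_space. dist_A A u up < \<delta> \<longrightarrow>
    (\<forall>x. \<bar>mass u x - mfun (Tp x)\<bar> \<le> \<kappa> / 2) \<and> energy_fn \<gamma> v u - gf \<tau>1 \<le> \<eta>"
proof -
  define C1 C2 C3 C4 where "C1 = 1 + 2 * (Mb + Wn)" and "C2 = (1 + 2 * (Mb + Wn)) / (c * \<tau>l)"
    and "C3 = 1 / (c * \<tau>l) * (Mb + Wn) + (k / \<tau>l + 3 * k) / (c * \<tau>l)" and "C4 = Mb + Wn + v / 2"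
  define C where "C = max 1 (max (max C1 C2) (max C3 C4))"
  have C: "1 \<le> C" "C1 \<le> C" "C2 \<le> C" "C3 \<le> C" "C4 \<le> C" by (auto simp: C_def)
  define B where "B = (c + 1 / ml) * C\<^sup>2"
  have B: "0 < B" using c_pos ml_pos C(1) by (simp add: B_def add_pos_pos)
  have "isCont gf \<tau>1" by (rule DERIV_isCont[OF gf_deriv])
  then obtain r where r: "r > 0" "\<And>T. \<bar>T - \<tau>1\<bar> < r \<Longrightarrow> \<bar>gf T - gf \<tau>1\<bar> < \<eta> / 2"
    unfolding isCont_def LIM_def using assms by (metis (no_types, opaque_lifting) abs_zero diff_self dist_real_def half_gt_zero)
  \<comment> \<open>In this order: the smallness assumed in \<open>datum_close\<close>, the modulus
    within half the radius \<kappa>, T 0 within the continuity radius of \<open>gf\<close>, and the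
    quadratic part below \<eta> / 2.\<close>
  define \<delta> where "\<delta> = min (min 1 (\<kappa> / (2 * C))) (min (r / (2 * C)) (\<eta> / (2 * B)))"
  have \<delta>: "0 < \<delta>" "\<delta> \<le> 1" "C * \<delta> \<le> \<kappa> / 2" "C * \<delta> \<le> r / 2" "B * \<delta> \<le> \<eta> / 2"
  proof -
    show "0 < \<delta>" "\<delta> \<le> 1" using C B r assms \<kappa>_pos by (auto simp: \<delta>_def)
    have "\<delta> \<le> \<kappa> / (2 * C)" "\<delta> \<le> r / (2 * C)" "\<delta> \<le> \<eta> / (2 * B)" by (auto simp: \<delta>_def)
    then show "C * \<delta> \<le> \<kappa> / 2" "C * \<delta> \<le> r / 2" "B * \<delta> \<le> \<eta> / 2"
      using C(1) B by (auto simp: pos_le_divide_eq mult_ac)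
  qed
  have up_C: "y \<le> C * \<delta>" if "y \<le> D * \<delta>" "D \<le> C" for y D
    using order_trans[OF that(1) mult_right_mono[OF that(2)]] \<delta>(1) by simp
  have "(\<forall>x. \<bar>mass u x - mfun (Tp x)\<bar> \<le> \<kappa> / 2) \<and> energy_fn \<gamma> v u - gf \<tau>1 \<le> \<eta>"
    if A: "A > 0" and E: "u \<in> energy_space" and d: "dist_A A u up < \<delta>" for A u
  proof -
    note dc = datum_close[OF E A less_imp_le[OF d] \<delta>(2), folded C1_def, folded C2_def C3_def C4_def]
    have m: "\<bar>mass u x - mfun (Tp x)\<bar> \<le> \<kappa> / 2" for x using up_C[OF dc(1) C(2)] \<delta>(3) order_trans by blast
    have n: "near u" unfolding near_def
    proof (intro conjI E allI)
      fix x show "\<bar>mass u x - mfun (Tp x)\<bar> \<le> \<kappa>" using m[of x] \<kappa>_pos by linarith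
    qed
    have b: "\<bar>Tf u 0 - \<tau>1\<bar> \<le> C * \<delta>" "l2norm (ef u) \<le> C * \<delta>" "l2norm (jf u) \<le> C * \<delta>"
      using up_C[OF dc(2)[OF n]] up_C[OF dc(3)[OF n] C(4)] up_C[OF dc(4)[OF n] C(5)] C(3)
      by (auto simp: C1_def C2_def)
    have "\<bar>gf (Tf u 0) - gf \<tau>1\<bar> < \<eta> / 2" by (rule r(2)) (use b(1) \<delta>(4) r(1) in linarith)
    moreover have "Qf u \<le> \<eta> / 2"
    proof -
      have "Qf u \<le> c * (l2norm (ef u))\<^sup>2 + 1 / ml * (l2norm (jf u))\<^sup>2" using Qf_upper[OF n] by (simp add: ml_def)
      also have "\<dots> \<le> c * (C * \<delta>)\<^sup>2 + 1 / ml * (C * \<delta>)\<^sup>2"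
        using c_pos ml_pos by (intro add_mono mult_left_mono power_mono b) auto
      also have "\<dots> = B * \<delta> * \<delta>" by (simp add: B_def power2_eq_square algebra_simps)
      also have "\<dots> \<le> B * \<delta> * 1" using \<delta> B by (intro mult_left_mono) auto
      finally show ?thesis using \<delta>(5) by linarith
    qed
    ultimately have "energy_fn \<gamma> v u - gf \<tau>1 \<le> \<eta>" unfolding energy_identity[OF n] by linarith
    with m show ?thesis by blast
  qed
  with \<delta>(1) show ?thesis by blast
qed

lemma orbital_stability:
  assumes "\<epsilon> > 0" "A > 0"
  shows "\<exists>\<delta>>0. \<forall>u0\<in>energy_space. dist_A A u0 up < \<delta> \<longrightarrow> (\<forall>\<psi>. global_solution \<gamma> v u0 \<psi> \<longrightarrow>
     (\<forall>t. \<exists>\<phi>. dist_A A (\<psi> t) (\<lambda>x. exp (\<i> * of_real \<phi>) * up x) \<le> \<epsilon>))"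
proof -
  define K3 KA where "K3 = 3 * (K1 + K2)" and "KA = Kq * K5 + K6 * Wn + K6 * (1 + sqrt A) + 3 * K1"
  have K3: "0 < K3" using K1_pos K2_pos by (simp add: K3_def)
  have KA: "0 < KA" unfolding KA_def using K_nonneg K1_pos assms(2)
    by (intro add_nonneg_pos add_nonneg_nonneg mult_nonneg_nonneg) (auto simp: Wn_def)
  \<comment> \<open>The size allowed for the defects: the first bound yields the final distance, the
    second returns the modulus to half the radius \<kappa>.\<close>
  define s where "s = min (\<epsilon> / KA) (\<kappa> / (2 * K3))"
  have s: "0 < s" "KA * s \<le> \<epsilon>" "K3 * s \<le> \<kappa> / 2"
  proof -
    show "0 < s" using assms KA K3 \<kappa>_pos by (simp add: s_def)
    have "s \<le> \<epsilon> / KA" "s \<le> \<kappa> / (2 * K3)" by (auto simp: s_def)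
    then show "KA * s \<le> \<epsilon>" "K3 * s \<le> \<kappa> / 2" using KA K3 by (auto simp: pos_le_divide_eq mult_ac)
  qed
  \<comment> \<open>The energy excess that \<open>coercivity\<close> converts into defects of size
    at most s.\<close>
  define \<eta> where "\<eta> = s\<^sup>2 / cst"
  have \<eta>: "\<eta> > 0" "cst * \<eta> \<le> s\<^sup>2" using s(1) cst_pos by (auto simp: \<eta>_def)
  obtain \<delta> where \<delta>: "\<delta> > 0" "\<And>u x. u \<in> energy_space \<Longrightarrow> dist_A A u up < \<delta> \<Longrightarrow> \<bar>mass u x - mfun (Tp x)\<bar> \<le> \<kappa> / 2"
      "\<And>u. u \<in> energy_space \<Longrightarrow> dist_A A u up < \<delta> \<Longrightarrow> energy_fn \<gamma> v u - gf \<tau>1 \<le> \<eta>"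
    using small_datum_energy[OF \<eta>(1)] assms(2) by blast
  have "\<exists>\<phi>. dist_A A (\<psi> t) (\<lambda>x. exp (\<i> * of_real \<phi>) * up x) \<le> \<epsilon>"
    if u0: "u0 \<in> energy_space" "dist_A A u0 up < \<delta>" and sol: "global_solution \<gamma> v u0 \<psi>" for u0 \<psi> t
  proof -
    interpret gp_solution \<gamma> v \<psi> by (rule global_solution_gp_solution[OF sol])
    have \<psi>0: "\<psi> 0 = u0" using sol by (simp add: global_solution_def)
    define f where "f t x = mass (\<psi> t) x - mfun (Tp x)" for t x
    \<comment> \<open>Conservation is available only on time intervals on which the solution is
      already known to be near the profile; the lower bound \<open>ml\<close> on the mass comes from
      there.\<close>
    have en: "near (\<psi> t) \<and> energy_fn \<gamma> v (\<psi> t) - gf \<tau>1 \<le> \<eta>"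
      if h: "\<And>s y. \<bar>s\<bar> < h \<Longrightarrow> \<bar>f s y\<bar> \<le> \<kappa>" and t: "\<bar>t\<bar> < h" for h t
    proof -
      have n: "near (\<psi> s)" if "- h < s" "s < h" for s
        using h[of s] that energy by (auto simp: near_def f_def)
      have m: "ml \<le> mass (\<psi> s) x" if "- h < s" "s < h" for s x
        using near_Tf(5)[OF n[OF that]] by (simp add: ml_def)
      have "energy_fn \<gamma> v (\<psi> t) = energy_fn \<gamma> v (\<psi> 0)"
      proof (cases "0 \<le> t")
        case True
        then show ?thesis using energy_conservation[where lo="- h" and hi=h and a=0 and b=t, OF ml_pos m] t by simp
      next
        case False
        then show ?thesis using energy_conservation[where lo="- h" and hi=h and a=t and b=0, OF ml_pos m] t by simp
      qed
      then show ?thesis using \<delta>(3)[OF u0] n[of t] t \<psi>0 by auto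
    qed
    have small: "\<bar>f t x\<bar> \<le> \<kappa> / 2" for t x
    proof (rule continuity_method[where f=f, OF \<kappa>_pos])
      fix t e :: real assume "e > 0"
      from mass_tendsto[OF this, of t] show "\<exists>d>0. \<forall>s. \<bar>s - t\<bar> < d \<longrightarrow> (\<forall>x. \<bar>f s x - f t x\<bar> < e)"
        by (simp add: f_def)
    next
      show "\<bar>f 0 x\<bar> \<le> \<kappa> / 2" for x using \<delta>(2)[OF u0] \<psi>0 by (simp add: f_def)
    next
      fix h t :: real and x assume h: "\<And>s y. \<bar>s\<bar> < h \<Longrightarrow> \<bar>f s y\<bar> \<le> \<kappa>" and t: "\<bar>t\<bar> < h"
      note en = en[OF h t]
      have "\<bar>f t x\<bar> \<le> K3 * s"
        unfolding f_def K3_def using small_energy_close(1)[OF _ _ \<eta>(2)] en s(1) by auto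
      then show "\<bar>f t x\<bar> \<le> \<kappa> / 2" using s(3) by linarith
    qed
    have "\<bar>f s y\<bar> \<le> \<kappa>" for s y using small[of s y] \<kappa>_pos by linarith
    then have "near (\<psi> t) \<and> energy_fn \<gamma> v (\<psi> t) - gf \<tau>1 \<le> \<eta>" by (intro en[of "\<bar>t\<bar> + 1"]) auto
    then obtain \<phi> where "\<And>A. A > 0 \<Longrightarrow> dist_A A (\<psi> t) (\<lambda>x. exp (\<i> * of_real \<phi>) * up x) \<le> (Kq * K5 + K6 * Wn + K6 * (1 + sqrt A) + 3 * K1) * s"
      using small_energy_close(2)[OF _ _ \<eta>(2)] s(1) by (meson less_imp_le)
    from this[OF assms(2)] have "dist_A A (\<psi> t) (\<lambda>x. exp (\<i> * of_real \<phi>) * up x) \<le> KA * s" by (simp add: KA_def)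
    then show ?thesis using s(2) order_trans by blast
  qed
  with \<delta>(1) show ?thesis by blast
qed

end

theorem theorem1p5:
  fixes \<gamma> v \<xi>1 \<xi>2 :: real
  assumes "0 < \<gamma>"
    and "0 < v" and "v < v_cr \<gamma>"
    and "\<xi>2 < \<xi>1"
    and "{\<xi>. 0 < \<xi> \<and> xi_equation \<gamma> v \<xi>} = {\<xi>1, \<xi>2}"
  shows "\<forall>\<epsilon>>0. \<forall>A>0. \<exists>\<delta>>0. \<forall>u0\<in>energy_space.
           dist_A A u0 (stat_sol v \<xi>1) < \<delta> \<longrightarrow>
           (\<forall>\<psi>. global_solution \<gamma> v u0 \<psi> \<longrightarrow>
              (SUP t::real. INF \<phi>::real.
                 ereal (dist_A A (\<psi> t) (\<lambda>x. exp (\<i> * of_real \<phi>) * stat_sol v \<xi>1 x))) \<le> ereal \<epsilon>)"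
proof -
  have \<xi>: "0 < \<xi>1 \<and> xi_equation \<gamma> v \<xi>1" "0 < \<xi>2 \<and> xi_equation \<gamma> v \<xi>2" using assms(5) by blast+
  interpret profile \<gamma> v \<xi>1 \<xi>2
    using assms(1,2,4) \<xi> xi_equation_imp_subsonic by unfold_locales auto
  show ?thesis
  proof (intro allI impI)
    fix \<epsilon> A :: real assume "\<epsilon> > 0" "A > 0"
    from orbital_stability[OF this] obtain \<delta> where \<delta>: "\<delta> > 0"
      "\<And>u0 \<psi> t. u0 \<in> energy_space \<Longrightarrow> dist_A A u0 (stat_sol v \<xi>1) < \<delta> \<Longrightarrow> global_solution \<gamma> v u0 \<psi> \<Longrightarrow>
        \<exists>\<phi>. dist_A A (\<psi> t) (\<lambda>x. exp (\<i> * of_real \<phi>) * stat_sol v \<xi>1 x) \<le> \<epsilon>"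
      unfolding up_def by blast
    show "\<exists>\<delta>>0. \<forall>u0\<in>energy_space. dist_A A u0 (stat_sol v \<xi>1) < \<delta> \<longrightarrow> (\<forall>\<psi>. global_solution \<gamma> v u0 \<psi> \<longrightarrow>
      (SUP t::real. INF \<phi>::real. ereal (dist_A A (\<psi> t) (\<lambda>x. exp (\<i> * of_real \<phi>) * stat_sol v \<xi>1 x))) \<le> ereal \<epsilon>)"
    proof (intro exI[of _ \<delta>] conjI \<delta>(1) ballI impI allI SUP_least)
      \<comment> \<open>The supremum is bounded time by time, and each infimum by the single phase
        found for that time.\<close>
      fix u0 \<psi> and t :: real
      assume "u0 \<in> energy_space" "dist_A A u0 (stat_sol v \<xi>1) < \<delta>" "global_solution \<gamma> v u0 \<psi>"
      from \<delta>(2)[OF this, of t] obtain \<phi> where "dist_A A (\<psi> t) (\<lambda>x. exp (\<i> * of_real \<phi>) * stat_sol v \<xi>1 x) \<le> \<epsilon>" by blast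
      then show "(INF \<phi>::real. ereal (dist_A A (\<psi> t) (\<lambda>x. exp (\<i> * of_real \<phi>) * stat_sol v \<xi>1 x))) \<le> ereal \<epsilon>"
        by (intro INF_lower2[of \<phi>]) auto
    qed
  qed
qed

end
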